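(* Let $D\subset\mathbb{R}^d$ be a bounded open set and let $Y=(Y_1,\dots,Y_n)$ be a family of $C^\infty$ vector fields defined on an open neighbourhood $U$ of the closure $\overline{D}$. Suppose that $Y_1,\dots,Y_n$ satisfy the Hörmander condition on $U$. Then for every integer $k\ge1$, every constant $c$ with $0<c\le|D|$ and every $f\in L^2(D)$, each of the following shape optimization problems admits a solution: $$\min\Big\{\lambda_k(\Omega)\ :\ \Omega\subset D\text{ quasi-open},\ |\Omega|\le c\Big\},$$ $$\min\Big\{E_f(\Omega)\ :\ \Omega\subset D\text{ quasi-open},\ |\Omega|\le c\Big\}.$$
   Context: $|\cdot|$ denotes Lebesgue measure. Hörmander condition on $U$: the Lie algebra generated by $Y_1,\dots,Y_n$ has dimension $d$ at each point $x\in U$. Let $H=W^{1,2}_0(D;Y)$ be the closure of $C_c^\infty(D)$ with respect to the norm $\|u\|_H=\big(\|u\|_{L^2}^2+\sum_{j=1}^n\|Y_ju\|_{L^2}^2\big)^{1/2}$, where $Y_ju$ is the derivative of $u$ along $Y_j$ in the sense of distributions. For $u\in H$ put $|Yu|=(|Y_1u|^2+\dots+|Y_nu|^2)^{1/2}\in L^2(D)$. Capacity: for $E\subset D$, $\operatorname{cap}(E)=\inf\{\|u\|_H^2:\ u\in H,\ u\ge0\text{ on }D,\ u\ge1\text{ in a neighbourhood of }E\}$. Functions in $H$ are identified with their quasi-continuous representatives (defined up to sets of zero capacity). A set is quasi-open if (up to a set of zero capacity) it is of the form $\{u>0\}$ for some $u\in H$. For $\Omega\subset D$, $H_0(\Omega)=\{u\in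 H:\ \operatorname{cap}(\{u\ne0\}\setminus\Omega)=0\}$. Eigenvalues: $\lambda_k(\Omega)=\inf_{K}\sup\{\int_\Omega|Yu|^2\,dx:\ u\in K,\ \int_\Omega u^2\,dx=1\}$, the infimum being over all $k$-dimensional linear subspaces $K$ of $H_0(\Omega)$ (infimum over the empty family is $+\infty$). Dirichlet energy: $E_f(\Omega)=\inf\{\frac12\int_\Omega|Yu|^2\,dx+\frac12\int_\Omega u^2\,dx-\int_\Omega uf\,dx:\ u\in H_0(\Omega)\}$. *)

theory Defs
  imports "HOL-Analysis.Analysis"
begin

text \<open>
  Everything is meant for open sets \<open>U\<close>, \<open>D\<close>. Functions and vector fields on such a set are total
  functions of which only the values on the set matter.
\<close>

primrec Ck_on :: "nat \<Rightarrow> 'a::real_normed_vector set \<Rightarrow> ('a \<Rightarrow> 'b::real_normed_vector) \<Rightarrow> bool" where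
  "Ck_on 0 U f \<longleftrightarrow> continuous_on U f"
| "Ck_on (Suc m) U f \<longleftrightarrow>
     (\<forall>x\<in>U. f differentiable (at x)) \<and> (\<forall>v. Ck_on m U (\<lambda>x. frechet_derivative f (at x) v))"

definition smooth_on :: "'a::real_normed_vector set \<Rightarrow> ('a \<Rightarrow> 'b::real_normed_vector) \<Rightarrow> bool" where
  "smooth_on U f \<longleftrightarrow> (\<forall>m. Ck_on m U f)"

definition lie_bracket ::
    "(real ^ 'd \<Rightarrow> real ^ 'd) \<Rightarrow> (real ^ 'd \<Rightarrow> real ^ 'd) \<Rightarrow> real ^ 'd \<Rightarrow> real ^ 'd" where
  "lie_bracket X Z = (\<lambda>x. frechet_derivative Z (at x) (X x) - frechet_derivative X (at x) (Z x))"

inductive_set lie_algebra :: "nat \<Rightarrow> (nat \<Rightarrow> real ^ 'd \<Rightarrow> real ^ 'd) \<Rightarrow> (real ^ 'd \<Rightarrow> real ^ 'd) set"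
  for n :: nat and Y :: "nat \<Rightarrow> real ^ 'd \<Rightarrow> real ^ 'd" where
  generator: "j \<in> {1..n} \<Longrightarrow> Y j \<in> lie_algebra n Y"
| zero: "(\<lambda>x. 0) \<in> lie_algebra n Y"
| add: "X \<in> lie_algebra n Y \<Longrightarrow> Z \<in> lie_algebra n Y \<Longrightarrow> (\<lambda>x. X x + Z x) \<in> lie_algebra n Y"
| scale: "X \<in> lie_algebra n Y \<Longrightarrow> (\<lambda>x. r *\<^sub>R X x) \<in> lie_algebra n Y"
| bracket: "X \<in> lie_algebra n Y \<Longrightarrow> Z \<in> lie_algebra n Y \<Longrightarrow> lie_bracket X Z \<in> lie_algebra n Y"

definition hormander :: "(real ^ 'd) set \<Rightarrow> nat \<Rightarrow> (nat \<Rightarrow> real ^ 'd \<Rightarrow> real ^ 'd) \<Rightarrow> bool" where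
  "hormander U n Y \<longleftrightarrow> (\<forall>x\<in>U. dim {X x |X. X \<in> lie_algebra n Y} = CARD('d))"

definition divergence :: "(real ^ 'd \<Rightarrow> real ^ 'd) \<Rightarrow> real ^ 'd \<Rightarrow> real" where
  "divergence X x = (\<Sum>i\<in>UNIV. frechet_derivative X (at x) (axis i 1) $ i)"

definition test_functions :: "(real ^ 'd) set \<Rightarrow> (real ^ 'd \<Rightarrow> real) set" where
  "test_functions D =
     {\<phi>. smooth_on UNIV \<phi> \<and> compact (closure {x. \<phi> x \<noteq> 0}) \<and> closure {x. \<phi> x \<noteq> 0} \<subseteq> D}"

definition L2 :: "(real ^ 'd) set \<Rightarrow> (real ^ 'd \<Rightarrow> real) set" where
  "L2 D = {u. u \<in> borel_measurable (lebesgue_on D) \<and> integrable (lebesgue_on D) (\<lambda>x. (u x)\<^sup>2)}"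

text \<open>
  \<open>g\<close> is the distributional derivative of \<open>u\<close> along \<open>X = \<Sum>i. a\<^sub>i \<partial>\<^sub>i\<close>: the formal adjoint of \<open>X\<close> is
  \<open>\<phi> \<mapsto> - \<Sum>i. \<partial>\<^sub>i (a\<^sub>i \<phi>) = - (X \<phi> + (div X) \<phi>)\<close>.
\<close>

definition has_dist_derivative ::
    "(real ^ 'd) set \<Rightarrow> (real ^ 'd \<Rightarrow> real ^ 'd) \<Rightarrow> (real ^ 'd \<Rightarrow> real) \<Rightarrow> (real ^ 'd \<Rightarrow> real) \<Rightarrow> bool" where
  "has_dist_derivative D X u g \<longleftrightarrow>
     (\<forall>\<phi>\<in>test_functions D.
        (\<integral>x. g x * \<phi> x \<partial>lebesgue_on D) =
        - (\<integral>x. u x * (frechet_derivative \<phi> (at x) (X x) + divergence X x * \<phi> x) \<partial>lebesgue_on D))"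

text \<open>Determined only up to a null set, and only for \<open>u\<close> with a derivative in \<open>L2 D\<close>.\<close>

definition dist_derivative ::
    "(real ^ 'd) set \<Rightarrow> (real ^ 'd \<Rightarrow> real ^ 'd) \<Rightarrow> (real ^ 'd \<Rightarrow> real) \<Rightarrow> real ^ 'd \<Rightarrow> real" where
  "dist_derivative D X u = (SOME g. g \<in> L2 D \<and> has_dist_derivative D X u g)"

definition norm_Y ::
    "(real ^ 'd) set \<Rightarrow> nat \<Rightarrow> (nat \<Rightarrow> real ^ 'd \<Rightarrow> real ^ 'd) \<Rightarrow> (real ^ 'd \<Rightarrow> real) \<Rightarrow> real ^ 'd \<Rightarrow> real" where
  "norm_Y D n Y u x = sqrt (\<Sum>j=1..n. (dist_derivative D (Y j) u x)\<^sup>2)"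

definition norm_H ::
    "(real ^ 'd) set \<Rightarrow> nat \<Rightarrow> (nat \<Rightarrow> real ^ 'd \<Rightarrow> real ^ 'd) \<Rightarrow> (real ^ 'd \<Rightarrow> real) \<Rightarrow> real" where
  "norm_H D n Y u =
     sqrt ((\<integral>x. (u x)\<^sup>2 \<partial>lebesgue_on D) +
           (\<Sum>j=1..n. \<integral>x. (dist_derivative D (Y j) u x)\<^sup>2 \<partial>lebesgue_on D))"

definition W12 ::
    "(real ^ 'd) set \<Rightarrow> nat \<Rightarrow> (nat \<Rightarrow> real ^ 'd \<Rightarrow> real ^ 'd) \<Rightarrow> (real ^ 'd \<Rightarrow> real) set" where
  "W12 D n Y = {u \<in> L2 D. \<forall>j\<in>{1..n}. \<exists>g\<in>L2 D. has_dist_derivative D (Y j) u g}"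

text \<open>
  The closure is taken in \<open>W12\<close>. An element of \<open>W12_0\<close> is an arbitrary representative of its
  almost-everywhere class; the quasi-continuous ones are singled out in \<open>H_qc\<close> below.
\<close>

definition W12_0 ::
    "(real ^ 'd) set \<Rightarrow> nat \<Rightarrow> (nat \<Rightarrow> real ^ 'd \<Rightarrow> real ^ 'd) \<Rightarrow> (real ^ 'd \<Rightarrow> real) set" where
  "W12_0 D n Y =
     {u \<in> W12 D n Y. \<forall>\<epsilon>>0. \<exists>\<phi>\<in>test_functions D. norm_H D n Y (\<lambda>x. u x - \<phi> x) < \<epsilon>}"

definition cap ::
    "(real ^ 'd) set \<Rightarrow> nat \<Rightarrow> (nat \<Rightarrow> real ^ 'd \<Rightarrow> real ^ 'd) \<Rightarrow> (real ^ 'd) set \<Rightarrow> ereal" where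
  "cap D n Y E =
     (INF u \<in> {u \<in> W12_0 D n Y. (AE x in lebesgue_on D. 0 \<le> u x) \<and>
                 (\<exists>V. open V \<and> E \<subseteq> V \<and> V \<subseteq> D \<and> (AE x in lebesgue_on V. 1 \<le> u x))}.
        ereal ((norm_H D n Y u)\<^sup>2))"

definition quasi_continuous ::
    "(real ^ 'd) set \<Rightarrow> nat \<Rightarrow> (nat \<Rightarrow> real ^ 'd \<Rightarrow> real ^ 'd) \<Rightarrow> (real ^ 'd \<Rightarrow> real) \<Rightarrow> bool" where
  "quasi_continuous D n Y u \<longleftrightarrow>
     (\<forall>\<epsilon>>0. \<exists>G. open G \<and> G \<subseteq> D \<and> cap D n Y G < ereal \<epsilon> \<and> continuous_on (D - G) u)"

definition H_qc ::
    "(real ^ 'd) set \<Rightarrow> nat \<Rightarrow> (nat \<Rightarrow> real ^ 'd \<Rightarrow> real ^ 'd) \<Rightarrow> (real ^ 'd \<Rightarrow> real) set" where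
  "H_qc D n Y = {u \<in> W12_0 D n Y. quasi_continuous D n Y u}"

definition quasi_open ::
    "(real ^ 'd) set \<Rightarrow> nat \<Rightarrow> (nat \<Rightarrow> real ^ 'd \<Rightarrow> real ^ 'd) \<Rightarrow> (real ^ 'd) set \<Rightarrow> bool" where
  "quasi_open D n Y \<Omega> \<longleftrightarrow>
     \<Omega> \<subseteq> D \<and> (\<exists>u\<in>H_qc D n Y. cap D n Y (sym_diff \<Omega> {x \<in> D. 0 < u x}) = 0)"

definition H0 ::
    "(real ^ 'd) set \<Rightarrow> nat \<Rightarrow> (nat \<Rightarrow> real ^ 'd \<Rightarrow> real ^ 'd) \<Rightarrow> (real ^ 'd) set \<Rightarrow> (real ^ 'd \<Rightarrow> real) set" where
  "H0 D n Y \<Omega> = {u \<in> H_qc D n Y. cap D n Y ({x \<in> D. u x \<noteq> 0} - \<Omega>) = 0}"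

text \<open>
  \<open>K\<close> is the set of all representatives in \<open>V\<close> of a \<open>k\<close>-dimensional space of almost-everywhere
  classes. The dimension has to be counted modulo null functions: in a space of plain functions,
  \<open>k\<close> independent ones could all represent the zero class.
\<close>

definition subspace_of_dim ::
    "(real ^ 'd) set \<Rightarrow> nat \<Rightarrow> (real ^ 'd \<Rightarrow> real) set \<Rightarrow> (real ^ 'd \<Rightarrow> real) set \<Rightarrow> bool" where
  "subspace_of_dim D k V K \<longleftrightarrow>
     (\<exists>e :: nat \<Rightarrow> real ^ 'd \<Rightarrow> real.
        (\<forall>i<k. e i \<in> V) \<and>
        (\<forall>a :: nat \<Rightarrow> real. (AE x in lebesgue_on D. (\<Sum>i<k. a i * e i x) = 0) \<longrightarrow> (\<forall>i<k. a i = 0)) \<and>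
        K = {u \<in> V. \<exists>a :: nat \<Rightarrow> real. AE x in lebesgue_on D. u x = (\<Sum>i<k. a i * e i x)})"

definition eigenvalue ::
    "(real ^ 'd) set \<Rightarrow> nat \<Rightarrow> (nat \<Rightarrow> real ^ 'd \<Rightarrow> real ^ 'd) \<Rightarrow> nat \<Rightarrow> (real ^ 'd) set \<Rightarrow> ereal" where
  "eigenvalue D n Y k \<Omega> =
     (INF K \<in> {K. subspace_of_dim D k (H0 D n Y \<Omega>) K}.
        SUP u \<in> {u \<in> K. (\<integral>x. (u x)\<^sup>2 \<partial>lebesgue_on \<Omega>) = 1}.
          ereal (\<integral>x. (norm_Y D n Y u x)\<^sup>2 \<partial>lebesgue_on \<Omega>))"

definition dirichlet_energy ::
    "(real ^ 'd) set \<Rightarrow> nat \<Rightarrow> (nat \<Rightarrow> real ^ 'd \<Rightarrow> real ^ 'd) \<Rightarrow> (real ^ 'd \<Rightarrow> real) \<Rightarrow> (real ^ 'd) set \<Rightarrow> ereal" where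
  "dirichlet_energy D n Y f \<Omega> =
     (INF u \<in> H0 D n Y \<Omega>.
        ereal (1/2 * (\<integral>x. (norm_Y D n Y u x)\<^sup>2 \<partial>lebesgue_on \<Omega>)
             + 1/2 * (\<integral>x. (u x)\<^sup>2 \<partial>lebesgue_on \<Omega>)
             - (\<integral>x. u x * f x \<partial>lebesgue_on \<Omega>)))"

end

theory Submission
  imports Defs "HOL-Library.Diagonal_Subsequence"
begin

text \<open>
  The embedding of the energy space into \<open>L\<^sup>2\<close> is compact. Given a bounded sequence \<open>u\<close> in the energy
  space that converges weakly to zero, solve \<open>\<Delta>w = u\<close> up to smooth errors with a compactly supported
  parametrix. Then \<open>\<partial>w \<rightarrow> 0\<close> strongly while the second derivatives of \<open>Y\<^sub>jw\<close> stay bounded.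
  Integrating by parts against a commutator propagates the smallness of \<open>X\<partial>w\<close> from a field \<open>X\<close> to
  \<open>[Y\<^sub>j,X]\<close>, so the Hoermander condition yields \<open>\<partial>\<partial>w \<rightarrow> 0\<close> and hence \<open>u \<rightarrow> 0\<close>.

  By compactness the (bases of) almost optimal functions of a minimizing sequence of sets converge in
  \<open>L\<^sup>2\<close> and almost everywhere. The limits have no larger energy by the parallelogram law. The set where
  some quasi-continuous representative of a limit is nonzero is quasi-open, has measure at most \<open>c\<close>
  by Fatou's lemma, and is optimal, because \<open>Y\<^sub>ju = 0\<close> almost everywhere on \<open>{u = 0}\<close>.
\<close>

text \<open>Bounds on u and the Y_j u alone leave no room for commutators: every bracket costs a
  derivative that is not controlled. Replacing u by \<partial>w with \<Delta>w \<approx> u buys that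
  room, since then one arbitrary derivative of v = \<partial>w and one of each Y_j v stay bounded,
  which is exactly what the integration by parts for [Y_j,X] consumes. Only qualitative smallness is
  propagated, so no fractional Sobolev norm and no subelliptic exponent occurs. The parametrix is an
  integral over scales of rescaled bumps; its Laplacian follows from the fundamental theorem of
  calculus in the scale variable. Weak convergence is encoded as decay of mollifications at a
  shrinking scale, which a diagonal subsequence provides.

  In the variational half, distributional derivatives are chosen representatives and are additive
  only almost everywhere, so a function travels together with candidates for its derivatives.
  Capacity and quasi-open sets are handled with the smooth function t^2/(1+t^2) in place of lattice
  operations such as |u| and min(u,1).\<close>

section \<open>Square-integrable functions and their seminorm over a general measure\<close>

definition sqi :: "'a measure \<Rightarrow> ('a \<Rightarrow> real) set" where
  "sqi M = {u. u \<in> borel_measurable M \<and> integrable M (\<lambda>x. (u x)\<^sup>2)}"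

text \<open>The Bochner integral of a non-integrable square is 0, so this is the L2 seminorm only on
  \<open>sqi M\<close>; hence the membership hypotheses throughout.\<close>

definition nrm2 :: "'a measure \<Rightarrow> ('a \<Rightarrow> real) \<Rightarrow> real" where
  "nrm2 M u = sqrt (\<integral>x. (u x)\<^sup>2 \<partial>M)"

lemma sqi_measurable [measurable_dest]: "u \<in> sqi M \<Longrightarrow> u \<in> borel_measurable M"
  by (simp add: sqi_def)

lemma sqi_integrable_mult:
  assumes "u \<in> sqi M" "v \<in> sqi M" shows "integrable M (\<lambda>x. u x * v x)"
proof -
  have [measurable]: "u \<in> borel_measurable M" "v \<in> borel_measurable M"
    using assms by (auto simp: sqi_def)
  have i: "integrable M (\<lambda>x. (u x)\<^sup>2 + (v x)\<^sup>2)" using assms by (auto simp: sqi_def)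
  show ?thesis
  proof (rule Bochner_Integration.integrable_bound[OF i], measurable, intro AE_I2)
    fix x
    have "2 * (\<bar>u x\<bar> * \<bar>v x\<bar>) \<le> (u x)\<^sup>2 + (v x)\<^sup>2"
      using sum_squares_bound[of "\<bar>u x\<bar>" "\<bar>v x\<bar>"] by simp
    moreover have "0 \<le> \<bar>u x\<bar> * \<bar>v x\<bar>" by simp
    ultimately have "\<bar>u x\<bar> * \<bar>v x\<bar> \<le> (u x)\<^sup>2 + (v x)\<^sup>2" by linarith
    thus "norm (u x * v x) \<le> norm ((u x)\<^sup>2 + (v x)\<^sup>2)"
      by (simp add: abs_mult)
  qed
qed

lemma sqi_square: "u \<in> sqi M \<Longrightarrow> integrable M (\<lambda>x. (u x)\<^sup>2)" by (simp add: sqi_def)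

lemma sqi_0: "(\<lambda>x. 0) \<in> sqi M" by (simp add: sqi_def)

lemma sqi_add: assumes "u \<in> sqi M" "v \<in> sqi M" shows "(\<lambda>x. u x + v x) \<in> sqi M"
proof -
  have "integrable M (\<lambda>x. (u x)\<^sup>2 + (v x)\<^sup>2 + 2 * (u x * v x))"
    using assms sqi_integrable_mult[OF assms] by (auto simp: sqi_def)
  moreover have "(\<lambda>x. (u x)\<^sup>2 + (v x)\<^sup>2 + 2 * (u x * v x)) = (\<lambda>x. (u x + v x)\<^sup>2)"
    by (auto simp: power2_eq_square algebra_simps)
  ultimately show ?thesis using assms by (auto simp: sqi_def)
qed

lemma sqi_cmult: "u \<in> sqi M \<Longrightarrow> (\<lambda>x. a * u x) \<in> sqi M"
  by (auto simp: sqi_def power_mult_distrib)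

lemma sqi_diff: assumes "u \<in> sqi M" "v \<in> sqi M" shows "(\<lambda>x. u x - v x) \<in> sqi M"
  using sqi_add[OF assms(1) sqi_cmult[OF assms(2), of "-1"]] by simp

lemma sqi_sum: "(\<And>i. i \<in> I \<Longrightarrow> f i \<in> sqi M) \<Longrightarrow> (\<lambda>x. \<Sum>i\<in>I. f i x) \<in> sqi M"
  by (induction I rule: infinite_finite_induct) (auto intro: sqi_0 sqi_add)

lemma sqi_bound:
  assumes "u \<in> sqi M" "v \<in> borel_measurable M" "AE x in M. \<bar>v x\<bar> \<le> \<bar>u x\<bar>"
  shows "v \<in> sqi M"
proof -
  have "integrable M (\<lambda>x. (v x)\<^sup>2)"
    by (rule Bochner_Integration.integrable_bound[OF sqi_square[OF assms(1)]])
      (use assms in \<open>auto simp: abs_le_square_iff\<close>)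
  thus ?thesis using assms by (simp add: sqi_def)
qed

lemma sqi_bounded_mult:
  assumes "u \<in> sqi M" "b \<in> borel_measurable M" "AE x in M. \<bar>b x\<bar> \<le> B"
  shows "(\<lambda>x. b x * u x) \<in> sqi M"
proof (rule sqi_bound[OF sqi_cmult[OF assms(1), of B]])
  show "(\<lambda>x. b x * u x) \<in> borel_measurable M" using assms by (auto simp: sqi_def)
  show "AE x in M. \<bar>b x * u x\<bar> \<le> \<bar>B * u x\<bar>"
    using assms(3) by eventually_elim (auto simp: abs_mult intro!: mult_right_mono)
qed

lemma sqi_cong_AE:
  assumes "u \<in> sqi M" "v \<in> borel_measurable M" "AE x in M. v x = u x"
  shows "v \<in> sqi M"
  by (rule sqi_bound[OF assms(1,2)]) (use assms(3) in auto)

lemma nrm2_ge0: "0 \<le> nrm2 M u" by (simp add: nrm2_def)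

lemma nrm2_sq: "(nrm2 M u)\<^sup>2 = (\<integral>x. (u x)\<^sup>2 \<partial>M)" by (simp add: nrm2_def)

lemma nrm2_0 [simp]: "nrm2 M (\<lambda>x. 0) = 0" by (simp add: nrm2_def)

lemma nrm2_cmult: "nrm2 M (\<lambda>x. a * u x) = \<bar>a\<bar> * nrm2 M u"
  by (simp add: nrm2_def power_mult_distrib real_sqrt_mult)

lemma nrm2_minus_commute: "nrm2 M (\<lambda>x. u x - v x) = nrm2 M (\<lambda>x. v x - u x)"
  by (simp add: nrm2_def power2_commute)

lemma nrm2_cong_AE:
  assumes "u \<in> borel_measurable M" "v \<in> borel_measurable M" "AE x in M. u x = v x"
  shows "nrm2 M u = nrm2 M v"
proof -
  have "(\<integral>x. (u x)\<^sup>2 \<partial>M) = (\<integral>x. (v x)\<^sup>2 \<partial>M)"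
    by (rule integral_cong_AE) (use assms in auto)
  thus ?thesis by (simp add: nrm2_def)
qed

lemma nrm2_mono:
  assumes "u \<in> sqi M" "v \<in> borel_measurable M" "AE x in M. \<bar>v x\<bar> \<le> \<bar>u x\<bar>"
  shows "nrm2 M v \<le> nrm2 M u"
proof -
  have "(\<integral>x. (v x)\<^sup>2 \<partial>M) \<le> (\<integral>x. (u x)\<^sup>2 \<partial>M)"
  proof (rule integral_mono_AE)
    show "integrable M (\<lambda>x. (v x)\<^sup>2)" using sqi_bound[OF assms] by (simp add: sqi_def)
    show "AE x in M. (v x)\<^sup>2 \<le> (u x)\<^sup>2" using assms(3) by (auto simp: abs_le_square_iff)
  qed (use assms in \<open>simp add: sqi_def\<close>)
  thus ?thesis by (simp add: nrm2_def)
qed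

text \<open>The quadratic t \<mapsto> \<integral>(u + tv)^2 is nonnegative; its minimizer t = -p/b
  gives the bound. For b = 0 it is affine in t, which forces p = 0.\<close>

lemma Cauchy_Schwarz_nrm2:
  assumes "u \<in> sqi M" "v \<in> sqi M"
  shows "\<bar>\<integral>x. u x * v x \<partial>M\<bar> \<le> nrm2 M u * nrm2 M v"
proof -
  define a b p where "a = (\<integral>x. (u x)\<^sup>2 \<partial>M)" "b = (\<integral>x. (v x)\<^sup>2 \<partial>M)" "p = (\<integral>x. u x * v x \<partial>M)"
  have ab: "0 \<le> a" "0 \<le> b" by (auto simp: a_b_p_def)
  have quad: "0 \<le> a + 2 * t * p + t\<^sup>2 * b" for t
  proof -
    have "(\<integral>x. (u x + t * v x)\<^sup>2 \<partial>M) = (\<integral>x. (u x)\<^sup>2 + 2 * t * (u x * v x) + t\<^sup>2 * (v x)\<^sup>2 \<partial>M)"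
      by (rule Bochner_Integration.integral_cong) (auto simp: power2_eq_square algebra_simps)
    also have "\<dots> = a + 2 * t * p + t\<^sup>2 * b"
      unfolding a_b_p_def using assms sqi_integrable_mult[OF assms] by (simp add: sqi_def)
    finally show ?thesis using Bochner_Integration.integral_nonneg[of M "\<lambda>x. (u x + t * v x)\<^sup>2"]
      by simp
  qed
  have "p\<^sup>2 \<le> a * b"
  proof (cases "b = 0")
    case True
    have "p = 0"
    proof (rule ccontr)
      assume "p \<noteq> 0"
      \<comment> \<open>With b = 0 the affine function takes the value -1 at this t.\<close>
      have "0 \<le> a + 2 * (-(a+1) / (2*p)) * p" using quad[of "-(a+1) / (2*p)"] True by simp
      also have "\<dots> = -1" using \<open>p \<noteq> 0\<close> by (simp add: field_simps)
      finally show False by simp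
    qed
    thus ?thesis using True by simp
  next
    case False
    hence "b > 0" using ab by simp
    have "0 \<le> a + 2 * (-p/b) * p + (-p/b)\<^sup>2 * b" by (rule quad)
    also have "\<dots> = a - p\<^sup>2 / b" using \<open>b > 0\<close> by (simp add: field_simps power2_eq_square)
    finally show ?thesis using \<open>b > 0\<close> by (simp add: field_simps)
  qed
  hence "sqrt (p\<^sup>2) \<le> sqrt (a * b)" by (rule real_sqrt_le_mono)
  thus ?thesis by (simp add: nrm2_def a_b_p_def real_sqrt_mult)
qed

lemma nrm2_triangle:
  assumes "u \<in> sqi M" "v \<in> sqi M"
  shows "nrm2 M (\<lambda>x. u x + v x) \<le> nrm2 M u + nrm2 M v"
proof (rule power2_le_imp_le)
  have "(nrm2 M (\<lambda>x. u x + v x))\<^sup>2 = (\<integral>x. (u x)\<^sup>2 + (v x)\<^sup>2 + 2 * (u x * v x) \<partial>M)"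
    unfolding nrm2_sq by (rule Bochner_Integration.integral_cong) (auto simp: power2_eq_square algebra_simps)
  also have "\<dots> = (nrm2 M u)\<^sup>2 + (nrm2 M v)\<^sup>2 + 2 * (\<integral>x. u x * v x \<partial>M)"
    using assms sqi_integrable_mult[OF assms] by (simp add: sqi_def nrm2_sq)
  also have "\<dots> \<le> (nrm2 M u + nrm2 M v)\<^sup>2"
    using Cauchy_Schwarz_nrm2[OF assms] by (simp add: power2_sum)
  finally show "(nrm2 M (\<lambda>x. u x + v x))\<^sup>2 \<le> (nrm2 M u + nrm2 M v)\<^sup>2" .
qed (simp add: nrm2_ge0)

lemma nrm2_triangle_diff:
  assumes "u \<in> sqi M" "v \<in> sqi M"
  shows "nrm2 M (\<lambda>x. u x - v x) \<le> nrm2 M u + nrm2 M v"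
  using nrm2_triangle[OF assms(1) sqi_cmult[OF assms(2), of "-1"]] nrm2_cmult[of M "-1" v] by simp

lemma nrm2_triangle3:
  assumes "u \<in> sqi M" "v \<in> sqi M" "w \<in> sqi M"
  shows "nrm2 M (\<lambda>x. u x - w x) \<le> nrm2 M (\<lambda>x. u x - v x) + nrm2 M (\<lambda>x. v x - w x)"
  using nrm2_triangle[OF sqi_diff[OF assms(1,2)] sqi_diff[OF assms(2,3)]] by simp

lemma nrm2_sum:
  assumes "\<And>i. i \<in> I \<Longrightarrow> f i \<in> sqi M"
  shows "nrm2 M (\<lambda>x. \<Sum>i\<in>I. f i x) \<le> (\<Sum>i\<in>I. nrm2 M (f i))"
  using assms
proof (induction I rule: infinite_finite_induct)
  case (insert i I)
  have "nrm2 M (\<lambda>x. f i x + (\<Sum>i\<in>I. f i x)) \<le> nrm2 M (f i) + nrm2 M (\<lambda>x. \<Sum>i\<in>I. f i x)"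
    by (rule nrm2_triangle) (use insert in \<open>auto intro: sqi_sum\<close>)
  thus ?case using insert by auto
qed auto

lemma nrm2_bounded_mult:
  assumes "u \<in> sqi M" "b \<in> borel_measurable M" "AE x in M. \<bar>b x\<bar> \<le> B"
  shows "nrm2 M (\<lambda>x. b x * u x) \<le> \<bar>B\<bar> * nrm2 M u"
proof -
  have "nrm2 M (\<lambda>x. b x * u x) \<le> nrm2 M (\<lambda>x. B * u x)"
  proof (rule nrm2_mono[OF sqi_cmult[OF assms(1)]])
    show "(\<lambda>x. b x * u x) \<in> borel_measurable M" using assms by (auto simp: sqi_def)
    show "AE x in M. \<bar>b x * u x\<bar> \<le> \<bar>B * u x\<bar>"
      using assms(3) by eventually_elim (auto simp: abs_mult intro!: mult_right_mono)
  qed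
  thus ?thesis by (simp add: nrm2_cmult)
qed

lemma nrm2_eq_0D:
  assumes "u \<in> sqi M" "nrm2 M u = 0" shows "AE x in M. u x = 0"
proof -
  have "(\<integral>x. (u x)\<^sup>2 \<partial>M) = 0" using assms(2) by (simp add: nrm2_def)
  thus ?thesis using integral_nonneg_eq_0_iff_AE[OF sqi_square[OF assms(1)]] by simp
qed

lemma nrm2_tendsto_imp_tendsto_integral:
  assumes "u \<in> sqi M" "\<And>m. f m \<in> sqi M" "g \<in> sqi M" "(\<lambda>m. nrm2 M (\<lambda>x. f m x - u x)) \<longlonglongrightarrow> 0"
  shows "(\<lambda>m. \<integral>x. f m x * g x \<partial>M) \<longlonglongrightarrow> (\<integral>x. u x * g x \<partial>M)"
proof -
  have "(\<lambda>m. (\<integral>x. f m x * g x \<partial>M) - (\<integral>x. u x * g x \<partial>M)) \<longlonglongrightarrow> 0"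
  proof (rule Lim_null_comparison[where g="\<lambda>m. nrm2 M (\<lambda>x. f m x - u x) * nrm2 M g"])
    have "norm ((\<integral>x. f m x * g x \<partial>M) - (\<integral>x. u x * g x \<partial>M)) \<le> nrm2 M (\<lambda>x. f m x - u x) * nrm2 M g" for m
    proof -
      have "(\<integral>x. f m x * g x \<partial>M) - (\<integral>x. u x * g x \<partial>M) = (\<integral>x. (f m x - u x) * g x \<partial>M)"
        using assms sqi_integrable_mult[OF _ assms(3)]
        by (simp add: left_diff_distrib)
      thus ?thesis using Cauchy_Schwarz_nrm2[OF sqi_diff[OF assms(2)[of m] assms(1)] assms(3)] by simp
    qed
    thus "\<forall>\<^sub>F m in sequentially. norm ((\<integral>x. f m x * g x \<partial>M) - (\<integral>x. u x * g x \<partial>M)) \<le> nrm2 M (\<lambda>x. f m x - u x) * nrm2 M g"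
      by simp
    show "(\<lambda>m. nrm2 M (\<lambda>x. f m x - u x) * nrm2 M g) \<longlonglongrightarrow> 0"
      using tendsto_mult_right[OF assms(4), of "nrm2 M g"] by simp
  qed
  thus ?thesis by (simp add: LIM_zero_iff)
qed

lemma nrm2_tendsto_AE_subseq:
  assumes "u \<in> sqi M" "\<And>m. f m \<in> sqi M" "(\<lambda>m. nrm2 M (\<lambda>x. f m x - u x)) \<longlonglongrightarrow> 0"
  obtains r where "strict_mono (r :: nat \<Rightarrow> nat)" "AE x in M. (\<lambda>m. f (r m) x) \<longlonglongrightarrow> u x"
proof -
  have sq: "(\<lambda>m. (nrm2 M (\<lambda>x. f m x - u x))\<^sup>2) \<longlonglongrightarrow> 0\<^sup>2" by (intro tendsto_power assms)
  have "\<exists>r. strict_mono r \<and> (AE x in M. (\<lambda>m. (f (r m) x - u x)\<^sup>2) \<longlonglongrightarrow> 0)"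
  proof (rule tendsto_L1_AE_subseq)
    show "integrable M (\<lambda>x. (f m x - u x)\<^sup>2)" for m using sqi_diff[OF assms(2)[of m] assms(1)] by (simp add: sqi_def)
    show "(\<lambda>n. \<integral>x. norm ((f n x - u x)\<^sup>2) \<partial>M) \<longlonglongrightarrow> 0" using sq by (simp add: nrm2_sq)
  qed
  then obtain r where r: "strict_mono r" "AE x in M. (\<lambda>m. (f (r m) x - u x)\<^sup>2) \<longlonglongrightarrow> 0" by auto
  have "AE x in M. (\<lambda>m. f (r m) x) \<longlonglongrightarrow> u x"
    using r(2)
  proof eventually_elim
    case (elim x)
    have "(\<lambda>m. sqrt ((f (r m) x - u x)\<^sup>2)) \<longlonglongrightarrow> sqrt 0" by (intro tendsto_real_sqrt elim)
    hence "(\<lambda>m. \<bar>f (r m) x - u x\<bar>) \<longlonglongrightarrow> 0" by simp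
    thus ?case by (simp add: LIM_zero_iff tendsto_rabs_zero_iff)
  qed
  thus ?thesis using r(1) that by blast
qed

lemma sqi_dominated_convergence:
  assumes "g \<in> sqi M" "\<And>m. f m \<in> borel_measurable M" "u \<in> borel_measurable M"
    "AE x in M. (\<lambda>m. f m x) \<longlonglongrightarrow> u x" "\<And>m. AE x in M. \<bar>f m x - u x\<bar> \<le> \<bar>g x\<bar>"
  shows "(\<lambda>m. nrm2 M (\<lambda>x. f m x - u x)) \<longlonglongrightarrow> 0"
proof -
  have "(\<lambda>m. \<integral>x. (f m x - u x)\<^sup>2 \<partial>M) \<longlonglongrightarrow> (\<integral>x. 0 \<partial>M)"
  proof (rule integral_dominated_convergence[where w="\<lambda>x. (g x)\<^sup>2"])
    show "AE x in M. (\<lambda>i. (f i x - u x)\<^sup>2) \<longlonglongrightarrow> 0" using assms(4)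
    proof eventually_elim
      case (elim x)
      have "(\<lambda>i. (f i x - u x)\<^sup>2) \<longlonglongrightarrow> (u x - u x)\<^sup>2" by (intro tendsto_intros elim)
      thus ?case by simp
    qed
    show "AE x in M. norm ((f i x - u x)\<^sup>2) \<le> (g x)\<^sup>2" for i
      using assms(5)[of i] by eventually_elim (simp add: abs_le_square_iff)
  qed (use assms in \<open>auto simp: sqi_def\<close>)
  hence "(\<lambda>m. sqrt (\<integral>x. (f m x - u x)\<^sup>2 \<partial>M)) \<longlonglongrightarrow> sqrt 0" by (intro tendsto_real_sqrt) simp
  thus ?thesis by (simp add: nrm2_def)
qed

text \<open>Over a finite measure an L2-Cauchy sequence is L1-Cauchy and therefore has an almost
  everywhere convergent subsequence; Fatou's lemma then upgrades the pointwise limit to an L2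
  limit.\<close>

lemma sqi_complete:
  assumes fin: "finite_measure M" and f: "\<And>m. f m \<in> sqi M"
    and C: "\<And>e. e > 0 \<Longrightarrow> \<exists>N. \<forall>m\<ge>N. \<forall>l\<ge>N. nrm2 M (\<lambda>x. f m x - f l x) \<le> e"
  obtains u where "u \<in> sqi M" "(\<lambda>m. nrm2 M (\<lambda>x. f m x - u x)) \<longlonglongrightarrow> 0"
proof -
  interpret finite_measure M by fact
  have one: "(\<lambda>x. 1) \<in> sqi M" by (simp add: sqi_def)
  have L1: "(\<integral>x. \<bar>v x\<bar> \<partial>M) \<le> nrm2 M v * nrm2 M (\<lambda>x. 1)" if "v \<in> sqi M" for v
  proof -
    have "(\<lambda>x. \<bar>v x\<bar>) \<in> sqi M" using that by (auto simp: sqi_def)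
    from Cauchy_Schwarz_nrm2[OF this one] show ?thesis by (simp add: nrm2_def)
  qed
  have int: "integrable M (f m)" for m using sqi_integrable_mult[OF f[of m] one] by simp
  have "\<exists>r. strict_mono r \<and> (AE x in M. Cauchy (\<lambda>i. f (r i) x))"
  proof -
    have "\<exists>N. \<forall>i\<ge>N. \<forall>j\<ge>N. (LINT x|M. norm (f i x - f j x)) < e" if "e > 0" for e
    proof -
      define e' where "e' = e / (2 * (nrm2 M (\<lambda>x. 1) + 1))"
      have pos: "nrm2 M (\<lambda>x. 1) + 1 > 0" using nrm2_ge0[of M "\<lambda>x. 1"] by linarith
      have "e' > 0" using that pos by (simp add: e'_def)
      then obtain N where N: "\<forall>m\<ge>N. \<forall>l\<ge>N. nrm2 M (\<lambda>x. f m x - f l x) \<le> e'" using C by blast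
      have "(LINT x|M. norm (f i x - f j x)) < e" if "i \<ge> N" "j \<ge> N" for i j
      proof -
        have "(LINT x|M. norm (f i x - f j x)) \<le> nrm2 M (\<lambda>x. f i x - f j x) * nrm2 M (\<lambda>x. 1)"
          using L1[OF sqi_diff[OF f[of i] f[of j]]] by simp
        also have "\<dots> \<le> e' * (nrm2 M (\<lambda>x. 1) + 1)"
          using N that nrm2_ge0[of M "\<lambda>x. 1"] \<open>e' > 0\<close> by (intro mult_mono) auto
        also have "\<dots> = e / 2" unfolding e'_def using pos by (simp add: divide_simps)
        also have "\<dots> < e" using \<open>e > 0\<close> by simp
        finally show ?thesis .
      qed
      thus ?thesis by blast
    qed
    from cauchy_L1_AE_cauchy_subseq[OF int this]
    show ?thesis by metis
  qed
  then obtain r where r: "strict_mono r" "AE x in M. Cauchy (\<lambda>i. f (r i) x)" by auto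
  define u where "u = (\<lambda>x. lim (\<lambda>i. f (r i) x))"
  have fm[measurable]: "f m \<in> borel_measurable M" for m using f by (simp add: sqi_def)
  have um[measurable]: "u \<in> borel_measurable M" unfolding u_def by measurable
  have conv: "AE x in M. (\<lambda>i. f (r i) x) \<longlonglongrightarrow> u x"
    using r(2) by eventually_elim (simp add: u_def Cauchy_convergent_iff convergent_LIMSEQ_iff)
  \<comment> \<open>Letting l run through \<open>r i\<close> in the Cauchy estimate, Fatou's lemma
    replaces \<open>f l\<close> by \<open>u\<close>; integrability and the bound come out
    together.\<close>
  have bd: "integrable M (\<lambda>x. (f m x - u x)\<^sup>2) \<and> nrm2 M (\<lambda>x. f m x - u x) \<le> e"
    if "e > 0" and N: "\<forall>m\<ge>N. \<forall>l\<ge>N. nrm2 M (\<lambda>x. f m x - f l x) \<le> e" and "m \<ge> N" for e N m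
  proof -
    have "(\<integral>\<^sup>+x. ennreal ((f m x - u x)\<^sup>2) \<partial>M) = (\<integral>\<^sup>+x. liminf (\<lambda>i. ennreal ((f m x - f (r i) x)\<^sup>2)) \<partial>M)"
    proof (rule nn_integral_cong_AE)
      show "AE x in M. ennreal ((f m x - u x)\<^sup>2) = liminf (\<lambda>i. ennreal ((f m x - f (r i) x)\<^sup>2))"
        using conv
      proof eventually_elim
        case (elim x)
        have "(\<lambda>i. ennreal ((f m x - f (r i) x)\<^sup>2)) \<longlonglongrightarrow> ennreal ((f m x - u x)\<^sup>2)"
          by (intro tendsto_ennrealI tendsto_intros elim)
        from lim_imp_Liminf[OF _ this] show ?case by simp
      qed
    qed
    also have "\<dots> \<le> liminf (\<lambda>i. \<integral>\<^sup>+x. ennreal ((f m x - f (r i) x)\<^sup>2) \<partial>M)"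
      by (rule nn_integral_liminf) measurable
    also have "\<dots> \<le> liminf (\<lambda>i. ennreal (e\<^sup>2))"
    proof (rule Liminf_mono)
      show "\<forall>\<^sub>F i in sequentially. (\<integral>\<^sup>+x. ennreal ((f m x - f (r i) x)\<^sup>2) \<partial>M) \<le> ennreal (e\<^sup>2)"
        unfolding eventually_sequentially
      proof (intro exI[of _ N] allI impI)
        fix i assume "N \<le> i"
        hence "N \<le> r i" using seq_suble[OF r(1), of i] by linarith
        hence "nrm2 M (\<lambda>x. f m x - f (r i) x) \<le> e" using N \<open>m \<ge> N\<close> by blast
        hence "(\<integral>x. (f m x - f (r i) x)\<^sup>2 \<partial>M) \<le> e\<^sup>2"
          unfolding nrm2_sq[symmetric] using nrm2_ge0[of M] by (intro power_mono) auto
        thus "(\<integral>\<^sup>+x. ennreal ((f m x - f (r i) x)\<^sup>2) \<partial>M) \<le> ennreal (e\<^sup>2)"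
          using sqi_square[OF sqi_diff[OF f[of m] f[of "r i"]]]
          by (subst nn_integral_eq_integral) (auto intro: ennreal_leI)
      qed
    qed
    also have "\<dots> = ennreal (e\<^sup>2)" by (simp add: Liminf_const)
    finally have le: "(\<integral>\<^sup>+x. ennreal ((f m x - u x)\<^sup>2) \<partial>M) \<le> ennreal (e\<^sup>2)" .
    have i: "integrable M (\<lambda>x. (f m x - u x)\<^sup>2)"
      by (rule integrableI_bounded) (use le in \<open>auto intro: le_less_trans\<close>)
    have "(\<integral>x. (f m x - u x)\<^sup>2 \<partial>M) \<le> e\<^sup>2"
      using le nn_integral_eq_integral[OF i] by simp
    hence "nrm2 M (\<lambda>x. f m x - u x) \<le> sqrt (e\<^sup>2)" unfolding nrm2_def by (rule real_sqrt_le_mono)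
    thus ?thesis using i \<open>e > 0\<close> by simp
  qed
  obtain N where N: "\<forall>m\<ge>N. \<forall>l\<ge>N. nrm2 M (\<lambda>x. f m x - f l x) \<le> 1" using C[of 1] by auto
  have "(\<lambda>x. f N x - u x) \<in> sqi M" using bd[OF _ N, of N] by (simp add: sqi_def)
  from sqi_diff[OF f[of N] this] have us: "u \<in> sqi M" by simp
  have "(\<lambda>m. nrm2 M (\<lambda>x. f m x - u x)) \<longlonglongrightarrow> 0"
  proof (rule LIMSEQ_I)
    fix e :: real assume "e > 0"
    then obtain N where N: "\<forall>m\<ge>N. \<forall>l\<ge>N. nrm2 M (\<lambda>x. f m x - f l x) \<le> e/2" using C[of "e/2"] by auto
    show "\<exists>no. \<forall>n\<ge>no. norm (nrm2 M (\<lambda>x. f n x - u x) - 0) < e"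
      using bd[OF _ N] \<open>e > 0\<close> nrm2_ge0[of M] by (intro exI[of _ N]) fastforce
  qed
  thus ?thesis using us that by blast
qed

section \<open>Smooth functions\<close>

lemma has_derivative_frechet: "f differentiable (at x) \<Longrightarrow> (f has_derivative frechet_derivative f (at x)) (at x)"
  by (simp add: frechet_derivative_works)

lemma frechet_derivative_eqI: "(f has_derivative f') (at x) \<Longrightarrow> frechet_derivative f (at x) = f'"
  by (metis frechet_derivative_at)

lemma frechet_derivative_cong_open:
  assumes "open U" "x \<in> U" "\<And>y. y \<in> U \<Longrightarrow> f y = g y"
  shows "frechet_derivative f (at x) = frechet_derivative g (at x)"
proof -
  have "(f has_derivative f') (at x) \<longleftrightarrow> (g has_derivative f') (at x)" for f'
    using has_derivative_transform_within_open[OF _ assms(1,2), of f f' UNIV g]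
      has_derivative_transform_within_open[OF _ assms(1,2), of g f' UNIV f] assms(3) by auto
  thus ?thesis unfolding frechet_derivative_def by simp
qed

lemma Ck_on_cong:
  assumes "open U" "Ck_on m U f" "\<And>x. x \<in> U \<Longrightarrow> f x = g x"
  shows "Ck_on m U g"
  using assms(2,3)
proof (induction m arbitrary: f g)
  case 0 thus ?case by (simp cong: continuous_on_cong)
next
  case (Suc m)
  have "g differentiable (at x)" if "x \<in> U" for x
  proof -
    have "(f has_derivative frechet_derivative f (at x)) (at x)"
      using Suc.prems that by (simp add: has_derivative_frechet)
    hence "(g has_derivative frechet_derivative f (at x)) (at x)"
      using has_derivative_transform_within_open[OF _ assms(1) that] Suc.prems(2) by blast
    thus ?thesis by (auto simp: differentiable_def)
  qed
  moreover have "Ck_on m U (\<lambda>x. frechet_derivative g (at x) v)" for v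
  proof (rule Suc.IH)
    show "Ck_on m U (\<lambda>x. frechet_derivative f (at x) v)" using Suc.prems by simp
    show "frechet_derivative f (at x) v = frechet_derivative g (at x) v" if "x \<in> U" for x
      using frechet_derivative_cong_open[OF assms(1) that Suc.prems(2)] by simp
  qed
  ultimately show ?case by simp
qed

text \<open>\<open>Ck_on\<close> speaks of the operator \<open>frechet_derivative\<close>;
  uniqueness of derivatives at points of an open set lets any explicit derivative take its
  place.\<close>

lemma Ck_on_SucI:
  assumes "open U" "\<And>x. x \<in> U \<Longrightarrow> (f has_derivative f' x) (at x)" "\<And>v. Ck_on m U (\<lambda>x. f' x v)"
  shows "Ck_on (Suc m) U f"
proof -
  have "Ck_on m U (\<lambda>x. frechet_derivative f (at x) v)" for v
    by (rule Ck_on_cong[OF assms(1,3)]) (use frechet_derivative_eqI[OF assms(2)] in simp)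
  thus ?thesis using assms(2) by (auto simp: differentiable_def)
qed

lemma Ck_on_SucD: "Ck_on (Suc m) U f \<Longrightarrow> x \<in> U \<Longrightarrow> (f has_derivative frechet_derivative f (at x)) (at x)"
  by (simp add: has_derivative_frechet)

lemma Ck_on_Suc_imp: "Ck_on (Suc m) U f \<Longrightarrow> Ck_on m U f"
proof (induction m arbitrary: f)
  case 0 thus ?case
    by (auto intro!: continuous_at_imp_continuous_on differentiable_imp_continuous_within)
qed auto

lemma Ck_on_const: "Ck_on m U (\<lambda>x. c)"
  by (induction m arbitrary: c) auto

lemma Ck_on_linear: assumes "bounded_linear h" "open U" shows "Ck_on m U h"
proof (cases m)
  case 0 thus ?thesis using assms by (simp add: linear_continuous_on)
next
  case (Suc k)
  show ?thesis unfolding Suc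
    by (rule Ck_on_SucI[OF assms(2), of _ "\<lambda>x. h"])
      (auto intro: bounded_linear_imp_has_derivative assms Ck_on_const)
qed

lemma Ck_on_add:
  assumes "open U" "Ck_on m U f" "Ck_on m U g" shows "Ck_on m U (\<lambda>x. f x + g x)"
  using assms(2,3)
proof (induction m arbitrary: f g)
  case 0 thus ?case by (auto intro: continuous_intros)
next
  case (Suc m)
  show ?case
    by (rule Ck_on_SucI[OF assms(1), of _ "\<lambda>x v. frechet_derivative f (at x) v + frechet_derivative g (at x) v"])
      (use Suc in \<open>auto intro!: has_derivative_add has_derivative_frechet\<close>)
qed

lemma Ck_on_bounded_linear:
  assumes "open U" "bounded_linear h" "Ck_on m U f" shows "Ck_on m U (\<lambda>x. h (f x))"
  using assms(3)
proof (induction m arbitrary: f)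
  case 0 thus ?case using bounded_linear.continuous_on[OF assms(2)] by simp
next
  case (Suc m)
  show ?case
    by (rule Ck_on_SucI[OF assms(1), of _ "\<lambda>x v. h (frechet_derivative f (at x) v)"])
      (use Suc in \<open>auto intro!: bounded_linear.has_derivative[OF assms(2)] has_derivative_frechet\<close>)
qed

lemma Ck_on_mult:
  fixes f g :: "'a::real_normed_vector \<Rightarrow> real"
  assumes "open U" "Ck_on m U f" "Ck_on m U g" shows "Ck_on m U (\<lambda>x. f x * g x)"
  using assms(2,3)
proof (induction m arbitrary: f g)
  case 0 thus ?case by (auto intro: continuous_intros)
next
  case (Suc m)
  show ?case
  proof (rule Ck_on_SucI[OF assms(1), of _ "\<lambda>x v. f x * frechet_derivative g (at x) v + frechet_derivative f (at x) v * g x"])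
    show "((\<lambda>x. f x * g x) has_derivative (\<lambda>v. f x * frechet_derivative g (at x) v + frechet_derivative f (at x) v * g x)) (at x)"
      if "x \<in> U" for x
      by (rule has_derivative_mult) (use Suc.prems that in \<open>auto intro: has_derivative_frechet\<close>)
    show "Ck_on m U (\<lambda>x. f x * frechet_derivative g (at x) v + frechet_derivative f (at x) v * g x)" for v
      using Suc.prems Ck_on_Suc_imp[OF Suc.prems(1)] Ck_on_Suc_imp[OF Suc.prems(2)]
      by (intro Ck_on_add assms(1) Suc.IH) auto
  qed
qed

lemma Ck_on_inverse:
  fixes f :: "'a::real_normed_vector \<Rightarrow> real"
  assumes "open U" "Ck_on m U f" "\<And>x. x \<in> U \<Longrightarrow> f x \<noteq> 0" shows "Ck_on m U (\<lambda>x. inverse (f x))"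
  using assms(2)
proof (induction m)
  case 0 thus ?case using assms(3) by (auto intro!: continuous_intros)
next
  case (Suc m)
  show ?case
  proof (rule Ck_on_SucI[OF assms(1), of _ "\<lambda>x v. (-1) * ((inverse (f x) * frechet_derivative f (at x) v) * inverse (f x))"])
    show "((\<lambda>x. inverse (f x)) has_derivative (\<lambda>v. (-1) * ((inverse (f x) * frechet_derivative f (at x) v) * inverse (f x)))) (at x)"
      if "x \<in> U" for x
      using Deriv.has_derivative_inverse[OF assms(3)[OF that] Ck_on_SucD[OF Suc.prems that]] by simp
    show "Ck_on m U (\<lambda>x. (-1) * ((inverse (f x) * frechet_derivative f (at x) v) * inverse (f x)))" for v
      using Suc.prems Suc.IH[OF Ck_on_Suc_imp[OF Suc.prems]]
      by (intro Ck_on_mult assms(1) Ck_on_const) auto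
  qed
qed

text \<open>\<open>G\<close> is assumed smooth to all orders because the induction on
  \<open>m\<close> is applied to the derivative of \<open>G\<close>, not to \<open>G\<close>
  itself.\<close>

lemma Ck_on_compose_real:
  fixes f :: "'a::real_normed_vector \<Rightarrow> real" and G :: "real \<Rightarrow> real"
  assumes "open U" "Ck_on m U f" "\<And>m. Ck_on m UNIV G" shows "Ck_on m U (\<lambda>x. G (f x))"
  using assms(2,3)
proof (induction m arbitrary: G)
  case 0
  have "Ck_on 0 UNIV G" by (rule 0(2))
  thus ?case using 0(1) by (auto intro: continuous_on_compose2)
next
  case (Suc m)
  have dG: "(G has_derivative frechet_derivative G (at t)) (at t)" for t
    using Suc.prems(2)[of "Suc 0"] Ck_on_SucD by blast
  have lin: "frechet_derivative G (at t) s = s * frechet_derivative G (at t) 1" for s t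
  proof -
    have "linear (frechet_derivative G (at t))" using dG has_derivative_linear by blast
    from linear_scale[OF this, of s 1] show ?thesis by simp
  qed
  show ?case
  proof (rule Ck_on_SucI[OF assms(1), of _ "\<lambda>x v. frechet_derivative f (at x) v * frechet_derivative G (at (f x)) 1"])
    show "((\<lambda>x. G (f x)) has_derivative (\<lambda>v. frechet_derivative f (at x) v * frechet_derivative G (at (f x)) 1)) (at x)"
      if "x \<in> U" for x
      using has_derivative_compose[OF Ck_on_SucD[OF Suc.prems(1) that] dG]
      by (subst (asm) lin) simp
    have "Ck_on k UNIV (\<lambda>t. frechet_derivative G (at t) 1)" for k
      using Suc.prems(2)[of "Suc k"] by simp
    hence "Ck_on m U (\<lambda>x. frechet_derivative G (at (f x)) 1)"
      using Suc.IH[OF Ck_on_Suc_imp[OF Suc.prems(1)]] by blast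
    thus "Ck_on m U (\<lambda>x. frechet_derivative f (at x) v * frechet_derivative G (at (f x)) 1)" for v
      using Suc.prems(1) by (intro Ck_on_mult assms(1)) auto
  qed
qed

lemma Ck_on_subset: "Ck_on m U f \<Longrightarrow> V \<subseteq> U \<Longrightarrow> Ck_on m V f"
  by (induction m arbitrary: f) (auto intro: continuous_on_subset)

lemma Ck_on_Un:
  assumes "open U" "open V" "Ck_on m U f" "Ck_on m V f" shows "Ck_on m (U \<union> V) f"
  using assms(3,4) by (induction m arbitrary: f) (auto intro: continuous_on_open_Un assms)

lemma smooth_on_const: "smooth_on U (\<lambda>x. c)" by (simp add: smooth_on_def Ck_on_const)
lemma smooth_on_linear: "bounded_linear h \<Longrightarrow> open U \<Longrightarrow> smooth_on U h"
  by (simp add: smooth_on_def Ck_on_linear)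
lemma smooth_on_add: "open U \<Longrightarrow> smooth_on U f \<Longrightarrow> smooth_on U g \<Longrightarrow> smooth_on U (\<lambda>x. f x + g x)"
  by (simp add: smooth_on_def Ck_on_add)
lemma smooth_on_bounded_linear: "open U \<Longrightarrow> bounded_linear h \<Longrightarrow> smooth_on U f \<Longrightarrow> smooth_on U (\<lambda>x. h (f x))"
  by (simp add: smooth_on_def Ck_on_bounded_linear)
lemma smooth_on_mult:
  fixes f g :: "'a::real_normed_vector \<Rightarrow> real"
  shows "open U \<Longrightarrow> smooth_on U f \<Longrightarrow> smooth_on U g \<Longrightarrow> smooth_on U (\<lambda>x. f x * g x)"
  by (simp add: smooth_on_def Ck_on_mult)
lemma smooth_on_inverse:
  fixes f :: "'a::real_normed_vector \<Rightarrow> real"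
  shows "open U \<Longrightarrow> smooth_on U f \<Longrightarrow> (\<And>x. x \<in> U \<Longrightarrow> f x \<noteq> 0) \<Longrightarrow> smooth_on U (\<lambda>x. inverse (f x))"
  by (simp add: smooth_on_def Ck_on_inverse)
lemma smooth_on_compose_real:
  fixes f :: "'a::real_normed_vector \<Rightarrow> real" and G :: "real \<Rightarrow> real"
  shows "open U \<Longrightarrow> smooth_on U f \<Longrightarrow> smooth_on UNIV G \<Longrightarrow> smooth_on U (\<lambda>x. G (f x))"
  by (simp add: smooth_on_def Ck_on_compose_real)
lemma smooth_on_cong: "open U \<Longrightarrow> smooth_on U f \<Longrightarrow> (\<And>x. x \<in> U \<Longrightarrow> f x = g x) \<Longrightarrow> smooth_on U g"
  unfolding smooth_on_def using Ck_on_cong by blast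
lemma smooth_on_subset: "smooth_on U f \<Longrightarrow> V \<subseteq> U \<Longrightarrow> smooth_on V f"
  unfolding smooth_on_def using Ck_on_subset by blast
lemma smooth_on_Un: "open U \<Longrightarrow> open V \<Longrightarrow> smooth_on U f \<Longrightarrow> smooth_on V f \<Longrightarrow> smooth_on (U \<union> V) f"
  by (simp add: smooth_on_def Ck_on_Un)
lemma smooth_on_continuous: "smooth_on U f \<Longrightarrow> continuous_on U f"
  unfolding smooth_on_def by (metis Ck_on.simps(1))
lemma smooth_on_differentiable: "smooth_on U f \<Longrightarrow> x \<in> U \<Longrightarrow> f differentiable (at x)"
  unfolding smooth_on_def by (metis Ck_on.simps(2))
lemma smooth_on_has_derivative:
  "smooth_on U f \<Longrightarrow> x \<in> U \<Longrightarrow> (f has_derivative frechet_derivative f (at x)) (at x)"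
  by (simp add: smooth_on_differentiable has_derivative_frechet)
lemma smooth_on_frechet_derivative: "smooth_on U f \<Longrightarrow> smooth_on U (\<lambda>x. frechet_derivative f (at x) v)"
  unfolding smooth_on_def by (metis Ck_on.simps(2))
lemma smooth_on_sum:
  "open U \<Longrightarrow> (\<And>i. i \<in> I \<Longrightarrow> smooth_on U (f i)) \<Longrightarrow> smooth_on U (\<lambda>x. \<Sum>i\<in>I. f i x)"
  by (induction I rule: infinite_finite_induct) (auto intro: smooth_on_const smooth_on_add)
lemma smooth_on_prod:
  fixes f :: "'i \<Rightarrow> 'a::real_normed_vector \<Rightarrow> real"
  shows "open U \<Longrightarrow> (\<And>i. i \<in> I \<Longrightarrow> smooth_on U (f i)) \<Longrightarrow> smooth_on U (\<lambda>x. \<Prod>i\<in>I. f i x)"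
  by (induction I rule: infinite_finite_induct) (auto intro: smooth_on_const smooth_on_mult)
lemma smooth_on_uminus: "open U \<Longrightarrow> smooth_on U f \<Longrightarrow> smooth_on U (\<lambda>x. - f x)"
  using smooth_on_bounded_linear[OF _ bounded_linear_minus[OF bounded_linear_ident]] by blast
lemma smooth_on_diff: "open U \<Longrightarrow> smooth_on U f \<Longrightarrow> smooth_on U g \<Longrightarrow> smooth_on U (\<lambda>x. f x - g x)"
  using smooth_on_add[of U f "\<lambda>x. - g x"] smooth_on_uminus[of U g] by simp
lemma smooth_on_nth: "open U \<Longrightarrow> smooth_on U X \<Longrightarrow> smooth_on U (\<lambda>x. X x $ i)"
  for X :: "'a::real_normed_vector \<Rightarrow> real ^ 'd"
  using smooth_on_bounded_linear[OF _ bounded_linear_vec_nth] by blast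

lemma smooth_on_scaleR_const:
  assumes "open U" "smooth_on U f" shows "smooth_on U (\<lambda>x. f x *\<^sub>R c)"
  by (rule smooth_on_bounded_linear[OF assms(1) bounded_linear_scaleR_left assms(2)])

lemma smooth_on_vec:
  fixes X :: "'a::real_normed_vector \<Rightarrow> real ^ 'd"
  assumes "open U" "\<And>i. smooth_on U (\<lambda>x. X x $ i)" shows "smooth_on U X"
proof -
  have "smooth_on U (\<lambda>x. \<Sum>i\<in>UNIV. (X x $ i) *\<^sub>R axis i (1::real))"
    by (intro smooth_on_sum smooth_on_scaleR_const assms)
  moreover have "(\<lambda>x. \<Sum>i\<in>UNIV. (X x $ i) *\<^sub>R axis i (1::real)) = X"
    by (simp add: fun_eq_iff vec_eq_iff sum.If_cases axis_def if_distrib cong: if_cong)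
  ultimately show ?thesis by simp
qed

section \<open>A bump function on the line\<close>

text \<open>These are t^(-p) exp(-1/t), extended by 0. Differentiation maps the family into its own
  span, so that smoothness of all members is a single induction; index 0 is the classical flat
  function.\<close>

definition flat :: "nat \<Rightarrow> real \<Rightarrow> real" where
  "flat p t = (if t > 0 then (1/t)^p * exp (-(1/t)) else 0)"

text \<open>Substituting s = 1/t reduces this to the decay of s^p / exp s at infinity.\<close>

lemma flat_tendsto_0: "((\<lambda>t. flat p t) \<longlongrightarrow> 0) (at 0)"
proof -
  have "((\<lambda>t. (1/t)^p * exp (-(1/t))) \<longlongrightarrow> 0) (at_right (0::real))"
  proof -
    have "((\<lambda>s::real. s^p / exp s) \<longlongrightarrow> 0) at_top" by (rule tendsto_power_div_exp_0)
    hence "((\<lambda>t::real. (inverse t)^p / exp (inverse t)) \<longlongrightarrow> 0) (at_right 0)"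
      by (rule filterlim_compose[OF _ filterlim_inverse_at_top_right])
    thus ?thesis by (simp add: exp_minus divide_inverse)
  qed
  hence r: "((\<lambda>t. flat p t) \<longlongrightarrow> 0) (at_right 0)"
    by (rule Lim_transform_eventually) (auto simp: flat_def eventually_at_filter)
  have l: "((\<lambda>t. flat p t) \<longlongrightarrow> 0) (at_left 0)"
    by (rule Lim_transform_eventually[OF tendsto_const]) (auto simp: flat_def eventually_at_filter)
  show ?thesis using l r by (simp add: filterlim_split_at)
qed

lemma flat_DERIV: "(flat p has_real_derivative (flat (p+2) t - p * flat (p+1) t)) (at t)"
proof -
  consider "t > 0" | "t < 0" | "t = 0" by linarith
  thus ?thesis
  proof cases
    case 1
    have "((\<lambda>t. (1/t)^p * exp (-(1/t))) has_real_derivative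
        ((1/t)^(p+2) * exp (-(1/t)) - p * ((1/t)^(p+1) * exp(-(1/t))))) (at t)"
    proof (cases p)
      case 0
      show ?thesis using 1 unfolding 0
        by (auto intro!: derivative_eq_intros simp: field_simps power2_eq_square)
    next
      case (Suc q)
      have "((\<lambda>t. (1/t)^Suc q * exp (-(1/t))) has_real_derivative
          (real (Suc q) * (1/t)^q * (-1/t\<^sup>2) * exp (-(1/t)) + (exp (-(1/t)) * (1/t\<^sup>2)) * (1/t)^Suc q)) (at t)"
      proof (rule DERIV_mult)
        have "((\<lambda>t. 1/t) has_real_derivative (-1/t\<^sup>2)) (at t)"
          using 1 by (auto intro!: derivative_eq_intros simp: power2_eq_square)
        from DERIV_power_Suc[OF this, of q]
        show "((\<lambda>t. (1/t)^Suc q) has_real_derivative real (Suc q) * (1/t)^q * (-1/t\<^sup>2)) (at t)"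
          by (simp add: ac_simps)
        show "((\<lambda>t. exp (-(1/t))) has_real_derivative exp (-(1/t)) * (1/t\<^sup>2)) (at t)"
          using 1 by (auto intro!: derivative_eq_intros simp: power2_eq_square)
      qed
      moreover have "real (Suc q) * (1/t)^q * (-1/t\<^sup>2) * exp (-(1/t)) + (exp (-(1/t)) * (1/t\<^sup>2)) * (1/t)^Suc q
          = (1/t)^(Suc q+2) * exp (-(1/t)) - real (Suc q) * ((1/t)^(Suc q+1) * exp(-(1/t)))"
        using 1 by (simp add: field_simps power2_eq_square)
      ultimately show ?thesis unfolding Suc by simp
    qed
    hence "((\<lambda>t. (1/t)^p * exp (-(1/t))) has_real_derivative (flat (p+2) t - p * flat (p+1) t)) (at t)"
      using 1 by (simp add: flat_def)
    thus ?thesis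
      by (rule has_field_derivative_transform_within_open[of _ _ _ "{0<..}"]) (use 1 in \<open>auto simp: flat_def\<close>)
  next
    case 2
    have "((\<lambda>t. 0) has_real_derivative (flat (p+2) t - p * flat (p+1) t)) (at t)"
      using 2 by (simp add: flat_def)
    thus ?thesis
      by (rule has_field_derivative_transform_within_open[of _ _ _ "{..<0}"]) (use 2 in \<open>auto simp: flat_def\<close>)
  next
    case 3
    \<comment> \<open>At 0 the difference quotient of \<open>flat p\<close> is
      \<open>flat (p+1)\<close>.\<close>
    have "((\<lambda>y. (flat p y - flat p 0) / (y - 0)) \<longlongrightarrow> 0) (at 0)"
      by (rule Lim_transform_eventually[OF flat_tendsto_0[of "p+1"]])
        (auto simp: flat_def eventually_at_filter)
    thus ?thesis using 3 by (simp add: has_field_derivative_iff flat_def)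
  qed
qed

lemma Ck_on_flat: "Ck_on m UNIV (flat p)"
proof (induction m arbitrary: p)
  case 0 show ?case using DERIV_isCont[OF flat_DERIV] by (auto intro!: continuous_at_imp_continuous_on)
next
  case (Suc m)
  show ?case
  proof (rule Ck_on_SucI[of _ _ "\<lambda>t v. (flat (p+2) t + (- real p) * flat (p+1) t) * v"])
    show "(flat p has_derivative (\<lambda>v. (flat (p+2) t + (- real p) * flat (p+1) t) * v)) (at t)" for t
      using flat_DERIV[of p t] by (simp add: has_field_derivative_def)
    show "Ck_on m UNIV (\<lambda>t. (flat (p+2) t + (- real p) * flat (p+1) t) * v)" for v
      by (intro Ck_on_mult Ck_on_add Ck_on_const Suc) auto
  qed auto
qed

lemma smooth_flat: "smooth_on UNIV (flat 0)" by (simp add: smooth_on_def Ck_on_flat)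
lemma flat_pos_iff: "flat 0 t > 0 \<longleftrightarrow> t > 0" and flat_nonneg: "flat 0 t \<ge> 0" by (auto simp: flat_def)

definition bump :: "real ^ 'd \<Rightarrow> real ^ 'd \<Rightarrow> real ^ 'd \<Rightarrow> real" where
  "bump a b x = (\<Prod>i\<in>UNIV. flat 0 (x $ i - a $ i) * flat 0 (b $ i - x $ i))"

lemma smooth_bump: "smooth_on UNIV (bump a b)"
proof -
  have "smooth_on UNIV (\<lambda>x. x $ i)" for i by (intro smooth_on_linear) (auto intro: bounded_linear_vec_nth)
  thus ?thesis unfolding bump_def
    by (intro smooth_on_prod smooth_on_mult smooth_on_compose_real[OF _ _ smooth_flat] smooth_on_diff smooth_on_const) auto
qed

lemma bump_nonneg: "bump a b x \<ge> 0"
  unfolding bump_def by (intro prod_nonneg) (auto intro: flat_nonneg mult_nonneg_nonneg)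

lemma bump_pos_iff: "bump a b x > 0 \<longleftrightarrow> x \<in> box a b"
proof
  assume "bump a b x > 0"
  hence "(\<Prod>i\<in>UNIV. flat 0 (x $ i - a $ i) * flat 0 (b $ i - x $ i)) \<noteq> 0"
    unfolding bump_def by linarith
  hence "flat 0 (x $ i - a $ i) * flat 0 (b $ i - x $ i) \<noteq> 0" for i
    unfolding prod_zero_iff[OF finite] by blast
  hence "flat 0 (x $ i - a $ i) > 0 \<and> flat 0 (b $ i - x $ i) > 0" for i
    using flat_nonneg[of "x $ i - a $ i"] flat_nonneg[of "b $ i - x $ i"] by (auto simp: less_eq_real_def)
  hence "a $ i < x $ i \<and> x $ i < b $ i" for i by (simp add: flat_pos_iff)
  thus "x \<in> box a b" by (simp add: mem_box_cart)
next
  assume "x \<in> box a b"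
  thus "bump a b x > 0" unfolding bump_def
    by (intro prod_pos) (auto simp: mem_box_cart flat_pos_iff intro!: mult_pos_pos)
qed

section \<open>Smooth functions vanishing off a compact set\<close>

text \<open>Recording the set \<open>K\<close> rather than the mere existence of a compact support
  keeps sums, derivatives and whole sequences inside one set, on which integration by parts has no
  boundary term. \<open>test_functions D\<close> is the union of these spaces over compact
  \<open>K\<close> inside \<open>D\<close>.\<close>

definition Cc :: "(real ^ 'd) set \<Rightarrow> (real ^ 'd \<Rightarrow> real) set" where
  "Cc K = {f. smooth_on UNIV f \<and> (\<forall>x. x \<notin> K \<longrightarrow> f x = 0)}"

lemma CcD: "f \<in> Cc K \<Longrightarrow> smooth_on UNIV f" "f \<in> Cc K \<Longrightarrow> x \<notin> K \<Longrightarrow> f x = 0"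
  by (auto simp: Cc_def)

lemma test_functions_iff: "f \<in> test_functions D \<longleftrightarrow> (\<exists>K. compact K \<and> K \<subseteq> D \<and> f \<in> Cc K)"
proof
  assume "f \<in> test_functions D"
  thus "\<exists>K. compact K \<and> K \<subseteq> D \<and> f \<in> Cc K"
    using closure_subset[of "{x. f x \<noteq> 0}"]
    by (intro exI[of _ "closure {x. f x \<noteq> 0}"]) (auto simp: test_functions_def Cc_def)
next
  assume "\<exists>K. compact K \<and> K \<subseteq> D \<and> f \<in> Cc K"
  then obtain K where K: "compact K" "K \<subseteq> D" "f \<in> Cc K" by auto
  have sub: "closure {x. f x \<noteq> 0} \<subseteq> K"
    by (rule closure_minimal) (use K in \<open>auto simp: Cc_def compact_imp_closed\<close>)
  hence "compact (closure {x. f x \<noteq> 0})"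
    using K(1) by (meson bounded_subset closed_closure compact_eq_bounded_closed)
  thus "f \<in> test_functions D" using K sub by (auto simp: test_functions_def Cc_def)
qed

lemma Cc_mono: "f \<in> Cc K \<Longrightarrow> K \<subseteq> K' \<Longrightarrow> f \<in> Cc K'" by (auto simp: Cc_def)
lemma Cc_0: "(\<lambda>x. 0) \<in> Cc K" by (simp add: Cc_def smooth_on_const)
lemma Cc_add: "f \<in> Cc K \<Longrightarrow> g \<in> Cc K \<Longrightarrow> (\<lambda>x. f x + g x) \<in> Cc K"
  by (auto simp: Cc_def intro: smooth_on_add)
lemma Cc_diff: "f \<in> Cc K \<Longrightarrow> g \<in> Cc K \<Longrightarrow> (\<lambda>x. f x - g x) \<in> Cc K"
  by (auto simp: Cc_def intro: smooth_on_diff)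
lemma Cc_sum: "(\<And>i. i \<in> I \<Longrightarrow> f i \<in> Cc K) \<Longrightarrow> (\<lambda>x. \<Sum>i\<in>I. f i x) \<in> Cc K"
  by (auto simp: Cc_def intro: smooth_on_sum)
lemma Cc_cmult: "f \<in> Cc K \<Longrightarrow> (\<lambda>x. c * f x) \<in> Cc K"
  by (auto simp: Cc_def intro: smooth_on_mult smooth_on_const)

text \<open>The coefficient is smooth on \<open>U\<close> only. The product is smooth on
  \<open>U\<close> and vanishes on the complement of \<open>K\<close>, and these two open sets cover
  the whole space.\<close>

lemma Cc_smooth_mult:
  assumes "closed K" "K \<subseteq> U" "open U" "smooth_on U a" "f \<in> Cc K"
  shows "(\<lambda>x. a x * f x) \<in> Cc K"
proof -
  have f: "smooth_on UNIV f" using assms by (simp add: Cc_def)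
  have "smooth_on U (\<lambda>x. a x * f x)"
    by (intro smooth_on_mult assms smooth_on_subset[OF f]) auto
  moreover have "smooth_on (-K) (\<lambda>x. a x * f x)"
    by (rule smooth_on_cong[OF _ smooth_on_const[of _ 0]]) (use assms in \<open>auto simp: Cc_def\<close>)
  ultimately have "smooth_on (U \<union> -K) (\<lambda>x. a x * f x)" by (intro smooth_on_Un) (use assms in auto)
  moreover have "U \<union> -K = UNIV" using assms by auto
  ultimately show ?thesis using assms by (auto simp: Cc_def)
qed

lemma Cc_mult: "smooth_on UNIV a \<Longrightarrow> f \<in> Cc K \<Longrightarrow> (\<lambda>x. a x * f x) \<in> Cc K"
  by (auto simp: Cc_def intro: smooth_on_mult)

lemma Cc_derivative_outside:
  assumes "closed K" "f \<in> Cc K" "x \<notin> K"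
  shows "frechet_derivative f (at x) = (\<lambda>v. 0)"
  using frechet_derivative_cong_open[of "-K" x f "\<lambda>x. 0"] assms by (auto simp: Cc_def)

definition deriv_along :: "(real ^ 'd \<Rightarrow> real ^ 'd) \<Rightarrow> (real ^ 'd \<Rightarrow> real) \<Rightarrow> real ^ 'd \<Rightarrow> real" where
  "deriv_along X f x = frechet_derivative f (at x) (X x)"

abbreviation pd :: "'d \<Rightarrow> (real ^ 'd \<Rightarrow> real) \<Rightarrow> real ^ 'd \<Rightarrow> real" where
  "pd i f \<equiv> deriv_along (\<lambda>x. axis i 1) f"

lemma vec_expand: "v = (\<Sum>i\<in>UNIV. (v $ i) *\<^sub>R axis i (1::real))" for v :: "real ^ 'd"
  by (simp add: vec_eq_iff sum.If_cases axis_def if_distrib cong: if_cong)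

lemma frechet_expand:
  fixes f :: "real ^ 'd \<Rightarrow> 'b::real_normed_vector"
  assumes "f differentiable (at x)"
  shows "frechet_derivative f (at x) v = (\<Sum>i\<in>UNIV. (v $ i) *\<^sub>R frechet_derivative f (at x) (axis i 1))"
proof -
  have "linear (frechet_derivative f (at x))" using assms by (rule linear_frechet_derivative)
  thus ?thesis by (subst (1) vec_expand[of v]) (simp add: linear_sum linear_scale)
qed

lemma deriv_along_expand:
  assumes "f differentiable (at x)"
  shows "deriv_along X f x = (\<Sum>i\<in>UNIV. X x $ i * pd i f x)"
  using frechet_expand[OF assms, of "X x"] by (simp add: deriv_along_def)

lemma Cc_deriv_along_expand: "f \<in> Cc K \<Longrightarrow> deriv_along X f = (\<lambda>x. \<Sum>i\<in>UNIV. X x $ i * pd i f x)"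
  by (rule ext, rule deriv_along_expand) (auto simp: Cc_def intro: smooth_on_differentiable)

lemma pd_eq: "pd i f = (\<lambda>x. frechet_derivative f (at x) (axis i 1))"
  by (simp add: fun_eq_iff deriv_along_def)

lemma smooth_on_pd: "smooth_on U f \<Longrightarrow> smooth_on U (pd i f)"
  unfolding pd_eq by (rule smooth_on_frechet_derivative)

lemma Cc_pd: "closed K \<Longrightarrow> f \<in> Cc K \<Longrightarrow> pd i f \<in> Cc K"
  using Cc_derivative_outside[of K f] smooth_on_pd[of UNIV f]
  by (auto simp: Cc_def) (simp add: deriv_along_def)

lemma Cc_deriv_along:
  assumes "closed K" "K \<subseteq> U" "open U" "smooth_on U X" "f \<in> Cc K"
  shows "deriv_along X f \<in> Cc K"
  by (subst Cc_deriv_along_expand[OF assms(5), of X])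
    (intro Cc_sum Cc_smooth_mult[OF assms(1-3)] smooth_on_nth Cc_pd assms)

lemma deriv_along_add:
  "f differentiable (at x) \<Longrightarrow> g differentiable (at x) \<Longrightarrow> deriv_along X (\<lambda>x. f x + g x) x = deriv_along X f x + deriv_along X g x"
  unfolding deriv_along_def
  by (subst frechet_derivative_eqI[OF has_derivative_add[OF has_derivative_frechet has_derivative_frechet]]) auto

lemma deriv_along_mult:
  "f differentiable (at x) \<Longrightarrow> g differentiable (at x) \<Longrightarrow>
    deriv_along X (\<lambda>x. f x * g x) x = f x * deriv_along X g x + deriv_along X f x * g x"
  unfolding deriv_along_def
  by (subst frechet_derivative_eqI[OF has_derivative_mult[OF has_derivative_frechet has_derivative_frechet]]) auto

lemma deriv_along_const [simp]: "deriv_along X (\<lambda>x. c) x = 0"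
  by (simp add: deriv_along_def)

lemma deriv_along_cmult:
  "f differentiable (at x) \<Longrightarrow> deriv_along X (\<lambda>x. c * f x) x = c * deriv_along X f x"
  using deriv_along_mult[of "\<lambda>x. c" x f X] by simp

lemma deriv_along_diff:
  "f differentiable (at x) \<Longrightarrow> g differentiable (at x) \<Longrightarrow> deriv_along X (\<lambda>x. f x - g x) x = deriv_along X f x - deriv_along X g x"
  unfolding deriv_along_def
  by (subst frechet_derivative_eqI[OF has_derivative_diff[OF has_derivative_frechet has_derivative_frechet]]) auto

lemma deriv_along_sum:
  "(\<And>i. i \<in> I \<Longrightarrow> f i differentiable (at x)) \<Longrightarrow> deriv_along X (\<lambda>x. \<Sum>i\<in>I. f i x) x = (\<Sum>i\<in>I. deriv_along X (f i) x)"
proof (induction I rule: infinite_finite_induct)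
  case (insert a I)
  thus ?case by (simp add: deriv_along_add)
qed auto

lemma Cc_differentiable: "f \<in> Cc K \<Longrightarrow> f differentiable (at x)"
  by (auto simp: Cc_def intro: smooth_on_differentiable)

lemma Cc_continuous: "f \<in> Cc K \<Longrightarrow> continuous_on S f"
  by (auto simp: Cc_def intro: smooth_on_continuous continuous_on_subset)

section \<open>Symmetry of second derivatives\<close>

text \<open>Two applications of the mean value theorem: one along \<open>a\<close> to the increment
  of \<open>f\<close> in direction \<open>b\<close>, one along \<open>b\<close> to the directional
  derivative of \<open>f\<close> in direction \<open>a\<close>.\<close>

lemma second_difference_mean_value:
  fixes f :: "'a::real_normed_vector \<Rightarrow> real"
  assumes f: "smooth_on UNIV f" and h: "h > 0"
  obtains s t where "0 < s" "s < h" "0 < t" "t < h"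
    "f (x + h *\<^sub>R a + h *\<^sub>R b) - f (x + h *\<^sub>R a) - f (x + h *\<^sub>R b) + f x
      = h * h * frechet_derivative (\<lambda>y. frechet_derivative f (at y) a) (at (x + s *\<^sub>R a + t *\<^sub>R b)) b"
proof -
  have D: "((\<lambda>s. g (y + s *\<^sub>R c)) has_real_derivative frechet_derivative g (at (y + s *\<^sub>R c)) c) (at s)"
    if "smooth_on UNIV g" for g :: "'a \<Rightarrow> real" and y c s
  proof -
    have g: "(g has_derivative frechet_derivative g (at (y + s *\<^sub>R c))) (at (y + s *\<^sub>R c))"
      using smooth_on_has_derivative[OF that] by simp
    have "((\<lambda>s. y + s *\<^sub>R c) has_derivative (\<lambda>r. r *\<^sub>R c)) (at s)"
      by (auto intro!: derivative_eq_intros)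
    from has_derivative_compose[OF this g]
    have "((\<lambda>s. g (y + s *\<^sub>R c)) has_derivative (\<lambda>r. frechet_derivative g (at (y + s *\<^sub>R c)) (r *\<^sub>R c))) (at s)" .
    moreover have "linear (frechet_derivative g (at (y + s *\<^sub>R c)))" using g has_derivative_linear by blast
    ultimately show ?thesis by (simp add: has_field_derivative_def linear_scale mult.commute[of _ "frechet_derivative _ _ _"]  mult_commute_abs)
  qed
  define \<Phi> where "\<Phi> s = f (x + h *\<^sub>R b + s *\<^sub>R a) - f (x + s *\<^sub>R a)" for s
  have "\<exists>s. 0 < s \<and> s < h \<and> \<Phi> h - \<Phi> 0 = (h - 0) *
      (frechet_derivative f (at (x + h *\<^sub>R b + s *\<^sub>R a)) a - frechet_derivative f (at (x + s *\<^sub>R a)) a)"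
    unfolding \<Phi>_def by (rule MVT2[OF h]) (intro DERIV_diff D f)
  then obtain s where s: "0 < s" "s < h" "\<Phi> h - \<Phi> 0 = h *
      (frechet_derivative f (at (x + h *\<^sub>R b + s *\<^sub>R a)) a - frechet_derivative f (at (x + s *\<^sub>R a)) a)" by auto
  let ?g = "\<lambda>y. frechet_derivative f (at y) a"
  have "\<exists>t. 0 < t \<and> t < h \<and> ?g (x + s *\<^sub>R a + h *\<^sub>R b) - ?g (x + s *\<^sub>R a + 0 *\<^sub>R b) = (h - 0) *
      frechet_derivative ?g (at (x + s *\<^sub>R a + t *\<^sub>R b)) b"
    by (rule MVT2[OF h]) (intro D smooth_on_frechet_derivative f)
  then obtain t where t: "0 < t" "t < h" "?g (x + s *\<^sub>R a + h *\<^sub>R b) - ?g (x + s *\<^sub>R a) = h *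
      frechet_derivative ?g (at (x + s *\<^sub>R a + t *\<^sub>R b)) b" by auto
  have "x + h *\<^sub>R b + s *\<^sub>R a = x + s *\<^sub>R a + h *\<^sub>R b" "x + h *\<^sub>R b + h *\<^sub>R a = x + h *\<^sub>R a + h *\<^sub>R b" by simp_all
  hence "f (x + h *\<^sub>R a + h *\<^sub>R b) - f (x + h *\<^sub>R a) - f (x + h *\<^sub>R b) + f x
      = h * h * frechet_derivative ?g (at (x + s *\<^sub>R a + t *\<^sub>R b)) b"
    using s(3)[unfolded \<Phi>_def] t(3) by (simp only: scaleR_zero_left add_0_right)
  thus ?thesis using that s t by blast
qed

text \<open>The second difference is symmetric in \<open>a\<close> and \<open>b\<close>; divided by
  h^2 it converges to either mixed derivative, by continuity of second derivatives.\<close>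

lemma symmetric_second_derivative:
  fixes f :: "'a::real_normed_vector \<Rightarrow> real"
  assumes f: "smooth_on UNIV f"
  shows "frechet_derivative (\<lambda>y. frechet_derivative f (at y) a) (at x) b
       = frechet_derivative (\<lambda>y. frechet_derivative f (at y) b) (at x) a"
proof -
  define h where "h n = inverse (real (Suc n))" for n
  have h: "h n > 0" for n by (simp add: h_def)
  have h0: "h \<longlonglongrightarrow> 0" unfolding h_def by (rule LIMSEQ_inverse_real_of_nat)
  have lim: "\<exists>X. (\<forall>n. f (x + h n *\<^sub>R a + h n *\<^sub>R b) - f (x + h n *\<^sub>R a) - f (x + h n *\<^sub>R b) + f x = h n * h n * X n)
     \<and> X \<longlonglongrightarrow> frechet_derivative (\<lambda>y. frechet_derivative f (at y) a) (at x) b" for a b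
  proof -
    let ?F = "\<lambda>z. frechet_derivative (\<lambda>y. frechet_derivative f (at y) a) (at z) b"
    have "\<forall>n. \<exists>s t. 0 < s \<and> s < h n \<and> 0 < t \<and> t < h n \<and>
      f (x + h n *\<^sub>R a + h n *\<^sub>R b) - f (x + h n *\<^sub>R a) - f (x + h n *\<^sub>R b) + f x
      = h n * h n * ?F (x + s *\<^sub>R a + t *\<^sub>R b)"
      by (metis second_difference_mean_value[OF f h])
    then obtain s t where st: "\<And>n. 0 < s n \<and> s n < h n \<and> 0 < t n \<and> t n < h n \<and>
      f (x + h n *\<^sub>R a + h n *\<^sub>R b) - f (x + h n *\<^sub>R a) - f (x + h n *\<^sub>R b) + f x
      = h n * h n * ?F (x + s n *\<^sub>R a + t n *\<^sub>R b)" by metis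
    have "s \<longlonglongrightarrow> 0" "t \<longlonglongrightarrow> 0"
      by (rule tendsto_sandwich[OF _ _ tendsto_const h0]; use st in \<open>auto intro!: always_eventually less_imp_le\<close>)+
    hence "(\<lambda>n. x + s n *\<^sub>R a + t n *\<^sub>R b) \<longlonglongrightarrow> x + 0 *\<^sub>R a + 0 *\<^sub>R b" by (intro tendsto_intros)
    moreover have "continuous_on UNIV ?F"
      by (intro smooth_on_continuous smooth_on_frechet_derivative f)
    ultimately have "(\<lambda>n. ?F (x + s n *\<^sub>R a + t n *\<^sub>R b)) \<longlonglongrightarrow> ?F (x + 0 *\<^sub>R a + 0 *\<^sub>R b)"
      by (intro continuous_on_tendsto_compose[where f="?F"]) auto
    thus ?thesis using st by (intro exI[of _ "\<lambda>n. ?F (x + s n *\<^sub>R a + t n *\<^sub>R b)"]) auto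
  qed
  obtain X where X: "\<forall>n. f (x + h n *\<^sub>R a + h n *\<^sub>R b) - f (x + h n *\<^sub>R a) - f (x + h n *\<^sub>R b) + f x = h n * h n * X n"
     "X \<longlonglongrightarrow> frechet_derivative (\<lambda>y. frechet_derivative f (at y) a) (at x) b" using lim by blast
  obtain Z where Z: "\<forall>n. f (x + h n *\<^sub>R b + h n *\<^sub>R a) - f (x + h n *\<^sub>R b) - f (x + h n *\<^sub>R a) + f x = h n * h n * Z n"
     "Z \<longlonglongrightarrow> frechet_derivative (\<lambda>y. frechet_derivative f (at y) b) (at x) a" using lim by blast
  have "X n = Z n" for n
  proof -
    have "x + h n *\<^sub>R b + h n *\<^sub>R a = x + h n *\<^sub>R a + h n *\<^sub>R b" by simp
    hence "h n * h n * X n = h n * h n * Z n" using X(1) Z(1) by (smt (verit))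
    thus ?thesis using h[of n] by simp
  qed
  hence "X = Z" by auto
  thus ?thesis using X(2) Z(2) LIMSEQ_unique by blast
qed

lemma pd_commute: "smooth_on UNIV f \<Longrightarrow> pd i (pd j f) = pd j (pd i f)"
  using symmetric_second_derivative[of f "axis j 1" _ "axis i 1"]
  by (simp add: pd_eq)

text \<open>The second-order terms of the two iterated derivatives agree by symmetry, and what
  remains are the derivatives of the coefficients, that is the bracket. Off \<open>K\<close> the
  fields need not be differentiable, but there both sides vanish.\<close>

lemma deriv_along_lie_bracket:
  assumes K: "closed K" "K \<subseteq> U" "open U" and X: "smooth_on U X" and Z: "smooth_on U Z" and f: "f \<in> Cc K"
  shows "deriv_along (lie_bracket X Z) f = (\<lambda>x. deriv_along X (deriv_along Z f) x - deriv_along Z (deriv_along X f) x)"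
proof
  fix x
  show "deriv_along (lie_bracket X Z) f x = deriv_along X (deriv_along Z f) x - deriv_along Z (deriv_along X f) x"
  proof (cases "x \<in> K")
    case False
    have "deriv_along A g x = 0" if "g \<in> Cc K" for A g
      using Cc_derivative_outside[OF K(1) that False] by (simp add: deriv_along_def)
    thus ?thesis using f Cc_deriv_along[OF K X f] Cc_deriv_along[OF K Z f] by simp
  next
    case True
    hence xU: "x \<in> U" using K by auto
    have fs: "smooth_on UNIV f" using f by (simp add: Cc_def)
    have df: "g differentiable (at x)" if "g \<in> Cc K" for g using Cc_differentiable[OF that] .
    have dX: "(\<lambda>y. A y $ i) differentiable (at x)" if "smooth_on U A" for A :: "real^'a \<Rightarrow> real^'a" and i
      using smooth_on_differentiable[OF smooth_on_nth[OF K(3) that] xU] .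
    have dXi: "deriv_along B (\<lambda>y. A y $ i) x = frechet_derivative A (at x) (B x) $ i" if "smooth_on U A"
      for A :: "real^'a \<Rightarrow> real^'a" and i B
    proof -
      have "((\<lambda>y. A y $ i) has_derivative (\<lambda>v. frechet_derivative A (at x) v $ i)) (at x)"
        by (rule bounded_linear.has_derivative[OF bounded_linear_vec_nth smooth_on_has_derivative[OF that xU]])
      from frechet_derivative_eqI[OF this] show ?thesis by (simp add: deriv_along_def)
    qed
    \<comment> \<open>The part with second derivatives of \<open>f\<close> is symmetric in
      \<open>A\<close> and \<open>B\<close> and drops out of the commutator; the part with the
      derivative of \<open>B\<close> leaves the bracket.\<close>
    have main: "deriv_along A (deriv_along B f) x
       = (\<Sum>i\<in>UNIV. B x $ i * (\<Sum>j\<in>UNIV. A x $ j * pd j (pd i f) x) + frechet_derivative B (at x) (A x) $ i * pd i f x)"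
      if "smooth_on U A" "smooth_on U B" for A B
    proof -
      have "deriv_along A (deriv_along B f) x = (\<Sum>i\<in>UNIV. deriv_along A (\<lambda>x. B x $ i * pd i f x) x)"
        unfolding Cc_deriv_along_expand[OF f, of B]
        by (intro deriv_along_sum differentiable_mult dX that df Cc_pd K f)
      also have "\<dots> = (\<Sum>i\<in>UNIV. B x $ i * deriv_along A (pd i f) x + deriv_along A (\<lambda>x. B x $ i) x * pd i f x)"
        by (intro sum.cong refl deriv_along_mult dX that df Cc_pd K f)
      finally show ?thesis
        using deriv_along_expand[OF df[OF Cc_pd[OF K(1) f]], of A] dXi[OF that(2)] by simp
    qed
    have sym: "(\<Sum>i\<in>UNIV. Z x $ i * (\<Sum>j\<in>UNIV. X x $ j * pd j (pd i f) x)) = (\<Sum>i\<in>UNIV. X x $ i * (\<Sum>j\<in>UNIV. Z x $ j * pd j (pd i f) x))"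
      by (simp add: sum_distrib_left pd_commute[OF fs] ac_simps) (subst sum.swap, simp add: pd_commute[OF fs] ac_simps)
    have "deriv_along (lie_bracket X Z) f x = (\<Sum>i\<in>UNIV. lie_bracket X Z x $ i * pd i f x)"
      by (rule deriv_along_expand) (rule df[OF f])
    also have "\<dots> = deriv_along X (deriv_along Z f) x - deriv_along Z (deriv_along X f) x"
      unfolding main[OF X Z] main[OF Z X] sum.distrib sym
      by (simp add: lie_bracket_def left_diff_distrib sum_subtractf)
    finally show ?thesis .
  qed
qed

lemma smooth_on_lie_bracket:
  assumes "open U" "smooth_on U X" "smooth_on U Z" shows "smooth_on U (lie_bracket X Z)"
proof -
  have *: "smooth_on U (\<lambda>x. frechet_derivative Z (at x) (X x))" if X: "smooth_on U X" and Z: "smooth_on U Z"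
    for X Z :: "real^'a \<Rightarrow> real^'a"
  proof (rule smooth_on_vec[OF assms(1)])
    fix i
    have "smooth_on U (\<lambda>x. \<Sum>k\<in>UNIV. X x $ k * frechet_derivative Z (at x) (axis k 1) $ i)"
      by (intro smooth_on_sum smooth_on_mult smooth_on_nth smooth_on_frechet_derivative assms(1) X Z)
    thus "smooth_on U (\<lambda>x. frechet_derivative Z (at x) (X x) $ i)"
    proof (rule smooth_on_cong[OF assms(1)])
      fix x assume "x \<in> U"
      from frechet_expand[OF smooth_on_differentiable[OF Z this], of "X x"]
      show "(\<Sum>k\<in>UNIV. X x $ k * frechet_derivative Z (at x) (axis k 1) $ i) = frechet_derivative Z (at x) (X x) $ i"
        by simp
    qed
  qed
  show ?thesis unfolding lie_bracket_def by (intro smooth_on_diff assms(1) * assms)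
qed

lemma smooth_on_divergence:
  assumes "open U" "smooth_on U X" shows "smooth_on U (divergence X)"
proof -
  have "smooth_on U (\<lambda>x. \<Sum>i\<in>UNIV. frechet_derivative X (at x) (axis i 1) $ i)"
    by (intro smooth_on_sum smooth_on_nth smooth_on_frechet_derivative assms)
  thus ?thesis by (simp add: divergence_def[abs_def])
qed

section \<open>Integration by parts\<close>

lemma integrable_compact_support:
  fixes f :: "'a::euclidean_space \<Rightarrow> real"
  assumes "compact K" "continuous_on UNIV f" "\<And>x. x \<notin> K \<Longrightarrow> f x = 0"
  shows "integrable lborel f"
proof -
  have "integrable lborel (\<lambda>x. indicator K x *\<^sub>R f x)"
    by (rule borel_integrable_compact[OF assms(1) continuous_on_subset[OF assms(2)]]) auto
  moreover have "(\<lambda>x. indicator K x *\<^sub>R f x) = f" using assms(3) by (auto simp: indicator_def fun_eq_iff)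
  ultimately show ?thesis by simp
qed

lemma Cc_measurable: "f \<in> Cc K \<Longrightarrow> f \<in> borel_measurable borel"
  by (rule borel_measurable_continuous_onI[OF Cc_continuous])

lemma Cc_integrable: "compact K \<Longrightarrow> f \<in> Cc K \<Longrightarrow> integrable lborel f"
  by (rule integrable_compact_support) (auto intro: Cc_continuous dest: CcD)

lemma Cc_sqi: "compact K \<Longrightarrow> f \<in> Cc K \<Longrightarrow> f \<in> sqi lborel"
  unfolding sqi_def using integrable_compact_support[of K "\<lambda>x. (f x)\<^sup>2"]
  by (auto intro: continuous_intros Cc_continuous dest: CcD simp: Cc_measurable)

lemma continuous_bounded_on_compact:
  fixes f :: "'a::topological_space \<Rightarrow> real"
  assumes "compact K" "continuous_on K f"
  obtains B where "0 \<le> B" "\<And>x. x \<in> K \<Longrightarrow> \<bar>f x\<bar> \<le> B"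
proof -
  have "bounded (f ` K)" by (intro compact_imp_bounded compact_continuous_image assms)
  then obtain B where "\<And>y. y \<in> f ` K \<Longrightarrow> norm y \<le> B" unfolding bounded_iff by blast
  thus ?thesis using that[of "\<bar>B\<bar>"] by fastforce
qed

lemma Cc_bounded:
  assumes "compact K" "f \<in> Cc K" obtains B where "0 \<le> B" "\<And>x. \<bar>f x\<bar> \<le> B"
proof -
  obtain B where "0 \<le> B" "\<And>x. x \<in> K \<Longrightarrow> \<bar>f x\<bar> \<le> B"
    using continuous_bounded_on_compact[OF assms(1) Cc_continuous[OF assms(2)]] by blast
  moreover from this have "\<bar>f x\<bar> \<le> B" for x by (cases "x \<in> K") (use CcD(2)[OF assms(2)] in auto)
  ultimately show ?thesis using that by blast
qed

lemma Cc_derivative_bounded: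
  assumes "compact K" "f \<in> Cc K"
  obtains B where "0 \<le> B" "\<And>x v. \<bar>frechet_derivative f (at x) v\<bar> \<le> B * norm v"
proof -
  have "\<exists>B. 0 \<le> B \<and> (\<forall>x. \<bar>pd i f x\<bar> \<le> B)" for i
    using Cc_bounded[OF assms(1) Cc_pd[OF compact_imp_closed[OF assms(1)] assms(2)]] by metis
  then obtain B where B: "\<And>i. 0 \<le> B i" "\<And>i x. \<bar>pd i f x\<bar> \<le> B i" by metis
  have "\<bar>frechet_derivative f (at x) v\<bar> \<le> (\<Sum>i\<in>UNIV. B i) * norm v" for x v
  proof -
    have "frechet_derivative f (at x) v = (\<Sum>i\<in>UNIV. v $ i * pd i f x)"
      using frechet_expand[OF Cc_differentiable[OF assms(2)], of x v] by (simp add: deriv_along_def)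
    hence "\<bar>frechet_derivative f (at x) v\<bar> \<le> (\<Sum>i\<in>UNIV. \<bar>v $ i * pd i f x\<bar>)" by simp
    also have "\<dots> \<le> (\<Sum>i\<in>UNIV. norm v * B i)"
      by (intro sum_mono) (auto simp: abs_mult intro!: mult_mono B component_le_norm_cart)
    also have "\<dots> = (\<Sum>i\<in>UNIV. B i) * norm v" by (simp add: sum_distrib_left mult.commute)
    finally show ?thesis .
  qed
  thus ?thesis using that[of "\<Sum>i\<in>UNIV. B i"] B(1) by (simp add: sum_nonneg)
qed

lemma Cc_lipschitz:
  assumes "compact K" "f \<in> Cc K"
  obtains L where "0 \<le> L" "\<And>x y. \<bar>f x - f y\<bar> \<le> L * norm (x - y)"
proof -
  obtain B where B: "0 \<le> B" "\<And>x v. \<bar>frechet_derivative f (at x) v\<bar> \<le> B * norm v"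
    using Cc_derivative_bounded[OF assms] by blast
  have "norm (f x - f y) \<le> B * norm (x - y)" for x y
  proof (rule differentiable_bound[of UNIV f "\<lambda>x. frechet_derivative f (at x)"])
    show "(f has_derivative frechet_derivative f (at x)) (at x within UNIV)" for x
      using has_derivative_frechet[OF Cc_differentiable[OF assms(2)]] by simp
    show "onorm (frechet_derivative f (at x)) \<le> B" for x
      by (rule onorm_bound) (use B in auto)
  qed auto
  thus ?thesis using that B(1) by simp
qed

text \<open>The constant does not depend on the base point, which is what permits differentiation
  under the integral sign in the averages below by a direct estimate. It comes from the mean value
  theorem along the segment and Lipschitz constants of the first derivatives.\<close>

lemma Cc_taylor2:
  assumes "compact K" "f \<in> Cc K"
  obtains C where "0 \<le> C" "\<And>y h. \<bar>f (y + h) - f y - frechet_derivative f (at y) h\<bar> \<le> C * (norm h)\<^sup>2"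
proof -
  have "\<exists>L. 0 \<le> L \<and> (\<forall>x y. \<bar>pd i f x - pd i f y\<bar> \<le> L * norm (x - y))" for i
    using Cc_lipschitz[OF assms(1) Cc_pd[OF compact_imp_closed[OF assms(1)] assms(2)]] by metis
  then obtain L where L: "\<And>i. 0 \<le> L i" "\<And>i x y. \<bar>pd i f x - pd i f y\<bar> \<le> L i * norm (x - y)" by metis
  have ex: "frechet_derivative f (at x) v = (\<Sum>i\<in>UNIV. v $ i * pd i f x)" for x v
    using frechet_expand[OF Cc_differentiable[OF assms(2)], of x v] by (simp add: deriv_along_def)
  have "\<bar>f (y + h) - f y - frechet_derivative f (at y) h\<bar> \<le> (\<Sum>i\<in>UNIV. L i) * (norm h)\<^sup>2" for y h
  proof -
    have "((\<lambda>t. f (y + t *\<^sub>R h)) has_real_derivative frechet_derivative f (at (y + t *\<^sub>R h)) h) (at t)" for t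
    proof -
      have g: "(f has_derivative frechet_derivative f (at (y + t *\<^sub>R h))) (at (y + t *\<^sub>R h))"
        using has_derivative_frechet[OF Cc_differentiable[OF assms(2)]] .
      have "((\<lambda>s. y + s *\<^sub>R h) has_derivative (\<lambda>r. r *\<^sub>R h)) (at t)" by (auto intro!: derivative_eq_intros)
      from has_derivative_compose[OF this g]
      have "((\<lambda>s. f (y + s *\<^sub>R h)) has_derivative (\<lambda>r. frechet_derivative f (at (y + t *\<^sub>R h)) (r *\<^sub>R h))) (at t)" .
      moreover have "linear (frechet_derivative f (at (y + t *\<^sub>R h)))" using g has_derivative_linear by blast
      ultimately show ?thesis by (simp add: has_field_derivative_def linear_scale mult_commute_abs)
    qed
    hence "\<exists>t. 0 < t \<and> t < 1 \<and> f (y + 1 *\<^sub>R h) - f (y + 0 *\<^sub>R h) = (1 - 0) * frechet_derivative f (at (y + t *\<^sub>R h)) h"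
      by (intro MVT2) auto
    then obtain t where t: "0 < t" "t < 1" "f (y + h) - f y = frechet_derivative f (at (y + t *\<^sub>R h)) h" by auto
    have "f (y + h) - f y - frechet_derivative f (at y) h = (\<Sum>i\<in>UNIV. h $ i * (pd i f (y + t *\<^sub>R h) - pd i f y))"
      unfolding t(3) ex by (simp add: sum_subtractf right_diff_distrib)
    hence "\<bar>f (y + h) - f y - frechet_derivative f (at y) h\<bar> \<le> (\<Sum>i\<in>UNIV. \<bar>h $ i * (pd i f (y + t *\<^sub>R h) - pd i f y)\<bar>)" by simp
    also have "\<dots> \<le> (\<Sum>i\<in>UNIV. norm h * (L i * norm h))"
    proof (intro sum_mono)
      fix i
      have "\<bar>pd i f (y + t *\<^sub>R h) - pd i f y\<bar> \<le> L i * norm (t *\<^sub>R h)" using L(2)[of i "y + t *\<^sub>R h" y] by simp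
      also have "\<dots> \<le> L i * norm h" using t L(1) by (intro mult_left_mono) (auto intro: mult_left_le_one_le)
      finally show "\<bar>h $ i * (pd i f (y + t *\<^sub>R h) - pd i f y)\<bar> \<le> norm h * (L i * norm h)"
        unfolding abs_mult by (intro mult_mono component_le_norm_cart) auto
    qed
    also have "\<dots> = (\<Sum>i\<in>UNIV. L i) * (norm h)\<^sup>2"
      by (simp add: sum_distrib_left sum_distrib_right power2_eq_square ac_simps)
    finally show ?thesis .
  qed
  thus ?thesis using that[of "\<Sum>i\<in>UNIV. L i"] L(1) by (simp add: sum_nonneg)
qed

lemma integral_translation:
  fixes f :: "'a::euclidean_space \<Rightarrow> real"
  assumes "f \<in> borel_measurable borel"
  shows "(\<integral>x. f (a + x) \<partial>lborel) = (\<integral>x. f x \<partial>lborel)"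
proof -
  have "(\<integral>x. f x \<partial>lborel) = (\<integral>x. f x \<partial>(distr lborel borel ((+) a)))" by (simp add: lborel_distr_plus)
  also have "\<dots> = (\<integral>x. f (a + x) \<partial>lborel)" using assms by (subst integral_distr) auto
  finally show ?thesis by simp
qed

lemma nn_integral_translation:
  fixes f :: "'a::euclidean_space \<Rightarrow> ennreal"
  assumes "f \<in> borel_measurable borel"
  shows "(\<integral>\<^sup>+x. f (a + x) \<partial>lborel) = (\<integral>\<^sup>+x. f x \<partial>lborel)"
proof -
  have "(\<integral>\<^sup>+x. f x \<partial>lborel) = (\<integral>\<^sup>+x. f x \<partial>(distr lborel borel ((+) a)))" by (simp add: lborel_distr_plus)
  also have "\<dots> = (\<integral>\<^sup>+x. f (a + x) \<partial>lborel)" using assms by (subst nn_integral_distr) auto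
  finally show ?thesis by simp
qed

text \<open>The difference quotients have integral zero by translation invariance.\<close>

lemma integral_pd_eq_0:
  assumes K: "compact K" and f: "f \<in> Cc K"
  shows "(\<integral>x. pd i f x \<partial>lborel) = 0"
proof -
  define v :: "real^'a" where "v = axis i 1"
  define h where "h n = inverse (real (Suc n))" for n
  have h: "h n > 0" "h n \<le> 1" for n by (auto simp: h_def field_simps)
  have h0: "h \<longlonglongrightarrow> 0" unfolding h_def by (rule LIMSEQ_inverse_real_of_nat)
  have nv: "norm v = 1" by (simp add: v_def)
  obtain L where L: "0 \<le> L" "\<And>x y. \<bar>f x - f y\<bar> \<le> L * norm (x - y)" using Cc_lipschitz[OF K f] by blast
  obtain C where C: "0 \<le> C" "\<And>y h. \<bar>f (y + h) - f y - frechet_derivative f (at y) h\<bar> \<le> C * (norm h)\<^sup>2"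
    using Cc_taylor2[OF K f] by blast
  obtain R where R: "\<And>x. x \<in> K \<Longrightarrow> norm x \<le> R" using compact_imp_bounded[OF K] unfolding bounded_iff by blast
  have fm[measurable]: "f \<in> borel_measurable borel" using Cc_measurable[OF f] .
  have int: "integrable lborel f" using Cc_integrable[OF K f] .
  let ?q = "\<lambda>n x. (f (h n *\<^sub>R v + x) - f x) / h n"
  have int': "integrable lborel (\<lambda>x. f (a + x))" for a
  proof -
    have "integrable (distr lborel borel ((+) a)) f" using int by (simp add: lborel_distr_plus)
    thus ?thesis by (subst (asm) integrable_distr_eq) auto
  qed
  have zero: "(\<integral>x. ?q n x \<partial>lborel) = 0" for n
  proof -
    have "(\<integral>x. f (h n *\<^sub>R v + x) - f x \<partial>lborel) = 0"
      using int int' integral_translation[OF fm, of "h n *\<^sub>R v"] by (simp add: Bochner_Integration.integral_diff)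
    thus ?thesis by simp
  qed
  have "(\<lambda>n. \<integral>x. ?q n x \<partial>lborel) \<longlonglongrightarrow> (\<integral>x. pd i f x \<partial>lborel)"
  \<comment> \<open>The shifts have length at most 1, so all difference quotients vanish outside the
    ball of radius R + 1, and the Lipschitz constant bounds them inside.\<close>
  proof (rule integral_dominated_convergence[where w="\<lambda>x. L * indicator (cball 0 (R+1)) x"])
    show "pd i f \<in> borel_measurable lborel"
      using Cc_measurable[OF Cc_pd[OF compact_imp_closed[OF K] f]] by simp
    show "integrable lborel (\<lambda>x. L * indicator (cball 0 (R+1)) x :: real)"
      by (intro integrable_mult_right integrable_real_indicator) (auto simp: emeasure_lborel_cball_finite[unfolded infinity_ennreal_def])
    show "AE x in lborel. (\<lambda>n. ?q n x) \<longlonglongrightarrow> pd i f x"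
    proof (rule AE_I2)
      fix x
      have "(\<lambda>n. ?q n x - pd i f x) \<longlonglongrightarrow> 0"
      proof (rule Lim_null_comparison[where g="\<lambda>n. C * h n"])
        have "norm (?q n x - pd i f x) \<le> C * h n" for n
        proof -
          have lin: "linear (frechet_derivative f (at x))" by (rule linear_frechet_derivative[OF Cc_differentiable[OF f]])
          have "\<bar>f (x + h n *\<^sub>R v) - f x - frechet_derivative f (at x) (h n *\<^sub>R v)\<bar> \<le> C * (h n)\<^sup>2"
            using C(2)[of x "h n *\<^sub>R v"] nv h(1)[of n] by simp
          hence "\<bar>f (h n *\<^sub>R v + x) - f x - h n * pd i f x\<bar> \<le> C * (h n)\<^sup>2"
            by (simp add: linear_scale[OF lin] deriv_along_def v_def add.commute)
          moreover have "?q n x - pd i f x = (f (h n *\<^sub>R v + x) - f x - h n * pd i f x) / h n"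
            using h(1)[of n] by (simp add: field_simps)
          ultimately show ?thesis using h(1)[of n] by (simp add: divide_le_eq power2_eq_square mult.assoc)
        qed
        thus "\<forall>\<^sub>F n in sequentially. norm (?q n x - pd i f x) \<le> C * h n" by simp
        show "(\<lambda>n. C * h n) \<longlonglongrightarrow> 0" using tendsto_mult_left[OF h0, of C] by simp
      qed
      thus "(\<lambda>n. ?q n x) \<longlonglongrightarrow> pd i f x" by (simp add: LIM_zero_iff)
    qed
    show "AE x in lborel. norm (?q n x) \<le> L * indicator (cball 0 (R+1)) x" for n
    proof (rule AE_I2)
      fix x
      show "norm (?q n x) \<le> L * indicator (cball 0 (R+1)) x"
      proof (cases "x \<in> cball 0 (R+1)")
        case True
        have "\<bar>f (h n *\<^sub>R v + x) - f x\<bar> \<le> L * h n" using L(2)[of "h n *\<^sub>R v + x" x] nv h(1)[of n] by simp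
        thus ?thesis using True h(1)[of n] by (simp add: divide_le_eq)
      next
        case False
        hence "norm x > R + 1" by simp
        moreover have "norm x \<le> norm (h n *\<^sub>R v + x) + norm (h n *\<^sub>R v)"
          using norm_triangle_ineq4[of "h n *\<^sub>R v + x" "h n *\<^sub>R v"] by simp
        ultimately have "norm (h n *\<^sub>R v + x) > R" "norm x > R" using nv h[of n] by auto
        hence "f (h n *\<^sub>R v + x) = 0" "f x = 0" using R CcD(2)[OF f] by force+
        thus ?thesis using False by simp
      qed
    qed
  qed measurable
  hence "(\<lambda>n::nat. 0) \<longlonglongrightarrow> (\<integral>x. pd i f x \<partial>lborel)" by (simp only: zero)
  thus ?thesis using LIMSEQ_unique[OF tendsto_const] by metis
qed

definition ip :: "(real ^ 'd \<Rightarrow> real) \<Rightarrow> (real ^ 'd \<Rightarrow> real) \<Rightarrow> real" where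
  "ip f g = (\<integral>x. f x * g x \<partial>lborel)"

lemma ip_commute: "ip f g = ip g f" by (simp add: ip_def mult.commute)

lemma Cc_mult_Cc: "f \<in> Cc K \<Longrightarrow> g \<in> Cc K \<Longrightarrow> (\<lambda>x. f x * g x) \<in> Cc K"
  by (rule Cc_mult) (auto simp: Cc_def)

lemma ip_add_left: "compact K \<Longrightarrow> f \<in> Cc K \<Longrightarrow> g \<in> Cc K \<Longrightarrow> h \<in> Cc K \<Longrightarrow> ip (\<lambda>x. f x + g x) h = ip f h + ip g h"
  unfolding ip_def by (simp add: distrib_right Cc_integrable Cc_mult_Cc)

lemma ip_diff_left: "compact K \<Longrightarrow> f \<in> Cc K \<Longrightarrow> g \<in> Cc K \<Longrightarrow> h \<in> Cc K \<Longrightarrow> ip (\<lambda>x. f x - g x) h = ip f h - ip g h"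
  unfolding ip_def by (simp add: left_diff_distrib Cc_integrable Cc_mult_Cc)

lemma ip_add_right: "compact K \<Longrightarrow> f \<in> Cc K \<Longrightarrow> g \<in> Cc K \<Longrightarrow> h \<in> Cc K \<Longrightarrow> ip h (\<lambda>x. f x + g x) = ip h f + ip h g"
  using ip_add_left[of K f g h] by (simp add: ip_commute)

lemma ip_le: "compact K \<Longrightarrow> f \<in> Cc K \<Longrightarrow> g \<in> Cc K \<Longrightarrow> \<bar>ip f g\<bar> \<le> nrm2 lborel f * nrm2 lborel g"
  unfolding ip_def by (intro Cauchy_Schwarz_nrm2 Cc_sqi)

lemma ip_self: "ip f f = (nrm2 lborel f)\<^sup>2"
  unfolding nrm2_sq by (simp add: ip_def power2_eq_square)

lemma ip_pd:
  assumes K: "compact K" and f: "f \<in> Cc K" and g: "g \<in> Cc K"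
  shows "ip (pd i f) g = - ip f (pd i g)"
proof -
  have c: "closed K" using K by (rule compact_imp_closed)
  have "0 = (\<integral>x. pd i (\<lambda>x. f x * g x) x \<partial>lborel)" using integral_pd_eq_0[OF K Cc_mult_Cc[OF f g]] by simp
  also have "\<dots> = (\<integral>x. f x * pd i g x + pd i f x * g x \<partial>lborel)"
    using deriv_along_mult[OF Cc_differentiable[OF f] Cc_differentiable[OF g]] by simp
  also have "\<dots> = ip f (pd i g) + ip (pd i f) g"
    unfolding ip_def by (intro Bochner_Integration.integral_add Cc_integrable[OF K] Cc_mult_Cc f g Cc_pd c)
  finally show ?thesis by simp
qed

text \<open>Each coordinate is integrated by parts against the product of a coefficient of
  \<open>X\<close> with \<open>g\<close>; the derivatives that fall on the coefficients add up to
  the divergence.\<close>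

lemma ip_deriv_along:
  assumes K: "compact K" "K \<subseteq> U" "open U" and X: "smooth_on U X" and f: "f \<in> Cc K" and g: "g \<in> Cc K"
  shows "ip (deriv_along X f) g = - ip f (deriv_along X g) - ip f (\<lambda>x. divergence X x * g x)"
proof -
  have c: "closed K" using K by (simp add: compact_imp_closed)
  have Xi: "(\<lambda>x. X x $ i * g x) \<in> Cc K" if "g \<in> Cc K" for g i
    by (rule Cc_smooth_mult[OF c K(2,3) smooth_on_nth[OF K(3) X] that])
  have "ip (deriv_along X f) g = (\<integral>x. (\<Sum>i\<in>UNIV. pd i f x * (X x $ i * g x)) \<partial>lborel)"
    unfolding ip_def by (subst Cc_deriv_along_expand[OF f, of X]) (simp add: sum_distrib_right sum_distrib_left ac_simps)
  also have "\<dots> = (\<Sum>i\<in>UNIV. ip (pd i f) (\<lambda>x. X x $ i * g x))"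
    unfolding ip_def by (intro Bochner_Integration.integral_sum Cc_integrable[OF K(1)] Cc_mult_Cc Xi Cc_pd c f g)
  also have "\<dots> = - (\<Sum>i\<in>UNIV. ip f (pd i (\<lambda>x. X x $ i * g x)))"
    by (simp add: ip_pd[OF K(1) f Xi[OF g]] sum_negf)
  also have "(\<Sum>i\<in>UNIV. ip f (pd i (\<lambda>x. X x $ i * g x))) = (\<integral>x. (\<Sum>i\<in>UNIV. f x * pd i (\<lambda>x. X x $ i * g x) x) \<partial>lborel)"
    unfolding ip_def by (intro Bochner_Integration.integral_sum[symmetric] Cc_integrable[OF K(1)] Cc_mult_Cc Xi Cc_pd c f g)
  also have "\<dots> = (\<integral>x. f x * (deriv_along X g x + divergence X x * g x) \<partial>lborel)"
  proof (rule Bochner_Integration.integral_cong[OF refl])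
    fix x
    show "(\<Sum>i\<in>UNIV. f x * pd i (\<lambda>x. X x $ i * g x) x) = f x * (deriv_along X g x + divergence X x * g x)"
    proof (cases "x \<in> K")
      case False thus ?thesis using CcD(2)[OF f] by simp
    next
      case True
      hence xU: "x \<in> U" using K by auto
      have "pd i (\<lambda>y. X y $ i) x = frechet_derivative X (at x) (axis i 1) $ i" for i
      proof -
        have "((\<lambda>y. X y $ i) has_derivative (\<lambda>v. frechet_derivative X (at x) v $ i)) (at x)"
          by (rule bounded_linear.has_derivative[OF bounded_linear_vec_nth smooth_on_has_derivative[OF X xU]])
        from frechet_derivative_eqI[OF this] show ?thesis by (simp add: deriv_along_def)
      qed
      hence "pd i (\<lambda>x. X x $ i * g x) x = X x $ i * pd i g x + frechet_derivative X (at x) (axis i 1) $ i * g x" for i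
        using deriv_along_mult[OF smooth_on_differentiable[OF smooth_on_nth[OF K(3) X] xU] Cc_differentiable[OF g]] by simp
      hence "(\<Sum>i\<in>UNIV. pd i (\<lambda>x. X x $ i * g x) x) = (\<Sum>i\<in>UNIV. X x $ i * pd i g x) + divergence X x * g x"
        by (simp add: sum.distrib divergence_def sum_distrib_right)
      thus ?thesis using deriv_along_expand[OF Cc_differentiable[OF g], of X x] by (simp add: sum_distrib_left[symmetric])
    qed
  qed
  also have "\<dots> = ip f (deriv_along X g) + ip f (\<lambda>x. divergence X x * g x)"
    unfolding ip_def distrib_left
    by (intro Bochner_Integration.integral_add Cc_integrable[OF K(1)] Cc_mult_Cc f g Cc_deriv_along[OF c K(2,3) X]
      Cc_smooth_mult[OF c K(2,3) smooth_on_divergence[OF K(3) X]])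
  finally show ?thesis by simp
qed

section \<open>Averages of translates\<close>

text \<open>An average of translates of \<open>f\<close> by \<open>q p\<close> with signed weight
  \<open>k p\<close>. Mollification and the potential are both of this form, with different
  parameter spaces, so smoothness, supports and L2 bounds are proved once for both.\<close>

definition avg :: "'p measure \<Rightarrow> ('p \<Rightarrow> real) \<Rightarrow> ('p \<Rightarrow> real ^ 'd) \<Rightarrow> (real ^ 'd \<Rightarrow> real) \<Rightarrow> real ^ 'd \<Rightarrow> real" where
  "avg M k q f x = (\<integral>p. k p * f (x - q p) \<partial>M)"

locale averaging = finite_measure M for M :: "'p measure" +
  fixes k :: "'p \<Rightarrow> real" and q :: "'p \<Rightarrow> real ^ 'd" and B R :: real
  assumes km[measurable]: "k \<in> borel_measurable M" and qm[measurable]: "q \<in> borel_measurable M"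
    and kB: "\<And>p. p \<in> space M \<Longrightarrow> \<bar>k p\<bar> \<le> B" and qR: "\<And>p. p \<in> space M \<Longrightarrow> norm (q p) \<le> R"
    and B0: "0 \<le> B" and R0: "0 \<le> R"
begin

lemma integrable_bounded_fn:
  fixes g :: "'p \<Rightarrow> real"
  assumes "g \<in> borel_measurable M" "\<And>p. p \<in> space M \<Longrightarrow> \<bar>g p\<bar> \<le> C"
  shows "integrable M g"
  by (rule integrable_const_bound[of _ C]) (use assms in auto)

lemma avg_integrable:
  assumes K: "compact K" and f: "f \<in> Cc K"
  shows "integrable M (\<lambda>p. k p * f (x - q p))"
proof -
  have [measurable]: "f \<in> borel_measurable borel" by (rule Cc_measurable[OF f])
  obtain C where C: "0 \<le> C" "\<And>x. \<bar>f x\<bar> \<le> C" using Cc_bounded[OF K f] by blast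
  show ?thesis
  proof (rule integrable_bounded_fn[of _ "B * C"])
    show "\<bar>k p * f (x - q p)\<bar> \<le> B * C" if "p \<in> space M" for p
      unfolding abs_mult by (intro mult_mono kB that C B0) auto
  qed measurable
qed

lemma avg_sum:
  assumes K: "compact K" and f: "\<And>i. i \<in> I \<Longrightarrow> f i \<in> Cc K"
  shows "avg M k q (\<lambda>x. \<Sum>i\<in>I. f i x) x = (\<Sum>i\<in>I. avg M k q (f i) x)"
  unfolding avg_def using avg_integrable[OF K f]
  by (simp add: sum_distrib_left)

text \<open>The second-order Taylor remainder of \<open>f\<close> is uniform in the base point, so
  it integrates to at most B C m |y - x|^2, where m is the total mass of the parameter
  space.\<close>

lemma avg_has_derivative:
  assumes K: "compact K" and f: "f \<in> Cc K"
  shows "(avg M k q f has_derivative (\<lambda>v. \<Sum>i\<in>UNIV. v $ i * avg M k q (pd i f) x)) (at x)"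
proof -
  have c: "closed K" using K by (rule compact_imp_closed)
  obtain C where C: "0 \<le> C" "\<And>y h. \<bar>f (y + h) - f y - frechet_derivative f (at y) h\<bar> \<le> C * (norm h)\<^sup>2"
    using Cc_taylor2[OF K f] by blast
  define m where "m = measure M (space M)"
  let ?f' = "\<lambda>v. \<Sum>i\<in>UNIV. v $ i * avg M k q (pd i f) x"
  have bl: "bounded_linear ?f'"
    by (intro bounded_linear_sum bounded_linear_mult_const bounded_linear_vec_nth)
  have est: "\<bar>avg M k q f y - avg M k q f x - ?f' (y - x)\<bar> \<le> B * C * m * (norm (y - x))\<^sup>2" for y
  proof -
    have i1: "integrable M (\<lambda>p. k p * pd i f (x - q p))" for i
      by (rule avg_integrable[OF K Cc_pd[OF c f]])
    have "avg M k q f y - avg M k q f x - ?f' (y - x) =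
      (\<integral>p. k p * f (y - q p) - k p * f (x - q p) - (\<Sum>i\<in>UNIV. (y - x) $ i * (k p * pd i f (x - q p))) \<partial>M)"
      unfolding avg_def using avg_integrable[OF K f] i1
      by (simp add: Bochner_Integration.integral_diff Bochner_Integration.integrable_sum Bochner_Integration.integral_sum)
    also have "\<bar>\<dots>\<bar> \<le> (\<integral>p. B * (C * (norm (y - x))\<^sup>2) \<partial>M)"
    proof (rule order_trans[OF integral_abs_bound integral_mono])
      show "integrable M (\<lambda>p. \<bar>k p * f (y - q p) - k p * f (x - q p) - (\<Sum>i\<in>UNIV. (y - x) $ i * (k p * pd i f (x - q p)))\<bar>)"
        using avg_integrable[OF K f] i1 by (intro integrable_abs Bochner_Integration.integrable_diff Bochner_Integration.integrable_sum integrable_mult_right)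
      fix p assume p: "p \<in> space M"
      have "k p * f (y - q p) - k p * f (x - q p) - (\<Sum>i\<in>UNIV. (y - x) $ i * (k p * pd i f (x - q p)))
        = k p * (f ((x - q p) + (y - x)) - f (x - q p) - frechet_derivative f (at (x - q p)) (y - x))"
        using frechet_expand[OF Cc_differentiable[OF f], of "x - q p" "y - x"]
        by (simp add: deriv_along_def right_diff_distrib sum_distrib_left ac_simps)
      thus "\<bar>k p * f (y - q p) - k p * f (x - q p) - (\<Sum>i\<in>UNIV. (y - x) $ i * (k p * pd i f (x - q p)))\<bar>
          \<le> B * (C * (norm (y - x))\<^sup>2)"
        by (auto simp only: abs_mult intro!: mult_mono kB p C(2) B0)
    qed simp
    also have "\<dots> = B * C * m * (norm (y - x))\<^sup>2" by (simp add: m_def)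
    finally show ?thesis .
  qed
  show ?thesis
  proof (rule has_derivativeI_sandwich[of 1, OF _ bl])
    show "norm (avg M k q f y - avg M k q f x - ?f' (y - x)) / norm (y - x) \<le> B * C * m * norm (y - x)"
      if "y \<noteq> x" for y
      using est[of y] that by (simp add: divide_le_eq power2_eq_square mult.assoc)
    have "((\<lambda>y. B * C * m * norm (y - x)) \<longlongrightarrow> B * C * m * norm (x - x)) (at x)" by (intro tendsto_intros)
    thus "((\<lambda>y. B * C * m * norm (y - x)) \<longlongrightarrow> 0) (at x)" by simp
  qed simp
qed

lemma avg_smooth:
  assumes K: "compact K" and f: "f \<in> Cc K"
  shows "smooth_on UNIV (avg M k q f)"
proof -
  have "Ck_on m UNIV (avg M k q f)" for m
    using f
  proof (induction m arbitrary: f)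
    case 0
    show ?case using has_derivative_continuous[OF avg_has_derivative[OF K 0]]
      by (simp add: continuous_on_eq_continuous_at)
  next
    case (Suc m)
    show ?case
    proof (rule Ck_on_SucI[OF _ avg_has_derivative[OF K Suc.prems]])
      show "Ck_on m UNIV (\<lambda>x. \<Sum>i\<in>UNIV. v $ i * avg M k q (pd i f) x)" for v
      proof -
        have "Ck_on m UNIV (\<lambda>x. v $ i * avg M k q (pd i f) x)" for i
          by (intro Ck_on_mult Ck_on_const Suc.IH Cc_pd compact_imp_closed K Suc.prems) simp
        moreover have "finite I \<Longrightarrow> Ck_on m UNIV (\<lambda>x. \<Sum>i\<in>I. g i x)" if "\<And>i. Ck_on m UNIV (g i)" for g :: "'d \<Rightarrow> real ^ 'd \<Rightarrow> real" and I
        proof (induction I rule: finite_induct)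
          case (insert i I)
          thus ?case using Ck_on_add[of UNIV m "g i" "\<lambda>x. \<Sum>i\<in>I. g i x"] that by simp
        qed (simp add: Ck_on_const)
        ultimately show ?thesis by simp
      qed
    qed simp
  qed
  thus ?thesis by (simp add: smooth_on_def)
qed

lemma pd_avg:
  assumes K: "compact K" and f: "f \<in> Cc K"
  shows "pd i (avg M k q f) = avg M k q (pd i f)"
proof
  fix x
  show "pd i (avg M k q f) x = avg M k q (pd i f) x"
    using frechet_derivative_eqI[OF avg_has_derivative[OF K f, of x]]
    by (simp add: deriv_along_def axis_def if_distrib if_distribR cong: if_cong)
qed

lemma avg_Cc:
  assumes K: "K \<subseteq> cball 0 r" "compact K" and f: "f \<in> Cc K"
  shows "avg M k q f \<in> Cc (cball 0 (r + R))"
proof -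
  have "avg M k q f x = 0" if "x \<notin> cball 0 (r + R)" for x
  proof -
    have "f (x - q p) = 0" if p: "p \<in> space M" for p
    proof -
      have "norm x \<le> norm (x - q p) + norm (q p)" by norm
      hence "norm (x - q p) > r" using qR[OF p] \<open>x \<notin> cball 0 (r + R)\<close> by auto
      hence "x - q p \<notin> K" using K(1) by auto
      thus ?thesis using CcD(2)[OF f] by simp
    qed
    hence "avg M k q f x = (\<integral>p. 0 \<partial>M)" unfolding avg_def by (intro Bochner_Integration.integral_cong) auto
    thus ?thesis by simp
  qed
  thus ?thesis using avg_smooth[OF K(2) f] by (simp add: Cc_def)
qed

text \<open>Young's inequality for convolutions: Cauchy-Schwarz with respect to the weight |k|,
  followed by Tonelli and translation invariance.\<close>

lemma avg_nrm2_le: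
  assumes K: "compact K" and f: "f \<in> Cc K"
  shows "nrm2 lborel (avg M k q f) \<le> (\<integral>p. \<bar>k p\<bar> \<partial>M) * nrm2 lborel f"
proof -
  define m where "m = (\<integral>p. \<bar>k p\<bar> \<partial>M)"
  have m0: "0 \<le> m" by (simp add: m_def)
  have [measurable]: "f \<in> borel_measurable borel" by (rule Cc_measurable[OF f])
  interpret P: pair_sigma_finite lborel M ..
  obtain C where C: "0 \<le> C" "\<And>x. \<bar>f x\<bar> \<le> C" using Cc_bounded[OF K f] by blast
  have ik: "integrable M (\<lambda>p. \<bar>k p\<bar>)" by (rule integrable_bounded_fn[of _ B]) (use kB in auto)
  have ikf: "integrable M (\<lambda>p. \<bar>k p\<bar> * (f (x - q p))\<^sup>2)" for x
  proof (rule integrable_bounded_fn[of _ "B * C\<^sup>2"])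
    show "\<bar>\<bar>k p\<bar> * (f (x - q p))\<^sup>2\<bar> \<le> B * C\<^sup>2" if "p \<in> space M" for p
      using C kB[OF that] by (auto simp: abs_mult intro!: mult_mono B0 abs_le_square_iff[THEN iffD1])
  qed measurable
  have pt: "(avg M k q f x)\<^sup>2 \<le> m * (\<integral>p. \<bar>k p\<bar> * (f (x - q p))\<^sup>2 \<partial>M)" for x
  proof -
    \<comment> \<open>One half of the weight goes to each factor, so that one norm is the total mass
      of |k| and the other keeps the weight on the square of \<open>f\<close>.\<close>
    let ?u = "\<lambda>p. sqrt \<bar>k p\<bar>" and ?v = "\<lambda>p. sqrt \<bar>k p\<bar> * \<bar>f (x - q p)\<bar>"
    have u: "?u \<in> sqi M" using ik by (simp add: sqi_def)
    have v: "?v \<in> sqi M" using ikf[of x] by (simp add: sqi_def power_mult_distrib)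
    have "\<bar>avg M k q f x\<bar> \<le> (\<integral>p. \<bar>k p * f (x - q p)\<bar> \<partial>M)" unfolding avg_def by (rule integral_abs_bound)
    also have "\<dots> = (\<integral>p. ?u p * ?v p \<partial>M)"
      by (rule Bochner_Integration.integral_cong) (auto simp: abs_mult simp flip: mult.assoc)
    also have "\<dots> \<le> nrm2 M ?u * nrm2 M ?v" using Cauchy_Schwarz_nrm2[OF u v] by simp
    finally have "(avg M k q f x)\<^sup>2 \<le> (nrm2 M ?u * nrm2 M ?v)\<^sup>2"
      using power_mono[of "\<bar>avg M k q f x\<bar>" _ 2] by simp
    thus ?thesis by (simp add: power_mult_distrib nrm2_sq m_def)
  qed
  have am: "avg M k q f \<in> borel_measurable borel"
    by (rule borel_measurable_continuous_onI[OF smooth_on_continuous[OF avg_smooth[OF K f]]])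
  have "(\<integral>\<^sup>+x. ennreal ((avg M k q f x)\<^sup>2) \<partial>lborel) \<le> (\<integral>\<^sup>+x. ennreal m * (\<integral>\<^sup>+p. ennreal (\<bar>k p\<bar> * (f (x - q p))\<^sup>2) \<partial>M) \<partial>lborel)"
  proof (rule nn_integral_mono)
    fix x :: "real^'d"
    show "ennreal ((avg M k q f x)\<^sup>2) \<le> ennreal m * (\<integral>\<^sup>+p. ennreal (\<bar>k p\<bar> * (f (x - q p))\<^sup>2) \<partial>M)"
      using pt[of x] m0 by (subst nn_integral_eq_integral[OF ikf]) (auto simp: ennreal_mult[symmetric] intro!: ennreal_leI)
  qed
  also have "\<dots> = ennreal m * (\<integral>\<^sup>+x. (\<integral>\<^sup>+p. ennreal (\<bar>k p\<bar> * (f (x - q p))\<^sup>2) \<partial>M) \<partial>lborel)"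
    by (rule nn_integral_cmult) measurable
  also have "(\<integral>\<^sup>+x. (\<integral>\<^sup>+p. ennreal (\<bar>k p\<bar> * (f (x - q p))\<^sup>2) \<partial>M) \<partial>lborel)
      = (\<integral>\<^sup>+p. (\<integral>\<^sup>+x. ennreal (\<bar>k p\<bar> * (f (x - q p))\<^sup>2) \<partial>lborel) \<partial>M)"
    by (rule P.Fubini'[symmetric]) measurable
  also have "\<dots> = (\<integral>\<^sup>+p. ennreal \<bar>k p\<bar> * (\<integral>\<^sup>+x. ennreal ((f x)\<^sup>2) \<partial>lborel) \<partial>M)"
  proof (rule nn_integral_cong)
    fix p
    have "(\<integral>\<^sup>+x. ennreal (\<bar>k p\<bar> * (f (x - q p))\<^sup>2) \<partial>lborel) = ennreal \<bar>k p\<bar> * (\<integral>\<^sup>+x. ennreal ((f (x - q p))\<^sup>2) \<partial>lborel)"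
      by (simp add: ennreal_mult nn_integral_cmult)
    also have "(\<integral>\<^sup>+x. ennreal ((f (x - q p))\<^sup>2) \<partial>lborel) = (\<integral>\<^sup>+x. ennreal ((f x)\<^sup>2) \<partial>lborel)"
      using nn_integral_translation[of "\<lambda>x. ennreal ((f x)\<^sup>2)" "- q p"] by simp
    finally show "(\<integral>\<^sup>+x. ennreal (\<bar>k p\<bar> * (f (x - q p))\<^sup>2) \<partial>lborel) = ennreal \<bar>k p\<bar> * (\<integral>\<^sup>+x. ennreal ((f x)\<^sup>2) \<partial>lborel)" .
  qed
  also have "\<dots> = (\<integral>\<^sup>+p. ennreal \<bar>k p\<bar> \<partial>M) * (\<integral>\<^sup>+x. ennreal ((f x)\<^sup>2) \<partial>lborel)"
    by (rule nn_integral_multc) measurable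
  also have "(\<integral>\<^sup>+p. ennreal \<bar>k p\<bar> \<partial>M) = ennreal m" unfolding m_def by (rule nn_integral_eq_integral[OF ik]) auto
  also have "(\<integral>\<^sup>+x. ennreal ((f x)\<^sup>2) \<partial>lborel) = ennreal ((nrm2 lborel f)\<^sup>2)"
    unfolding nrm2_sq by (rule nn_integral_eq_integral[OF sqi_square[OF Cc_sqi[OF K f]]]) auto
  finally have le: "(\<integral>\<^sup>+x. ennreal ((avg M k q f x)\<^sup>2) \<partial>lborel) \<le> ennreal (m\<^sup>2 * (nrm2 lborel f)\<^sup>2)"
    using m0 by (simp add: ennreal_mult[symmetric] power2_eq_square mult.assoc)
  have i: "integrable lborel (\<lambda>x. (avg M k q f x)\<^sup>2)"
    by (rule integrableI_bounded) (use le am in \<open>auto intro: le_less_trans\<close>)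
  have "(\<integral>x. (avg M k q f x)\<^sup>2 \<partial>lborel) \<le> m\<^sup>2 * (nrm2 lborel f)\<^sup>2"
    using le nn_integral_eq_integral[OF i] by simp
  hence "nrm2 lborel (avg M k q f) \<le> sqrt (m\<^sup>2 * (nrm2 lborel f)\<^sup>2)" unfolding nrm2_def[of lborel "avg M k q f"] by (rule real_sqrt_le_mono)
  thus ?thesis using m0 nrm2_ge0[of lborel f] by (simp add: real_sqrt_mult m_def)
qed

end

section \<open>A compactly supported parametrix of the Laplacian\<close>

lemma flat_le_1: "flat 0 t \<le> 1" by (simp add: flat_def)

definition bell :: "real ^ 'd \<Rightarrow> real" where "bell z = flat 0 (1 - (\<Sum>i\<in>UNIV. z $ i * z $ i))"

text \<open>Normalized so that the gradient of \<open>bell\<close> at z is -z \<open>bell'\<close>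
  z; the factor 2 is the derivative of |z|^2, and \<open>flat 2\<close> is the derivative of
  \<open>flat 0\<close>. This relation is what makes the Laplacian of the potential
  computable.\<close>

definition bell' :: "real ^ 'd \<Rightarrow> real" where "bell' z = 2 * flat 2 (1 - (\<Sum>i\<in>UNIV. z $ i * z $ i))"

lemma sum_squares_norm: "(\<Sum>i\<in>UNIV. z $ i * z $ i) = (norm z)\<^sup>2" for z :: "real ^ 'd"
  by (simp add: norm_vec_def L2_set_def power2_eq_square sum_nonneg)

lemma smooth_quad: "smooth_on UNIV (\<lambda>z :: real ^ 'd. 1 - (\<Sum>i\<in>UNIV. z $ i * z $ i))"
proof -
  have "smooth_on UNIV (\<lambda>z::real^'d. z $ i)" for i
    by (intro smooth_on_linear) (auto intro: bounded_linear_vec_nth)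
  thus ?thesis by (intro smooth_on_diff smooth_on_const smooth_on_sum smooth_on_mult) auto
qed

lemma flat_outside: "z \<notin> cball 0 1 \<Longrightarrow> flat p (1 - (\<Sum>i\<in>UNIV. z $ i * z $ i)) = 0"
  by (auto simp: flat_def sum_squares_norm power2_eq_square) (smt (verit) mult_less_cancel_left2 norm_ge_zero)

lemma smooth_flat_quad: "smooth_on UNIV (\<lambda>z :: real ^ 'd. flat p (1 - (\<Sum>i\<in>UNIV. z $ i * z $ i)))"
  by (rule smooth_on_compose_real[OF _ smooth_quad]) (auto simp: smooth_on_def Ck_on_flat)

lemma bell_Cc: "bell \<in> Cc (cball 0 1)"
  using smooth_flat_quad[of 0] flat_outside unfolding Cc_def bell_def[abs_def] by auto

lemma bell'_Cc: "bell' \<in> Cc (cball 0 1)"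
  using smooth_on_mult[OF _ smooth_on_const[of _ 2] smooth_flat_quad[of 2]] flat_outside
  unfolding Cc_def bell'_def[abs_def] by auto

lemma pd_bell: "pd i bell z = - (z $ i * bell' z)"
proof -
  let ?q = "\<lambda>z::real^'a. 1 - (\<Sum>i\<in>UNIV. z $ i * z $ i)"
  have q: "(?q has_derivative (\<lambda>v. - (\<Sum>i\<in>UNIV. 2 * z $ i * v $ i))) (at z)"
    by (auto intro!: derivative_eq_intros bounded_linear_imp_has_derivative bounded_linear_vec_nth simp: fun_eq_iff algebra_simps sum.distrib[symmetric] sum_distrib_left)
  have "(flat 0 has_derivative (\<lambda>v. flat 2 (?q z) * v)) (at (?q z))"
    using flat_DERIV[of 0 "?q z"] by (simp add: has_field_derivative_def numeral_2_eq_2)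
  from has_derivative_compose[OF q this]
  have "(bell has_derivative (\<lambda>v. flat 2 (?q z) * - (\<Sum>i\<in>UNIV. 2 * z $ i * v $ i))) (at z)"
    by (simp add: bell_def[abs_def])
  from frechet_derivative_eqI[OF this]
  show ?thesis by (simp add: deriv_along_def bell'_def axis_def if_distrib sum.If_cases cong: if_cong)
qed

lemma bell'_nonneg: "bell' z \<ge> 0" by (simp add: bell'_def flat_def)
lemma bell_nonneg: "bell z \<ge> 0" by (simp add: bell_def flat_def)
lemma bell_le_1: "bell z \<le> 1" by (simp add: bell_def flat_le_1)

definition bell_mass :: "'d::finite itself \<Rightarrow> real" where
  "bell_mass t = (\<integral>z. bell' z \<partial>(lborel :: (real ^ 'd) measure))"

text \<open>The mass is the coefficient with which the original function reappears in the Laplacian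
  of its potential; it has to be divided by in the end.\<close>

lemma bell_mass_pos: "bell_mass TYPE('d::finite) > 0"
proof -
  have int: "integrable lborel (bell' :: real^'d \<Rightarrow> real)" by (rule Cc_integrable[OF _ bell'_Cc]) simp
  have "bell_mass TYPE('d) \<noteq> 0"
  proof
    assume "bell_mass TYPE('d) = 0"
    hence ae: "AE z::real^'d in lborel. bell' z = 0"
      using integral_nonneg_eq_0_iff_AE[OF int] by (simp add: bell_mass_def bell'_nonneg)
    have "bell' z \<noteq> 0" if "z \<in> ball 0 1" for z :: "real^'d"
      using that power_strict_mono[of "norm z" 1 2] by (auto simp: bell'_def flat_def sum_squares_norm)
    hence "AE z::real^'d in lborel. z \<notin> ball 0 1" using ae by auto
    hence "emeasure lborel (ball (0::real^'d) 1) = 0"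
      using AE_iff_measurable[of "ball (0::real^'d) 1" lborel "\<lambda>z. z \<notin> ball 0 1"]
      by (simp add: set_eq_iff)
    moreover have "emeasure lborel (ball (0::real^'d) 1) = ennreal (measure lborel (ball (0::real^'d) 1))"
      by (rule emeasure_eq_ennreal_measure) (use emeasure_lborel_ball_finite[of "0::real^'d" 1] in auto)
    ultimately have "measure lborel (ball (0::real^'d) 1) = 0" by simp
    thus False using content_ball_pos[of 1 "0::real^'d"] by simp
  qed
  moreover have "bell_mass TYPE('d) \<ge> 0"
    unfolding bell_mass_def by (rule Bochner_Integration.integral_nonneg) (rule bell'_nonneg)
  ultimately show ?thesis by simp
qed

section \<open>Mollifications and the potential as averages\<close>

definition Mb :: "(real ^ 'd) measure" where "Mb = restrict_space lborel (cball 0 1)"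
definition Ms :: "real \<Rightarrow> real measure" where "Ms \<delta> = restrict_space lborel {0..\<delta>}"

lemma space_Mb [simp]: "space Mb = cball 0 1" by (simp add: Mb_def space_restrict_space)
lemma space_Ms [simp]: "space (Ms \<delta>) = {0..\<delta>}" by (simp add: Ms_def space_restrict_space)

lemma finite_Mb: "finite_measure (Mb :: (real ^ 'd) measure)"
  by (rule finite_measureI) (use emeasure_lborel_cball_finite[of "0::real^'d" 1] in \<open>auto simp: Mb_def emeasure_restrict_space space_restrict_space\<close>)

lemma finite_Ms: "finite_measure (Ms \<delta>)"
  by (rule finite_measureI) (auto simp: Ms_def emeasure_restrict_space space_restrict_space emeasure_lborel_Icc_eq)

lemma finite_MsMb: "finite_measure (Ms \<delta> \<Otimes>\<^sub>M (Mb :: (real ^ 'd) measure))"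
  by (rule finite_measure_pair_measure[OF finite_Mb finite_Ms])

lemma measurable_Mb: "f \<in> borel_measurable borel \<Longrightarrow> f \<in> borel_measurable Mb"
  unfolding Mb_def by (rule measurable_restrict_space1) simp
lemma measurable_Ms: "f \<in> borel_measurable borel \<Longrightarrow> f \<in> borel_measurable (Ms \<delta>)"
  unfolding Ms_def by (rule measurable_restrict_space1) simp

lemma integral_Mb:
  fixes g :: "real ^ 'd \<Rightarrow> real"
  assumes "\<And>z. z \<notin> cball 0 1 \<Longrightarrow> g z = 0"
  shows "(\<integral>z. g z \<partial>Mb) = (\<integral>z. g z \<partial>lborel)"
proof -
  have "(\<integral>z. g z \<partial>Mb) = (\<integral>z. indicator (cball 0 1) z *\<^sub>R g z \<partial>lborel)"
    unfolding Mb_def by (rule integral_restrict_space) simp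
  also have "\<dots> = (\<integral>z. g z \<partial>lborel)"
    by (rule Bochner_Integration.integral_cong) (use assms in \<open>auto simp: indicator_def\<close>)
  finally show ?thesis .
qed

text \<open>Convolution with the rescaling of \<open>b\<close> to scale \<open>s\<close>, not
  normalized by the mass of \<open>b\<close>. The scale sits in the translation and not in the
  kernel, so s = 0 is admissible and the dependence on \<open>s\<close> is differentiable.\<close>

definition smoothing :: "(real ^ 'd \<Rightarrow> real) \<Rightarrow> real \<Rightarrow> (real ^ 'd \<Rightarrow> real) \<Rightarrow> real ^ 'd \<Rightarrow> real" where
  "smoothing b s f = avg Mb b (\<lambda>z. s *\<^sub>R z) f"

lemma averaging_smoothing:
  assumes "b \<in> Cc (cball 0 1)"
  obtains B where "averaging Mb b (\<lambda>z. s *\<^sub>R z) B \<bar>s\<bar>"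
proof -
  obtain B where B: "0 \<le> B" "\<And>x. \<bar>b x\<bar> \<le> B" using Cc_bounded[OF compact_cball assms] by blast
  have "averaging Mb b (\<lambda>z. s *\<^sub>R z) B \<bar>s\<bar>"
  proof (intro averaging.intro finite_Mb averaging_axioms.intro B)
    show "norm (s *\<^sub>R z) \<le> \<bar>s\<bar>" if "z \<in> space Mb" for z :: "real^'a"
      using that by (simp add: mult_left_le)
  qed (auto intro!: measurable_Mb Cc_measurable[OF assms])
  thus ?thesis using that by blast
qed

text \<open>Convolution with the kernel y \<mapsto> \<integral> s^(1-d) bell(y/s) ds over scales
  from 0 to \<delta>, d being the dimension: a truncated fundamental solution of the Laplacian up to
  a constant factor. Integrating over scales gives one formula for all dimensions, and the support
  stays in the ball of radius \<delta>.\<close>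

definition potential :: "real \<Rightarrow> (real ^ 'd \<Rightarrow> real) \<Rightarrow> real ^ 'd \<Rightarrow> real" where
  "potential \<delta> f = avg (Ms \<delta> \<Otimes>\<^sub>M Mb) (\<lambda>p. fst p * bell (snd p)) (\<lambda>p. fst p *\<^sub>R snd p) f"

lemma averaging_potential:
  assumes "0 \<le> \<delta>"
  shows "averaging (Ms \<delta> \<Otimes>\<^sub>M (Mb :: (real ^ 'd) measure)) (\<lambda>p. fst p * bell (snd p)) (\<lambda>p. fst p *\<^sub>R snd p) \<delta> \<delta>"
proof (intro averaging.intro finite_MsMb averaging_axioms.intro assms)
  have [measurable]: "bell \<in> borel_measurable Mb" by (intro measurable_Mb Cc_measurable[OF bell_Cc])
  have [measurable]: "(\<lambda>z. z) \<in> borel_measurable Mb" "(\<lambda>z. z) \<in> borel_measurable (Ms \<delta>)"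
    by (auto intro!: measurable_Mb measurable_Ms)
  have f[measurable]: "fst \<in> borel_measurable (Ms \<delta> \<Otimes>\<^sub>M (Mb :: (real ^ 'd) measure))"
    using measurable_compose[OF measurable_fst, of "\<lambda>z. z" "Ms \<delta>" borel "Mb :: (real ^ 'd) measure"] by simp
  have s[measurable]: "snd \<in> borel_measurable (Ms \<delta> \<Otimes>\<^sub>M (Mb :: (real ^ 'd) measure))"
    using measurable_compose[OF measurable_snd, of "\<lambda>z. z" "Mb :: (real ^ 'd) measure" borel "Ms \<delta>"] by simp
  have b: "bell \<in> borel_measurable borel" by (rule Cc_measurable[OF bell_Cc])
  show "(\<lambda>p. fst p * bell (snd p)) \<in> borel_measurable (Ms \<delta> \<Otimes>\<^sub>M (Mb :: (real ^ 'd) measure))"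
    by (intro borel_measurable_times f measurable_compose[OF s b])
  show "(\<lambda>p. fst p *\<^sub>R snd p) \<in> borel_measurable (Ms \<delta> \<Otimes>\<^sub>M (Mb :: (real ^ 'd) measure))"
    by (intro borel_measurable_scaleR f s)
  fix p assume "p \<in> space (Ms \<delta> \<Otimes>\<^sub>M (Mb :: (real ^ 'd) measure))"
  hence p: "0 \<le> fst p" "fst p \<le> \<delta>" "norm (snd p) \<le> 1" by (auto simp: space_pair_measure)
  show "\<bar>fst p * bell (snd p)\<bar> \<le> \<delta>"
    using mult_mono[of "fst p" \<delta> "bell (snd p)" 1] p bell_nonneg[of "snd p"] bell_le_1[of "snd p"] by (simp add: abs_mult)
  show "norm (fst p *\<^sub>R snd p) \<le> \<delta>"
    using mult_mono[of "fst p" \<delta> "norm (snd p)" 1] p by simp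
qed

text \<open>The weight is at most \<delta> on a parameter space of mass \<delta> times the volume of
  the unit ball. The factor \<delta>^2 is what makes the potentials tend to 0 as the scale
  shrinks.\<close>

lemma potential_nrm2_le:
  assumes "0 \<le> \<delta>" "compact K" "f \<in> Cc K"
  shows "nrm2 lborel (potential \<delta> f) \<le> \<delta>\<^sup>2 * measure lborel (cball (0::real^'d) 1) * nrm2 lborel (f :: real ^ 'd \<Rightarrow> real)"
proof -
  let ?M = "Ms \<delta> \<Otimes>\<^sub>M (Mb :: (real ^ 'd) measure)"
  interpret averaging ?M "\<lambda>p. fst p * bell (snd p)" "\<lambda>p. fst p *\<^sub>R snd p" \<delta> \<delta>
    by (rule averaging_potential[OF assms(1)])
  interpret b: finite_measure "Mb :: (real ^ 'd) measure" by (rule finite_Mb)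
  have "(\<integral>p. \<bar>fst p * bell (snd p)\<bar> \<partial>?M) \<le> (\<integral>p. \<delta> \<partial>?M)"
  proof (rule integral_mono)
    show "integrable ?M (\<lambda>p. \<bar>fst p * bell (snd p)\<bar>)"
      by (rule integrable_bounded_fn[of _ \<delta>]) (use kB km in auto)
  qed (use kB in auto)
  also have "\<dots> = \<delta> * measure ?M (space ?M)" by simp
  also have "measure ?M (space ?M) = \<delta> * measure lborel (cball (0::real^'d) 1)"
  proof -
    have "measure ?M (space ?M) = measure (Ms \<delta>) {0..\<delta>} * measure Mb (cball (0::real^'d) 1)"
    proof -
      have "{0..\<delta>} \<in> sets (Ms \<delta>)" "cball 0 1 \<in> sets (Mb :: (real ^ 'd) measure)"
        using sets.top[of "Ms \<delta>"] sets.top[of "Mb :: (real ^ 'd) measure"] by auto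
      from b.emeasure_pair_measure_Times[OF this]
      have "emeasure ?M ({0..\<delta>} \<times> cball 0 1) = emeasure (Ms \<delta>) {0..\<delta>} * emeasure Mb (cball (0::real^'d) 1)" .
      thus ?thesis by (simp add: space_pair_measure measure_def enn2real_mult)
    qed
    also have "measure (Ms \<delta>) {0..\<delta>} = \<delta>" using assms(1) by (simp add: Ms_def measure_restrict_space)
    also have "measure Mb (cball (0::real^'d) 1) = measure lborel (cball (0::real^'d) 1)" by (simp add: Mb_def measure_restrict_space)
    finally show ?thesis .
  qed
  finally have "(\<integral>p. \<bar>fst p * bell (snd p)\<bar> \<partial>?M) \<le> \<delta>\<^sup>2 * measure lborel (cball (0::real^'d) 1)"
    by (simp add: power2_eq_square)
  from order_trans[OF avg_nrm2_le[OF assms(2,3)] mult_right_mono[OF this nrm2_ge0]]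
  show ?thesis unfolding potential_def .
qed

lemma Ck_on_affine:
  fixes f :: "'a::real_normed_vector \<Rightarrow> real"
  shows "Ck_on m UNIV f \<Longrightarrow> Ck_on m UNIV (\<lambda>z. f (x + s *\<^sub>R z))"
proof (induction m arbitrary: f)
  case 0 thus ?case by (auto intro!: continuous_on_compose2[of UNIV f] continuous_intros)
next
  case (Suc m)
  show ?case
  proof (rule Ck_on_SucI[of _ _ "\<lambda>z v. s * frechet_derivative f (at (x + s *\<^sub>R z)) v"])
    fix z
    have f: "(f has_derivative frechet_derivative f (at (x + s *\<^sub>R z))) (at (x + s *\<^sub>R z))" using Ck_on_SucD[OF Suc.prems] by simp
    have "((\<lambda>z. x + s *\<^sub>R z) has_derivative (\<lambda>v. s *\<^sub>R v)) (at z)" by (auto intro!: derivative_eq_intros)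
    from has_derivative_compose[OF this f]
    show "((\<lambda>z. f (x + s *\<^sub>R z)) has_derivative (\<lambda>v. s * frechet_derivative f (at (x + s *\<^sub>R z)) v)) (at z)"
      by (simp add: linear_scale[OF has_derivative_linear[OF f]])
    show "Ck_on m UNIV (\<lambda>z. s * frechet_derivative f (at (x + s *\<^sub>R z)) v)" for v
      by (intro Ck_on_mult Ck_on_const Suc.IH) (use Suc.prems in auto)
  qed simp
qed

lemma smooth_on_affine: "smooth_on UNIV f \<Longrightarrow> smooth_on UNIV (\<lambda>z. f (x + s *\<^sub>R z))"
  for f :: "'a::real_normed_vector \<Rightarrow> real"
  by (simp add: smooth_on_def Ck_on_affine)

lemma pd_affine:
  assumes "smooth_on UNIV f" shows "pd i (\<lambda>z. f (x + s *\<^sub>R z)) z = s * pd i f (x + s *\<^sub>R z)"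
proof -
  have f: "(f has_derivative frechet_derivative f (at (x + s *\<^sub>R z))) (at (x + s *\<^sub>R z))"
    using smooth_on_has_derivative[OF assms] by simp
  have "((\<lambda>z. x + s *\<^sub>R z) has_derivative (\<lambda>v. s *\<^sub>R v)) (at z)" by (auto intro!: derivative_eq_intros)
  from frechet_derivative_eqI[OF has_derivative_compose[OF this f]]
  show ?thesis by (simp add: deriv_along_def linear_scale[OF has_derivative_linear[OF f]])
qed

definition lap :: "(real ^ 'd \<Rightarrow> real) \<Rightarrow> real ^ 'd \<Rightarrow> real" where
  "lap f x = (\<Sum>i\<in>UNIV. pd i (pd i f) x)"

lemma lap_Cc: "closed K \<Longrightarrow> f \<in> Cc K \<Longrightarrow> lap f \<in> Cc K"
  using Cc_sum[of UNIV "\<lambda>i. pd i (pd i f)" K] by (simp add: lap_def[abs_def] Cc_pd)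

lemma smoothing_pd:
  assumes "compact K" "f \<in> Cc K" "b \<in> Cc (cball 0 1)"
  shows "pd i (smoothing b s f) = smoothing b s (pd i f)"
proof -
  obtain B where "averaging Mb b (\<lambda>z. s *\<^sub>R z) B \<bar>s\<bar>" using averaging_smoothing[OF assms(3)] by blast
  then interpret averaging Mb b "\<lambda>z. s *\<^sub>R z" B "\<bar>s\<bar>" .
  show ?thesis unfolding smoothing_def by (rule pd_avg[OF assms(1,2)])
qed

text \<open>Integration by parts in the averaging variable z; the factor \<open>s\<close> is the
  chain rule for z \<mapsto> x - s z, and the sign of the shift cancels that of the integration by
  parts.\<close>

lemma smoothing_by_parts:
  assumes K: "compact K" and f: "f \<in> Cc K" and b: "b \<in> Cc (cball 0 1)"
  shows "smoothing (pd i b) s f x = s * smoothing b s (pd i f) x"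
proof -
  let ?g = "\<lambda>z. f (x + (-s) *\<^sub>R z)"
  have fs: "smooth_on UNIV f" using f by (rule CcD)
  have g: "smooth_on UNIV ?g" by (rule smooth_on_affine[OF fs])
  have bg: "(\<lambda>z. ?g z * b z) \<in> Cc (cball 0 1)" by (rule Cc_mult[OF g b])
  have bg': "(\<lambda>z. ?g z * pd i b z) \<in> Cc (cball 0 1)" by (rule Cc_mult[OF g Cc_pd[OF _ b]]) simp
  have gb: "(\<lambda>z. pd i ?g z * b z) \<in> Cc (cball 0 1)" by (rule Cc_mult[OF smooth_on_pd[OF g] b])
  have "0 = (\<integral>z. pd i (\<lambda>z. ?g z * b z) z \<partial>lborel)" using integral_pd_eq_0[OF _ bg] by simp
  also have "\<dots> = (\<integral>z. ?g z * pd i b z + pd i ?g z * b z \<partial>lborel)"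
    using deriv_along_mult[OF smooth_on_differentiable[OF g UNIV_I] Cc_differentiable[OF b]] by simp
  also have "\<dots> = (\<integral>z. ?g z * pd i b z \<partial>lborel) + (\<integral>z. pd i ?g z * b z \<partial>lborel)"
    by (intro Bochner_Integration.integral_add Cc_integrable[OF compact_cball bg'] Cc_integrable[OF compact_cball gb])
  also have "(\<integral>z. ?g z * pd i b z \<partial>lborel) = smoothing (pd i b) s f x"
    unfolding smoothing_def avg_def using integral_Mb[of "\<lambda>z. ?g z * pd i b z", OF CcD(2)[OF bg']] by (simp add: mult.commute)
  also have "(\<integral>z. pd i ?g z * b z \<partial>lborel) = - s * smoothing b s (pd i f) x"
    unfolding smoothing_def avg_def using integral_Mb[of "\<lambda>z. pd i ?g z * b z", OF CcD(2)[OF gb]]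
    by (simp add: pd_affine[OF fs, of i x "-s", simplified] ac_simps) auto
  finally show ?thesis by simp
qed

lemma smoothing_has_derivative:
  assumes K: "compact K" and f: "f \<in> Cc K" and b: "b \<in> Cc (cball 0 1)"
  shows "((\<lambda>s. smoothing b s f x) has_real_derivative
    - (\<Sum>i\<in>UNIV. smoothing (\<lambda>z. z $ i * b z) s (pd i f) x)) (at s)"
proof -
  have c: "closed K" using K by (rule compact_imp_closed)
  obtain C where C: "0 \<le> C" "\<And>y h. \<bar>f (y + h) - f y - frechet_derivative f (at y) h\<bar> \<le> C * (norm h)\<^sup>2"
    using Cc_taylor2[OF K f] by blast
  obtain B where B: "0 \<le> B" "\<And>x. \<bar>b x\<bar> \<le> B" using Cc_bounded[OF compact_cball b] by blast
  have zb: "(\<lambda>z. z $ i * b z) \<in> Cc (cball 0 1)" for i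
    by (rule Cc_mult[OF smooth_on_linear b]) (auto intro: bounded_linear_vec_nth)
  have int: "integrable Mb (\<lambda>z. b z * g (x - s *\<^sub>R z))" if gb: "g \<in> Cc K" "b \<in> Cc (cball 0 1)" for g s and b :: "real^'a \<Rightarrow> real"
  proof -
    obtain B where "averaging Mb b (\<lambda>z. s *\<^sub>R z) B \<bar>s\<bar>" using averaging_smoothing[OF gb(2)] by blast
    then interpret averaging Mb b "\<lambda>z. s *\<^sub>R z" B "\<bar>s\<bar>" .
    show ?thesis by (rule avg_integrable[OF K gb(1)])
  qed
  interpret b: finite_measure "Mb :: (real ^ 'a) measure" by (rule finite_Mb)
  define m where "m = measure Mb (space Mb :: (real^'a) set)"
  let ?D = "- (\<Sum>i\<in>UNIV. smoothing (\<lambda>z. z $ i * b z) s (pd i f) x)"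
  have est: "\<bar>smoothing b t f x - smoothing b s f x - ?D * (t - s)\<bar> \<le> B * C * m * (norm (t - s))\<^sup>2" for t
  proof -
    have "smoothing b t f x - smoothing b s f x - ?D * (t - s) =
       (\<integral>z. b z * f (x - t *\<^sub>R z) - b z * f (x - s *\<^sub>R z) - (\<Sum>i\<in>UNIV. - (t - s) * (z $ i * b z * pd i f (x - s *\<^sub>R z))) \<partial>Mb)"
      unfolding smoothing_def avg_def using int[OF f b] int[OF Cc_pd[OF c f] zb]
      by (simp add: sum_negf sum_distrib_left[symmetric] mult.commute) (simp add: algebra_simps)
    also have "\<bar>\<dots>\<bar> \<le> (\<integral>z. B * (C * (norm (t - s))\<^sup>2) \<partial>(Mb :: (real^'a) measure))"
    proof (rule order_trans[OF integral_abs_bound integral_mono])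
      show "integrable Mb (\<lambda>z. \<bar>b z * f (x - t *\<^sub>R z) - b z * f (x - s *\<^sub>R z) - (\<Sum>i\<in>UNIV. - (t - s) * (z $ i * b z * pd i f (x - s *\<^sub>R z)))\<bar>)"
        using int[OF f b] int[OF Cc_pd[OF c f] zb]
        by (intro integrable_abs Bochner_Integration.integrable_diff Bochner_Integration.integrable_sum integrable_mult_right)
      fix z :: "real^'a" assume "z \<in> space Mb"
      hence z: "norm z \<le> 1" by simp
      have "b z * f (x - t *\<^sub>R z) - b z * f (x - s *\<^sub>R z) - (\<Sum>i\<in>UNIV. - (t - s) * (z $ i * b z * pd i f (x - s *\<^sub>R z)))
        = b z * (f ((x - s *\<^sub>R z) + (- (t - s)) *\<^sub>R z) - f (x - s *\<^sub>R z) - frechet_derivative f (at (x - s *\<^sub>R z)) ((- (t - s)) *\<^sub>R z))"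
      proof -
        have e: "(x - s *\<^sub>R z) + (- (t - s)) *\<^sub>R z = x - t *\<^sub>R z" by (simp add: algebra_simps)
        have "frechet_derivative f (at (x - s *\<^sub>R z)) ((- (t - s)) *\<^sub>R z) = (\<Sum>i\<in>UNIV. - (t - s) * (z $ i * pd i f (x - s *\<^sub>R z)))"
          by (subst frechet_expand[OF Cc_differentiable[OF f]]) (simp add: deriv_along_def mult.assoc)
        hence d: "b z * frechet_derivative f (at (x - s *\<^sub>R z)) ((- (t - s)) *\<^sub>R z) = (\<Sum>i\<in>UNIV. - (t - s) * (z $ i * b z * pd i f (x - s *\<^sub>R z)))"
          by (simp add: sum_distrib_left ac_simps)
        show ?thesis unfolding e right_diff_distrib d ..
      qed
      also have "\<bar>\<dots>\<bar> \<le> B * (C * (norm ((- (t - s)) *\<^sub>R z))\<^sup>2)"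
        unfolding abs_mult by (intro mult_mono B C) auto
      also have "\<dots> \<le> B * (C * (norm (t - s))\<^sup>2)"
        using z by (intro mult_left_mono power_mono B C) (auto simp: mult_left_le abs_minus_commute[of t s])
      finally show "\<bar>b z * f (x - t *\<^sub>R z) - b z * f (x - s *\<^sub>R z) - (\<Sum>i\<in>UNIV. - (t - s) * (z $ i * b z * pd i f (x - s *\<^sub>R z)))\<bar> \<le> B * (C * (norm (t - s))\<^sup>2)" .
    qed simp
    also have "\<dots> = B * C * m * (norm (t - s))\<^sup>2" by (simp add: m_def)
    finally show ?thesis .
  qed
  show ?thesis unfolding has_field_derivative_def
  proof (rule has_derivativeI_sandwich[of 1])
    show "bounded_linear ((*) ?D)" by (rule bounded_linear_mult_right)
    show "norm (smoothing b t f x - smoothing b s f x - ?D * (t - s)) / norm (t - s) \<le> B * C * m * norm (t - s)"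
      if "t \<noteq> s" for t
      using est[of t] that by (simp add: divide_le_eq power2_eq_square mult.assoc)
    have "((\<lambda>y. B * C * m * norm (y - s)) \<longlongrightarrow> B * C * m * norm (s - s)) (at s)" by (intro tendsto_intros)
    thus "((\<lambda>y. B * C * m * norm (y - s)) \<longlongrightarrow> 0) (at s)" by simp
  qed simp
qed

text \<open>Since the i-th partial derivative of \<open>bell\<close> is -z_i \<open>bell'\<close>,
  the derivative in s of the average with \<open>bell'\<close> is s times the average of \<Delta>f
  with \<open>bell\<close>. The latter is the integrand of the potential of \<Delta>f, so the
  integral over scales telescopes to the difference between scale \<delta> and scale 0.\<close>

lemma lap_potential:
  assumes K: "compact K" and f: "f \<in> Cc K" and \<delta>: "0 \<le> \<delta>"
  shows "lap (potential \<delta> f) x = smoothing bell' \<delta> f x - bell_mass TYPE('d) * f (x :: real ^ 'd)"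
proof -
  have c: "closed K" using K by (rule compact_imp_closed)
  let ?M = "Ms \<delta> \<Otimes>\<^sub>M (Mb :: (real ^ 'd) measure)"
  interpret averaging ?M "\<lambda>p. fst p * bell (snd p)" "\<lambda>p. fst p *\<^sub>R snd p" \<delta> \<delta>
    by (rule averaging_potential[OF \<delta>])
  interpret b: finite_measure "Mb :: (real ^ 'd) measure" by (rule finite_Mb)
  interpret a: finite_measure "Ms \<delta>" by (rule finite_Ms)
  interpret P: pair_sigma_finite "Ms \<delta>" "Mb :: (real ^ 'd) measure" ..
  have lf: "lap f \<in> Cc K" by (rule lap_Cc[OF c f])
  have "lap (potential \<delta> f) x = potential \<delta> (lap f) x"
    unfolding potential_def lap_def pd_avg[OF K f] pd_avg[OF K Cc_pd[OF c f]]
    by (subst avg_sum[OF K]) (auto simp: lap_def Cc_pd c f)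
  also have "\<dots> = (\<integral>s. (\<integral>z. s * bell z * lap f (x - s *\<^sub>R z) \<partial>Mb) \<partial>(Ms \<delta>))"
    unfolding potential_def avg_def
    using P.integral_fst'[OF avg_integrable[OF K lf, of x]] by simp
  also have "\<dots> = (\<integral>s. s * smoothing bell s (lap f) x \<partial>(Ms \<delta>))"
    unfolding smoothing_def avg_def by (simp add: mult.assoc)
  also have "\<dots> = (\<integral>s. s * smoothing bell s (lap f) x * indicator {0..\<delta>} s \<partial>lborel)"
    unfolding Ms_def by (subst integral_restrict_space) (auto simp: mult.commute)
  also have "\<dots> = smoothing bell' \<delta> f x - smoothing bell' 0 f x"
  proof (rule integral_FTC_Icc_real[OF \<delta>])
    fix s
    have "smoothing (\<lambda>z. z $ i * bell' z) s (pd i f) x = - smoothing (pd i bell) s (pd i f) x" for i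
      unfolding smoothing_def avg_def by (simp add: pd_bell)
    hence "- (\<Sum>i\<in>UNIV. smoothing (\<lambda>z. z $ i * bell' z) s (pd i f) x) = s * (\<Sum>i\<in>UNIV. smoothing bell s (pd i (pd i f)) x)"
      by (simp add: smoothing_by_parts[OF K Cc_pd[OF c f] bell_Cc] sum_negf sum_distrib_left)
    also have "(\<Sum>i\<in>UNIV. smoothing bell s (pd i (pd i f)) x) = smoothing bell s (lap f) x"
    proof -
      obtain B where "averaging Mb bell (\<lambda>z::real^'d. s *\<^sub>R z) B \<bar>s\<bar>" using averaging_smoothing[OF bell_Cc] by blast
      then interpret s: averaging Mb bell "\<lambda>z::real^'d. s *\<^sub>R z" B "\<bar>s\<bar>" .
      show ?thesis unfolding smoothing_def lap_def[abs_def] by (rule s.avg_sum[OF K, symmetric]) (intro Cc_pd c f)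
    qed
    finally show "((\<lambda>s. smoothing bell' s f x) has_real_derivative s * smoothing bell s (lap f) x) (at s)"
      using smoothing_has_derivative[OF K f bell'_Cc, of x s] by simp
    show "isCont (\<lambda>s. s * smoothing bell s (lap f) x) s"
      by (intro continuous_intros DERIV_isCont[OF smoothing_has_derivative[OF K lf bell_Cc]])
  qed
  \<comment> \<open>At scale 0 nothing is translated and the mass of \<open>bell'\<close> factors
    out.\<close>
  also have "smoothing bell' 0 f x = bell_mass TYPE('d) * f x"
    unfolding smoothing_def avg_def bell_mass_def
    using integral_Mb[of "bell' :: real^'d \<Rightarrow> real", OF CcD(2)[OF bell'_Cc]] by (simp only: mult_1_left) simp
  finally show ?thesis .
qed

section \<open>Bounded and null sequences\<close>

text \<open>All members of the sequence are supported in one fixed \<open>K\<close>; thus a pairing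
  of a null sequence with a bounded one tends to 0, and derivatives may be moved between the
  two.\<close>

definition bdd :: "(real ^ 'd) set \<Rightarrow> (nat \<Rightarrow> real ^ 'd \<Rightarrow> real) \<Rightarrow> bool" where
  "bdd K F \<longleftrightarrow> (\<forall>m. F m \<in> Cc K) \<and> (\<exists>B. \<forall>m. nrm2 lborel (F m) \<le> B)"

definition nul :: "(real ^ 'd) set \<Rightarrow> (nat \<Rightarrow> real ^ 'd \<Rightarrow> real) \<Rightarrow> bool" where
  "nul K F \<longleftrightarrow> (\<forall>m. F m \<in> Cc K) \<and> (\<lambda>m. nrm2 lborel (F m)) \<longlonglongrightarrow> 0"

lemma bdd_Cc: "bdd K F \<Longrightarrow> F m \<in> Cc K" and nul_Cc: "nul K F \<Longrightarrow> F m \<in> Cc K"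
  by (auto simp: bdd_def nul_def)

lemma nul_imp_bdd: "nul K F \<Longrightarrow> bdd K F"
proof -
  assume F: "nul K F"
  hence "Bseq (\<lambda>m. nrm2 lborel (F m))" by (auto simp: nul_def intro: convergent_imp_Bseq convergentI)
  then obtain B where "\<And>m. norm (nrm2 lborel (F m)) \<le> B" by (auto simp: Bseq_def)
  thus ?thesis using F unfolding bdd_def nul_def by (metis abs_le_D1 real_norm_def)
qed

lemma nulI:
  assumes "\<And>m. F m \<in> Cc K" "\<And>m. nrm2 lborel (F m) \<le> e m" "e \<longlonglongrightarrow> 0"
  shows "nul K F"
proof -
  have "(\<lambda>m. nrm2 lborel (F m)) \<longlonglongrightarrow> 0"
    by (rule tendsto_sandwich[OF _ _ tendsto_const assms(3)]) (use assms(2) in \<open>auto simp: nrm2_ge0\<close>)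
  thus ?thesis using assms(1) by (simp add: nul_def)
qed

lemma nul_ip_self:
  assumes "\<And>m. F m \<in> Cc K" "(\<lambda>m. ip (F m) (F m)) \<longlonglongrightarrow> 0"
  shows "nul K F"
proof -
  have "(\<lambda>m. sqrt (ip (F m) (F m))) \<longlonglongrightarrow> sqrt 0" by (intro tendsto_real_sqrt assms)
  hence "(\<lambda>m. nrm2 lborel (F m)) \<longlonglongrightarrow> 0" by (simp add: ip_self nrm2_ge0)
  thus ?thesis using assms(1) by (simp add: nul_def)
qed

context
  fixes K :: "(real ^ 'd) set"
  assumes K: "compact K"
begin

lemma bdd_add: assumes "bdd K F" "bdd K G" shows "bdd K (\<lambda>m x. F m x + G m x)"
proof -
  obtain B C where B: "\<And>m. nrm2 lborel (F m) \<le> B" and C: "\<And>m. nrm2 lborel (G m) \<le> C"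
    using assms by (auto simp: bdd_def)
  have "nrm2 lborel (\<lambda>x. F m x + G m x) \<le> B + C" for m
    by (rule order_trans[OF nrm2_triangle[OF Cc_sqi[OF K] Cc_sqi[OF K]]]) (use assms B C in \<open>auto simp: bdd_def intro: add_mono\<close>)
  thus ?thesis using assms by (auto simp: bdd_def intro: Cc_add)
qed

lemma nul_add: assumes "nul K F" "nul K G" shows "nul K (\<lambda>m x. F m x + G m x)"
proof (rule nulI)
  show "nrm2 lborel (\<lambda>x. F m x + G m x) \<le> nrm2 lborel (F m) + nrm2 lborel (G m)" for m
    by (intro nrm2_triangle Cc_sqi[OF K]) (use assms in \<open>auto simp: nul_def\<close>)
  show "(\<lambda>m. nrm2 lborel (F m) + nrm2 lborel (G m)) \<longlonglongrightarrow> 0"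
    using assms by (auto simp: nul_def intro: tendsto_add_zero)
qed (use assms in \<open>auto simp: nul_def intro: Cc_add\<close>)

lemma bdd_0: "bdd K (\<lambda>m x. 0)" by (auto simp: bdd_def Cc_0)
lemma nul_0: "nul K (\<lambda>m x. 0)" by (auto simp: nul_def Cc_0)

lemma bdd_sum: "(\<And>i. i \<in> I \<Longrightarrow> bdd K (F i)) \<Longrightarrow> bdd K (\<lambda>m x. \<Sum>i\<in>I. F i m x)"
  by (induction I rule: infinite_finite_induct) (auto intro: bdd_0 bdd_add)

lemma nul_sum: "(\<And>i. i \<in> I \<Longrightarrow> nul K (F i)) \<Longrightarrow> nul K (\<lambda>m x. \<Sum>i\<in>I. F i m x)"
  by (induction I rule: infinite_finite_induct) (auto intro: nul_0 nul_add)

lemma nrm2_mult_le: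
  assumes "\<And>x. x \<in> K \<Longrightarrow> \<bar>a x\<bar> \<le> A" "f \<in> Cc K" "(\<lambda>x. a x * f x) \<in> Cc K" "0 \<le> A"
  shows "nrm2 lborel (\<lambda>x. a x * f x) \<le> A * nrm2 lborel f"
proof -
  have "nrm2 lborel (\<lambda>x. a x * f x) \<le> nrm2 lborel (\<lambda>x. A * f x)"
  proof (rule nrm2_mono[OF sqi_cmult[OF Cc_sqi[OF K assms(2)]]])
    show "(\<lambda>x. a x * f x) \<in> borel_measurable lborel" using Cc_measurable[OF assms(3)] by simp
    have "\<bar>a x * f x\<bar> \<le> \<bar>A * f x\<bar>" for x
    proof (cases "x \<in> K")
      case True
      show ?thesis using mult_right_mono[OF assms(1)[OF True] abs_ge_zero[of "f x"]] assms(4)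
        unfolding abs_mult by simp
    next
      case False show ?thesis unfolding CcD(2)[OF assms(2) False] by simp
    qed
    thus "AE x in lborel. \<bar>a x * f x\<bar> \<le> \<bar>A * f x\<bar>" by simp
  qed
  thus ?thesis using assms(4) by (simp add: nrm2_cmult)
qed

lemma ip_bdd_nul:
  assumes "bdd K F" "nul K G" shows "(\<lambda>m. ip (F m) (G m)) \<longlonglongrightarrow> 0"
proof -
  obtain B where B: "\<And>m. nrm2 lborel (F m) \<le> B" using assms by (auto simp: bdd_def)
  have est: "norm (ip (F m) (G m)) \<le> B * nrm2 lborel (G m)" for m
    using ip_le[OF K bdd_Cc[OF assms(1)] nul_Cc[OF assms(2)], of m m] mult_right_mono[OF B[of m] nrm2_ge0[of lborel "G m"]]
    by simp
  have lim: "(\<lambda>m. B * nrm2 lborel (G m)) \<longlonglongrightarrow> 0"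
    using assms(2) tendsto_mult_left[of "\<lambda>m. nrm2 lborel (G m)" 0 _ B] by (simp add: nul_def)
  show ?thesis by (rule Lim_null_comparison[OF always_eventually lim]) (use est in blast)
qed

lemma ip_nul_bdd: "nul K F \<Longrightarrow> bdd K G \<Longrightarrow> (\<lambda>m. ip (F m) (G m)) \<longlonglongrightarrow> 0"
  using ip_bdd_nul[of G F] by (simp add: ip_commute)

end

text \<open>The support changes from \<open>K'\<close> to \<open>K\<close>: a cutoff brings a
  sequence that lives on a larger set back to where the vector fields are smooth.\<close>

lemma bdd_mult_Cc:
  assumes K: "compact K" and K': "compact K'" and p: "p \<in> Cc K" and F: "bdd K' F"
  shows "bdd K (\<lambda>m x. p x * F m x)"
proof -
  obtain A where A: "0 \<le> A" "\<And>x. \<bar>p x\<bar> \<le> A" using Cc_bounded[OF K p] by blast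
  obtain B where B: "\<And>m. nrm2 lborel (F m) \<le> B" using F by (auto simp: bdd_def)
  have c: "(\<lambda>x. p x * F m x) \<in> Cc K" for m
    using Cc_mult[OF CcD(1)[OF bdd_Cc[OF F]] p] by (simp add: mult.commute)
  have "nrm2 lborel (\<lambda>x. p x * F m x) \<le> A * B" for m
    by (rule order_trans[OF nrm2_mult_le[OF K' A(2) bdd_Cc[OF F]]])
      (use A B CcD(1)[OF p] bdd_Cc[OF F] in \<open>auto intro!: Cc_mult mult_left_mono\<close>)
  thus ?thesis using c by (auto simp: bdd_def)
qed

lemma nul_mult_Cc:
  assumes K: "compact K" and K': "compact K'" and p: "p \<in> Cc K" and F: "nul K' F"
  shows "nul K (\<lambda>m x. p x * F m x)"
proof -
  obtain A where A: "0 \<le> A" "\<And>x. \<bar>p x\<bar> \<le> A" using Cc_bounded[OF K p] by blast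
  show ?thesis
  proof (rule nulI)
    show "(\<lambda>x. p x * F m x) \<in> Cc K" for m
      using Cc_mult[OF CcD(1)[OF nul_Cc[OF F]] p] by (simp add: mult.commute)
    show "nrm2 lborel (\<lambda>x. p x * F m x) \<le> A * nrm2 lborel (F m)" for m
      by (rule nrm2_mult_le[OF K' A(2) nul_Cc[OF F]]) (use A CcD(1)[OF p] nul_Cc[OF F] in \<open>auto intro!: Cc_mult\<close>)
    show "(\<lambda>m. A * nrm2 lborel (F m)) \<longlonglongrightarrow> 0"
      using F tendsto_mult_left[of "\<lambda>m. nrm2 lborel (F m)" 0 _ A] by (simp add: nul_def)
  qed
qed

text \<open>The fields are smooth on \<open>U\<close> while the functions are supported in
  \<open>K\<close>, so that multiplication by coefficients and differentiation along fields never
  leave \<open>Cc K\<close>.\<close>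

locale compact_in_open =
  fixes K U :: "(real ^ 'd) set"
  assumes K: "compact K" "K \<subseteq> U" and U: "open U"
begin

lemma clK: "closed K" using K by (simp add: compact_imp_closed)

lemma mult_Cc: "smooth_on U a \<Longrightarrow> f \<in> Cc K \<Longrightarrow> (\<lambda>x. a x * f x) \<in> Cc K"
  by (rule Cc_smooth_mult[OF clK K(2) U])

lemma along_Cc: "smooth_on U X \<Longrightarrow> f \<in> Cc K \<Longrightarrow> deriv_along X f \<in> Cc K"
  by (rule Cc_deriv_along[OF clK K(2) U])

lemma smooth_bounded_on_K:
  assumes "smooth_on U a" obtains A where "0 \<le> A" "\<And>x. x \<in> K \<Longrightarrow> \<bar>a x\<bar> \<le> (A::real)"
  using continuous_bounded_on_compact[OF K(1) continuous_on_subset[OF smooth_on_continuous[OF assms] K(2)]] by blast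

lemma bdd_mult: assumes a: "smooth_on U a" and F: "bdd K F" shows "bdd K (\<lambda>m x. a x * F m x)"
proof -
  obtain A where A: "0 \<le> A" "\<And>x. x \<in> K \<Longrightarrow> \<bar>a x\<bar> \<le> A" using smooth_bounded_on_K[OF a] by blast
  obtain B where B: "\<And>m. nrm2 lborel (F m) \<le> B" using F by (auto simp: bdd_def)
  have "nrm2 lborel (\<lambda>x. a x * F m x) \<le> A * B" for m
    by (rule order_trans[OF nrm2_mult_le[OF K(1) A(2) bdd_Cc[OF F] mult_Cc[OF a bdd_Cc[OF F]] A(1)]])
      (use A B in \<open>auto intro!: mult_left_mono\<close>)
  thus ?thesis using F a by (auto simp: bdd_def intro: mult_Cc)
qed

lemma nul_mult: assumes a: "smooth_on U a" and F: "nul K F" shows "nul K (\<lambda>m x. a x * F m x)"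
proof -
  obtain A where A: "0 \<le> A" "\<And>x. x \<in> K \<Longrightarrow> \<bar>a x\<bar> \<le> A" using smooth_bounded_on_K[OF a] by blast
  show ?thesis
  proof (rule nulI[OF mult_Cc[OF a nul_Cc[OF F]]])
    show "nrm2 lborel (\<lambda>x. a x * F m x) \<le> A * nrm2 lborel (F m)" for m
      by (rule nrm2_mult_le[OF K(1) A(2) nul_Cc[OF F] mult_Cc[OF a nul_Cc[OF F]] A(1)])
    show "(\<lambda>m. A * nrm2 lborel (F m)) \<longlonglongrightarrow> 0"
      using F tendsto_mult_left[of "\<lambda>m. nrm2 lborel (F m)" 0 _ A] by (simp add: nul_def)
  qed
qed

lemma bdd_cmult: "bdd K F \<Longrightarrow> bdd K (\<lambda>m x. c * F m x)" by (rule bdd_mult[OF smooth_on_const])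
lemma nul_cmult: "nul K F \<Longrightarrow> nul K (\<lambda>m x. c * F m x)" by (rule nul_mult[OF smooth_on_const])
lemma bdd_diff: "bdd K F \<Longrightarrow> bdd K G \<Longrightarrow> bdd K (\<lambda>m x. F m x - G m x)"
  using bdd_add[OF K(1), of F "\<lambda>m x. (-1) * G m x"] bdd_cmult[of G "-1"] by simp
lemma nul_diff: "nul K F \<Longrightarrow> nul K G \<Longrightarrow> nul K (\<lambda>m x. F m x - G m x)"
  using nul_add[OF K(1), of F "\<lambda>m x. (-1) * G m x"] nul_cmult[of G "-1"] by simp

lemma bdd_along:
  assumes "smooth_on U X" "\<And>m. F m \<in> Cc K" "\<And>i. bdd K (\<lambda>m. pd i (F m))"
  shows "bdd K (\<lambda>m. deriv_along X (F m))"
proof -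
  have "bdd K (\<lambda>m x. \<Sum>i\<in>UNIV. X x $ i * pd i (F m) x)"
    by (intro bdd_sum[OF K(1)] bdd_mult smooth_on_nth U assms)
  moreover have "(\<lambda>m. deriv_along X (F m)) = (\<lambda>m x. \<Sum>i\<in>UNIV. X x $ i * pd i (F m) x)"
    by (intro ext deriv_along_expand Cc_differentiable[OF assms(2)])
  ultimately show ?thesis by simp
qed

lemma along_mult:
  assumes a: "smooth_on U a" and h: "h \<in> Cc K"
  shows "deriv_along X (\<lambda>x. a x * h x) = (\<lambda>x. a x * deriv_along X h x + deriv_along X a x * h x)"
proof
  fix x
  show "deriv_along X (\<lambda>x. a x * h x) x = a x * deriv_along X h x + deriv_along X a x * h x"
  proof (cases "x \<in> K")
    case True
    thus ?thesis using K by (intro deriv_along_mult smooth_on_differentiable[OF a] Cc_differentiable[OF h]) auto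
  next
    case False
    thus ?thesis using Cc_derivative_outside[OF clK h False] Cc_derivative_outside[OF clK mult_Cc[OF a h] False] CcD(2)[OF h False]
      by (simp add: deriv_along_def)
  qed
qed

lemma bdd_pd_mult:
  assumes "smooth_on U a" "bdd K F" "bdd K (\<lambda>m. pd k (F m))"
  shows "bdd K (\<lambda>m. pd k (\<lambda>x. a x * F m x))"
proof -
  have "bdd K (\<lambda>m x. a x * pd k (F m) x + pd k a x * F m x)"
    by (intro bdd_add[OF K(1)] bdd_mult smooth_on_pd assms)
  thus ?thesis using along_mult[OF assms(1) bdd_Cc[OF assms(2)]] by simp
qed

lemma ip_along:
  "smooth_on U X \<Longrightarrow> f \<in> Cc K \<Longrightarrow> g \<in> Cc K \<Longrightarrow>
    ip (deriv_along X f) g = - ip f (deriv_along X g) - ip f (\<lambda>x. divergence X x * g x)"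
  by (rule ip_deriv_along[OF K U])

lemma smooth_div: "smooth_on U X \<Longrightarrow> smooth_on U (divergence X)"
  by (rule smooth_on_divergence[OF U])

lemma smooth_bracket: "smooth_on U X \<Longrightarrow> smooth_on U Z \<Longrightarrow> smooth_on U (lie_bracket X Z)"
  by (rule smooth_on_lie_bracket[OF U])

lemma along_bracket:
  "smooth_on U X \<Longrightarrow> smooth_on U Z \<Longrightarrow> f \<in> Cc K \<Longrightarrow>
    deriv_along (lie_bracket X Z) f = (\<lambda>x. deriv_along X (deriv_along Z f) x - deriv_along Z (deriv_along X f) x)"
  by (rule deriv_along_lie_bracket[OF clK K(2) U])

section \<open>Commutators\<close>

text \<open>
  With \<open>Z = [Y,X]\<close>, write \<open>\<parallel>Zv\<parallel>\<^sup>2 = \<langle>YXv,Zv\<rangle> - \<langle>XYv,Zv\<rangle>\<close> and integrate by parts until every term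
  pairs one of the null sequences \<open>Xv\<close>, \<open>Yv\<close> with a bounded one.
\<close>

lemma nul_lie_bracket:
  assumes Y: "smooth_on U Y" and X: "smooth_on U X" and v: "\<And>m. v m \<in> Cc K"
    and Dv: "\<And>i. bdd K (\<lambda>m. pd i (v m))"
    and DYv: "\<And>i. bdd K (\<lambda>m. pd i (deriv_along Y (v m)))"
    and Yv: "nul K (\<lambda>m. deriv_along Y (v m))" and Xv: "nul K (\<lambda>m. deriv_along X (v m))"
  shows "nul K (\<lambda>m. deriv_along (lie_bracket Y X) (v m))"
proof -
  define Z where "Z = lie_bracket Y X"
  have Z: "smooth_on U Z" unfolding Z_def by (rule smooth_bracket[OF Y X])
  let ?X = "\<lambda>m. deriv_along X (v m)" and ?Y = "\<lambda>m. deriv_along Y (v m)" and ?Z = "\<lambda>m. deriv_along Z (v m)"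
  have cX: "?X m \<in> Cc K" and cY: "?Y m \<in> Cc K" and cZ: "?Z m \<in> Cc K" for m by (intro along_Cc X Y Z v)+
  have bZ: "bdd K ?Z" by (rule bdd_along[OF Z v Dv])
  have bZY: "bdd K (\<lambda>m. deriv_along Z (?Y m))" by (rule bdd_along[OF Z cY DYv])
  \<comment> \<open>No bound on general second derivatives of v is available, only on those passing
    through Y. Hence YZv is rewritten as [Y,Z]v + ZYv.\<close>
  have bYZ: "bdd K (\<lambda>m. deriv_along Y (?Z m))"
  proof -
    have "bdd K (\<lambda>m x. deriv_along (lie_bracket Y Z) (v m) x + deriv_along Z (?Y m) x)"
      by (intro bdd_add[OF K(1)] bZY bdd_along[OF smooth_bracket[OF Y Z] v Dv])
    thus ?thesis by (simp add: along_bracket[OF Y Z v])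
  qed
  \<comment> \<open>In the second term, XZv is replaced by [X,Z]v + ZXv after X has been moved to
    the other factor, and then Z is moved onto Yv. In this way two derivatives fall on v only if one
    of them is Y.\<close>
  have eq: "ip (?Z m) (?Z m) =
      - ip (?X m) (deriv_along Y (?Z m)) - ip (?X m) (\<lambda>x. divergence Y x * ?Z m x)
      + ip (?Y m) (deriv_along (lie_bracket X Z) (v m)) + ip (?Y m) (\<lambda>x. divergence X x * ?Z m x)
      - ip (?X m) (deriv_along Z (?Y m)) - ip (?X m) (\<lambda>x. divergence Z x * ?Y m x)" for m
  proof -
    have "ip (?Z m) (?Z m) = ip (deriv_along Y (?X m)) (?Z m) - ip (deriv_along X (?Y m)) (?Z m)"
      using ip_diff_left[OF K(1) along_Cc[OF Y cX] along_Cc[OF X cY] cZ, of m m m] along_bracket[OF Y X v]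
      by (simp add: Z_def)
    moreover have "ip (deriv_along Y (?X m)) (?Z m) = - ip (?X m) (deriv_along Y (?Z m)) - ip (?X m) (\<lambda>x. divergence Y x * ?Z m x)"
      by (rule ip_along[OF Y cX cZ])
    moreover have "ip (deriv_along X (?Y m)) (?Z m) = - ip (?Y m) (deriv_along X (?Z m)) - ip (?Y m) (\<lambda>x. divergence X x * ?Z m x)"
      by (rule ip_along[OF X cY cZ])
    moreover have "ip (?Y m) (deriv_along X (?Z m)) = ip (?Y m) (deriv_along (lie_bracket X Z) (v m)) + ip (?Y m) (deriv_along Z (?X m))"
      using ip_add_right[OF K(1) along_Cc[OF smooth_bracket[OF X Z] v] along_Cc[OF Z cX] cY, of m m m] along_bracket[OF X Z v] by simp
    moreover have "ip (deriv_along Z (?X m)) (?Y m) = - ip (?X m) (deriv_along Z (?Y m)) - ip (?X m) (\<lambda>x. divergence Z x * ?Y m x)"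
      by (rule ip_along[OF Z cX cY])
    ultimately show ?thesis by (simp add: ip_commute[of "?Y m" "deriv_along Z (?X m)"])
  qed
  have lim: "(\<lambda>m. ip (?Z m) (?Z m)) \<longlonglongrightarrow> - 0 - 0 + 0 + 0 - 0 - 0"
    unfolding eq
    by (intro tendsto_intros ip_nul_bdd[OF K(1) Xv] ip_nul_bdd[OF K(1) Yv] bYZ bZY bdd_mult smooth_div bZ nul_imp_bdd[OF Yv]
        bdd_along[OF smooth_bracket[OF X Z] v Dv] X Y Z)
  show ?thesis unfolding Z_def[symmetric] by (rule nul_ip_self[OF cZ]) (use lim in simp)
qed

text \<open>Moving one Y across in the square of the norm pairs v, which tends to 0, with YYv and a
  multiple of Yv, which are bounded.\<close>

lemma nul_deriv_along_self:
  assumes Y: "smooth_on U Y" and v: "nul K v" and DYv: "\<And>i. bdd K (\<lambda>m. pd i (deriv_along Y (v m)))"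
    and Dv: "\<And>i. bdd K (\<lambda>m. pd i (v m))"
  shows "nul K (\<lambda>m. deriv_along Y (v m))"
proof (rule nul_ip_self)
  show c: "deriv_along Y (v m) \<in> Cc K" for m by (rule along_Cc[OF Y nul_Cc[OF v]])
  have eq: "ip (deriv_along Y (v m)) (deriv_along Y (v m)) = - ip (v m) (deriv_along Y (deriv_along Y (v m)))
     - ip (v m) (\<lambda>x. divergence Y x * deriv_along Y (v m) x)" for m
    by (rule ip_along[OF Y nul_Cc[OF v] c])
  have "(\<lambda>m. ip (deriv_along Y (v m)) (deriv_along Y (v m))) \<longlonglongrightarrow> - 0 - 0"
    unfolding eq
    by (intro tendsto_intros ip_nul_bdd[OF K(1) v] bdd_along[OF Y c DYv] bdd_mult smooth_div Y bdd_along[OF Y nul_Cc[OF v] Dv])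
  thus "(\<lambda>m. ip (deriv_along Y (v m)) (deriv_along Y (v m))) \<longlonglongrightarrow> 0" by simp
qed

text \<open>
  The induction over the Lie algebra carries stability under brackets with null directions along;
  for brackets this stability is the Jacobi identity.
\<close>

lemma nul_lie_algebra:
  assumes Y: "\<And>j. j \<in> {1..n} \<Longrightarrow> smooth_on U (Y j)" and v: "nul K v"
    and Dv: "\<And>i. bdd K (\<lambda>m. pd i (v m))"
    and DYv: "\<And>i j. j \<in> {1..n} \<Longrightarrow> bdd K (\<lambda>m. pd i (deriv_along (Y j) (v m)))"
    and X: "X \<in> lie_algebra n Y"
  shows "smooth_on U X \<and> nul K (\<lambda>m. deriv_along X (v m)) \<and>
    (\<forall>Z. smooth_on U Z \<and> nul K (\<lambda>m. deriv_along Z (v m)) \<longrightarrow> nul K (\<lambda>m. deriv_along (lie_bracket X Z) (v m)))"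
  using X
proof induction
  note vc = nul_Cc[OF v]
  {
    case (generator j)
    have n: "nul K (\<lambda>m. deriv_along (Y j) (v m))"
      by (rule nul_deriv_along_self[OF Y[OF generator] v DYv[OF generator] Dv])
    thus ?case using nul_lie_bracket[OF Y[OF generator] _ vc Dv DYv[OF generator] n] Y[OF generator] by blast
  next
    case zero
    have z: "deriv_along (\<lambda>x. 0) f = (\<lambda>x. 0)" if "f \<in> Cc K" for f
      using linear_0[OF linear_frechet_derivative[OF Cc_differentiable[OF that]]] by (simp add: deriv_along_def fun_eq_iff)
    moreover have "deriv_along Z (deriv_along (\<lambda>x. 0) f) = (\<lambda>x. 0)" if "f \<in> Cc K" for f Z
      by (simp only: z[OF that]) (simp add: fun_eq_iff)
    ultimately show ?case
      using nul_0[OF K(1)] along_bracket[OF smooth_on_const[of U 0] _ vc] along_Cc[OF _ vc] vc by (simp add: smooth_on_const)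
  next
    case (add X Z)
    have e: "deriv_along (\<lambda>x. X x + Z x) f = (\<lambda>x. deriv_along X f x + deriv_along Z f x)" if "f \<in> Cc K" for f
      using linear_add[OF linear_frechet_derivative[OF Cc_differentiable[OF that]]] by (simp add: deriv_along_def fun_eq_iff)
    have s: "smooth_on U (\<lambda>x. X x + Z x)" using add U by (intro smooth_on_add) auto
    have "nul K (\<lambda>m. deriv_along (lie_bracket (\<lambda>x. X x + Z x) W) (v m))"
      if W: "smooth_on U W" "nul K (\<lambda>m. deriv_along W (v m))" for W
    proof -
      have "nul K (\<lambda>m x. deriv_along (lie_bracket X W) (v m) x + deriv_along (lie_bracket Z W) (v m) x)"
        using add.IH W by (intro nul_add[OF K(1)]) auto
      moreover have "deriv_along (lie_bracket (\<lambda>x. X x + Z x) W) (v m) = (\<lambda>x. deriv_along (lie_bracket X W) (v m) x + deriv_along (lie_bracket Z W) (v m) x)" for m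
        using add.IH W along_bracket[OF s W(1) vc, of m] along_bracket[OF _ W(1) vc, of X m] along_bracket[OF _ W(1) vc, of Z m]
          e[OF vc[of m]] e[OF along_Cc[OF W(1) vc[of m]]]
          deriv_along_add[OF Cc_differentiable[OF along_Cc[OF _ vc[of m], of X]] Cc_differentiable[OF along_Cc[OF _ vc[of m], of Z]]]
        by (simp add: fun_eq_iff)
      ultimately show ?thesis by simp
    qed
    moreover have "nul K (\<lambda>m. deriv_along (\<lambda>x. X x + Z x) (v m))"
      using add.IH nul_add[OF K(1), of "\<lambda>m. deriv_along X (v m)" "\<lambda>m. deriv_along Z (v m)"] by (simp add: e[OF vc])
    ultimately show ?case using s by blast
  next
    case (scale X r)
    have e: "deriv_along (\<lambda>x. r *\<^sub>R X x) f = (\<lambda>x. r * deriv_along X f x)" if "f \<in> Cc K" for f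
      using linear_scale[OF linear_frechet_derivative[OF Cc_differentiable[OF that]]] by (simp add: deriv_along_def fun_eq_iff)
    have s: "smooth_on U (\<lambda>x. r *\<^sub>R X x)" using scale U by (intro smooth_on_bounded_linear[OF _ bounded_linear_scaleR_right]) auto
    have "nul K (\<lambda>m. deriv_along (lie_bracket (\<lambda>x. r *\<^sub>R X x) W) (v m))"
      if W: "smooth_on U W" "nul K (\<lambda>m. deriv_along W (v m))" for W
    proof -
      have "nul K (\<lambda>m x. r * deriv_along (lie_bracket X W) (v m) x)"
        using scale.IH W by (intro nul_cmult) auto
      moreover have "deriv_along (lie_bracket (\<lambda>x. r *\<^sub>R X x) W) (v m) = (\<lambda>x. r * deriv_along (lie_bracket X W) (v m) x)" for m
        using scale.IH W along_bracket[OF s W(1) vc, of m] along_bracket[OF _ W(1) vc, of X m]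
          e[OF vc[of m]] e[OF along_Cc[OF W(1) vc[of m]]]
          deriv_along_cmult[OF Cc_differentiable[OF along_Cc[OF _ vc[of m], of X]]]
        by (simp add: fun_eq_iff right_diff_distrib)
      ultimately show ?thesis by simp
    qed
    moreover have "nul K (\<lambda>m. deriv_along (\<lambda>x. r *\<^sub>R X x) (v m))"
      using scale.IH nul_cmult[of "\<lambda>m. deriv_along X (v m)" r] by (simp add: e[OF vc])
    ultimately show ?case using s by blast
  next
    case (bracket X Z)
    have X: "smooth_on U X" and Z: "smooth_on U Z" using bracket.IH by auto
    have "nul K (\<lambda>m. deriv_along (lie_bracket (lie_bracket X Z) W) (v m))"
      if W: "smooth_on U W" "nul K (\<lambda>m. deriv_along W (v m))" for W
    proof -
      have "nul K (\<lambda>m. deriv_along (lie_bracket Z W) (v m))" "nul K (\<lambda>m. deriv_along (lie_bracket X W) (v m))"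
        using bracket.IH W by blast+
      hence "nul K (\<lambda>m. deriv_along (lie_bracket X (lie_bracket Z W)) (v m))" "nul K (\<lambda>m. deriv_along (lie_bracket Z (lie_bracket X W)) (v m))"
        using bracket.IH smooth_bracket[OF Z W(1)] smooth_bracket[OF X W(1)] by blast+
      hence "nul K (\<lambda>m x. deriv_along (lie_bracket X (lie_bracket Z W)) (v m) x - deriv_along (lie_bracket Z (lie_bracket X W)) (v m) x)"
        by (rule nul_diff)
      \<comment> \<open>The Jacobi identity in derivation form, verified for the operators on
        \<open>Cc K\<close> by expanding all brackets into iterated derivatives.\<close>
      moreover have "deriv_along (lie_bracket (lie_bracket X Z) W) f
          = (\<lambda>x. deriv_along (lie_bracket X (lie_bracket Z W)) f x - deriv_along (lie_bracket Z (lie_bracket X W)) f x)"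
        if f: "f \<in> Cc K" for f
      proof -
        have d: "deriv_along A (\<lambda>x. g x - h x) = (\<lambda>x. deriv_along A g x - deriv_along A h x)" if "g \<in> Cc K" "h \<in> Cc K" for A g h
          by (intro ext deriv_along_diff Cc_differentiable[OF that(1)] Cc_differentiable[OF that(2)])
        note br = along_bracket[OF X Z] along_bracket[OF X W(1)] along_bracket[OF Z W(1)]
          along_bracket[OF smooth_bracket[OF X Z] W(1)] along_bracket[OF X smooth_bracket[OF Z W(1)]]
          along_bracket[OF Z smooth_bracket[OF X W(1)]]
        show ?thesis
          by (simp add: br f along_Cc[OF X] along_Cc[OF Z] along_Cc[OF W(1)] d fun_eq_iff)
      qed
      ultimately show ?thesis using vc by simp
    qed
    thus ?case using bracket.IH smooth_bracket[OF X Z] by blast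
  }
qed

section \<open>Elliptic regularity\<close>

lemma lap_K: "f \<in> Cc K \<Longrightarrow> lap f \<in> Cc K" by (rule lap_Cc[OF clK])
lemma pd_K: "f \<in> Cc K \<Longrightarrow> pd i f \<in> Cc K" by (rule Cc_pd[OF clK])

text \<open>Two integrations by parts; third derivatives commute, so one index can be exchanged
  between the factors.\<close>

lemma ip_second_derivatives:
  assumes g: "g \<in> Cc K"
  shows "ip (pd i (pd j g)) (pd i (pd j g)) = ip (pd j (pd j g)) (pd i (pd i g))"
proof -
  note s = CcD(1)[OF g] CcD(1)[OF pd_K[OF g]]
  have "ip (pd i (pd j g)) (pd i (pd j g)) = - ip (pd j g) (pd i (pd i (pd j g)))"
    by (intro ip_pd[OF K(1)] pd_K g)
  also have "pd i (pd i (pd j g)) = pd j (pd i (pd i g))" by (simp add: pd_commute[OF s(1), of i j] pd_commute[OF s(2), of i j])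
  also have "- ip (pd j g) (pd j (pd i (pd i g))) = ip (pd j (pd j g)) (pd i (pd i g))"
    using ip_pd[OF K(1) pd_K[OF g] pd_K[OF pd_K[OF g]], of j j i i] by simp
  finally show ?thesis .
qed

text \<open>Summed over all index pairs, the preceding identity says that the Hessian and the
  Laplacian have the same L2 norm; hence the constant is 1.\<close>

lemma nrm2_second_derivative_le:
  assumes g: "g \<in> Cc K" shows "nrm2 lborel (pd i (pd j g)) \<le> nrm2 lborel (lap g)"
proof (rule power2_le_imp_le[OF _ nrm2_ge0])
  have "(nrm2 lborel (pd i (pd j g)))\<^sup>2 \<le> (\<Sum>i\<in>UNIV. \<Sum>j\<in>UNIV. ip (pd i (pd j g)) (pd i (pd j g)))"
  proof -
    have "(nrm2 lborel (pd i (pd j g)))\<^sup>2 \<le> (\<Sum>j\<in>UNIV. (nrm2 lborel (pd i (pd j g)))\<^sup>2)"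
      by (rule member_le_sum[where f="\<lambda>j. (nrm2 lborel (pd i (pd j g)))\<^sup>2"]) auto
    also have "\<dots> \<le> (\<Sum>i\<in>UNIV. \<Sum>j\<in>UNIV. (nrm2 lborel (pd i (pd j g)))\<^sup>2)"
      by (rule member_le_sum[where f="\<lambda>i. \<Sum>j\<in>UNIV. (nrm2 lborel (pd i (pd j g)))\<^sup>2"]) (auto intro: sum_nonneg)
    finally show ?thesis by (simp add: ip_self)
  qed
  also have "\<dots> = (\<Sum>i\<in>UNIV. \<Sum>j\<in>UNIV. ip (pd j (pd j g)) (pd i (pd i g)))"
    by (intro sum.cong refl ip_second_derivatives[OF g])
  also have "\<dots> = (\<integral>x. (\<Sum>i\<in>UNIV. \<Sum>j\<in>UNIV. pd j (pd j g) x * pd i (pd i g) x) \<partial>lborel)"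
    unfolding ip_def
    by (subst Bochner_Integration.integral_sum, intro Bochner_Integration.integrable_sum Cc_integrable[OF K(1)] Cc_mult_Cc pd_K g,
        intro sum.cong refl Bochner_Integration.integral_sum[symmetric] Cc_integrable[OF K(1)] Cc_mult_Cc pd_K g)
  also have "\<dots> = (nrm2 lborel (lap g))\<^sup>2"
    unfolding nrm2_sq by (simp add: lap_def power2_eq_square sum_product mult.commute)
  finally show "(nrm2 lborel (pd i (pd j g)))\<^sup>2 \<le> (nrm2 lborel (lap g))\<^sup>2" .
qed

lemma ip_first_derivatives:
  assumes g: "g \<in> Cc K" shows "(\<Sum>i\<in>UNIV. ip (pd i g) (pd i g)) = - ip g (lap g)"
proof -
  have "(\<Sum>i\<in>UNIV. ip (pd i g) (pd i g)) = (\<Sum>i\<in>UNIV. - ip g (pd i (pd i g)))"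
    by (intro sum.cong refl ip_pd[OF K(1)] pd_K g)
  also have "\<dots> = - (\<integral>x. (\<Sum>i\<in>UNIV. g x * pd i (pd i g) x) \<partial>lborel)"
    unfolding ip_def sum_negf
    by (subst Bochner_Integration.integral_sum) (auto intro!: Cc_integrable[OF K(1)] Cc_mult_Cc pd_K g)
  finally show ?thesis by (simp add: ip_def lap_def sum_distrib_left)
qed

lemma bdd_second_derivatives:
  assumes "\<And>m. g m \<in> Cc K" "bdd K (\<lambda>m. lap (g m))" shows "bdd K (\<lambda>m. pd i (pd j (g m)))"
proof -
  obtain B where "\<And>m. nrm2 lborel (lap (g m)) \<le> B" using assms(2) by (auto simp: bdd_def)
  hence "nrm2 lborel (pd i (pd j (g m))) \<le> B" for m
    using nrm2_second_derivative_le[OF assms(1), of i j m] order_trans by blast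
  thus ?thesis using assms(1) by (auto simp: bdd_def intro: pd_K)
qed

text \<open>Interpolation: the squared norm of the gradient is -\<langle>g, \<Delta>g\<rangle>, a
  null sequence paired with a bounded one.\<close>

lemma nul_first_derivatives:
  assumes g: "nul K g" and l: "bdd K (\<lambda>m. lap (g m))" shows "nul K (\<lambda>m. pd i (g m))"
proof (rule nul_ip_self[OF pd_K[OF nul_Cc[OF g]]])
  have "(\<lambda>m. - ip (g m) (lap (g m))) \<longlonglongrightarrow> - 0" by (intro tendsto_intros ip_nul_bdd[OF K(1)] g l)
  hence lim: "(\<lambda>m. - ip (g m) (lap (g m))) \<longlonglongrightarrow> 0" by simp
  show "(\<lambda>m. ip (pd i (g m)) (pd i (g m))) \<longlonglongrightarrow> 0"
  proof (rule tendsto_sandwich[OF _ _ tendsto_const lim])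
    have "ip (pd i (g m)) (pd i (g m)) \<le> - ip (g m) (lap (g m))" for m
      unfolding ip_first_derivatives[OF nul_Cc[OF g], symmetric]
      by (rule member_le_sum[where f="\<lambda>i. ip (pd i (g m)) (pd i (g m))"]) (auto simp: ip_self)
    thus "\<forall>\<^sub>F m in sequentially. ip (pd i (g m)) (pd i (g m)) \<le> - ip (g m) (lap (g m))" by simp
  qed (simp add: ip_self)
qed

text \<open>Up to terms with at most two derivatives of w, the Laplacian of Yw is Y\<Delta>w, so
  elliptic regularity applied to Yw bounds its second derivatives. The outcome is the hypothesis on
  derivatives of Yv in the commutator lemmas, for v a partial derivative of w.\<close>

lemma bdd_pd_along_pd:
  assumes Y: "smooth_on U Y" and w: "nul K w" and l: "bdd K (\<lambda>m. lap (w m))"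
    and Yl: "bdd K (\<lambda>m. deriv_along Y (lap (w m)))"
  shows "bdd K (\<lambda>m. pd k (deriv_along Y (pd i (w m))))"
proof -
  note wc = nul_Cc[OF w]
  note a = smooth_on_nth[OF U Y]
  have b2: "bdd K (\<lambda>m. pd i (pd j (w m)))" for i j by (rule bdd_second_derivatives[OF wc l])
  have b1: "bdd K (\<lambda>m. pd i (w m))" for i by (rule nul_imp_bdd[OF nul_first_derivatives[OF w l]])
  define g where "g m = deriv_along Y (w m)" for m
  have gc: "g m \<in> Cc K" for m unfolding g_def by (rule along_Cc[OF Y wc])
  have ge: "g m = (\<lambda>x. \<Sum>l\<in>UNIV. Y x $ l * pd l (w m) x)" for m
    unfolding g_def by (intro ext deriv_along_expand Cc_differentiable[OF wc])
  have sumd: "pd k (\<lambda>x. \<Sum>l\<in>UNIV. f l x) = (\<lambda>x. \<Sum>l\<in>UNIV. pd k (f l) x)" if "\<And>l. f l \<in> Cc K"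
    for k and f :: "'d \<Rightarrow> real^'d \<Rightarrow> real"
    by (rule ext, rule deriv_along_sum) (rule Cc_differentiable[OF that])
  have addd: "pd k (\<lambda>x. f x + h x) = (\<lambda>x. pd k f x + pd k h x)" if "f \<in> Cc K" "h \<in> Cc K" for k f h
    by (intro ext deriv_along_add Cc_differentiable[OF that(1)] Cc_differentiable[OF that(2)])
  have am: "(\<lambda>x. Y x $ l * f x) \<in> Cc K" "(\<lambda>x. pd k (\<lambda>x. Y x $ l) x * f x) \<in> Cc K" if "f \<in> Cc K" for f l k
    by (intro mult_Cc a smooth_on_pd that)+
  have pg: "pd k (g m) = (\<lambda>x. (\<Sum>l\<in>UNIV. Y x $ l * pd k (pd l (w m)) x) + (\<Sum>l\<in>UNIV. pd k (\<lambda>x. Y x $ l) x * pd l (w m) x))" for k m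
    unfolding ge by (subst sumd) (auto simp: am pd_K wc along_mult[OF a pd_K[OF wc]] sum.distrib)
  have ppg: "pd k (pd k (g m)) = (\<lambda>x. (\<Sum>l\<in>UNIV. Y x $ l * pd k (pd k (pd l (w m))) x) +
      2 * (\<Sum>l\<in>UNIV. pd k (\<lambda>x. Y x $ l) x * pd k (pd l (w m)) x) + (\<Sum>l\<in>UNIV. pd k (pd k (\<lambda>x. Y x $ l)) x * pd l (w m) x))" for k m
    unfolding pg[of k]
    by (subst addd, intro Cc_sum am pd_K wc, intro Cc_sum am pd_K wc)
      (subst sumd, intro am pd_K wc, subst sumd, intro am pd_K wc,
        simp add: along_mult[OF a pd_K[OF pd_K[OF wc]]] along_mult[OF smooth_on_pd[OF a] pd_K[OF wc]] sum.distrib fun_eq_iff)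
  have "bdd K (\<lambda>m. lap (g m))"
  proof -
    \<comment> \<open>Third derivatives of w enter only through Y\<Delta>w, which is bounded by
      assumption.\<close>
    have swap: "(\<Sum>k\<in>UNIV. \<Sum>l\<in>UNIV. Y x $ l * pd k (pd k (pd l (w m))) x) = deriv_along Y (lap (w m)) x" for m x
    proof -
      note s = CcD(1)[OF wc[of m]] CcD(1)[OF pd_K[OF wc[of m]]]
      have "pd k (pd k (pd l (w m))) = pd l (pd k (pd k (w m)))" for k l
        by (simp add: pd_commute[OF s(1), of k l] pd_commute[OF s(2), of k l])
      moreover have "pd l (lap (w m)) x = (\<Sum>k\<in>UNIV. pd l (pd k (pd k (w m))) x)" for l
        unfolding lap_def[abs_def] by (subst sumd) (auto intro: pd_K wc)
      ultimately have "deriv_along Y (lap (w m)) x = (\<Sum>l\<in>UNIV. \<Sum>k\<in>UNIV. Y x $ l * pd k (pd k (pd l (w m))) x)"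
        using deriv_along_expand[OF Cc_differentiable[OF lap_K[OF wc[of m]]], of Y x]
        by (simp only: sum_distrib_left)
      thus ?thesis by (subst sum.swap) simp
    qed
    have "bdd K (\<lambda>m x. deriv_along Y (lap (w m)) x + (\<Sum>k\<in>UNIV. 2 * (\<Sum>l\<in>UNIV. pd k (\<lambda>x. Y x $ l) x * pd k (pd l (w m)) x))
        + (\<Sum>k\<in>UNIV. \<Sum>l\<in>UNIV. pd k (pd k (\<lambda>x. Y x $ l)) x * pd l (w m) x))"
      by (intro bdd_add[OF K(1)] bdd_sum[OF K(1)] bdd_mult smooth_on_const smooth_on_pd a b1 b2 Yl)
    thus ?thesis by (simp add: lap_def[of "g _", abs_def] ppg sum.distrib swap)
  qed
  hence bg: "bdd K (\<lambda>m. pd k (pd i (g m)))" by (rule bdd_second_derivatives[OF gc])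
  \<comment> \<open>Exchanging Y with a partial derivative costs derivatives of the coefficients
    times first derivatives of w.\<close>
  have Yi: "deriv_along Y (pd i (w m)) = (\<lambda>x. pd i (g m) x - (\<Sum>l\<in>UNIV. pd i (\<lambda>x. Y x $ l) x * pd l (w m) x))" for m
  proof -
    note s = CcD(1)[OF wc[of m]]
    have "deriv_along Y (pd i (w m)) = (\<lambda>x. \<Sum>l\<in>UNIV. Y x $ l * pd l (pd i (w m)) x)"
      by (intro ext deriv_along_expand Cc_differentiable[OF pd_K[OF wc]])
    thus ?thesis by (simp add: pg pd_commute[OF s, of _ i])
  qed
  have "bdd K (\<lambda>m x. pd k (pd i (g m)) x - (\<Sum>l\<in>UNIV. pd k (\<lambda>x. pd i (\<lambda>x. Y x $ l) x * pd l (w m) x) x))"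
    by (intro bdd_diff bg bdd_sum[OF K(1)] bdd_pd_mult smooth_on_pd a b1 b2)
  moreover have "pd k (deriv_along Y (pd i (w m))) = (\<lambda>x. pd k (pd i (g m)) x - (\<Sum>l\<in>UNIV. pd k (\<lambda>x. pd i (\<lambda>x. Y x $ l) x * pd l (w m) x) x))" for m
  proof -
    have "pd k (deriv_along Y (pd i (w m))) = (\<lambda>x. pd k (pd i (g m)) x - pd k (\<lambda>x. \<Sum>l\<in>UNIV. pd i (\<lambda>x. Y x $ l) x * pd l (w m) x) x)"
      unfolding Yi by (rule ext, rule deriv_along_diff) (intro Cc_differentiable[of _ K] pd_K gc Cc_sum am wc)+
    thus ?thesis by (simp add: sumd am pd_K wc)
  qed
  ultimately show ?thesis by simp
qed

end

section \<open>The compactness estimate\<close>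

text \<open>A finite sum of bumps over boxes covering \<open>C\<close>. No plateau of height 1 is
  asked for; where a lower bound matters, compactness of \<open>C\<close> supplies one.\<close>

lemma exists_cutoff:
  fixes C U :: "(real ^ 'd) set"
  assumes "compact C" "open U" "C \<subseteq> U"
  obtains K \<kappa> where "compact K" "K \<subseteq> U" "\<kappa> \<in> Cc K" "\<And>x. 0 \<le> \<kappa> x" "\<And>x. x \<in> C \<Longrightarrow> 0 < \<kappa> x"
proof -
  have "\<exists>a b. x \<in> box a b \<and> cbox a b \<subseteq> U" if "x \<in> C" for x
    using open_contains_cbox[OF assms(2)] that assms(3) by (metis subsetD)
  then obtain a b where ab: "\<And>x. x \<in> C \<Longrightarrow> x \<in> box (a x) (b x) \<and> cbox (a x) (b x) \<subseteq> U" by metis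
  have "C \<subseteq> (\<Union>x\<in>C. box (a x) (b x))" using ab by blast
  then obtain F where F: "F \<subseteq> C" "finite F" "C \<subseteq> (\<Union>x\<in>F. box (a x) (b x))"
    using compactE_image[OF assms(1), of C "\<lambda>x. box (a x) (b x)"] open_box by metis
  define K where "K = (\<Union>x\<in>F. cbox (a x) (b x))"
  define \<kappa> where "\<kappa> y = (\<Sum>x\<in>F. bump (a x) (b x) y)" for y
  have "compact K" unfolding K_def using F(2) by (intro compact_UN) auto
  moreover have "K \<subseteq> U" unfolding K_def using F(1) ab by blast
  moreover have "\<kappa> \<in> Cc K"
  proof -
    have "smooth_on UNIV \<kappa>" unfolding \<kappa>_def by (intro smooth_on_sum smooth_bump) simp
    moreover have "\<kappa> y = 0" if "y \<notin> K" for y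
    proof -
      have "bump (a x) (b x) y = 0" if "x \<in> F" for x
      proof -
        have "y \<notin> box (a x) (b x)" using \<open>y \<notin> K\<close> that box_subset_cbox[of "a x" "b x"] unfolding K_def by blast
        thus ?thesis using bump_pos_iff[of "a x" "b x" y] bump_nonneg[of "a x" "b x" y] by linarith
      qed
      thus ?thesis unfolding \<kappa>_def by simp
    qed
    ultimately show ?thesis by (simp add: Cc_def)
  qed
  moreover have "0 \<le> \<kappa> y" for y unfolding \<kappa>_def by (intro sum_nonneg bump_nonneg)
  moreover have "0 < \<kappa> y" if yC: "y \<in> C" for y
  proof -
    obtain x where x: "x \<in> F" "y \<in> box (a x) (b x)" using F(3) yC by blast
    hence "0 < bump (a x) (b x) y" by (simp add: bump_pos_iff)
    also have "\<dots> \<le> \<kappa> y" unfolding \<kappa>_def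
      by (rule member_le_sum[where f="\<lambda>x. bump (a x) (b x) y"]) (auto intro: bump_nonneg x F)
    finally show ?thesis .
  qed
  ultimately show ?thesis using that by blast
qed

lemma lie_algebra_smooth:
  assumes "open U" "\<And>j. j \<in> {1..n} \<Longrightarrow> smooth_on U (Y j)" "X \<in> lie_algebra n Y"
  shows "smooth_on U X"
  using assms(3)
proof induction
  case (scale X r)
  thus ?case using smooth_on_bounded_linear[OF assms(1) bounded_linear_scaleR_right] by blast
qed (use assms(1,2) in \<open>auto intro: smooth_on_const smooth_on_add smooth_on_lie_bracket\<close>)

text \<open>The values at x of the fields in the Lie algebra form a subspace, so full dimension
  means that every axis vector is such a value.\<close>

lemma hormander_frame_at:
  assumes "hormander U n Y" "x \<in> U"
  obtains X where "\<And>i. X i \<in> lie_algebra n Y" "\<And>i. X i x = axis i 1"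
proof -
  let ?S = "{X x |X. X \<in> lie_algebra n Y}"
  have sub: "subspace ?S"
  proof (rule subspaceI)
    show "0 \<in> ?S" using lie_algebra.zero[of n Y] by (auto intro!: exI[of _ "\<lambda>x. 0"])
    show "a + b \<in> ?S" if ab: "a \<in> ?S" "b \<in> ?S" for a b
    proof -
      obtain A B where AB: "a = A x" "b = B x" "A \<in> lie_algebra n Y" "B \<in> lie_algebra n Y" using ab by auto
      show ?thesis using lie_algebra.add[OF AB(3,4)] AB(1,2) by (auto intro!: exI[of _ "\<lambda>x. A x + B x"])
    qed
    show "c *\<^sub>R a \<in> ?S" if a: "a \<in> ?S" for c a
    proof -
      obtain A where A: "a = A x" "A \<in> lie_algebra n Y" using a by auto
      show ?thesis using lie_algebra.scale[OF A(2), of c] A(1) by (auto intro!: exI[of _ "\<lambda>x. c *\<^sub>R A x"])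
    qed
  qed
  have "dim ?S = DIM(real^'a)" using assms by (simp add: hormander_def)
  hence "span ?S = UNIV" using dim_eq_full by blast
  hence "?S = UNIV" by (simp only: span_eq_iff[THEN iffD2, OF sub])
  hence "\<exists>X. axis i 1 = X x \<and> X \<in> lie_algebra n Y" for i
    using UNIV_I[of "axis i (1::real)"] by blast
  then obtain X where "\<And>i. axis i 1 = X i x \<and> X i \<in> lie_algebra n Y" by metis
  thus ?thesis using that[of X] by simp
qed

text \<open>Near each point a frame of Lie algebra fields differs from the axis vectors by at most
  1/2 in total, so the error is absorbed into the left side, whence the factor 2. Finitely many such
  neighbourhoods cover \<open>C\<close>, and their frames are united.\<close>

lemma hormander_coercive:
  fixes C U :: "(real ^ 'd) set"
  assumes H: "hormander U n Y" and C: "compact C" "C \<subseteq> U" and U: "open U"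
    and Y: "\<And>j. j \<in> {1..n} \<Longrightarrow> smooth_on U (Y j)"
  obtains F where "finite F" "F \<subseteq> lie_algebra n Y"
    "\<And>y \<xi>. y \<in> C \<Longrightarrow> norm \<xi> \<le> 2 * (\<Sum>X\<in>F. \<bar>X y \<bullet> \<xi>\<bar>)"
proof -
  have loc: "\<exists>F r. finite F \<and> F \<subseteq> lie_algebra n Y \<and> 0 < r \<and>
      (\<forall>y\<in>ball x r. \<forall>\<xi>. norm \<xi> \<le> 2 * (\<Sum>X\<in>F. \<bar>X y \<bullet> \<xi>\<bar>))" if "x \<in> C" for x
  proof -
    have xU: "x \<in> U" using that C by auto
    obtain X where X: "\<And>i. X i \<in> lie_algebra n Y" "\<And>i. X i x = axis i 1" using hormander_frame_at[OF H xU] by blast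
    \<comment> \<open>The frame is passed on as a set of fields; sums over the set and over the
      indices agree because distinct indices give distinct fields.\<close>
    have inj: "inj X"
    proof (rule injI)
      fix i j assume "X i = X j"
      hence "axis i (1::real) = axis j 1" using X(2) by metis
      thus "i = j" by (simp add: axis_eq_axis)
    qed
    have cont: "continuous_on U (\<lambda>y. \<Sum>i\<in>UNIV. norm (X i y - X i x))"
      by (intro continuous_intros smooth_on_continuous lie_algebra_smooth[OF U Y X(1)])
    hence "isCont (\<lambda>y. \<Sum>i\<in>UNIV. norm (X i y - X i x)) x" using U xU by (simp add: continuous_on_eq_continuous_at)
    then obtain r where r: "0 < r" "\<And>y. dist y x < r \<Longrightarrow> dist (\<Sum>i\<in>UNIV. norm (X i y - X i x)) (\<Sum>i\<in>UNIV. norm (X i x - X i x)) < 1/2"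
      unfolding continuous_at_eps_delta using half_gt_zero[OF zero_less_one] by blast
    have "norm \<xi> \<le> 2 * (\<Sum>X\<in>range X. \<bar>X y \<bullet> \<xi>\<bar>)" if y: "y \<in> ball x r" for y \<xi>
    proof -
      have small: "(\<Sum>i\<in>UNIV. norm (X i y - X i x)) \<le> 1/2" using r(2)[of y] y by (simp add: dist_commute)
      have "norm \<xi> \<le> (\<Sum>i\<in>UNIV. \<bar>\<xi> $ i\<bar>)" by (rule norm_le_l1_cart)
      also have "\<dots> = (\<Sum>i\<in>UNIV. \<bar>X i x \<bullet> \<xi>\<bar>)" by (simp add: X(2) inner_axis')
      also have "\<dots> \<le> (\<Sum>i\<in>UNIV. \<bar>X i y \<bullet> \<xi>\<bar> + norm (X i y - X i x) * norm \<xi>)"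
      proof (rule sum_mono)
        fix i
        have "X i x \<bullet> \<xi> = X i y \<bullet> \<xi> - (X i y - X i x) \<bullet> \<xi>" by (simp add: inner_diff_left)
        thus "\<bar>X i x \<bullet> \<xi>\<bar> \<le> \<bar>X i y \<bullet> \<xi>\<bar> + norm (X i y - X i x) * norm \<xi>"
          using Cauchy_Schwarz_ineq2[of "X i y - X i x" \<xi>] by linarith
      qed
      also have "\<dots> = (\<Sum>i\<in>UNIV. \<bar>X i y \<bullet> \<xi>\<bar>) + (\<Sum>i\<in>UNIV. norm (X i y - X i x)) * norm \<xi>"
        by (simp add: sum.distrib sum_distrib_right)
      also have "\<dots> \<le> (\<Sum>i\<in>UNIV. \<bar>X i y \<bullet> \<xi>\<bar>) + 1/2 * norm \<xi>" by (intro add_left_mono mult_right_mono small) simp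
      finally have "norm \<xi> \<le> 2 * (\<Sum>i\<in>UNIV. \<bar>X i y \<bullet> \<xi>\<bar>)" by simp
      thus ?thesis using sum.reindex[OF inj, of "\<lambda>X. \<bar>X y \<bullet> \<xi>\<bar>"] by simp
    qed
    thus ?thesis using X(1) r(1) by (intro exI[of _ "range X"] exI[of _ r]) auto
  qed
  then obtain F r where Fr: "\<And>x. x \<in> C \<Longrightarrow> finite (F x) \<and> F x \<subseteq> lie_algebra n Y \<and> 0 < r x \<and>
      (\<forall>y\<in>ball x (r x). \<forall>\<xi>. norm \<xi> \<le> 2 * (\<Sum>X\<in>F x. \<bar>X y \<bullet> \<xi>\<bar>))" by metis
  have "C \<subseteq> (\<Union>x\<in>C. ball x (r x))" using Fr by fastforce
  then obtain T where T: "T \<subseteq> C" "finite T" "C \<subseteq> (\<Union>x\<in>T. ball x (r x))"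
    using compactE_image[OF C(1), of C "\<lambda>x. ball x (r x)"] open_ball by metis
  define G where "G = (\<Union>x\<in>T. F x)"
  have G: "finite G" "G \<subseteq> lie_algebra n Y" using T Fr unfolding G_def by blast+
  have "norm \<xi> \<le> 2 * (\<Sum>X\<in>G. \<bar>X y \<bullet> \<xi>\<bar>)" if y: "y \<in> C" for y \<xi>
  proof -
    obtain x where x: "x \<in> T" "y \<in> ball x (r x)" using T(3) y by blast
    have "norm \<xi> \<le> 2 * (\<Sum>X\<in>F x. \<bar>X y \<bullet> \<xi>\<bar>)" using Fr x T(1) by blast
    also have "(\<Sum>X\<in>F x. \<bar>X y \<bullet> \<xi>\<bar>) \<le> (\<Sum>X\<in>G. \<bar>X y \<bullet> \<xi>\<bar>)"
      by (rule sum_mono2) (use G x G_def in auto)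
    finally show ?thesis by simp
  qed
  thus ?thesis using that G by blast
qed

text \<open>Coercivity, applied at each point of \<open>C\<close> to the gradient of
  \<open>v m\<close>, dominates it by finitely many derivatives along Lie algebra fields. It is
  uniform only on a compact set, hence the indicator of \<open>C\<close>.\<close>

lemma nul_on_compact_of_lie_algebra:
  fixes C K U :: "(real ^ 'd) set"
  assumes cio: "compact_in_open K U" and H: "hormander U n Y" and C: "compact C" "C \<subseteq> U"
    and Y: "\<And>j. j \<in> {1..n} \<Longrightarrow> smooth_on U (Y j)"
    and v: "\<And>m. v m \<in> Cc K"
    and null: "\<And>X. X \<in> lie_algebra n Y \<Longrightarrow> nul K (\<lambda>m. deriv_along X (v m))"
  shows "(\<lambda>m. nrm2 lborel (\<lambda>x. indicator C x * pd i (v m) x)) \<longlonglongrightarrow> 0"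
proof -
  interpret compact_in_open K U by (rule cio)
  obtain F where F: "finite F" "F \<subseteq> lie_algebra n Y" "\<And>y \<xi>. y \<in> C \<Longrightarrow> norm \<xi> \<le> 2 * (\<Sum>X\<in>F. \<bar>X y \<bullet> \<xi>\<bar>)"
    using hormander_coercive[OF H C U Y] by blast
  have sq: "deriv_along X (v m) \<in> sqi lborel" if "X \<in> F" for X m
    using nul_Cc[OF null] F(2) that Cc_sqi[OF K(1)] by blast
  have sqa: "(\<lambda>x. \<bar>deriv_along X (v m) x\<bar>) \<in> sqi lborel" if "X \<in> F" for X m
    using sq[OF that, of m] by (auto simp: sqi_def)
  have na: "nrm2 lborel (\<lambda>x. \<bar>g x\<bar>) = nrm2 lborel g" for g :: "real^'d \<Rightarrow> real" by (simp add: nrm2_def)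
  have pt: "\<bar>indicator C x * pd i (v m) x\<bar> \<le> \<bar>2 * (\<Sum>X\<in>F. \<bar>deriv_along X (v m) x\<bar>)\<bar>" for x m
  proof (cases "x \<in> C")
    case True
    define \<xi> where "\<xi> = (\<chi> k. pd k (v m) x)"
    have "\<bar>pd i (v m) x\<bar> = \<bar>\<xi> $ i\<bar>" by (simp add: \<xi>_def)
    also have "\<dots> \<le> norm \<xi>" by (rule component_le_norm_cart)
    also have "\<dots> \<le> 2 * (\<Sum>X\<in>F. \<bar>X x \<bullet> \<xi>\<bar>)" by (rule F(3)[OF True])
    also have "(\<Sum>X\<in>F. \<bar>X x \<bullet> \<xi>\<bar>) = (\<Sum>X\<in>F. \<bar>deriv_along X (v m) x\<bar>)"
    proof (intro sum.cong refl)
      fix X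
      show "\<bar>X x \<bullet> \<xi>\<bar> = \<bar>deriv_along X (v m) x\<bar>"
        by (subst deriv_along_expand[OF Cc_differentiable[OF v[of m]], of X]) (simp add: inner_vec_def \<xi>_def)
    qed
    finally show ?thesis using True by simp
  qed simp
  have le: "nrm2 lborel (\<lambda>x. indicator C x * pd i (v m) x) \<le> 2 * (\<Sum>X\<in>F. nrm2 lborel (deriv_along X (v m)))" for m
  proof -
    have "nrm2 lborel (\<lambda>x. indicator C x * pd i (v m) x) \<le> nrm2 lborel (\<lambda>x. 2 * (\<Sum>X\<in>F. \<bar>deriv_along X (v m) x\<bar>))"
    proof (rule nrm2_mono)
      show "(\<lambda>x. 2 * (\<Sum>X\<in>F. \<bar>deriv_along X (v m) x\<bar>)) \<in> sqi lborel" by (intro sqi_cmult sqi_sum sqa)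
      have "pd i (v m) \<in> borel_measurable borel" by (rule Cc_measurable[OF pd_K[OF v]])
      moreover have "C \<in> sets borel" using C(1) by (simp add: borel_closed compact_imp_closed)
      ultimately show "(\<lambda>x. indicator C x * pd i (v m) x) \<in> borel_measurable lborel" by simp
    qed (use pt in simp)
    also have "\<dots> = 2 * nrm2 lborel (\<lambda>x. \<Sum>X\<in>F. \<bar>deriv_along X (v m) x\<bar>)" by (simp add: nrm2_cmult)
    also have "\<dots> \<le> 2 * (\<Sum>X\<in>F. nrm2 lborel (\<lambda>x. \<bar>deriv_along X (v m) x\<bar>))"
      by (intro mult_left_mono nrm2_sum sqa) simp_all
    finally show ?thesis by (simp add: na)
  qed
  have "(\<lambda>m. 2 * (\<Sum>X\<in>F. nrm2 lborel (deriv_along X (v m)))) \<longlonglongrightarrow> 2 * (\<Sum>X\<in>F. 0)"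
    using null F(2) by (intro tendsto_intros) (auto simp: nul_def)
  hence lim: "(\<lambda>m. 2 * (\<Sum>X\<in>F. nrm2 lborel (deriv_along X (v m)))) \<longlonglongrightarrow> 0" by simp
  show ?thesis by (rule tendsto_sandwich[OF _ _ tendsto_const lim]) (use le in \<open>auto simp: nrm2_ge0\<close>)
qed

text \<open>The hypotheses on the mollifications \<open>S\<close> and their derivatives
  \<open>DS\<close> play the part of weak convergence to 0: they make the error of the parametrix a
  null sequence with bounded derivatives. All second derivatives of the cut-off potential are shown
  to tend to 0 on the closure of \<open>D\<close>; their trace returns u up to a positive
  factor.\<close>

lemma null_sequence_of_smoothings:
  fixes D U :: "(real ^ 'd) set"
  assumes D: "bounded D" and U: "open U" "closure D \<subseteq> U" and H: "hormander U n Y"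
    and Y: "\<And>j. j \<in> {1..n} \<Longrightarrow> smooth_on U (Y j)"
    and u: "bdd (closure D) u"
    and Yu: "\<And>j. j \<in> {1..n} \<Longrightarrow> bdd (closure D) (\<lambda>m. deriv_along (Y j) (u m))"
    and \<delta>: "\<And>m. 0 \<le> \<delta> m" "\<And>m. \<delta> m \<le> 1" "\<delta> \<longlonglongrightarrow> 0"
    and S: "(\<lambda>m. nrm2 lborel (smoothing bell' (\<delta> m) (u m))) \<longlonglongrightarrow> 0"
    and DS: "\<And>i. (\<lambda>m. nrm2 lborel (pd i (smoothing bell' (\<delta> m) (u m)))) \<longlonglongrightarrow> 0"
  shows "(\<lambda>m. nrm2 lborel (u m)) \<longlonglongrightarrow> 0"
proof -
  define C where "C = closure D"
  have C: "compact C" using D by (simp add: C_def)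
  obtain R where R: "C \<subseteq> cball 0 R" "0 \<le> R"
  proof -
    obtain b where "\<And>x. x \<in> C \<Longrightarrow> norm x \<le> b" using compact_imp_bounded[OF C] unfolding bounded_iff by blast
    thus ?thesis using that[of "max b 0"] by fastforce
  qed
  \<comment> \<open>Averaging at scales up to 1 may spread supports beyond \<open>U\<close>.
    Elliptic regularity involves no vector fields and is therefore used on this larger ball, with
    the whole space as surrounding open set.\<close>
  define L where "L = cball (0::real^'d) (R + 1)"
  have L: "compact L" by (simp add: L_def)
  interpret L: compact_in_open L UNIV by unfold_locales (use L in auto)
  obtain K \<kappa> where K: "compact K" "K \<subseteq> U" and \<kappa>: "\<kappa> \<in> Cc K" "\<And>x. 0 \<le> \<kappa> x" "\<And>x. x \<in> C \<Longrightarrow> 0 < \<kappa> x"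
    using exists_cutoff[OF C U(1)] U(2) unfolding C_def by metis
  interpret K: compact_in_open K U by unfold_locales (use K U in auto)
  have CK: "C \<subseteq> K" using \<kappa>(3) CcD(2)[OF \<kappa>(1)] by fastforce
  have uC: "u m \<in> Cc C" for m using bdd_Cc[OF u] by (simp add: C_def)
  have uK: "bdd K u" using u CK unfolding bdd_def C_def by (auto intro: Cc_mono)
  have YuK: "bdd K (\<lambda>m. deriv_along (Y j) (u m))" if "j \<in> {1..n}" for j
    using Yu[OF that] CK unfolding bdd_def C_def by (auto intro: Cc_mono)
  define w where "w m = potential (\<delta> m) (u m)" for m
  define S' where "S' m = smoothing bell' (\<delta> m) (u m)" for m
  define c where "c = bell_mass TYPE('d)"
  have c: "c > 0" using bell_mass_pos by (simp add: c_def)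
  have mono: "Cc (cball 0 (R + \<delta> m)) \<subseteq> Cc L" for m
    using \<delta>(2)[of m] subset_cball[of "R + \<delta> m" "R + 1" "0::real^'d"] unfolding L_def by (auto intro: Cc_mono)
  have wL: "w m \<in> Cc L" for m
  proof -
    interpret averaging "Ms (\<delta> m) \<Otimes>\<^sub>M (Mb :: (real ^ 'd) measure)" "\<lambda>p. fst p * bell (snd p)" "\<lambda>p. fst p *\<^sub>R snd p" "\<delta> m" "\<delta> m"
      by (rule averaging_potential[OF \<delta>(1)])
    show ?thesis using avg_Cc[OF R(1) C uC[of m]] mono by (auto simp: w_def potential_def)
  qed
  have SL: "S' m \<in> Cc L" for m
  proof -
    obtain B where "averaging Mb bell' (\<lambda>z::real^'d. \<delta> m *\<^sub>R z) B \<bar>\<delta> m\<bar>" using averaging_smoothing[OF bell'_Cc] by blast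
    then interpret averaging Mb bell' "\<lambda>z::real^'d. \<delta> m *\<^sub>R z" B "\<bar>\<delta> m\<bar>" .
    show ?thesis using avg_Cc[OF R(1) C uC[of m]] mono[of m] \<delta>(1)[of m] by (auto simp: S'_def smoothing_def)
  qed
  have nS: "nul L S'" using S SL by (simp add: nul_def S'_def)
  have nDS: "nul L (\<lambda>m. pd i (S' m))" for i using DS[of i] L.pd_K[OF SL] by (simp add: nul_def S'_def)
  have CL: "C \<subseteq> L" using R by (auto simp: L_def)
  have uL: "bdd L u" using u CL unfolding bdd_def C_def by (auto intro: Cc_mono)
  have lapw: "lap (w m) = (\<lambda>x. S' m x - c * u m x)" for m
    unfolding w_def S'_def c_def by (rule ext) (rule lap_potential[OF C uC \<delta>(1)])
  have bl: "bdd L (\<lambda>m. lap (w m))" unfolding lapw by (intro L.bdd_diff L.bdd_cmult uL nul_imp_bdd[OF nS])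
  obtain B where B: "\<And>m. nrm2 lborel (u m) \<le> B" using u by (auto simp: bdd_def)
  define V where "V = measure lborel (cball (0::real^'d) 1)"
  have nw: "nul L w"
  proof (rule nulI[OF wL])
    show "nrm2 lborel (w m) \<le> (\<delta> m)\<^sup>2 * V * B" for m
      unfolding w_def V_def by (rule order_trans[OF potential_nrm2_le[OF \<delta>(1) C uC] mult_left_mono[OF B]]) simp
    have "(\<lambda>m. (\<delta> m)\<^sup>2 * V * B) \<longlonglongrightarrow> 0\<^sup>2 * V * B" by (intro tendsto_intros \<delta>(3))
    thus "(\<lambda>m. (\<delta> m)\<^sup>2 * V * B) \<longlonglongrightarrow> 0" by simp
  qed
  have nDw: "nul L (\<lambda>m. pd i (w m))" for i by (rule L.nul_first_derivatives[OF nw bl])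
  have bDDw: "bdd L (\<lambda>m. pd i (pd j (w m)))" for i j by (rule L.bdd_second_derivatives[OF wL bl])
  \<comment> \<open>The cutoff returns to \<open>K\<close>, where the fields are smooth; \<kappa> is
    positive on the closure of \<open>D\<close>, so u is not lost.\<close>
  define \<omega> where "\<omega> m x = \<kappa> x * w m x" for m x
  have n\<omega>: "nul K \<omega>" unfolding \<omega>_def[abs_def] by (rule nul_mult_Cc[OF K(1) L \<kappa>(1) nw])
  note \<omega>c = nul_Cc[OF n\<omega>]
  have sc: "smooth_on UNIV \<kappa>" using \<kappa>(1) by (rule CcD)
  have \<kappa>d: "pd i \<kappa> \<in> Cc K" "pd i (pd j \<kappa>) \<in> Cc K" for i j by (intro K.pd_K \<kappa>)+
  \<comment> \<open>The part of \<Delta>(\<kappa>w) other than the multiple of \<kappa>u: the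
    mollification and the commutator of the Laplacian with the cutoff, which contains at most first
    derivatives of w.\<close>
  define e where "e m x = \<kappa> x * S' m x + (2 * (\<Sum>i\<in>UNIV. pd i \<kappa> x * pd i (w m) x) + lap \<kappa> x * w m x)" for m x
  have lap\<omega>: "lap (\<omega> m) = (\<lambda>x. e m x - c * (\<kappa> x * u m x))" for m
  proof
    fix x
    have d: "f differentiable (at x)" if "f \<in> Cc L \<or> smooth_on UNIV f" for f
      using that by (auto intro: Cc_differentiable smooth_on_differentiable)
    have 1: "pd i (\<omega> m) = (\<lambda>x. \<kappa> x * pd i (w m) x + pd i \<kappa> x * w m x)" for i
      unfolding \<omega>_def[abs_def] by (rule L.along_mult[OF sc wL])
    have "pd i (pd i (\<omega> m)) x = \<kappa> x * pd i (pd i (w m)) x + 2 * (pd i \<kappa> x * pd i (w m) x) + pd i (pd i \<kappa>) x * w m x" for i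
    proof -
      have "pd i (pd i (\<omega> m)) x = pd i (\<lambda>x. \<kappa> x * pd i (w m) x) x + pd i (\<lambda>x. pd i \<kappa> x * w m x) x"
        unfolding 1 by (intro deriv_along_add d disjI1 L.mult_Cc smooth_on_pd sc L.pd_K wL)
      thus ?thesis
        using fun_cong[OF L.along_mult[OF sc L.pd_K[OF wL], of "\<lambda>x. axis i 1" i m], of x]
          fun_cong[OF L.along_mult[OF smooth_on_pd[OF sc] wL, of "\<lambda>x. axis i 1" i m], of x] by simp
    qed
    hence "lap (\<omega> m) x = \<kappa> x * lap (w m) x + 2 * (\<Sum>i\<in>UNIV. pd i \<kappa> x * pd i (w m) x) + lap \<kappa> x * w m x"
      by (simp add: lap_def sum.distrib sum_distrib_left sum_distrib_right)
    thus "lap (\<omega> m) x = e m x - c * (\<kappa> x * u m x)" by (simp add: lapw e_def algebra_simps)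
  qed
  have lc: "lap \<kappa> \<in> Cc K" by (rule K.lap_K[OF \<kappa>(1)])
  have ne: "nul K e"
    unfolding e_def[abs_def]
    by (intro nul_add[OF K(1)] K.nul_cmult nul_sum[OF K(1)] nul_mult_Cc[OF K(1) L] \<kappa> \<kappa>d lc nS nDw nw)
  have b\<kappa>u: "bdd K (\<lambda>m x. \<kappa> x * u m x)" by (rule K.bdd_mult[OF smooth_on_subset[OF sc] uK]) simp
  have bl\<omega>: "bdd K (\<lambda>m. lap (\<omega> m))"
    unfolding lap\<omega> by (intro K.bdd_diff nul_imp_bdd[OF ne] K.bdd_cmult b\<kappa>u)
  \<comment> \<open>Here the derivatives of the mollifications are needed, together with the second
    derivatives of w.\<close>
  have bDe: "bdd K (\<lambda>m. pd k (e m))" for k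
  proof -
    have p: "bdd K (\<lambda>m. pd k (\<lambda>x. p x * F m x))" if p: "p \<in> Cc K" and F: "bdd L F" "bdd L (\<lambda>m. pd k (F m))" for p F
    proof -
      have "pd k (\<lambda>x. p x * F m x) = (\<lambda>x. p x * pd k (F m) x + pd k p x * F m x)" for m
        by (rule L.along_mult[OF CcD(1)[OF p] bdd_Cc[OF F(1)]])
      thus ?thesis using bdd_add[OF K(1) bdd_mult_Cc[OF K(1) L p F(2)] bdd_mult_Cc[OF K(1) L K.pd_K[OF p] F(1)]] by simp
    qed
    have cK: "(\<lambda>x. p x * F x) \<in> Cc K" if "p \<in> Cc K" "F \<in> Cc L" for p F
      using Cc_mult[OF CcD(1)[OF that(2)] that(1)] by (simp add: mult.commute)
    have "pd k (e m) = (\<lambda>x. pd k (\<lambda>x. \<kappa> x * S' m x) x + (2 * (\<Sum>i\<in>UNIV. pd k (\<lambda>x. pd i \<kappa> x * pd i (w m) x) x) + pd k (\<lambda>x. lap \<kappa> x * w m x) x))" for m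
    proof
      fix x
      note q = Cc_differentiable[OF cK[OF \<kappa>(1) SL]] Cc_differentiable[OF cK[OF \<kappa>d(1) L.pd_K[OF wL]]] Cc_differentiable[OF cK[OF lc wL]]
      have sd: "(\<lambda>x. \<Sum>i\<in>UNIV. pd i \<kappa> x * pd i (w m) x) differentiable (at x)"
        by (intro Cc_differentiable[of _ K] Cc_sum cK \<kappa>d L.pd_K wL)
      show "pd k (e m) x = pd k (\<lambda>x. \<kappa> x * S' m x) x + (2 * (\<Sum>i\<in>UNIV. pd k (\<lambda>x. pd i \<kappa> x * pd i (w m) x) x) + pd k (\<lambda>x. lap \<kappa> x * w m x) x)"
        unfolding e_def[abs_def]
        by (subst deriv_along_add[OF q(1)], intro differentiable_add differentiable_mult sd differentiable_const q(3))
          (subst deriv_along_add, intro differentiable_mult sd differentiable_const, rule q(3), subst deriv_along_cmult[OF sd], subst deriv_along_sum[OF q(2)], simp_all)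
    qed
    moreover have "bdd K (\<lambda>m x. pd k (\<lambda>x. \<kappa> x * S' m x) x + (2 * (\<Sum>i\<in>UNIV. pd k (\<lambda>x. pd i \<kappa> x * pd i (w m) x) x) + pd k (\<lambda>x. lap \<kappa> x * w m x) x))"
      by (intro bdd_add[OF K(1)] K.bdd_cmult bdd_sum[OF K(1)] p \<kappa> \<kappa>d lc nul_imp_bdd nS nDS nDw nw bDDw)
    ultimately show ?thesis by simp
  qed
  \<comment> \<open>This is where the bound on Y_j u enters: differentiating \<kappa>u along Y_j
    produces Y_j u and u only.\<close>
  have bYl: "bdd K (\<lambda>m. deriv_along (Y j) (lap (\<omega> m)))" if j: "j \<in> {1..n}" for j
  proof -
    have cu: "(\<lambda>x. \<kappa> x * u m x) \<in> Cc K" for m by (rule bdd_Cc[OF b\<kappa>u])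
    have "deriv_along (Y j) (lap (\<omega> m)) = (\<lambda>x. deriv_along (Y j) (e m) x - c * (\<kappa> x * deriv_along (Y j) (u m) x + deriv_along (Y j) \<kappa> x * u m x))" for m
    proof
      fix x
      have "deriv_along (Y j) (lap (\<omega> m)) x = deriv_along (Y j) (e m) x - deriv_along (Y j) (\<lambda>x. c * (\<kappa> x * u m x)) x"
        unfolding lap\<omega> by (intro deriv_along_diff Cc_differentiable[of _ K] Cc_cmult cu nul_Cc[OF ne])
      also have "deriv_along (Y j) (\<lambda>x. c * (\<kappa> x * u m x)) x = c * deriv_along (Y j) (\<lambda>x. \<kappa> x * u m x) x"
        by (rule deriv_along_cmult[OF Cc_differentiable[OF cu]])
      also have "deriv_along (Y j) (\<lambda>x. \<kappa> x * u m x) x = \<kappa> x * deriv_along (Y j) (u m) x + deriv_along (Y j) \<kappa> x * u m x"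
        by (rule fun_cong[OF K.along_mult[OF smooth_on_subset[OF sc] bdd_Cc[OF uK]]]) simp
      finally show "deriv_along (Y j) (lap (\<omega> m)) x = deriv_along (Y j) (e m) x - c * (\<kappa> x * deriv_along (Y j) (u m) x + deriv_along (Y j) \<kappa> x * u m x)" .
    qed
    moreover have "bdd K (\<lambda>m x. deriv_along (Y j) (e m) x - c * (\<kappa> x * deriv_along (Y j) (u m) x + deriv_along (Y j) \<kappa> x * u m x))"
      by (intro K.bdd_diff K.bdd_along[OF Y[OF j] nul_Cc[OF ne] bDe] K.bdd_cmult bdd_add[OF K(1)] K.bdd_mult uK YuK[OF j]
          smooth_on_subset[OF sc] smooth_on_subset[OF CcD(1)[OF K.along_Cc[OF Y[OF j] \<kappa>(1)]]] subset_UNIV)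
    ultimately show ?thesis by simp
  qed
  have nulDD: "(\<lambda>m. nrm2 lborel (\<lambda>x. indicator C x * pd k (pd i (\<omega> m)) x)) \<longlonglongrightarrow> 0" for k i
  proof (rule nul_on_compact_of_lie_algebra[OF K.compact_in_open_axioms H C _ Y])
    show "C \<subseteq> U" using U(2) by (simp add: C_def)
    show "pd i (\<omega> m) \<in> Cc K" for m by (rule K.pd_K[OF \<omega>c])
    show "nul K (\<lambda>m. deriv_along X (pd i (\<omega> m)))" if "X \<in> lie_algebra n Y" for X
      using K.nul_lie_algebra[OF Y K.nul_first_derivatives[OF n\<omega> bl\<omega>] K.bdd_second_derivatives[OF \<omega>c bl\<omega>]
          K.bdd_pd_along_pd[OF Y n\<omega> bl\<omega> bYl] that] by blast
  qed
  have Cb: "C \<in> sets borel" using C by (simp add: borel_closed compact_imp_closed)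
  have ind: "(\<lambda>x. indicator C x * f x) \<in> sqi lborel" "nrm2 lborel (\<lambda>x. indicator C x * f x) \<le> nrm2 lborel f" if f: "f \<in> Cc K" for f
  proof -
    note fs = Cc_sqi[OF K(1) f]
    have m: "(\<lambda>x. indicator C x * f x) \<in> borel_measurable lborel" using Cc_measurable[OF f] Cb by simp
    have "\<bar>indicator C x * f x\<bar> \<le> \<bar>f x\<bar>" for x by (auto simp: indicator_def)
    thus "(\<lambda>x. indicator C x * f x) \<in> sqi lborel" "nrm2 lborel (\<lambda>x. indicator C x * f x) \<le> nrm2 lborel f"
      using sqi_bound[OF fs m] nrm2_mono[OF fs m] by auto
  qed
  obtain \<kappa>0 where \<kappa>0: "0 < \<kappa>0" "\<And>x. x \<in> C \<Longrightarrow> \<kappa>0 \<le> \<kappa> x"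
  proof (cases "C = {}")
    case True thus ?thesis using that[of 1] by simp
  next
    case False
    obtain x0 where "x0 \<in> C" "\<And>x. x \<in> C \<Longrightarrow> \<kappa> x0 \<le> \<kappa> x"
      using continuous_attains_inf[OF C False Cc_continuous[OF \<kappa>(1)]] by blast
    thus ?thesis using that[of "\<kappa> x0"] \<kappa>(3) by blast
  qed
  \<comment> \<open>On \<open>C\<close> the product c \<kappa> u equals the error minus the trace of
    the Hessian of \<omega>, and \<kappa> is at least \<kappa>0 there.\<close>
  have le: "c * \<kappa>0 * nrm2 lborel (u m) \<le> nrm2 lborel (e m) + (\<Sum>i\<in>UNIV. nrm2 lborel (\<lambda>x. indicator C x * pd i (pd i (\<omega> m)) x))" for m
  proof -
    have "c * \<kappa>0 * nrm2 lborel (u m) = nrm2 lborel (\<lambda>x. c * \<kappa>0 * u m x)" using c \<kappa>0 by (simp add: nrm2_cmult)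
    also have "\<dots> \<le> nrm2 lborel (\<lambda>x. indicator C x * e m x - (\<Sum>i\<in>UNIV. indicator C x * pd i (pd i (\<omega> m)) x))"
    proof (rule nrm2_mono)
      show "(\<lambda>x. indicator C x * e m x - (\<Sum>i\<in>UNIV. indicator C x * pd i (pd i (\<omega> m)) x)) \<in> sqi lborel"
        by (intro sqi_diff sqi_sum ind K.pd_K \<omega>c nul_Cc[OF ne])
      show "(\<lambda>x. c * \<kappa>0 * u m x) \<in> borel_measurable lborel" using Cc_measurable[OF uC[of m]] by simp
      have "\<bar>c * \<kappa>0 * u m x\<bar> \<le> \<bar>indicator C x * e m x - (\<Sum>i\<in>UNIV. indicator C x * pd i (pd i (\<omega> m)) x)\<bar>" for x
      proof (cases "x \<in> C")
        case True
        have "(\<Sum>i\<in>UNIV. pd i (pd i (\<omega> m)) x) = e m x - c * (\<kappa> x * u m x)"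
          using fun_cong[OF lap\<omega>[of m], of x] by (simp add: lap_def)
        hence eq: "indicator C x * e m x - (\<Sum>i\<in>UNIV. indicator C x * pd i (pd i (\<omega> m)) x) = c * \<kappa> x * u m x"
          using True by simp
        have "c * \<kappa>0 * \<bar>u m x\<bar> \<le> c * \<kappa> x * \<bar>u m x\<bar>" using c \<kappa>0(2)[OF True] by (intro mult_right_mono) auto
        thus ?thesis unfolding eq using c \<kappa>0 \<kappa>(2)[of x] by (simp add: abs_mult)
      next
        case False thus ?thesis using CcD(2)[OF uC False] by simp
      qed
      thus "AE x in lborel. \<bar>c * \<kappa>0 * u m x\<bar> \<le> \<bar>indicator C x * e m x - (\<Sum>i\<in>UNIV. indicator C x * pd i (pd i (\<omega> m)) x)\<bar>" by simp
    qed
    also have "\<dots> \<le> nrm2 lborel (\<lambda>x. indicator C x * e m x) + nrm2 lborel (\<lambda>x. \<Sum>i\<in>UNIV. indicator C x * pd i (pd i (\<omega> m)) x)"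
      by (intro nrm2_triangle_diff sqi_sum ind K.pd_K \<omega>c nul_Cc[OF ne])
    also have "\<dots> \<le> nrm2 lborel (e m) + (\<Sum>i\<in>UNIV. nrm2 lborel (\<lambda>x. indicator C x * pd i (pd i (\<omega> m)) x))"
      by (intro add_mono ind(2) nrm2_sum ind(1) K.pd_K \<omega>c nul_Cc[OF ne])
    finally show ?thesis .
  qed
  have "(\<lambda>m. nrm2 lborel (e m) + (\<Sum>i\<in>UNIV. nrm2 lborel (\<lambda>x. indicator C x * pd i (pd i (\<omega> m)) x))) \<longlonglongrightarrow> 0 + (\<Sum>i\<in>(UNIV::'d set). 0)"
    using ne by (intro tendsto_intros nulDD) (simp add: nul_def)
  hence lim: "(\<lambda>m. nrm2 lborel (e m) + (\<Sum>i\<in>UNIV. nrm2 lborel (\<lambda>x. indicator C x * pd i (pd i (\<omega> m)) x))) \<longlonglongrightarrow> 0" by simp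
  have "(\<lambda>m. c * \<kappa>0 * nrm2 lborel (u m)) \<longlonglongrightarrow> 0"
    by (rule tendsto_sandwich[OF _ _ tendsto_const lim]) (use le c \<kappa>0 in \<open>auto simp: nrm2_ge0\<close>)
  hence "(\<lambda>m. inverse (c * \<kappa>0) * (c * \<kappa>0 * nrm2 lborel (u m))) \<longlonglongrightarrow> inverse (c * \<kappa>0) * 0" by (intro tendsto_intros)
  thus ?thesis using c \<kappa>0 by (simp add: field_simps)
qed

section \<open>Compactness\<close>

lemma diagonal_convergent_subsequence:
  fixes f :: "'i \<Rightarrow> nat \<Rightarrow> real"
  assumes I: "countable I" and B: "\<And>i m. i \<in> I \<Longrightarrow> \<bar>f i m\<bar> \<le> B i"
  obtains r where "strict_mono (r :: nat \<Rightarrow> nat)" "\<And>i. i \<in> I \<Longrightarrow> convergent (\<lambda>m. f i (r m))"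
proof (cases "I = {}")
  case True thus ?thesis using that[of id] by (simp add: strict_mono_def)
next
  case False
  define \<sigma> where "\<sigma> = from_nat_into I"
  have \<sigma>: "\<sigma> k \<in> I" for k using False by (simp add: \<sigma>_def from_nat_into)
  interpret subseqs "\<lambda>k s. convergent (\<lambda>m. f (\<sigma> k) (s m))"
  proof
    fix k and s :: "nat \<Rightarrow> nat" assume "strict_mono s"
    have "bounded (range (\<lambda>m. f (\<sigma> k) (s m)))" using B[OF \<sigma>[of k]] by (auto simp: bounded_iff)
    then obtain l r where "strict_mono r" "((\<lambda>m. f (\<sigma> k) (s m)) \<circ> r) \<longlonglongrightarrow> l"
      using bounded_imp_convergent_subsequence by blast
    thus "\<exists>r'. strict_mono r' \<and> convergent (\<lambda>m. f (\<sigma> k) ((s \<circ> r') m))"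
      by (auto simp: o_def convergent_def)
  qed
  have "convergent (\<lambda>m. f i (diagseq m))" if i: "i \<in> I" for i
  proof -
    obtain k where k: "i = \<sigma> k" using from_nat_into_surj[OF I i] by (auto simp: \<sigma>_def)
    \<comment> \<open>The diagonal sequence refines the k-th extraction only after its first k + 1
      terms are dropped, which does not affect convergence.\<close>
    have "convergent (\<lambda>m. f (\<sigma> k) ((diagseq \<circ> ((+) (Suc k))) m))"
    proof (rule diagseq_holds)
      fix r s :: "nat \<Rightarrow> nat" and n assume r: "strict_mono r" and s: "convergent (\<lambda>m. f (\<sigma> n) (s m))"
      from convergent_subseq_convergent[OF s r] show "convergent (\<lambda>m. f (\<sigma> n) ((s \<circ> r) m))" by (simp add: o_def)
    qed
    then obtain l where "(\<lambda>m. f (\<sigma> k) (diagseq (m + Suc k))) \<longlonglongrightarrow> l" by (auto simp: convergent_def add.commute)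
    hence "(\<lambda>m. f (\<sigma> k) (diagseq m)) \<longlonglongrightarrow> l" by (rule LIMSEQ_offset)
    thus ?thesis by (auto simp: k convergent_def)
  qed
  thus ?thesis using that subseq_diagseq by blast
qed

section \<open>Mollifications at a fixed scale\<close>

text \<open>Cauchy-Schwarz against \<open>b\<close>. The constant depends on \<open>b\<close> and
  \<open>s\<close> alone, not on \<open>f\<close> or its support, so it serves a whole bounded
  sequence.\<close>

lemma smoothing_sup_bound:
  fixes b :: "real ^ 'd \<Rightarrow> real"
  assumes b: "b \<in> Cc (cball 0 1)" and s: "s > 0"
  obtains A where "0 \<le> A" "\<And>K f x. compact K \<Longrightarrow> f \<in> Cc K \<Longrightarrow> \<bar>smoothing b s f x\<bar> \<le> A * nrm2 lborel f"
proof -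
  define d where "d = s ^ DIM(real ^ 'd)"
  have d: "d > 0" using s by (simp add: d_def)
  have "\<bar>smoothing b s f x\<bar> \<le> (nrm2 lborel b / sqrt d) * nrm2 lborel f" if K: "compact K" and f: "f \<in> Cc K" for K f x
  proof -
    let ?g = "\<lambda>z. f (x + (-s) *\<^sub>R z)"
    have fm[measurable]: "f \<in> borel_measurable borel" by (rule Cc_measurable[OF f])
    \<comment> \<open>Substitution y = x - s z, whose Jacobian is s to the power of the dimension.
      The resulting constant blows up as s tends to 0, which is harmless at a fixed scale.\<close>
    have lb: "lborel = density (distr lborel borel (\<lambda>z::real^'d. x + (-s) *\<^sub>R z)) (\<lambda>_. ennreal d)"
      using lborel_affine[of "-s" x] s by (simp add: d_def)
    have "(\<integral>\<^sup>+y. ennreal ((f y)\<^sup>2) \<partial>lborel) = ennreal d * (\<integral>\<^sup>+z. ennreal ((?g z)\<^sup>2) \<partial>lborel)"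
      by (subst (1) lb) (simp add: nn_integral_density nn_integral_cmult nn_integral_distr del: scaleR_minus_left)
    moreover have "(\<integral>\<^sup>+y. ennreal ((f y)\<^sup>2) \<partial>lborel) = ennreal ((nrm2 lborel f)\<^sup>2)"
      unfolding nrm2_sq by (rule nn_integral_eq_integral[OF sqi_square[OF Cc_sqi[OF K f]]]) auto
    ultimately have nn: "ennreal d * (\<integral>\<^sup>+z. ennreal ((?g z)\<^sup>2) \<partial>lborel) = ennreal ((nrm2 lborel f)\<^sup>2)" by simp
    have fin: "(\<integral>\<^sup>+z. ennreal ((?g z)\<^sup>2) \<partial>lborel) < \<infinity>"
    proof (rule ccontr)
      assume "\<not> ?thesis"
      hence "(\<integral>\<^sup>+z. ennreal ((?g z)\<^sup>2) \<partial>lborel) = top" by (simp add: less_top[symmetric])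
      thus False using nn d by (simp add: ennreal_mult_top)
    qed
    have ig: "integrable lborel (\<lambda>z. (?g z)\<^sup>2)" by (rule integrableI_bounded) (use fin in auto)
    hence g: "?g \<in> sqi lborel" by (simp add: sqi_def)
    have "d * (nrm2 lborel ?g)\<^sup>2 = (nrm2 lborel f)\<^sup>2"
      using nn d unfolding nrm2_sq[of lborel ?g] nn_integral_eq_integral[OF ig AE_I2[OF zero_le_power2]]
      by (simp add: ennreal_mult[symmetric])
    hence "sqrt (d * (nrm2 lborel ?g)\<^sup>2) = nrm2 lborel f" by (simp add: nrm2_ge0)
    hence ng: "nrm2 lborel ?g = nrm2 lborel f / sqrt d" using d nrm2_ge0[of lborel ?g] by (simp add: real_sqrt_mult field_simps)
    have "smoothing b s f x = (\<integral>z. b z * ?g z \<partial>lborel)"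
      unfolding smoothing_def avg_def using integral_Mb[of "\<lambda>z. b z * ?g z"] CcD(2)[OF b] by simp
    hence "\<bar>smoothing b s f x\<bar> \<le> nrm2 lborel b * nrm2 lborel ?g"
      using Cauchy_Schwarz_nrm2[OF Cc_sqi[OF compact_cball b] g] by simp
    thus ?thesis unfolding ng by simp
  qed
  moreover have "0 \<le> nrm2 lborel b / sqrt d" using nrm2_ge0[of lborel b] d by simp
  ultimately show ?thesis using that by blast
qed

lemma smoothing_Cc:
  assumes "b \<in> Cc (cball 0 1)" "K \<subseteq> cball 0 R" "compact K" "f \<in> Cc K" "0 \<le> s" "s \<le> 1"
  shows "smoothing b s f \<in> Cc (cball 0 (R + 1))"
proof -
  obtain B where "averaging Mb b (\<lambda>z. s *\<^sub>R z) B \<bar>s\<bar>" using averaging_smoothing[OF assms(1)] by blast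
  then interpret averaging Mb b "\<lambda>z. s *\<^sub>R z" B "\<bar>s\<bar>" .
  have "smoothing b s f \<in> Cc (cball 0 (R + s))" using avg_Cc[OF assms(2,3,4)] assms(5) by (simp add: smoothing_def)
  thus ?thesis by (rule Cc_mono) (use assms(6) in auto)
qed

lemma smoothing_diff:
  assumes "b \<in> Cc (cball 0 1)" "compact K" "f \<in> Cc K" "g \<in> Cc K"
  shows "smoothing b s (\<lambda>x. f x - g x) x = smoothing b s f x - smoothing b s g x"
proof -
  obtain B where "averaging Mb b (\<lambda>z. s *\<^sub>R z) B \<bar>s\<bar>" using averaging_smoothing[OF assms(1)] by blast
  then interpret averaging Mb b "\<lambda>z. s *\<^sub>R z" B "\<bar>s\<bar>" .
  show ?thesis unfolding smoothing_def avg_def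
    using avg_integrable[OF assms(2,3), of x] avg_integrable[OF assms(2,4), of x] by (simp add: right_diff_distrib)
qed

text \<open>A derivative of the mollification is 1/s times the mollification with a derivative of
  \<open>b\<close>, to which the sup bound applies.\<close>

lemma smoothing_lipschitz:
  fixes b :: "real ^ 'd \<Rightarrow> real"
  assumes b: "b \<in> Cc (cball 0 1)" and s: "0 < s" "s \<le> 1"
  obtains A where "0 \<le> A"
    "\<And>K f x y. compact K \<Longrightarrow> f \<in> Cc K \<Longrightarrow> \<bar>smoothing b s f x - smoothing b s f y\<bar> \<le> A * nrm2 lborel f * norm (x - y)"
proof -
  have "\<exists>A\<ge>0. \<forall>K f x. compact K \<longrightarrow> f \<in> Cc K \<longrightarrow> \<bar>smoothing (pd i b) s f x\<bar> \<le> A * nrm2 lborel f" for i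
    using smoothing_sup_bound[OF Cc_pd[OF closed_cball b] s(1), of i] by metis
  then obtain A where A: "\<And>i. 0 \<le> A i" "\<And>i K f x. compact K \<Longrightarrow> f \<in> Cc K \<Longrightarrow> \<bar>smoothing (pd i b) s f x\<bar> \<le> A i * nrm2 lborel f"
    by metis
  define C where "C = (\<Sum>i\<in>UNIV. A i) / s"
  have C0: "0 \<le> C" using A(1) s by (simp add: C_def sum_nonneg)
  have "\<bar>smoothing b s f x - smoothing b s f y\<bar> \<le> C * nrm2 lborel f * norm (x - y)" if K: "compact K" and f: "f \<in> Cc K" for K f x y
  proof -
    let ?S = "smoothing b s f"
    obtain B where "averaging Mb b (\<lambda>z. s *\<^sub>R z) B \<bar>s\<bar>" using averaging_smoothing[OF b] by blast
    then interpret averaging Mb b "\<lambda>z. s *\<^sub>R z" B "\<bar>s\<bar>" .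
    have sm: "smooth_on UNIV ?S" unfolding smoothing_def by (rule avg_smooth[OF K f])
    have pdb: "\<bar>pd i ?S z\<bar> \<le> A i / s * nrm2 lborel f" for i z
    proof -
      have "s * pd i ?S z = smoothing (pd i b) s f z"
        using smoothing_by_parts[OF K f b, of i s z] smoothing_pd[OF K f b, of i s] by simp
      hence "s * \<bar>pd i ?S z\<bar> \<le> A i * nrm2 lborel f" using A(2)[OF K f, of i z] s(1) by (metis abs_mult abs_of_pos)
      thus ?thesis using s(1) by (simp add: field_simps)
    qed
    have "norm (?S x - ?S y) \<le> C * nrm2 lborel f * norm (x - y)"
    proof (rule differentiable_bound[of UNIV ?S "\<lambda>x. frechet_derivative ?S (at x)"])
      show "(?S has_derivative frechet_derivative ?S (at x)) (at x within UNIV)" for x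
        using smooth_on_has_derivative[OF sm, of x] by simp
      show "onorm (frechet_derivative ?S (at z)) \<le> C * nrm2 lborel f" for z
      proof (rule onorm_bound)
        fix v
        have "frechet_derivative ?S (at z) v = (\<Sum>i\<in>UNIV. v $ i * pd i ?S z)"
          using frechet_expand[OF smooth_on_differentiable[OF sm UNIV_I], of z v] by (simp add: deriv_along_def)
        hence "norm (frechet_derivative ?S (at z) v) \<le> (\<Sum>i\<in>UNIV. \<bar>v $ i * pd i ?S z\<bar>)" by simp
        also have "\<dots> \<le> (\<Sum>i\<in>UNIV. norm v * (A i / s * nrm2 lborel f))"
          unfolding abs_mult by (intro sum_mono mult_mono component_le_norm_cart pdb) auto
        also have "\<dots> = C * nrm2 lborel f * norm v"
          by (simp add: C_def sum_distrib_left sum_distrib_right sum_divide_distrib ac_simps)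
        finally show "norm (frechet_derivative ?S (at z) v) \<le> C * nrm2 lborel f * norm v" .
      qed (use C0 nrm2_ge0[of lborel f] in auto)
    qed auto
    thus ?thesis by simp
  qed
  thus ?thesis using that C0 by blast
qed

text \<open>The Arzela-Ascoli argument: convergence on a dense set and a common Lipschitz constant
  give convergence at every point; uniform bounds and a common bounded support turn it into L2
  convergence by dominated convergence.\<close>

lemma smoothing_L2_Cauchy:
  fixes b :: "real ^ 'd \<Rightarrow> real"
  assumes b: "b \<in> Cc (cball 0 1)" and s: "0 < s" "s \<le> 1" and K: "compact K" and f: "bdd K f"
    and Q: "closure Q = UNIV" and conv: "\<And>x. x \<in> Q \<Longrightarrow> convergent (\<lambda>m. smoothing b s (f m) x)" and e: "e > 0"
  obtains N where "\<And>k l. k \<ge> N \<Longrightarrow> l \<ge> N \<Longrightarrow> nrm2 lborel (smoothing b s (\<lambda>x. f k x - f l x)) \<le> e"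
proof -
  obtain B' where B': "\<And>m. nrm2 lborel (f m) \<le> B'" using f by (auto simp: bdd_def)
  define B where "B = \<bar>B'\<bar>"
  have B: "nrm2 lborel (f m) \<le> B" "0 \<le> B" for m using B'[of m] by (auto simp: B_def)
  note fc = bdd_Cc[OF f]
  obtain A where A: "0 \<le> A" "\<And>K f x. compact K \<Longrightarrow> f \<in> Cc K \<Longrightarrow> \<bar>smoothing b s f x\<bar> \<le> A * nrm2 lborel f"
    using smoothing_sup_bound[OF b s(1)] by blast
  obtain L where L: "0 \<le> L" "\<And>K f x y. compact K \<Longrightarrow> f \<in> Cc K \<Longrightarrow> \<bar>smoothing b s f x - smoothing b s f y\<bar> \<le> L * nrm2 lborel f * norm (x - y)"
    using smoothing_lipschitz[OF b s] by blast
  obtain R where R: "K \<subseteq> cball 0 R"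
    using compact_imp_bounded[OF K] unfolding bounded_iff by (metis mem_cball_0 subsetI)
  define S where "S m = smoothing b s (f m)" for m
  have Sc: "S m \<in> Cc (cball 0 (R + 1))" for m unfolding S_def by (rule smoothing_Cc[OF b R K fc]) (use s in auto)
  have Sb: "\<bar>S m x\<bar> \<le> A * B" for m x
    using A(2)[OF K fc[of m], of x] mult_left_mono[OF B(1)[of m] A(1)] by (simp add: S_def)
  have lip: "\<bar>S m x - S m y\<bar> \<le> L * B * norm (x - y)" for m x y
  proof -
    have "\<bar>S m x - S m y\<bar> \<le> L * nrm2 lborel (f m) * norm (x - y)" using L(2)[OF K fc[of m], of x y] by (simp add: S_def)
    also have "\<dots> \<le> L * B * norm (x - y)" by (intro mult_right_mono mult_left_mono B L) auto
    finally show ?thesis .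
  qed
  have "Cauchy (\<lambda>m. S m x)" for x
  proof (rule metric_CauchyI)
    fix \<epsilon> :: real assume \<epsilon>: "\<epsilon> > 0"
    \<comment> \<open>Chosen so that moving from x to a point of \<open>Q\<close> at distance below
      r costs at most \<epsilon>/3; the summand 1 avoids division by zero.\<close>
    define r where "r = \<epsilon> / (3 * (L * B + 1))"
    have LB: "L * B + 1 > 0" using L(1) B(2) by (simp add: add_nonneg_pos)
    have r: "r > 0" using \<epsilon> LB by (simp add: r_def)
    have "x \<in> closure Q" using Q by simp
    then obtain y where y: "y \<in> Q" "dist y x < r" using r by (meson closure_approachable)
    have "L * B * norm (x - y) \<le> (L * B + 1) * r" using y(2) LB L(1) B(2)
      by (intro mult_mono) (auto simp: dist_norm norm_minus_commute)
    also have "\<dots> = \<epsilon> / 3" using LB by (simp add: r_def field_simps)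
    finally have near: "\<bar>S m x - S m y\<bar> \<le> \<epsilon> / 3" for m using lip[of m x y] by linarith
    have "Cauchy (\<lambda>m. S m y)" using conv[OF y(1)] unfolding S_def by (rule convergent_Cauchy)
    then obtain M where M: "\<And>k l. k \<ge> M \<Longrightarrow> l \<ge> M \<Longrightarrow> dist (S k y) (S l y) < \<epsilon> / 3"
      using metric_CauchyD[of "\<lambda>m. S m y" "\<epsilon>/3"] \<epsilon> by (metis divide_pos_pos zero_less_numeral)
    have "dist (S k x) (S l x) < \<epsilon>" if "k \<ge> M" "l \<ge> M" for k l
      using M[OF that] near[of k] near[of l] by (simp add: dist_real_def abs_if split: if_splits)
    thus "\<exists>M. \<forall>m\<ge>M. \<forall>n\<ge>M. dist (S m x) (S n x) < \<epsilon>" by blast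
  qed
  hence "\<exists>l. (\<lambda>m. S m x) \<longlonglongrightarrow> l" for x by (simp add: Cauchy_convergent_iff convergent_def)
  then obtain g where g: "\<And>x. (\<lambda>m. S m x) \<longlonglongrightarrow> g x" by metis
  have [measurable]: "S m \<in> borel_measurable borel" for m by (rule Cc_measurable[OF Sc])
  have gm: "g \<in> borel_measurable borel" by (rule borel_measurable_LIMSEQ_real[OF g]) measurable
  have gb: "\<bar>g x\<bar> \<le> A * B" for x
    by (rule LIMSEQ_le_const2[OF tendsto_rabs[OF g]]) (use Sb in auto)
  have g0: "g x = 0" if "x \<notin> cball 0 (R + 1)" for x
    using g[of x] CcD(2)[OF Sc that] LIMSEQ_unique[OF tendsto_const, of 0 "g x"] by simp
  \<comment> \<open>Both \<open>S m\<close> and the limit are bounded by A B and vanish off the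
    ball, so twice this bound dominates their difference.\<close>
  define h :: "real^'d \<Rightarrow> real" where "h x = 2 * (A * B) * indicator (cball 0 (R + 1)) x" for x
  have hs: "h \<in> sqi lborel"
  proof -
    have "integrable lborel (\<lambda>x::real^'d. (2 * (A * B))\<^sup>2 * indicator (cball 0 (R + 1)) x)"
      by (intro integrable_mult_right integrable_real_indicator) (auto simp: emeasure_lborel_cball_finite[unfolded infinity_ennreal_def])
    moreover have "(\<lambda>x. (h x)\<^sup>2) = (\<lambda>x. (2 * (A * B))\<^sup>2 * indicator (cball 0 (R + 1)) x)"
      by (auto simp: h_def indicator_def)
    moreover have "h \<in> borel_measurable lborel"
      unfolding h_def by (intro borel_measurable_times borel_measurable_indicator) auto
    ultimately show ?thesis by (simp only: sqi_def mem_Collect_eq simp_thms)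
  qed
  have bound: "\<bar>S m x - g x\<bar> \<le> \<bar>h x\<bar>" for m x
  proof (cases "x \<in> cball 0 (R + 1)")
    case True thus ?thesis using Sb[of m x] gb[of x] unfolding h_def by simp
  next
    case False thus ?thesis using g0 CcD(2)[OF Sc False] unfolding h_def by simp
  qed
  have lim: "(\<lambda>m. nrm2 lborel (\<lambda>x. S m x - g x)) \<longlonglongrightarrow> 0"
    by (rule sqi_dominated_convergence[OF hs]) (use g bound gm in auto)
  have gs: "g \<in> sqi lborel"
  proof (rule sqi_bound[OF hs])
    have "\<bar>g x\<bar> \<le> \<bar>h x\<bar>" for x
    proof (cases "x \<in> cball 0 (R + 1)")
      case True thus ?thesis using gb[of x] abs_ge_zero[of "g x"] unfolding h_def by simp
    next
      case False thus ?thesis using g0 by simp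
    qed
    thus "AE x in lborel. \<bar>g x\<bar> \<le> \<bar>h x\<bar>" by simp
  qed (use gm in simp)
  obtain N where N: "\<And>m. m \<ge> N \<Longrightarrow> norm (nrm2 lborel (\<lambda>x. S m x - g x) - 0) < e/2"
    using LIMSEQ_D[OF lim, of "e/2"] e by auto
  have Ss: "S m \<in> sqi lborel" for m by (rule Cc_sqi[OF compact_cball Sc])
  have "nrm2 lborel (smoothing b s (\<lambda>x. f k x - f l x)) \<le> e" if "k \<ge> N" "l \<ge> N" for k l
  proof -
    have "smoothing b s (\<lambda>x. f k x - f l x) = (\<lambda>x. S k x - S l x)"
      unfolding S_def by (rule ext) (rule smoothing_diff[OF b K fc fc])
    moreover have "nrm2 lborel (\<lambda>x. S k x - S l x) \<le> nrm2 lborel (\<lambda>x. S k x - g x) + nrm2 lborel (\<lambda>x. g x - S l x)"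
      by (rule nrm2_triangle3[OF Ss gs Ss])
    moreover have "nrm2 lborel (\<lambda>x. g x - S l x) = nrm2 lborel (\<lambda>x. S l x - g x)" by (rule nrm2_minus_commute)
    ultimately show ?thesis using N[OF that(1)] N[OF that(2)] by simp
  qed
  thus ?thesis using that by blast
qed

text \<open>A subsequence is taken along which the mollifications at every scale 1/(N+1) converge.
  If it were not Cauchy, differences of norm above e could be found whose mollifications at scale
  1/(N+1) are as small as desired, contrary to \<open>null_sequence_of_smoothings\<close>.\<close>

theorem compact_embedding_smooth:
  fixes D U :: "(real ^ 'd) set"
  assumes D: "bounded D" and U: "open U" "closure D \<subseteq> U" and H: "hormander U n Y"
    and Y: "\<And>j. j \<in> {1..n} \<Longrightarrow> smooth_on U (Y j)"
    and f: "bdd (closure D) f"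
    and Yf: "\<And>j. j \<in> {1..n} \<Longrightarrow> bdd (closure D) (\<lambda>m. deriv_along (Y j) (f m))"
  obtains r where "strict_mono (r :: nat \<Rightarrow> nat)"
    "\<And>e. e > 0 \<Longrightarrow> \<exists>N. \<forall>k\<ge>N. \<forall>l\<ge>N. nrm2 lborel (\<lambda>x. f (r k) x - f (r l) x) \<le> e"
proof -
  define C where "C = closure D"
  have C: "compact C" using D by (simp add: C_def)
  have CU: "C \<subseteq> U" using U by (simp add: C_def)
  interpret C: compact_in_open C U by unfold_locales (use C CU U in auto)
  note fc = bdd_Cc[OF f, folded C_def]
  obtain B where B: "\<And>m. nrm2 lborel (f m) \<le> B" using f by (auto simp: bdd_def)
  obtain Q :: "(real^'d) set" where Q: "countable Q" "closure Q = UNIV"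
    using separable[of "UNIV :: (real^'d) set"] by (metis top.extremum_unique)
  \<comment> \<open>\<open>None\<close> stands for the kernel itself, \<open>Some i\<close> for its
    i-th derivative, which controls the derivatives of the mollifications.\<close>
  define b :: "'d option \<Rightarrow> real^'d \<Rightarrow> real" where "b o' = (case o' of None \<Rightarrow> bell' | Some i \<Rightarrow> pd i bell')" for o'
  have b: "b o' \<in> Cc (cball 0 1)" for o'
    unfolding b_def by (cases o') (auto intro: bell'_Cc Cc_pd)
  define s where "s N = inverse (real (Suc N))" for N
  have s: "0 < s N" "s N \<le> 1" for N by (auto simp: s_def field_simps)
  have s0: "s \<longlonglongrightarrow> 0" unfolding s_def by (rule LIMSEQ_inverse_real_of_nat)
  have "\<exists>A. 0 \<le> A \<and> (\<forall>m x. \<bar>smoothing (b o') (s N) (f m) x\<bar> \<le> A * nrm2 lborel (f m))" for o' N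
    using smoothing_sup_bound[OF b s(1)] C fc by metis
  then obtain A where A: "\<And>o' N. 0 \<le> A o' N" "\<And>o' N m x. \<bar>smoothing (b o') (s N) (f m) x\<bar> \<le> A o' N * nrm2 lborel (f m)"
    by metis
  define I where "I = (UNIV :: nat set) \<times> (UNIV :: 'd option set) \<times> Q"
  have cI: "countable I" unfolding I_def using Q(1) by (intro countable_SIGMA) (auto intro: countable_finite)
  define F where "F i m = (case i of (N, o', x) \<Rightarrow> smoothing (b o') (s N) (f m) x)" for i m
  have Fb: "\<bar>F i m\<bar> \<le> (case i of (N, o', x) \<Rightarrow> A o' N * B)" for i m
  proof (cases i)
    case (fields N o' x)
    thus ?thesis using A(2)[of o' N m x] mult_left_mono[OF B[of m] A(1)[of o' N]] by (simp add: F_def)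
  qed
  obtain r where r: "strict_mono r" "\<And>i. i \<in> I \<Longrightarrow> convergent (\<lambda>m. F i (r m))"
    using diagonal_convergent_subsequence[of I F, OF cI Fb] by blast
  define g where "g m = f (r m)" for m
  have gb: "bdd C g" unfolding bdd_def g_def using fc B by blast
  have cau: "\<exists>M. \<forall>k\<ge>M. \<forall>l\<ge>M. nrm2 lborel (smoothing (b o') (s N) (\<lambda>x. g k x - g l x)) \<le> e" if "e > 0" for o' N e
  proof -
    have "convergent (\<lambda>m. smoothing (b o') (s N) (g m) x)" if "x \<in> Q" for x
      using r(2)[of "(N, o', x)"] that by (simp add: F_def I_def g_def)
    from smoothing_L2_Cauchy[OF b s C gb Q(2) this \<open>e > 0\<close>] show ?thesis by metis
  qed
  have "\<exists>M. \<forall>k\<ge>M. \<forall>l\<ge>M. nrm2 lborel (\<lambda>x. g k x - g l x) \<le> e" if e: "e > 0" for e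
  proof (rule ccontr)
    assume neg: "\<not> ?thesis"
    \<comment> \<open>The square of the scale is required because a derivative of the mollification
      is 1/s times the mollification with the differentiated kernel; a factor s still
      remains.\<close>
    define P where "P N k l \<longleftrightarrow> nrm2 lborel (\<lambda>x. g k x - g l x) > e \<and>
      (\<forall>o'. nrm2 lborel (smoothing (b o') (s N) (\<lambda>x. g k x - g l x)) \<le> (s N)\<^sup>2)" for N k l
    have "\<exists>k l. P N k l" for N
    proof -
      have "\<forall>o'. \<exists>M. \<forall>k\<ge>M. \<forall>l\<ge>M. nrm2 lborel (smoothing (b o') (s N) (\<lambda>x. g k x - g l x)) \<le> (s N)\<^sup>2"
        by (intro allI cau zero_less_power s(1))
      from choice[OF this] obtain M where M: "\<And>o' k l. k \<ge> M o' \<Longrightarrow> l \<ge> M o' \<Longrightarrow> nrm2 lborel (smoothing (b o') (s N) (\<lambda>x. g k x - g l x)) \<le> (s N)\<^sup>2"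
        by blast
      define M' where "M' = Max (range M)"
      have M': "M o' \<le> M'" for o' unfolding M'_def by (intro Max_ge) auto
      obtain k l where "k \<ge> M'" "l \<ge> M'" "\<not> nrm2 lborel (\<lambda>x. g k x - g l x) \<le> e" using neg by blast
      moreover from this have "M o' \<le> k" "M o' \<le> l" for o' using M'[of o'] by linarith+
      ultimately show ?thesis using M by (intro exI[of _ k] exI[of _ l]) (simp add: not_le P_def)
    qed
    then obtain k l where "\<And>N. P N (k N) (l N)" by metis
    hence kl: "\<And>N. nrm2 lborel (\<lambda>x. g (k N) x - g (l N) x) > e"
      "\<And>N o'. nrm2 lborel (smoothing (b o') (s N) (\<lambda>x. g (k N) x - g (l N) x)) \<le> (s N)\<^sup>2"
      unfolding P_def by auto
    define u where "u N x = g (k N) x - g (l N) x" for N x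
    have sub: "bdd C (\<lambda>N. h (q N))" if "bdd C h" for h q using that unfolding bdd_def by blast
    have uC: "bdd C u" unfolding u_def[abs_def] by (rule C.bdd_diff[OF sub[OF gb] sub[OF gb]])
    have Yg: "bdd C (\<lambda>m. deriv_along (Y j) (g m))" if "j \<in> {1..n}" for j
      using sub[OF Yf[OF that, folded C_def], of r] by (simp add: g_def)
    have Yu: "bdd C (\<lambda>N. deriv_along (Y j) (u N))" if j: "j \<in> {1..n}" for j
    proof -
      have "deriv_along (Y j) (u N) = (\<lambda>x. deriv_along (Y j) (g (k N)) x - deriv_along (Y j) (g (l N)) x)" for N
        unfolding u_def by (rule ext, rule deriv_along_diff) (rule Cc_differentiable[OF bdd_Cc[OF gb]])+
      thus ?thesis using C.bdd_diff[OF sub[OF Yg[OF j], of k] sub[OF Yg[OF j], of l]] by simp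
    qed
    have sq0: "(\<lambda>N. (s N)\<^sup>2) \<longlonglongrightarrow> 0" using tendsto_power[OF s0, of 2] by simp
    have "(\<lambda>N. nrm2 lborel (u N)) \<longlonglongrightarrow> 0"
    proof (rule null_sequence_of_smoothings[OF D U H Y uC[unfolded C_def] Yu[unfolded C_def] less_imp_le[OF s(1)] s(2) s0])
      show "(\<lambda>m. nrm2 lborel (smoothing bell' (s m) (u m))) \<longlonglongrightarrow> 0"
        by (rule tendsto_sandwich[OF _ _ tendsto_const sq0])
          (use kl(2)[of None] in \<open>auto simp: nrm2_ge0 b_def u_def[abs_def]\<close>)
      fix i
      show "(\<lambda>m. nrm2 lborel (pd i (smoothing bell' (s m) (u m)))) \<longlonglongrightarrow> 0"
      proof (rule tendsto_sandwich[OF _ _ tendsto_const s0])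
        have "nrm2 lborel (pd i (smoothing bell' (s m) (u m))) \<le> s m" for m
        proof -
          have "smoothing (pd i bell') (s m) (u m) = (\<lambda>x. s m * pd i (smoothing bell' (s m) (u m)) x)"
            by (rule ext) (simp add: smoothing_by_parts[OF C bdd_Cc[OF uC] bell'_Cc] smoothing_pd[OF C bdd_Cc[OF uC] bell'_Cc])
          hence "nrm2 lborel (smoothing (pd i bell') (s m) (u m)) = s m * nrm2 lborel (pd i (smoothing bell' (s m) (u m)))"
            using s(1)[of m] by (simp add: nrm2_cmult)
          moreover have "nrm2 lborel (smoothing (pd i bell') (s m) (u m)) \<le> (s m)\<^sup>2"
            using kl(2)[of "Some i" m] by (simp add: b_def u_def[abs_def])
          ultimately show ?thesis using s(1)[of m] by (simp add: power2_eq_square)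
        qed
        thus "\<forall>\<^sub>F m in sequentially. nrm2 lborel (pd i (smoothing bell' (s m) (u m))) \<le> s m" by simp
      qed (simp add: nrm2_ge0)
    qed
    moreover have "nrm2 lborel (u N) > e" for N using kl(1) by (simp add: u_def[abs_def])
    ultimately show False using e LIMSEQ_le_const[of "\<lambda>N. nrm2 lborel (u N)" 0 e] by (meson less_imp_le not_le)
  qed
  thus ?thesis using that r(1) by (simp add: g_def)
qed

section \<open>The energy space\<close>

lemma smooth_fraction: "smooth_on UNIV (f :: 'a::real_normed_vector \<Rightarrow> real) \<Longrightarrow> (\<And>x. 0 \<le> f x) \<Longrightarrow> smooth_on UNIV (\<lambda>x. f x * inverse (1 + f x))"
  by (intro smooth_on_mult smooth_on_inverse smooth_on_add smooth_on_const open_UNIV) (auto simp: add_nonneg_eq_0_iff)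

locale energy_space =
  fixes D U :: "(real ^ 'd) set" and n :: nat and Y :: "nat \<Rightarrow> real ^ 'd \<Rightarrow> real ^ 'd"
  assumes D: "open D" "bounded D" and U: "open U" "closure D \<subseteq> U"
    and Y: "\<And>j. j \<in> {1..n} \<Longrightarrow> smooth_on U (Y j)"
begin

abbreviation M where "M \<equiv> lebesgue_on D"
abbreviation T where "T \<equiv> test_functions D"

lemma Dl: "D \<in> sets lebesgue" using D(1) by simp
lemma Dlm: "D \<in> lmeasurable" using D bounded_set_imp_lmeasurable Dl by blast
lemma DU: "D \<subseteq> U" using U closure_subset by blast

lemma finite_M: "finite_measure M" by (rule finite_measure_lebesgue_on[OF Dlm])

sublocale finite_measure M by (rule finite_M)

lemma borel_imp_M: "g \<in> borel_measurable borel \<Longrightarrow> g \<in> borel_measurable M"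
  by (rule measurable_restrict_space1) (simp add: measurable_completion)

lemma integral_M:
  fixes g :: "real ^ 'd \<Rightarrow> real"
  assumes "g \<in> borel_measurable borel" "\<And>x. x \<notin> D \<Longrightarrow> g x = 0"
  shows "(\<integral>x. g x \<partial>M) = (\<integral>x. g x \<partial>lborel)"
proof -
  have "(\<integral>x. g x \<partial>M) = (\<integral>x. indicator D x *\<^sub>R g x \<partial>lebesgue)"
    by (rule integral_restrict_space) (use Dl in simp)
  also have "\<dots> = (\<integral>x. g x \<partial>lebesgue)"
    by (rule Bochner_Integration.integral_cong) (use assms(2) in \<open>auto simp: indicator_def\<close>)
  also have "\<dots> = (\<integral>x. g x \<partial>lborel)" by (rule integral_completion) (use assms in simp)
  finally show ?thesis .
qed

lemma nrm2_M: 
  assumes "g \<in> borel_measurable borel" "\<And>x. x \<notin> D \<Longrightarrow> g x = 0"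
  shows "nrm2 M g = nrm2 lborel g"
  unfolding nrm2_def using integral_M[of "\<lambda>x. (g x)\<^sup>2"] assms by simp

lemma L2_eq: "L2 D = sqi M" by (simp add: L2_def sqi_def)

lemma T_Cc: "f \<in> T \<Longrightarrow> f \<in> Cc (closure D)"
  using closure_subset[of D] by (auto simp: test_functions_iff intro: Cc_mono)

lemma T_outside: "f \<in> T \<Longrightarrow> x \<notin> D \<Longrightarrow> f x = 0"
  by (auto simp: test_functions_iff Cc_def)

lemma T_measurable: "f \<in> T \<Longrightarrow> f \<in> borel_measurable borel"
  using T_Cc Cc_measurable by blast

lemma T_bounded: "f \<in> T \<Longrightarrow> \<exists>B. \<forall>x. \<bar>f x\<bar> \<le> B"
  using Cc_bounded by (metis test_functions_iff)

lemma T_sqi: assumes f: "f \<in> T" shows "f \<in> sqi M"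
proof -
  obtain B where B: "\<And>x. \<bar>f x\<bar> \<le> B" using T_bounded[OF f] by blast
  have "integrable M (\<lambda>x. (f x)\<^sup>2)"
    by (rule integrable_const_bound[of _ "B\<^sup>2"])
      (use B borel_imp_M[OF T_measurable[OF f]] in \<open>auto intro!: abs_le_square_iff[THEN iffD1] order_trans[OF B]\<close>)
  thus ?thesis using borel_imp_M[OF T_measurable[OF f]] by (simp add: sqi_def)
qed

lemma T_nrm2: "f \<in> T \<Longrightarrow> nrm2 M f = nrm2 lborel f"
  by (rule nrm2_M) (auto intro: T_measurable T_outside)

lemma T_pair: assumes "f \<in> T" "g \<in> T" obtains K where "compact K" "K \<subseteq> D" "f \<in> Cc K" "g \<in> Cc K"
proof -
  obtain K1 K2 where K: "compact K1" "K1 \<subseteq> D" "f \<in> Cc K1" "compact K2" "K2 \<subseteq> D" "g \<in> Cc K2"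
    using assms unfolding test_functions_iff by blast
  show ?thesis
    by (rule that[of "K1 \<union> K2"]) (use K in \<open>auto intro: Cc_mono\<close>)
qed

lemma T_I: "compact K \<Longrightarrow> K \<subseteq> D \<Longrightarrow> f \<in> Cc K \<Longrightarrow> f \<in> T" by (auto simp: test_functions_iff)

lemma T_add: assumes "f \<in> T" "g \<in> T" shows "(\<lambda>x. f x + g x) \<in> T"
  by (rule T_pair[OF assms]) (rule T_I, auto intro: Cc_add)
lemma T_diff: assumes "f \<in> T" "g \<in> T" shows "(\<lambda>x. f x - g x) \<in> T"
  by (rule T_pair[OF assms]) (rule T_I, auto intro: Cc_diff)
lemma T_cmult: "f \<in> T \<Longrightarrow> (\<lambda>x. c * f x) \<in> T"
  unfolding test_functions_iff using Cc_cmult by blast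
lemma T_0: "(\<lambda>x. 0) \<in> T" by (rule T_I[of "{}"]) (auto intro: Cc_0)
lemma T_smooth: "f \<in> T \<Longrightarrow> smooth_on UNIV f" by (auto simp: test_functions_def)
lemma T_differentiable: "f \<in> T \<Longrightarrow> f differentiable (at x)" using T_smooth smooth_on_differentiable by blast

lemma T_along: assumes "f \<in> T" "j \<in> {1..n}" shows "deriv_along (Y j) f \<in> T"
proof -
  obtain K where K: "compact K" "K \<subseteq> D" "f \<in> Cc K" using assms unfolding test_functions_iff by blast
  show ?thesis by (rule T_I[OF K(1,2)], rule Cc_deriv_along[OF compact_imp_closed[OF K(1)] _ U(1) Y[OF assms(2)] K(3)])
      (use K DU in auto)
qed

text \<open>The formal adjoint of differentiation along \<open>Y j\<close>, with the opposite
  sign.\<close>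

definition adj :: "nat \<Rightarrow> (real ^ 'd \<Rightarrow> real) \<Rightarrow> real ^ 'd \<Rightarrow> real" where
  "adj j f x = deriv_along (Y j) f x + divergence (Y j) x * f x"

lemma T_adj: assumes "f \<in> T" "j \<in> {1..n}" shows "adj j f \<in> T"
proof -
  obtain K where K: "compact K" "K \<subseteq> D" "f \<in> Cc K" using assms unfolding test_functions_iff by blast
  have "(\<lambda>x. divergence (Y j) x * f x) \<in> T"
    by (rule T_I[OF K(1,2)], rule Cc_smooth_mult[OF compact_imp_closed[OF K(1)] _ U(1) smooth_on_divergence[OF U(1) Y[OF assms(2)]] K(3)])
      (use K DU in auto)
  from T_add[OF T_along[OF assms] this] show ?thesis by (simp add: adj_def[abs_def])
qed

lemma has_dist_derivative_iff:
  "has_dist_derivative D (Y j) u g \<longleftrightarrow> (\<forall>\<phi>\<in>T. (\<integral>x. g x * \<phi> x \<partial>M) = - (\<integral>x. u x * adj j \<phi> x \<partial>M))"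
  by (simp add: has_dist_derivative_def adj_def deriv_along_def)

lemma T_has_dist_derivative:
  assumes f: "f \<in> T" and j: "j \<in> {1..n}"
  shows "has_dist_derivative D (Y j) f (deriv_along (Y j) f)"
  unfolding has_dist_derivative_iff
proof
  fix \<phi> assume p: "\<phi> \<in> T"
  obtain K where K: "compact K" "K \<subseteq> D" "f \<in> Cc K" "\<phi> \<in> Cc K" using T_pair[OF f p] by blast
  have KU: "K \<subseteq> U" using K DU by auto
  have c: "closed K" using K by (simp add: compact_imp_closed)
  have dp: "(\<lambda>x. divergence (Y j) x * \<phi> x) \<in> Cc K"
    by (rule Cc_smooth_mult[OF c KU U(1) smooth_on_divergence[OF U(1) Y[OF j]] K(4)])
  have yp: "deriv_along (Y j) \<phi> \<in> Cc K" by (rule Cc_deriv_along[OF c KU U(1) Y[OF j] K(4)])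
  have "(\<integral>x. deriv_along (Y j) f x * \<phi> x \<partial>M) = ip (deriv_along (Y j) f) \<phi>"
    unfolding ip_def by (rule integral_M) (use T_measurable[OF T_along[OF f j]] T_measurable[OF p] T_outside[OF p] in auto)
  also have "\<dots> = - ip f (adj j \<phi>)"
    using ip_deriv_along[OF K(1) KU U(1) Y[OF j] K(3,4)] ip_add_right[OF K(1) yp dp K(3)] by (simp add: adj_def[abs_def])
  also have "ip f (adj j \<phi>) = (\<integral>x. f x * adj j \<phi> x \<partial>M)"
    unfolding ip_def by (rule integral_M[symmetric]) (use T_measurable[OF f] T_measurable[OF T_adj[OF p j]] T_outside[OF f] in auto)
  finally show "(\<integral>x. deriv_along (Y j) f x * \<phi> x \<partial>M) = - (\<integral>x. f x * adj j \<phi> x \<partial>M)" .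
qed

section \<open>Fundamental lemma of the calculus of variations and uniqueness of distributional
  derivatives\<close>

text \<open>The indicator of \<open>C\<close> is a bounded pointwise limit of test functions, so
  orthogonality to test functions passes to it by dominated convergence.\<close>

lemma integral_compact_eq_0:
  assumes g: "integrable M g" and orth: "\<And>\<phi>. \<phi> \<in> T \<Longrightarrow> (\<integral>x. g x * \<phi> x \<partial>M) = 0"
    and C: "compact C" "C \<subseteq> D"
  shows "(\<integral>x. g x * indicator C x \<partial>M) = 0"
proof (cases "C = {}")
  case True thus ?thesis by simp
next
  case False
  \<comment> \<open>Open neighbourhoods shrinking to \<open>C\<close>: a point outside
    \<open>C\<close> eventually leaves them, and there the approximations vanish.\<close>
  define O' where "O' m = {x\<in>D. infdist x C < inverse (real (Suc m))}" for m
  have oO: "open (O' m)" for m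
  proof -
    have "open (D \<inter> {x. infdist x C < inverse (real (Suc m))})"
      by (intro open_Int D open_Collect_less continuous_intros)
    thus ?thesis by (simp add: O'_def Int_def)
  qed
  have CO: "C \<subseteq> O' m" for m using C by (auto simp: O'_def)
  have "\<exists>\<theta>. \<theta> \<in> T \<and> (\<forall>x. 0 \<le> \<theta> x \<and> \<theta> x \<le> 1) \<and> (\<forall>x. x \<notin> O' m \<longrightarrow> \<theta> x = 0) \<and>
     (\<forall>x\<in>C. 1 - inverse (real (Suc m)) \<le> \<theta> x)" for m
  proof -
    obtain K k where K: "compact K" "K \<subseteq> O' m" "k \<in> Cc K" "\<And>x. 0 \<le> k x" "\<And>x. x \<in> C \<Longrightarrow> 0 < k x"
      using exists_cutoff[OF C(1) oO CO] by metis
    obtain x0 where x0: "x0 \<in> C" "\<And>x. x \<in> C \<Longrightarrow> k x0 \<le> k x"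
      using continuous_attains_inf[OF C(1) False Cc_continuous[OF K(3)]] by blast
    \<comment> \<open>Makes N k at least m + 1 on \<open>C\<close>, so that N k / (1 + N k) is
      within 1/(m+1) of 1 there.\<close>
    define N where "N = real (Suc m) / k x0"
    have N: "0 < N" using K(5)[OF x0(1)] by (simp add: N_def)
    define \<theta> where "\<theta> x = (N * k x) * inverse (1 + N * k x)" for x
    have Nk: "0 \<le> N * k x" for x using N K(4) by (simp add: less_imp_le)
    have "\<theta> \<in> Cc K"
    proof -
      have "smooth_on UNIV \<theta>" unfolding \<theta>_def[abs_def]
        by (intro smooth_fraction smooth_on_mult smooth_on_const open_UNIV CcD(1)[OF K(3)] Nk)
      thus ?thesis using CcD(2)[OF K(3)] by (auto simp: Cc_def \<theta>_def)
    qed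
    moreover have "1 - inverse (real (Suc m)) \<le> \<theta> x" if "x \<in> C" for x
    proof -
      have "real (Suc m) = N * k x0" using K(5)[OF x0(1)] by (simp add: N_def)
      also have "\<dots> \<le> N * k x" using x0(2)[OF that] N by (intro mult_left_mono) auto
      finally have "inverse (1 + N * k x) \<le> inverse (real (Suc m))" by (intro le_imp_inverse_le) auto
      moreover have "\<theta> x = 1 - inverse (1 + N * k x)" using Nk[of x] by (simp add: \<theta>_def field_simps add_nonneg_eq_0_iff)
      ultimately show ?thesis by simp
    qed
    moreover have "0 \<le> \<theta> x \<and> \<theta> x \<le> 1" for x
      using Nk[of x] by (simp add: \<theta>_def divide_inverse[symmetric] divide_le_eq_1)
    moreover have "\<theta> x = 0" if "x \<notin> O' m" for x using that K(2) CcD(2)[OF \<open>\<theta> \<in> Cc K\<close>] by blast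
    moreover have "K \<subseteq> D" using K(2) by (auto simp: O'_def)
    ultimately show ?thesis using T_I[OF K(1)] by blast
  qed
  then obtain \<theta> where \<theta>: "\<And>m. \<theta> m \<in> T" "\<And>m x. 0 \<le> \<theta> m x \<and> \<theta> m x \<le> 1" "\<And>m x. x \<notin> O' m \<Longrightarrow> \<theta> m x = 0"
     "\<And>m x. x \<in> C \<Longrightarrow> 1 - inverse (real (Suc m)) \<le> \<theta> m x" by metis
  have gm[measurable]: "g \<in> borel_measurable M" using g by simp
  have \<theta>m[measurable]: "\<theta> m \<in> borel_measurable M" for m by (rule borel_imp_M[OF T_measurable[OF \<theta>(1)]])
  have Cm: "(\<lambda>x. indicator C x :: real) \<in> borel_measurable M"
    by (rule borel_imp_M) (use C in \<open>auto intro!: borel_measurable_indicator borel_closed compact_imp_closed\<close>)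
  have "(\<lambda>m. \<integral>x. g x * \<theta> m x \<partial>M) \<longlonglongrightarrow> (\<integral>x. g x * indicator C x \<partial>M)"
  proof (rule integral_dominated_convergence[where w="\<lambda>x. \<bar>g x\<bar>"])
    show "AE x in M. (\<lambda>m. g x * \<theta> m x) \<longlonglongrightarrow> g x * indicator C x"
    proof (rule AE_I2)
      fix x
      have "(\<lambda>m. \<theta> m x) \<longlonglongrightarrow> indicator C x"
      proof (cases "x \<in> C")
        case True
        have l: "(\<lambda>m. 1 - inverse (real (Suc m))) \<longlonglongrightarrow> 1 - 0" by (intro tendsto_intros LIMSEQ_inverse_real_of_nat)
        hence l: "(\<lambda>m. 1 - inverse (real (Suc m))) \<longlonglongrightarrow> 1" by simp
        have "(\<lambda>m. \<theta> m x) \<longlonglongrightarrow> 1"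
          by (rule tendsto_sandwich[OF _ _ l tendsto_const]) (use \<theta>(2,4) True in auto)
        thus ?thesis using True by simp
      next
        case x: False
        have "infdist x C > 0" using infdist_pos_not_in_closed[OF compact_imp_closed[OF C(1)] False x] .
        then obtain m0 where m0: "inverse (real (Suc m0)) < infdist x C" using reals_Archimedean by blast
        have "\<theta> m x = 0" if "m \<ge> m0" for m
        proof (rule \<theta>(3))
          have "inverse (real (Suc m)) \<le> inverse (real (Suc m0))" using that by (intro le_imp_inverse_le) auto
          hence "\<not> infdist x C < inverse (real (Suc m))" using m0 by linarith
          thus "x \<notin> O' m" by (simp add: O'_def)
        qed
        hence "\<forall>\<^sub>F m in sequentially. \<theta> m x = 0" by (auto simp: eventually_sequentially)
        thus ?thesis using x by (simp add: tendsto_eventually)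
      qed
      thus "(\<lambda>m. g x * \<theta> m x) \<longlonglongrightarrow> g x * indicator C x" by (intro tendsto_intros)
    qed
    show "AE x in M. norm (g x * \<theta> m x) \<le> \<bar>g x\<bar>" for m
      using \<theta>(2)[of m] by (auto simp: abs_mult intro!: mult_left_le)
    show "integrable M (\<lambda>x. \<bar>g x\<bar>)" using g by simp
    show "(\<lambda>x. g x * indicator C x) \<in> borel_measurable M" using Cm by measurable
  qed measurable
  hence "(\<lambda>m::nat. 0) \<longlonglongrightarrow> (\<integral>x. g x * indicator C x \<partial>M)" by (simp only: orth[OF \<theta>(1)])
  thus ?thesis using LIMSEQ_unique[OF tendsto_const] by metis
qed

text \<open>A closed set inside {g > 0} carries zero integral of a positive function and is null;
  such sets exhaust {g > 0} up to arbitrarily small measure.\<close>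

lemma orthogonal_to_T_nonpos:
  assumes g: "integrable M g" and orth: "\<And>\<phi>. \<phi> \<in> T \<Longrightarrow> (\<integral>x. g x * \<phi> x \<partial>M) = 0"
  shows "AE x in M. g x \<le> 0"
proof -
  define S where "S = {x\<in>D. g x > 0}"
  have Sl: "S \<in> sets lebesgue"
  proof -
    have "{x \<in> space M. g x > 0} \<in> sets M" using g by measurable
    thus ?thesis using Dl by (auto simp: S_def sets_restrict_space_iff)
  qed
  have small: "emeasure lebesgue S \<le> ennreal e" if "e > 0" for e
  proof -
    obtain C where C: "closed C" "C \<subseteq> S" "S - C \<in> lmeasurable" "emeasure lebesgue (S - C) < ennreal e"
      using sets_lebesgue_inner_closed[OF Sl \<open>e > 0\<close>] by blast
    have CD: "C \<subseteq> D" using C(2) by (auto simp: S_def)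
    have cC: "compact C" using C(1) bounded_subset[OF D(2) CD] by (simp add: compact_eq_bounded_closed)
    have Cm: "(\<lambda>x. indicator C x :: real) \<in> borel_measurable M"
      by (rule borel_imp_M) (use C in \<open>auto intro!: borel_measurable_indicator borel_closed\<close>)
    have i: "integrable M (\<lambda>x. g x * indicator C x)"
      by (rule Bochner_Integration.integrable_bound[OF g]) (use Cm g in \<open>auto simp: indicator_def\<close>)
    have "AE x in M. g x * indicator C x = 0"
      using integral_compact_eq_0[OF g orth cC CD] integral_nonneg_eq_0_iff_AE[OF i] C(2)
      by (auto simp: S_def indicator_def less_imp_le subset_iff)
    hence "AE x in M. x \<notin> C"
    proof eventually_elim
      case (elim x) thus ?case using C(2) by (auto simp: S_def indicator_def split: if_splits)
    qed
    hence "AE x in lebesgue. x \<notin> C" using Dl CD by (subst (asm) AE_restrict_space_iff) auto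
    hence "emeasure lebesgue C = 0"
      using C(1) AE_iff_measurable[of C lebesgue "\<lambda>x. x \<notin> C"] by auto
    hence "emeasure lebesgue S = emeasure lebesgue (S - C)"
      using C(1) Sl by (subst emeasure_Diff_null_set) auto
    thus ?thesis using C(4) by simp
  qed
  have "emeasure lebesgue S \<le> 0"
    by (rule ennreal_le_epsilon) (use small in auto)
  hence "S \<in> null_sets lebesgue" using Sl by auto
  hence "AE x in lebesgue. x \<notin> S" by (rule AE_not_in)
  thus ?thesis using Dl by (subst AE_restrict_space_iff) (auto simp: S_def not_less)
qed

lemma sqi_integrable: "g \<in> sqi M \<Longrightarrow> integrable M g"
  using sqi_integrable_mult[of g M "\<lambda>x. 1"] by (simp add: sqi_def)

lemma orthogonal_to_T:
  assumes g: "g \<in> sqi M" and orth: "\<And>\<phi>. \<phi> \<in> T \<Longrightarrow> (\<integral>x. g x * \<phi> x \<partial>M) = 0"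
  shows "AE x in M. g x = 0"
proof -
  have "AE x in M. - g x \<le> 0"
    by (rule orthogonal_to_T_nonpos) (use sqi_integrable[OF g] orth in auto)
  thus ?thesis using orthogonal_to_T_nonpos[OF sqi_integrable[OF g] orth] by auto
qed

lemma has_dist_derivative_unique:
  assumes "has_dist_derivative D (Y j) u g" "has_dist_derivative D (Y j) u h" "g \<in> sqi M" "h \<in> sqi M"
  shows "AE x in M. g x = h x"
proof -
  have "AE x in M. g x - h x = 0"
  proof (rule orthogonal_to_T[OF sqi_diff[OF assms(3,4)]])
    fix \<phi> assume p: "\<phi> \<in> T"
    show "(\<integral>x. (g x - h x) * \<phi> x \<partial>M) = 0"
      using assms(1,2) p sqi_integrable_mult[OF assms(3) T_sqi[OF p]] sqi_integrable_mult[OF assms(4) T_sqi[OF p]]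
      by (simp add: has_dist_derivative_iff left_diff_distrib)
  qed
  thus ?thesis by auto
qed

lemma has_dist_derivative_limit:
  assumes j: "j \<in> {1..n}" and d: "\<And>m. has_dist_derivative D (Y j) (u m) (g m)"
    and s: "\<And>m. u m \<in> sqi M" "\<And>m. g m \<in> sqi M" "v \<in> sqi M" "h \<in> sqi M"
    and l: "(\<lambda>m. nrm2 M (\<lambda>x. u m x - v x)) \<longlonglongrightarrow> 0" "(\<lambda>m. nrm2 M (\<lambda>x. g m x - h x)) \<longlonglongrightarrow> 0"
  shows "has_dist_derivative D (Y j) v h"
  unfolding has_dist_derivative_iff
proof
  fix \<phi> assume p: "\<phi> \<in> T"
  have "(\<lambda>m. \<integral>x. g m x * \<phi> x \<partial>M) \<longlonglongrightarrow> (\<integral>x. h x * \<phi> x \<partial>M)"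
    by (rule nrm2_tendsto_imp_tendsto_integral[OF s(4,2) T_sqi[OF p] l(2)])
  moreover have "(\<lambda>m. - (\<integral>x. u m x * adj j \<phi> x \<partial>M)) \<longlonglongrightarrow> - (\<integral>x. v x * adj j \<phi> x \<partial>M)"
    by (intro tendsto_minus nrm2_tendsto_imp_tendsto_integral[OF s(3,1) T_sqi[OF T_adj[OF p j]] l(1)])
  moreover have "(\<lambda>m. \<integral>x. g m x * \<phi> x \<partial>M) = (\<lambda>m. - (\<integral>x. u m x * adj j \<phi> x \<partial>M))"
    using d p by (auto simp: has_dist_derivative_iff)
  ultimately show "(\<integral>x. h x * \<phi> x \<partial>M) = - (\<integral>x. v x * adj j \<phi> x \<partial>M)" using LIMSEQ_unique by (simp only:)
qed

text \<open>
  An element of the energy space is handled as the family of its function (index \<open>0\<close>) and its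
  derivatives along \<open>Y 1, \<dots>, Y n\<close>, so that its norm is an \<open>\<ell>\<^sup>2\<close>-sum of \<open>L\<^sup>2\<close>-norms.
\<close>

definition jet :: "(real ^ 'd \<Rightarrow> real) \<Rightarrow> nat \<Rightarrow> real ^ 'd \<Rightarrow> real" where
  "jet \<phi> j = (if j = 0 then \<phi> else deriv_along (Y j) \<phi>)"

definition hn :: "(nat \<Rightarrow> real ^ 'd \<Rightarrow> real) \<Rightarrow> real" where
  "hn h = L2_set (\<lambda>j. nrm2 M (h j)) {..n}"

definition hsub :: "(nat \<Rightarrow> real ^ 'd \<Rightarrow> real) \<Rightarrow> (nat \<Rightarrow> real ^ 'd \<Rightarrow> real) \<Rightarrow> nat \<Rightarrow> real ^ 'd \<Rightarrow> real" where
  "hsub g h = (\<lambda>j x. g j x - h j x)"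

definition sq :: "(nat \<Rightarrow> real ^ 'd \<Rightarrow> real) \<Rightarrow> bool" where "sq h \<longleftrightarrow> (\<forall>j\<le>n. h j \<in> sqi M)"

text \<open>The closure, component by component, of the families of test functions and their
  derivatives. Unlike \<open>dist_derivative\<close>, which is a choice, the components obey the
  linear operations exactly, so the vector space structure and completeness are direct;
  \<open>W12_0_iff\<close> gives the link to \<open>W12_0\<close>.\<close>

definition W0 :: "(nat \<Rightarrow> real ^ 'd \<Rightarrow> real) \<Rightarrow> bool" where
  "W0 h \<longleftrightarrow> sq h \<and> (\<forall>e>0. \<exists>\<phi>\<in>T. hn (hsub (jet \<phi>) h) < e)"

lemma hn_ge0: "0 \<le> hn h" by (simp add: hn_def)
lemma hn_component: "j \<le> n \<Longrightarrow> nrm2 M (h j) \<le> hn h"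
  unfolding hn_def by (rule member_le_L2_set) auto
lemma hn_square: "(hn h)\<^sup>2 = (\<Sum>j\<le>n. (nrm2 M (h j))\<^sup>2)"
  by (simp add: hn_def L2_set_def sum_nonneg)
lemma hn_le_sum: "hn h \<le> (\<Sum>j\<le>n. nrm2 M (h j))"
  unfolding hn_def by (rule L2_set_le_sum) (simp add: nrm2_ge0)

lemma jet_T: "\<phi> \<in> T \<Longrightarrow> j \<le> n \<Longrightarrow> jet \<phi> j \<in> T" by (auto simp: jet_def intro: T_along)
lemma sq_jet: "\<phi> \<in> T \<Longrightarrow> sq (jet \<phi>)" by (simp add: sq_def jet_T T_sqi)
lemma sq_hsub: "sq g \<Longrightarrow> sq h \<Longrightarrow> sq (hsub g h)" by (simp add: sq_def hsub_def sqi_diff)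

lemma hn_triangle:
  assumes "sq g" "sq h" shows "hn (\<lambda>j x. g j x + h j x) \<le> hn g + hn h"
proof -
  have "hn (\<lambda>j x. g j x + h j x) \<le> L2_set (\<lambda>j. nrm2 M (g j) + nrm2 M (h j)) {..n}"
    unfolding hn_def by (rule L2_set_mono) (use assms in \<open>auto simp: sq_def nrm2_ge0 intro: nrm2_triangle\<close>)
  also have "\<dots> \<le> hn g + hn h" unfolding hn_def by (rule L2_set_triangle_ineq)
  finally show ?thesis .
qed

lemma hn_hsub_triangle:
  assumes "sq f" "sq g" "sq h" shows "hn (hsub f h) \<le> hn (hsub f g) + hn (hsub g h)"
  using hn_triangle[OF sq_hsub[OF assms(1,2)] sq_hsub[OF assms(2,3)]] by (simp add: hsub_def)

lemma hn_hsub_commute: "hn (hsub f g) = hn (hsub g f)"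
  by (simp add: hn_def hsub_def nrm2_minus_commute[of M "f _"])

lemma hn_cmult: "hn (\<lambda>j x. c * h j x) = \<bar>c\<bar> * hn h"
  by (simp add: hn_def nrm2_cmult L2_set_right_distrib[symmetric])

lemma hn_le_hsub: assumes "sq f" "sq g" shows "hn f \<le> hn g + hn (hsub f g)"
  using hn_triangle[OF assms(2) sq_hsub[OF assms]] by (simp add: hsub_def)

lemma hn_parallelogram:
  assumes "sq g" "sq h"
  shows "(hn (\<lambda>j x. g j x + h j x))\<^sup>2 + (hn (hsub g h))\<^sup>2 = 2 * (hn g)\<^sup>2 + 2 * (hn h)\<^sup>2"
proof -
  have "(nrm2 M (\<lambda>x. g j x + h j x))\<^sup>2 + (nrm2 M (\<lambda>x. g j x - h j x))\<^sup>2 = 2 * (nrm2 M (g j))\<^sup>2 + 2 * (nrm2 M (h j))\<^sup>2" if "j \<le> n" for j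
  proof -
    have s: "g j \<in> sqi M" "h j \<in> sqi M" using assms that by (auto simp: sq_def)
    have "(nrm2 M (\<lambda>x. g j x + h j x))\<^sup>2 + (nrm2 M (\<lambda>x. g j x - h j x))\<^sup>2 = (\<integral>x. (g j x + h j x)\<^sup>2 + (g j x - h j x)\<^sup>2 \<partial>M)"
      unfolding nrm2_sq using sqi_square[OF sqi_add[OF s]] sqi_square[OF sqi_diff[OF s]] by simp
    also have "\<dots> = (\<integral>x. 2 * (g j x)\<^sup>2 + 2 * (h j x)\<^sup>2 \<partial>M)"
      by (rule Bochner_Integration.integral_cong) (auto simp: power2_eq_square algebra_simps)
    also have "\<dots> = 2 * (nrm2 M (g j))\<^sup>2 + 2 * (nrm2 M (h j))\<^sup>2"
      unfolding nrm2_sq using sqi_square[OF s(1)] sqi_square[OF s(2)] by simp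
    finally show ?thesis .
  qed
  thus ?thesis unfolding hn_square hsub_def by (simp add: sum.distrib[symmetric] sum_distrib_left)
qed

lemma hn_tendsto_iff: "((\<lambda>m. hn (hsub (f m) h)) \<longlonglongrightarrow> 0) \<longleftrightarrow> (\<forall>j\<le>n. (\<lambda>m. nrm2 M (\<lambda>x. f m j x - h j x)) \<longlonglongrightarrow> 0)"
proof safe
  fix j assume l: "(\<lambda>m. hn (hsub (f m) h)) \<longlonglongrightarrow> 0" and j: "j \<le> n"
  show "(\<lambda>m. nrm2 M (\<lambda>x. f m j x - h j x)) \<longlonglongrightarrow> 0"
    by (rule tendsto_sandwich[OF _ _ tendsto_const l])
      (use hn_component[OF j, of "hsub _ h"] in \<open>auto simp: nrm2_ge0 hsub_def\<close>)
next
  assume a: "\<forall>j\<le>n. (\<lambda>m. nrm2 M (\<lambda>x. f m j x - h j x)) \<longlonglongrightarrow> 0"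
  have "(\<lambda>m. \<Sum>j\<le>n. nrm2 M (\<lambda>x. f m j x - h j x)) \<longlonglongrightarrow> (\<Sum>j\<le>n. 0)" by (intro tendsto_sum) (use a in auto)
  hence l: "(\<lambda>m. \<Sum>j\<le>n. nrm2 M (\<lambda>x. f m j x - h j x)) \<longlonglongrightarrow> 0" by simp
  show "(\<lambda>m. hn (hsub (f m) h)) \<longlonglongrightarrow> 0"
    by (rule tendsto_sandwich[OF _ _ tendsto_const l]) (use hn_le_sum[of "hsub _ h"] in \<open>auto simp: hn_ge0 hsub_def\<close>)
qed

lemma W0_sq: "W0 h \<Longrightarrow> sq h" by (simp add: W0_def)

lemma W0_sequence:
  assumes "W0 h" obtains \<phi> where "\<And>m. \<phi> m \<in> T" "(\<lambda>m. hn (hsub (jet (\<phi> m)) h)) \<longlonglongrightarrow> 0"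
    "\<And>m. hn (hsub (jet (\<phi> m)) h) < inverse (real (Suc m))"
proof -
  have "\<exists>\<phi>. \<phi> \<in> T \<and> hn (hsub (jet \<phi>) h) < inverse (real (Suc m))" for m
    using assms unfolding W0_def by (meson inverse_positive_iff_positive of_nat_0_less_iff zero_less_Suc)
  then obtain \<phi> where \<phi>: "\<And>m. \<phi> m \<in> T" "\<And>m. hn (hsub (jet (\<phi> m)) h) < inverse (real (Suc m))" by metis
  have "(\<lambda>m. hn (hsub (jet (\<phi> m)) h)) \<longlonglongrightarrow> 0"
    by (rule tendsto_sandwich[OF _ _ tendsto_const LIMSEQ_inverse_real_of_nat])
      (use \<phi>(2) in \<open>auto simp: hn_ge0 less_imp_le\<close>)
  thus ?thesis using that \<phi> by blast
qed

lemma W0_closed: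
  assumes "\<And>m. W0 (f m)" "sq h" "(\<lambda>m. hn (hsub (f m) h)) \<longlonglongrightarrow> 0" shows "W0 h"
  unfolding W0_def
proof (intro conjI allI impI assms(2))
  fix e :: real assume e: "e > 0"
  then obtain m where m: "hn (hsub (f m) h) < e/2"
    using LIMSEQ_D[OF assms(3), of "e/2"] by (auto simp: hn_ge0)
  obtain \<phi> where p: "\<phi> \<in> T" "hn (hsub (jet \<phi>) (f m)) < e/2" using assms(1)[of m] e unfolding W0_def by (meson half_gt_zero)
  have "hn (hsub (jet \<phi>) h) \<le> hn (hsub (jet \<phi>) (f m)) + hn (hsub (f m) h)"
    by (rule hn_hsub_triangle[OF sq_jet[OF p(1)] W0_sq[OF assms(1)] assms(2)])
  thus "\<exists>\<phi>\<in>T. hn (hsub (jet \<phi>) h) < e" using p m by (intro bexI[of _ \<phi>]) auto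
qed

lemma W0_jet: "\<phi> \<in> T \<Longrightarrow> W0 (jet \<phi>)"
proof -
  assume p: "\<phi> \<in> T"
  have "hn (hsub (jet \<phi>) (jet \<phi>)) = 0" by (simp add: hn_def hsub_def L2_set_def)
  thus ?thesis unfolding W0_def using sq_jet[OF p] p by (metis)
qed

lemma jet_add: "\<phi> \<in> T \<Longrightarrow> \<psi> \<in> T \<Longrightarrow> jet (\<lambda>x. \<phi> x + \<psi> x) = (\<lambda>j x. jet \<phi> j x + jet \<psi> j x)"
  by (auto simp: jet_def fun_eq_iff deriv_along_add T_differentiable)
lemma jet_diff: "\<phi> \<in> T \<Longrightarrow> \<psi> \<in> T \<Longrightarrow> jet (\<lambda>x. \<phi> x - \<psi> x) = hsub (jet \<phi>) (jet \<psi>)"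
  by (auto simp: jet_def hsub_def fun_eq_iff deriv_along_diff T_differentiable)
lemma jet_cmult: "\<phi> \<in> T \<Longrightarrow> jet (\<lambda>x. c * \<phi> x) = (\<lambda>j x. c * jet \<phi> j x)"
  by (auto simp: jet_def fun_eq_iff deriv_along_cmult T_differentiable)

lemma W0_add: assumes "W0 g" "W0 h" shows "W0 (\<lambda>j x. g j x + h j x)"
  unfolding W0_def
proof (intro conjI allI impI)
  show "sq (\<lambda>j x. g j x + h j x)" using assms by (auto simp: W0_def sq_def intro: sqi_add)
  fix e :: real assume "e > 0"
  then obtain \<phi> \<psi> where p: "\<phi> \<in> T" "hn (hsub (jet \<phi>) g) < e/2" "\<psi> \<in> T" "hn (hsub (jet \<psi>) h) < e/2"
    using assms unfolding W0_def by (meson half_gt_zero)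
  have "hn (hsub (jet (\<lambda>x. \<phi> x + \<psi> x)) (\<lambda>j x. g j x + h j x)) = hn (\<lambda>j x. hsub (jet \<phi>) g j x + hsub (jet \<psi>) h j x)"
    by (simp add: jet_add[OF p(1,3)] hsub_def algebra_simps)
  also have "\<dots> \<le> hn (hsub (jet \<phi>) g) + hn (hsub (jet \<psi>) h)"
    by (intro hn_triangle sq_hsub sq_jet p W0_sq assms)
  finally show "\<exists>\<phi>\<in>T. hn (hsub (jet \<phi>) (\<lambda>j x. g j x + h j x)) < e"
    using p T_add[OF p(1,3)] by (intro bexI[of _ "\<lambda>x. \<phi> x + \<psi> x"]) auto
qed

lemma W0_cmult: assumes "W0 h" shows "W0 (\<lambda>j x. c * h j x)"
  unfolding W0_def
proof (intro conjI allI impI)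
  show "sq (\<lambda>j x. c * h j x)" using assms by (auto simp: W0_def sq_def intro: sqi_cmult)
  fix e :: real assume "e > 0"
  hence "e / (\<bar>c\<bar> + 1) > 0" by (simp add: add_nonneg_pos)
  then obtain \<phi> where p: "\<phi> \<in> T" "hn (hsub (jet \<phi>) h) < e / (\<bar>c\<bar> + 1)"
    using assms unfolding W0_def by blast
  have "hn (hsub (jet (\<lambda>x. c * \<phi> x)) (\<lambda>j x. c * h j x)) = \<bar>c\<bar> * hn (hsub (jet \<phi>) h)"
    using hn_cmult[of c "hsub (jet \<phi>) h"] by (simp add: jet_cmult[OF p(1)] hsub_def right_diff_distrib)
  also have "\<dots> \<le> (\<bar>c\<bar> + 1) * hn (hsub (jet \<phi>) h)" by (intro mult_right_mono) (auto simp: hn_ge0)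
  also have "\<dots> < e" using p(2) by (simp add: less_divide_eq add_nonneg_pos mult.commute)
  finally show "\<exists>\<phi>\<in>T. hn (hsub (jet \<phi>) (\<lambda>j x. c * h j x)) < e"
    using T_cmult[OF p(1)] by (intro bexI[of _ "\<lambda>x. c * \<phi> x"])
qed

lemma W0_0: "W0 (\<lambda>j x. 0)"
proof -
  have "jet (\<lambda>x. 0) = (\<lambda>j x. 0)" by (auto simp: jet_def fun_eq_iff)
  thus ?thesis using W0_jet[OF T_0] by simp
qed

lemma W0_sum: "(\<And>i. i \<in> I \<Longrightarrow> W0 (h i)) \<Longrightarrow> W0 (\<lambda>j x. \<Sum>i\<in>I. h i j x)"
  by (induction I rule: infinite_finite_induct) (auto intro: W0_0 W0_add)

lemma W0_hsub: "W0 g \<Longrightarrow> W0 h \<Longrightarrow> W0 (hsub g h)"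
  using W0_add[of g "\<lambda>j x. (-1) * h j x"] W0_cmult[of h "-1"] by (simp add: hsub_def)

lemma W0_complete:
  assumes f: "\<And>m. W0 (f m)" and C: "\<And>e. e > 0 \<Longrightarrow> \<exists>N. \<forall>m\<ge>N. \<forall>l\<ge>N. hn (hsub (f m) (f l)) \<le> e"
  obtains h where "W0 h" "(\<lambda>m. hn (hsub (f m) h)) \<longlonglongrightarrow> 0"
proof -
  have "\<forall>j. \<exists>u. j \<le> n \<longrightarrow> u \<in> sqi M \<and> (\<lambda>m. nrm2 M (\<lambda>x. f m j x - u x)) \<longlonglongrightarrow> 0"
  proof (intro allI)
    fix j
    have "\<exists>u. u \<in> sqi M \<and> (\<lambda>m. nrm2 M (\<lambda>x. f m j x - u x)) \<longlonglongrightarrow> 0" if j: "j \<le> n"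
  proof -
    have cau: "\<exists>N. \<forall>m\<ge>N. \<forall>l\<ge>N. nrm2 M (\<lambda>x. f m j x - f l j x) \<le> e" if e: "e > 0" for e
    proof -
      obtain N where N: "\<forall>m\<ge>N. \<forall>l\<ge>N. hn (hsub (f m) (f l)) \<le> e" using C[OF e] by blast
      have "nrm2 M (\<lambda>x. f m j x - f l j x) \<le> hn (hsub (f m) (f l))" for m l
        using hn_component[OF j, of "hsub (f m) (f l)"] by (simp add: hsub_def)
      thus ?thesis using N order_trans by blast
    qed
    have fs: "f m j \<in> sqi M" for m using W0_sq[OF f] j by (simp add: sq_def)
    show ?thesis
    proof (rule sqi_complete[OF finite_M, of "\<lambda>m. f m j", OF fs cau])
      fix u assume "u \<in> sqi M" "(\<lambda>m. nrm2 M (\<lambda>x. f m j x - u x)) \<longlonglongrightarrow> 0"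
      thus ?thesis by blast
    qed
  qed
    thus "\<exists>u. j \<le> n \<longrightarrow> u \<in> sqi M \<and> (\<lambda>m. nrm2 M (\<lambda>x. f m j x - u x)) \<longlonglongrightarrow> 0" by blast
  qed
  from choice[OF this] obtain h where h: "\<And>j. j \<le> n \<Longrightarrow> h j \<in> sqi M \<and> (\<lambda>m. nrm2 M (\<lambda>x. f m j x - h j x)) \<longlonglongrightarrow> 0" by blast
  hence l: "(\<lambda>m. hn (hsub (f m) h)) \<longlonglongrightarrow> 0" by (simp add: hn_tendsto_iff)
  have "sq h" using h by (simp add: sq_def)
  thus ?thesis using that[OF W0_closed[OF f _ l] l] by blast
qed

lemma W0_has_dist_derivative:
  assumes "W0 h" "j \<in> {1..n}" shows "has_dist_derivative D (Y j) (h 0) (h j)"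
proof -
  obtain \<phi> where p: "\<And>m. \<phi> m \<in> T" "(\<lambda>m. hn (hsub (jet (\<phi> m)) h)) \<longlonglongrightarrow> 0" using W0_sequence[OF assms(1)] by metis
  have l: "(\<lambda>m. nrm2 M (\<lambda>x. jet (\<phi> m) j x - h j x)) \<longlonglongrightarrow> 0" if "j \<le> n" for j using p(2) that by (simp add: hn_tendsto_iff)
  have s: "h j \<in> sqi M" if "j \<le> n" for j using W0_sq[OF assms(1)] that by (simp add: sq_def)
  show ?thesis
  proof (rule has_dist_derivative_limit[OF assms(2) T_has_dist_derivative[OF p(1) assms(2)] T_sqi[OF p(1)] T_sqi[OF T_along[OF p(1) assms(2)]]])
    show "(\<lambda>m. nrm2 M (\<lambda>x. \<phi> m x - h 0 x)) \<longlonglongrightarrow> 0" using l[of 0] by (simp add: jet_def)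
    show "(\<lambda>m. nrm2 M (\<lambda>x. deriv_along (Y j) (\<phi> m) x - h j x)) \<longlonglongrightarrow> 0" using l[of j] assms(2) by (simp add: jet_def)
  qed (use s assms(2) in auto)
qed

section \<open>Comparison with the energy space built from chosen distributional derivatives\<close>

abbreviation dd where "dd j u \<equiv> dist_derivative D (Y j) u"

lemma dd_works:
  assumes "g \<in> sqi M" "has_dist_derivative D (Y j) u g"
  shows "dd j u \<in> sqi M" "has_dist_derivative D (Y j) u (dd j u)" "AE x in M. dd j u x = g x"
proof -
  have "dd j u \<in> L2 D \<and> has_dist_derivative D (Y j) u (dd j u)"
    unfolding dist_derivative_def by (rule someI[of _ g]) (use assms L2_eq in auto)
  thus 1: "dd j u \<in> sqi M" "has_dist_derivative D (Y j) u (dd j u)" by (auto simp: L2_eq)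
  show "AE x in M. dd j u x = g x" by (rule has_dist_derivative_unique[OF 1(2) assms(2) 1(1) assms(1)])
qed

definition wjet :: "(real ^ 'd \<Rightarrow> real) \<Rightarrow> nat \<Rightarrow> real ^ 'd \<Rightarrow> real" where
  "wjet u j = (if j = 0 then u else dd j u)"

lemma norm_H_eq: "norm_H D n Y u = hn (wjet u)"
proof -
  have "(\<Sum>j\<le>n. (nrm2 M (wjet u j))\<^sup>2) = (nrm2 M u)\<^sup>2 + (\<Sum>j=1..n. (nrm2 M (dd j u))\<^sup>2)"
  proof -
    have "{..n} = insert 0 {1..n}" by auto
    thus ?thesis by (simp add: wjet_def)
  qed
  thus ?thesis unfolding hn_def L2_set_def norm_H_def nrm2_sq by simp
qed

lemma hn_cong_AE:
  assumes "sq g" "sq h" "\<And>j. j \<le> n \<Longrightarrow> AE x in M. g j x = h j x" shows "hn g = hn h"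
  unfolding hn_def
  by (rule L2_set_cong) (use assms in \<open>auto simp: sq_def intro!: nrm2_cong_AE sqi_measurable\<close>)

lemma W0_cong_AE:
  assumes "W0 g" "sq h" "\<And>j. j \<le> n \<Longrightarrow> AE x in M. g j x = h j x" shows "W0 h"
proof (rule W0_closed[of "\<lambda>m. g"])
  have "hn (hsub g h) = hn (\<lambda>j x. 0)"
    by (rule hn_cong_AE[OF sq_hsub[OF W0_sq[OF assms(1)] assms(2)]])
      (use assms(3) in \<open>auto simp: sq_def sqi_0 hsub_def\<close>)
  thus "(\<lambda>m. hn (hsub g h)) \<longlonglongrightarrow> 0" by (simp add: hn_def L2_set_def)
qed (use assms in auto)

lemma has_dist_derivative_cong:
  assumes "AE x in M. u x = v x" "u \<in> borel_measurable M" "v \<in> borel_measurable M" "j \<in> {1..n}" "has_dist_derivative D (Y j) u g"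
  shows "has_dist_derivative D (Y j) v g"
  unfolding has_dist_derivative_iff
proof
  fix \<phi> assume p: "\<phi> \<in> T"
  have [measurable]: "adj j \<phi> \<in> borel_measurable M" by (rule borel_imp_M[OF T_measurable[OF T_adj[OF p assms(4)]]])
  have "(\<integral>x. u x * adj j \<phi> x \<partial>M) = (\<integral>x. v x * adj j \<phi> x \<partial>M)"
    by (rule integral_cong_AE) (use assms in auto)
  thus "(\<integral>x. g x * \<phi> x \<partial>M) = - (\<integral>x. v x * adj j \<phi> x \<partial>M)" using assms(5) p by (simp add: has_dist_derivative_iff)
qed

lemma W12_iff: "u \<in> W12 D n Y \<longleftrightarrow> u \<in> sqi M \<and> (\<forall>j\<in>{1..n}. \<exists>g\<in>sqi M. has_dist_derivative D (Y j) u g)"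
  by (simp add: W12_def L2_eq)

lemma has_dist_derivative_diff:
  assumes "has_dist_derivative D (Y j) u g" "has_dist_derivative D (Y j) v h" "j \<in> {1..n}"
    "u \<in> sqi M" "v \<in> sqi M" "g \<in> sqi M" "h \<in> sqi M"
  shows "has_dist_derivative D (Y j) (\<lambda>x. u x - v x) (\<lambda>x. g x - h x)"
  unfolding has_dist_derivative_iff
proof
  fix \<phi> assume p: "\<phi> \<in> T"
  show "(\<integral>x. (g x - h x) * \<phi> x \<partial>M) = - (\<integral>x. (u x - v x) * adj j \<phi> x \<partial>M)"
    using assms(1,2) p sqi_integrable_mult[OF assms(6) T_sqi[OF p]] sqi_integrable_mult[OF assms(7) T_sqi[OF p]]
      sqi_integrable_mult[OF assms(4) T_sqi[OF T_adj[OF p assms(3)]]] sqi_integrable_mult[OF assms(5) T_sqi[OF T_adj[OF p assms(3)]]]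
    by (simp add: has_dist_derivative_iff left_diff_distrib)
qed

text \<open>The chosen derivative of u - \<phi> agrees almost everywhere with the difference of the
  derivatives, by uniqueness; hence the distance in \<open>norm_H\<close> is the distance of the
  families.\<close>

lemma W12_0_iff: "u \<in> W12_0 D n Y \<longleftrightarrow> W0 (wjet u)"
proof -
  have eq: "norm_H D n Y (\<lambda>x. u x - \<phi> x) = hn (hsub (jet \<phi>) (wjet u))"
    if u: "u \<in> sqi M" "\<And>j. j \<in> {1..n} \<Longrightarrow> dd j u \<in> sqi M \<and> has_dist_derivative D (Y j) u (dd j u)" and p: "\<phi> \<in> T" for \<phi>
  proof -
    have d: "has_dist_derivative D (Y j) (\<lambda>x. u x - \<phi> x) (\<lambda>x. dd j u x - deriv_along (Y j) \<phi> x)" if j: "j \<in> {1..n}" for j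
      by (rule has_dist_derivative_diff) (use u p j T_has_dist_derivative T_sqi T_along in auto)
    have s: "(\<lambda>x. dd j u x - deriv_along (Y j) \<phi> x) \<in> sqi M" if j: "j \<in> {1..n}" for j
      by (rule sqi_diff[OF conjunct1[OF u(2)[OF j]] T_sqi[OF T_along[OF p j]]])
    note w = dd_works[OF s d]
    have "hn (wjet (\<lambda>x. u x - \<phi> x)) = hn (hsub (wjet u) (jet \<phi>))"
    proof (rule hn_cong_AE)
      show "sq (wjet (\<lambda>x. u x - \<phi> x))" unfolding sq_def wjet_def using w(1) sqi_diff[OF u(1) T_sqi[OF p]] by auto
      show "sq (hsub (wjet u) (jet \<phi>))" by (rule sq_hsub[OF _ sq_jet[OF p]]) (use u in \<open>auto simp: sq_def wjet_def\<close>)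
      show "AE x in M. wjet (\<lambda>x. u x - \<phi> x) j x = hsub (wjet u) (jet \<phi>) j x" if "j \<le> n" for j
        using w(3)[of j] that by (cases "j = 0") (auto simp: wjet_def hsub_def jet_def)
    qed
    thus ?thesis by (simp add: norm_H_eq hn_hsub_commute)
  qed
  show ?thesis
  proof
    assume a: "u \<in> W12_0 D n Y"
    hence W: "u \<in> sqi M" "\<forall>j\<in>{1..n}. \<exists>g\<in>sqi M. has_dist_derivative D (Y j) u g" by (auto simp: W12_0_def W12_iff)
    hence d: "dd j u \<in> sqi M \<and> has_dist_derivative D (Y j) u (dd j u)" if "j \<in> {1..n}" for j using dd_works that by blast
    have "sq (wjet u)" using W(1) d by (auto simp: sq_def wjet_def)
    moreover have "\<exists>\<phi>\<in>T. hn (hsub (jet \<phi>) (wjet u)) < e" if "e > 0" for e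
      using a that eq[OF W(1) d] by (auto simp: W12_0_def)
    ultimately show "W0 (wjet u)" by (simp add: W0_def)
  next
    assume a: "W0 (wjet u)"
    have u: "u \<in> sqi M" using W0_sq[OF a] by (auto simp: sq_def wjet_def dest: spec[of _ 0])
    have d: "dd j u \<in> sqi M \<and> has_dist_derivative D (Y j) u (dd j u)" if j: "j \<in> {1..n}" for j
      using W0_has_dist_derivative[OF a j] W0_sq[OF a] j by (auto simp: sq_def wjet_def dest: spec[of _ j])
    have "u \<in> W12 D n Y" unfolding W12_iff using u d by blast
    thus "u \<in> W12_0 D n Y" using a eq[OF u d] by (auto simp: W12_0_def W0_def)
  qed
qed

text \<open>Any measurable representative of the function may be used: the derivatives chosen for it
  agree almost everywhere with the components of \<open>h\<close>.\<close>

lemma W0_imp_W12_0: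
  assumes "W0 h" "u \<in> borel_measurable M" "AE x in M. u x = h 0 x"
  shows "u \<in> W12_0 D n Y" "\<And>j. j \<le> n \<Longrightarrow> AE x in M. wjet u j x = h j x" "hn (wjet u) = hn h"
proof -
  have h: "h j \<in> sqi M" if "j \<le> n" for j using W0_sq[OF assms(1)] that by (simp add: sq_def)
  have u: "u \<in> sqi M" by (rule sqi_cong_AE[OF h[of 0] assms(2,3)]) simp
  have d: "has_dist_derivative D (Y j) u (h j)" if "j \<in> {1..n}" for j
    by (rule has_dist_derivative_cong[OF _ _ assms(2) that W0_has_dist_derivative[OF assms(1) that]])
      (use assms(3) h[of 0] in \<open>auto intro: sqi_measurable\<close>)
  have dw: "dd j u \<in> sqi M" "AE x in M. dd j u x = h j x" if "j \<in> {1..n}" for j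
    using dd_works[OF h d[OF that]] that by auto
  show ae: "AE x in M. wjet u j x = h j x" if "j \<le> n" for j
    using dw(2)[of j] assms(3) that by (cases "j = 0") (auto simp: wjet_def)
  have sqw: "sq (wjet u)" using u dw(1) by (auto simp: sq_def wjet_def)
  show "u \<in> W12_0 D n Y" unfolding W12_0_iff
  proof (rule W0_cong_AE[OF assms(1) sqw])
    show "AE x in M. h j x = wjet u j x" if "j \<le> n" for j using ae[OF that] by eventually_elim simp
  qed
  show "hn (wjet u) = hn h" by (rule hn_cong_AE[OF sqw W0_sq[OF assms(1)] ae])
qed

end

text \<open>Closure under midpoints suffices to apply the parallelogram law and is easier to handle than convex hulls of functions.\<close>

inductive_set midhull :: "(nat \<Rightarrow> nat \<Rightarrow> 'a \<Rightarrow> real) \<Rightarrow> nat \<Rightarrow> (nat \<Rightarrow> 'a \<Rightarrow> real) set"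
  for f :: "nat \<Rightarrow> nat \<Rightarrow> 'a \<Rightarrow> real" and N :: nat where
  base: "N \<le> m \<Longrightarrow> f m \<in> midhull f N"
| mid: "a \<in> midhull f N \<Longrightarrow> b \<in> midhull f N \<Longrightarrow> (\<lambda>j x. (1/2) * (a j x + b j x)) \<in> midhull f N"

lemma midhull_mono: "a \<in> midhull f N' \<Longrightarrow> N \<le> N' \<Longrightarrow> a \<in> midhull f N"
proof (induction rule: midhull.induct)
  case (base m) thus ?case by (intro midhull.base) simp
next
  case (mid a b) thus ?case by (intro midhull.mid)
qed

context energy_space
begin

lemma midhull_W0: assumes "\<And>m. W0 (f m)" "a \<in> midhull f N" shows "W0 a"
  using assms(2)
proof (induction rule: midhull.induct)
  case (base m) show ?case by (rule assms(1))
next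
  case (mid a b) show ?case by (rule W0_cmult[OF W0_add[OF mid.IH]])
qed

lemma midhull_near:
  assumes f: "\<And>m. W0 (f m)" and a: "a \<in> midhull f N" and u: "u \<in> sqi M" and e: "\<And>m. m \<ge> N \<Longrightarrow> nrm2 M (\<lambda>x. f m 0 x - u x) \<le> e"
  shows "nrm2 M (\<lambda>x. a 0 x - u x) \<le> e"
  using a
proof (induction rule: midhull.induct)
  case (mid a b)
  have s: "a 0 \<in> sqi M" "b 0 \<in> sqi M" using W0_sq[OF midhull_W0[OF f mid.hyps(1)]] W0_sq[OF midhull_W0[OF f mid.hyps(2)]] by (auto simp: sq_def)
  have "nrm2 M (\<lambda>x. (1/2) * (a 0 x + b 0 x) - u x) = nrm2 M (\<lambda>x. (1/2) * ((a 0 x - u x) + (b 0 x - u x)))"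
    by (simp add: algebra_simps)
  also have "\<dots> = (1/2) * nrm2 M (\<lambda>x. (a 0 x - u x) + (b 0 x - u x))"
    using nrm2_cmult[of M "1/2" "\<lambda>x. (a 0 x - u x) + (b 0 x - u x)"] by simp
  also have "\<dots> \<le> (1/2) * (e + e)"
    using nrm2_triangle[OF sqi_diff[OF s(1) u] sqi_diff[OF s(2) u]] mid.IH by auto
  finally show ?case by simp
qed (use e in auto)

section \<open>Lower semicontinuity of the energy norm\<close>

text \<open>Mazur's lemma without weak topologies: near-minimizers of the norm over the midpoint
  hulls of the tails form a Cauchy sequence. Their limit has norm at most \<beta>, because each hull
  contains a member of the sequence, and its function is u, because the hull of a late tail stays
  close to u in L2.\<close>

lemma W0_lower_semicontinuous:
  assumes f: "\<And>m. W0 (f m)" and b: "\<And>m. hn (f m) \<le> b m" "b \<longlonglongrightarrow> \<beta>" and u: "u \<in> sqi M"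
    and conv: "(\<lambda>m. nrm2 M (\<lambda>x. f m 0 x - u x)) \<longlonglongrightarrow> 0"
  obtains h where "W0 h" "h 0 = u" "hn h \<le> \<beta>"
proof -
  define d where "d N = Inf (hn ` midhull f N)" for N
  have bb: "bdd_below (hn ` midhull f N)" for N by (rule bdd_belowI[of _ 0]) (auto simp: hn_ge0)
  have ne: "hn ` midhull f N \<noteq> {}" for N using midhull.base[of N N f] by blast
  have dle: "d N \<le> hn a" if "a \<in> midhull f N" for a N unfolding d_def using that by (intro cInf_lower bb) auto
  have d0: "0 \<le> d N" for N unfolding d_def by (rule cInf_greatest[OF ne]) (auto simp: hn_ge0)
  have dmono: "d N \<le> d N'" if "N \<le> N'" for N N'
    unfolding d_def by (rule cInf_superset_mono[OF ne bb]) (use that midhull_mono in blast)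
  define \<epsilon> where "\<epsilon> N = inverse (real (Suc N))" for N
  have \<epsilon>: "0 < \<epsilon> N" "\<epsilon> \<longlonglongrightarrow> 0" for N using LIMSEQ_inverse_real_of_nat by (auto simp: \<epsilon>_def[abs_def])
  have "\<exists>a. a \<in> midhull f N \<and> hn a < d N + \<epsilon> N" for N
    using cInf_lessD[OF ne, of N "d N + \<epsilon> N"] \<epsilon>(1)[of N] unfolding d_def by auto
  then obtain z where z: "\<And>N. z N \<in> midhull f N" "\<And>N. hn (z N) < d N + \<epsilon> N" by metis
  have zW: "W0 (z N)" for N by (rule midhull_W0[OF f z(1)])
  have dconv: "\<exists>l. d \<longlonglongrightarrow> l"
  proof -
    have "Bseq b" using b(2) by (auto intro: convergent_imp_Bseq convergentI)
    then obtain C where C: "\<And>m. norm (b m) \<le> C" by (auto simp: Bseq_def)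
    have "d N \<le> C" for N using dle[OF midhull.base[of N N f]] b(1)[of N] C[of N] by auto
    hence "Bseq d" using d0 by (intro BseqI'[of _ C]) auto
    thus ?thesis using Bseq_monoseq_convergent[of d] dmono by (auto simp: monoseq_def convergent_def)
  qed
  then obtain l where l: "d \<longlonglongrightarrow> l" by blast
  have dl: "d N \<le> l" for N by (rule LIMSEQ_le_const[OF l]) (use dmono in auto)
  have l0: "0 \<le> l" using d0[of 0] dl[of 0] by linarith
  \<comment> \<open>The midpoint of two late near-minimizers lies in the hull of the tail from N, so
    its norm is at least \<open>d N\<close>; the parallelogram law converts this into closeness of
    the two.\<close>
  have est: "(hn (hsub (z m) (z k)))\<^sup>2 \<le> 2 * (l + \<epsilon> N)\<^sup>2 + 2 * (l + \<epsilon> N)\<^sup>2 - 4 * (d N)\<^sup>2" if mk: "m \<ge> N" "k \<ge> N" for m k N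
  proof -
    let ?c = "\<lambda>j x. (1/2) * (z m j x + z k j x)"
    have "?c \<in> midhull f N" by (intro midhull.mid midhull_mono[OF z(1)] mk)
    hence "d N \<le> hn ?c" by (rule dle)
    also have "hn ?c = (1/2) * hn (\<lambda>j x. z m j x + z k j x)"
      using hn_cmult[of "1/2" "\<lambda>j x. z m j x + z k j x"] by simp
    finally have "2 * d N \<le> hn (\<lambda>j x. z m j x + z k j x)" by simp
    hence "(2 * d N)\<^sup>2 \<le> (hn (\<lambda>j x. z m j x + z k j x))\<^sup>2" using d0[of N] by (intro power_mono) auto
    moreover have "\<epsilon> m \<le> \<epsilon> N" "\<epsilon> k \<le> \<epsilon> N" using mk by (auto simp: \<epsilon>_def intro!: le_imp_inverse_le)
    hence "(hn (z m))\<^sup>2 \<le> (l + \<epsilon> N)\<^sup>2" "(hn (z k))\<^sup>2 \<le> (l + \<epsilon> N)\<^sup>2"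
      using z(2)[of m] z(2)[of k] dl[of m] dl[of k] by (auto intro!: power_mono simp: hn_ge0)
    ultimately show ?thesis using hn_parallelogram[OF W0_sq[OF zW] W0_sq[OF zW], of m k] by (simp add: power_mult_distrib)
  qed
  have rlim: "(\<lambda>N. 2 * (l + \<epsilon> N)\<^sup>2 + 2 * (l + \<epsilon> N)\<^sup>2 - 4 * (d N)\<^sup>2) \<longlonglongrightarrow> 2 * (l + 0)\<^sup>2 + 2 * (l + 0)\<^sup>2 - 4 * l\<^sup>2"
    by (intro tendsto_intros l \<epsilon>(2))
  have "\<exists>N. \<forall>m\<ge>N. \<forall>k\<ge>N. hn (hsub (z m) (z k)) \<le> e" if e: "e > 0" for e
  proof -
    have "\<forall>\<^sub>F N in sequentially. 2 * (l + \<epsilon> N)\<^sup>2 + 2 * (l + \<epsilon> N)\<^sup>2 - 4 * (d N)\<^sup>2 < e\<^sup>2"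
      by (rule order_tendstoD(2)[OF rlim]) (use e in simp)
    then obtain N where N: "2 * (l + \<epsilon> N)\<^sup>2 + 2 * (l + \<epsilon> N)\<^sup>2 - 4 * (d N)\<^sup>2 < e\<^sup>2" by (auto simp: eventually_sequentially)
    have "hn (hsub (z m) (z k)) \<le> e" if "m \<ge> N" "k \<ge> N" for m k
    proof (rule power2_le_imp_le)
      show "(hn (hsub (z m) (z k)))\<^sup>2 \<le> e\<^sup>2" using est[OF that] N by linarith
    qed (use e in simp)
    thus ?thesis by blast
  qed
  from W0_complete[of z, OF zW this] obtain h where h: "W0 h" "(\<lambda>m. hn (hsub (z m) h)) \<longlonglongrightarrow> 0" by blast
  have hs: "h j \<in> sqi M" if "j \<le> n" for j using W0_sq[OF h(1)] that by (simp add: sq_def)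
  have zs: "z m j \<in> sqi M" if "j \<le> n" for j m using W0_sq[OF zW] that by (simp add: sq_def)
  have hle: "hn h \<le> \<beta>"
  proof (rule LIMSEQ_le_const)
    have "(\<lambda>N. b N + \<epsilon> N + hn (hsub (z N) h)) \<longlonglongrightarrow> \<beta> + 0 + 0" by (intro tendsto_add b(2) \<epsilon>(2) h(2))
    thus "(\<lambda>N. b N + \<epsilon> N + hn (hsub (z N) h)) \<longlonglongrightarrow> \<beta>" by simp
    have "hn h \<le> b N + \<epsilon> N + hn (hsub (z N) h)" for N
      using hn_le_hsub[OF W0_sq[OF h(1)] W0_sq[OF zW], of N] hn_hsub_commute[of h "z N"] z(2)[of N] dle[OF midhull.base[of N N f]] b(1)[of N]
      by linarith
    thus "\<exists>N. \<forall>n\<ge>N. hn h \<le> b n + \<epsilon> n + hn (hsub (z n) h)" by blast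
  qed
  have z0u: "(\<lambda>N. nrm2 M (\<lambda>x. z N 0 x - u x)) \<longlonglongrightarrow> 0"
  proof (rule LIMSEQ_I)
    fix e :: real assume e: "e > 0"
    then obtain N where N: "\<And>m. m \<ge> N \<Longrightarrow> nrm2 M (\<lambda>x. f m 0 x - u x) < e/2"
      using LIMSEQ_D[OF conv, of "e/2"] by (auto simp: nrm2_ge0)
    have "nrm2 M (\<lambda>x. z m 0 x - u x) \<le> e/2" if "m \<ge> N" for m
      by (rule midhull_near[OF f z(1) u]) (use N that in \<open>auto intro: less_imp_le\<close>)
    hence "nrm2 M (\<lambda>x. z m 0 x - u x) < e" if "m \<ge> N" for m using that e by fastforce
    thus "\<exists>no. \<forall>n\<ge>no. norm (nrm2 M (\<lambda>x. z n 0 x - u x) - 0) < e"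
      by (intro exI[of _ N]) (simp add: nrm2_ge0)
  qed
  have z0h: "(\<lambda>N. nrm2 M (\<lambda>x. h 0 x - z N 0 x)) \<longlonglongrightarrow> 0"
    using h(2) by (simp add: hn_tendsto_iff nrm2_minus_commute[of M "h 0"])
  have "nrm2 M (\<lambda>x. h 0 x - u x) \<le> 0"
  proof (rule LIMSEQ_le_const)
    show "(\<lambda>N. nrm2 M (\<lambda>x. h 0 x - z N 0 x) + nrm2 M (\<lambda>x. z N 0 x - u x)) \<longlonglongrightarrow> 0"
      using tendsto_add[OF z0h z0u] by simp
    show "\<exists>N. \<forall>n\<ge>N. nrm2 M (\<lambda>x. h 0 x - u x) \<le> nrm2 M (\<lambda>x. h 0 x - z n 0 x) + nrm2 M (\<lambda>x. z n 0 x - u x)"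
      using nrm2_triangle3[OF hs[of 0] zs[of 0] u] by auto
  qed
  hence "nrm2 M (\<lambda>x. h 0 x - u x) = 0" using nrm2_ge0[of M] by (simp add: antisym)
  from nrm2_eq_0D[OF sqi_diff[OF hs[of 0] u] this] have ae: "AE x in M. h 0 x = u x" by simp
  \<comment> \<open>Changing the function component on a null set makes its equality with u
    literal.\<close>
  define g where "g = h(0 := u)"
  have gs: "sq g" using hs u by (auto simp: sq_def g_def)
  have gae: "AE x in M. h j x = g j x" if "j \<le> n" for j using ae by (auto simp: g_def)
  show ?thesis
  proof (rule that)
    show "W0 g" by (rule W0_cong_AE[OF h(1) gs gae])
    show "g 0 = u" by (simp add: g_def)
    show "hn g \<le> \<beta>" using hle hn_cong_AE[OF W0_sq[OF h(1)] gs gae] by simp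
  qed
qed

section \<open>Chain rule\<close>

text \<open>Test functions approximating \<open>h\<close> are composed with \<open>G\<close>. The
  error in a derivative splits into G'(\<psi>) times an L2-small term, controlled by |G'| \<le> 1,
  and (G'(\<psi>) - G'(h 0)) times a fixed function, controlled by dominated convergence along an
  almost everywhere convergent subsequence.\<close>

lemma W0_chain:
  assumes G: "\<And>t. (G has_real_derivative G' t) (at t)" and G'c: "continuous_on UNIV G'" and G'L: "\<And>t. \<bar>G' t\<bar> \<le> 1"
    and G0: "G 0 = 0" and GT: "\<And>\<phi>. \<phi> \<in> T \<Longrightarrow> (\<lambda>x. G (\<phi> x)) \<in> T" and h: "W0 h"
  shows "W0 (\<lambda>j x. if j = 0 then G (h 0 x) else G' (h 0 x) * h j x)" (is "W0 ?g")
proof -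
  have hs: "h j \<in> sqi M" if "j \<le> n" for j using W0_sq[OF h] that by (simp add: sq_def)
  have hm[measurable]: "h 0 \<in> borel_measurable M" using hs[of 0] by (simp add: sqi_def)
  have G'm[measurable]: "G' \<in> borel_measurable borel" by (rule borel_measurable_continuous_onI[OF G'c])
  have Gm[measurable]: "G \<in> borel_measurable borel"
    by (rule borel_measurable_continuous_onI) (auto intro!: continuous_at_imp_continuous_on DERIV_isCont[OF G])
  have lip: "\<bar>G a - G b\<bar> \<le> \<bar>a - b\<bar>" for a b
    using differentiable_bound[of UNIV G "\<lambda>t s. G' t * s" 1 a b] G G'L
    by (simp add: has_field_derivative_def onorm_bound abs_mult mult_left_le_one_le)
  have m2: "(\<lambda>x. G' (h 0 x) * h j x) \<in> borel_measurable M" if "j \<le> n" for j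
    using hs[OF that] by (intro borel_measurable_times measurable_compose[OF hm G'm]) (auto simp: sqi_def)
  have sg: "sq ?g"
    unfolding sq_def
  proof (intro allI impI)
    fix j assume j: "j \<le> n"
    show "?g j \<in> sqi M"
    proof (cases "j = 0")
      case True
      have "(\<lambda>x. G (h 0 x)) \<in> sqi M"
        by (rule sqi_bound[OF hs[of 0]]) (use lip[of _ 0] G0 in auto)
      thus ?thesis using True by simp
    next
      case False
      have "(\<lambda>x. G' (h 0 x) * h j x) \<in> sqi M"
        by (rule sqi_bounded_mult[OF hs[OF j], of _ 1]) (use G'L in auto)
      thus ?thesis using False by simp
    qed
  qed
  obtain \<phi> where p: "\<And>m. \<phi> m \<in> T" "(\<lambda>m. hn (hsub (jet (\<phi> m)) h)) \<longlonglongrightarrow> 0" using W0_sequence[OF h] by metis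
  have pj: "(\<lambda>m. nrm2 M (\<lambda>x. jet (\<phi> m) j x - h j x)) \<longlonglongrightarrow> 0" if "j \<le> n" for j using p(2) that by (simp add: hn_tendsto_iff)
  have "(\<lambda>m. nrm2 M (\<lambda>x. \<phi> m x - h 0 x)) \<longlonglongrightarrow> 0" using pj[of 0] by (simp add: jet_def)
  from nrm2_tendsto_AE_subseq[OF hs[of 0] T_sqi[OF p(1)] this]
  obtain r where r: "strict_mono r" "AE x in M. (\<lambda>m. \<phi> (r m) x) \<longlonglongrightarrow> h 0 x" by auto
  define \<psi> where "\<psi> m = \<phi> (r m)" for m
  have \<psi>T: "\<psi> m \<in> T" for m by (simp add: \<psi>_def p)
  have \<psi>l: "(\<lambda>m. nrm2 M (\<lambda>x. jet (\<psi> m) j x - h j x)) \<longlonglongrightarrow> 0" if "j \<le> n" for j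
    using LIMSEQ_subseq_LIMSEQ[OF pj[OF that] r(1)] by (simp add: \<psi>_def o_def)
  have \<psi>m[measurable]: "\<psi> m \<in> borel_measurable M" for m using T_sqi[OF \<psi>T] by (simp add: sqi_def)
  have jetG: "jet (\<lambda>x. G (\<psi> m x)) j = (\<lambda>x. G' (\<psi> m x) * jet (\<psi> m) j x)" if "j \<noteq> 0" for m j
  proof
    fix x
    have "(\<psi> m has_derivative frechet_derivative (\<psi> m) (at x)) (at x)" by (rule has_derivative_frechet[OF T_differentiable[OF \<psi>T]])
    from has_derivative_compose[OF this G[of "\<psi> m x", unfolded has_field_derivative_def]]
    have "((\<lambda>x. G (\<psi> m x)) has_derivative (\<lambda>v. G' (\<psi> m x) * frechet_derivative (\<psi> m) (at x) v)) (at x)" .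
    from frechet_derivative_eqI[OF this]
    show "jet (\<lambda>x. G (\<psi> m x)) j x = G' (\<psi> m x) * jet (\<psi> m) j x" using that by (simp add: jet_def deriv_along_def)
  qed
  show ?thesis
  proof (rule W0_closed[of "\<lambda>m. jet (\<lambda>x. G (\<psi> m x))", OF W0_jet[OF GT[OF \<psi>T]] sg])
    show "(\<lambda>m. hn (hsub (jet (\<lambda>x. G (\<psi> m x))) ?g)) \<longlonglongrightarrow> 0"
      unfolding hn_tendsto_iff
    proof (intro allI impI)
      fix j assume j: "j \<le> n"
      show "(\<lambda>m. nrm2 M (\<lambda>x. jet (\<lambda>x. G (\<psi> m x)) j x - ?g j x)) \<longlonglongrightarrow> 0"
      proof (cases "j = 0")
        case True
        have l0: "(\<lambda>m. nrm2 M (\<lambda>x. \<psi> m x - h 0 x)) \<longlonglongrightarrow> 0" using \<psi>l[of 0] by (simp add: jet_def)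
        have "nrm2 M (\<lambda>x. G (\<psi> m x) - G (h 0 x)) \<le> nrm2 M (\<lambda>x. \<psi> m x - h 0 x)" for m
          by (rule nrm2_mono[OF sqi_diff[OF T_sqi[OF \<psi>T] hs[of 0]]]) (use lip in auto)
        hence "(\<lambda>m. nrm2 M (\<lambda>x. G (\<psi> m x) - G (h 0 x))) \<longlonglongrightarrow> 0"
          by (intro tendsto_sandwich[OF _ _ tendsto_const l0]) (auto simp: nrm2_ge0)
        thus ?thesis using True by (simp add: jet_def)
      next
        case False
        have js: "jet (\<psi> m) j \<in> sqi M" for m using sq_jet[OF \<psi>T] j by (simp add: sq_def)
        have l2: "(\<lambda>m. nrm2 M (\<lambda>x. G' (\<psi> m x) * h j x - G' (h 0 x) * h j x)) \<longlonglongrightarrow> 0"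
        proof (rule sqi_dominated_convergence[OF sqi_cmult[OF hs[OF j], of 2]])
          show "(\<lambda>x. G' (\<psi> m x) * h j x) \<in> borel_measurable M" for m
            using hs[OF j] by (intro borel_measurable_times measurable_compose[OF \<psi>m G'm]) (auto simp: sqi_def)
          show "(\<lambda>x. G' (h 0 x) * h j x) \<in> borel_measurable M" by (rule m2[OF j])
          show "AE x in M. (\<lambda>m. G' (\<psi> m x) * h j x) \<longlonglongrightarrow> G' (h 0 x) * h j x"
            using r(2)
          proof eventually_elim
            case (elim x)
            have "(\<lambda>m. G' (\<psi> m x)) \<longlonglongrightarrow> G' (h 0 x)"
              by (rule continuous_on_tendsto_compose[OF G'c]) (use elim in \<open>auto simp: \<psi>_def\<close>)
            thus ?case by (intro tendsto_intros)
          qed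
          show "AE x in M. \<bar>G' (\<psi> m x) * h j x - G' (h 0 x) * h j x\<bar> \<le> \<bar>2 * h j x\<bar>" for m
          proof (rule AE_I2)
            fix x
            have "\<bar>G' (\<psi> m x) - G' (h 0 x)\<bar> \<le> 2" using G'L[of "\<psi> m x"] G'L[of "h 0 x"] by linarith
            from mult_right_mono[OF this abs_ge_zero[of "h j x"]]
            show "\<bar>G' (\<psi> m x) * h j x - G' (h 0 x) * h j x\<bar> \<le> \<bar>2 * h j x\<bar>"
              by (simp add: abs_mult left_diff_distrib[symmetric])
          qed
        qed
        have s1: "(\<lambda>x. G' (\<psi> m x) * (jet (\<psi> m) j x - h j x)) \<in> sqi M" for m
          by (rule sqi_bounded_mult[OF sqi_diff[OF js hs[OF j]], of _ 1]) (use G'L in auto)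
        have s2: "(\<lambda>x. G' (\<psi> m x) * h j x - G' (h 0 x) * h j x) \<in> sqi M" for m
          by (intro sqi_diff sqi_bounded_mult[OF hs[OF j], of _ 1]) (use G'L in auto)
        have le: "nrm2 M (\<lambda>x. jet (\<lambda>x. G (\<psi> m x)) j x - ?g j x) \<le>
            nrm2 M (\<lambda>x. jet (\<psi> m) j x - h j x) + nrm2 M (\<lambda>x. G' (\<psi> m x) * h j x - G' (h 0 x) * h j x)" for m
        proof -
          have "nrm2 M (\<lambda>x. jet (\<lambda>x. G (\<psi> m x)) j x - ?g j x) =
            nrm2 M (\<lambda>x. G' (\<psi> m x) * (jet (\<psi> m) j x - h j x) + (G' (\<psi> m x) * h j x - G' (h 0 x) * h j x))"
            using False by (simp add: jetG[OF False] algebra_simps)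
          also have "\<dots> \<le> nrm2 M (\<lambda>x. G' (\<psi> m x) * (jet (\<psi> m) j x - h j x)) + nrm2 M (\<lambda>x. G' (\<psi> m x) * h j x - G' (h 0 x) * h j x)"
            by (rule nrm2_triangle[OF s1 s2])
          also have "nrm2 M (\<lambda>x. G' (\<psi> m x) * (jet (\<psi> m) j x - h j x)) \<le> \<bar>1\<bar> * nrm2 M (\<lambda>x. jet (\<psi> m) j x - h j x)"
            by (rule nrm2_bounded_mult[OF sqi_diff[OF js hs[OF j]]]) (use G'L in auto)
          finally show ?thesis by simp
        qed
        have lim: "(\<lambda>m. nrm2 M (\<lambda>x. jet (\<psi> m) j x - h j x) + nrm2 M (\<lambda>x. G' (\<psi> m x) * h j x - G' (h 0 x) * h j x)) \<longlonglongrightarrow> 0"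
          using tendsto_add[OF \<psi>l[OF j] l2] by simp
        show ?thesis
          by (rule tendsto_sandwich[OF _ _ tendsto_const lim]) (auto simp only: nrm2_ge0 le eventually_True)
      qed
    qed
  qed
qed

lemma T_compose:
  assumes p: "\<phi> \<in> T" and s: "smooth_on UNIV (\<lambda>x. G (\<phi> x))" and G: "G 0 = 0"
  shows "(\<lambda>x. G (\<phi> x)) \<in> T"
proof -
  obtain K where K: "compact K" "K \<subseteq> D" "\<phi> \<in> Cc K" using p unfolding test_functions_iff by blast
  have "(\<lambda>x. G (\<phi> x)) \<in> Cc K" using s CcD(2)[OF K(3)] G by (simp add: Cc_def)
  thus ?thesis using T_I[OF K(1,2)] by blast
qed

text \<open>
  Composing with \<open>t \<mapsto> t / (1 + k\<^sup>2 t\<^sup>2)\<close> and letting \<open>k\<close> tend to infinity leaves the zero function, whose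
  derivative is the limit of the derivatives, namely that of \<open>h 0\<close> cut off to the zero set.
\<close>

lemma W0_derivative_zero_set:
  assumes h: "W0 h" and j: "j \<in> {1..n}" shows "AE x in M. h 0 x = 0 \<longrightarrow> h j x = 0"
proof -
  have hs: "h i \<in> sqi M" if "i \<le> n" for i using W0_sq[OF h] that by (simp add: sq_def)
  have hm[measurable]: "h 0 \<in> borel_measurable M" using hs[of 0] by (simp add: sqi_def)
  have hjm: "h i \<in> borel_measurable M" if "i \<le> n" for i using hs[OF that] by (simp add: sqi_def)
  define G where "G k t = t * inverse (1 + (k * t)\<^sup>2)" for k t :: real
  define G' where "G' k t = (1 - (k * t)\<^sup>2) * (inverse (1 + (k * t)\<^sup>2))\<^sup>2" for k t :: real
  have pos: "1 + (k * t)\<^sup>2 > 0" for k t :: real by (simp add: add_pos_nonneg)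
  have nz: "1 + (k * t)\<^sup>2 \<noteq> 0" for k t :: real using pos[of k t] by simp
  have dG: "(G k has_real_derivative G' k t) (at t)" for k t
  proof -
    have "(G k has_real_derivative (1 * inverse (1 + (k * t)\<^sup>2) + (- (inverse (1 + (k * t)\<^sup>2) * (2 * (k * t) * k) * inverse (1 + (k * t)\<^sup>2))) * t)) (at t)"
      unfolding G_def using nz[of k t] by (auto intro!: derivative_eq_intros)
    moreover have "1 * inverse (1 + (k * t)\<^sup>2) + (- (inverse (1 + (k * t)\<^sup>2) * (2 * (k * t) * k) * inverse (1 + (k * t)\<^sup>2))) * t = G' k t"
    proof -
      have "(1 + (k * t)\<^sup>2) * inverse (1 + (k * t)\<^sup>2) = 1" using nz[of k t] by simp
      thus ?thesis unfolding G'_def by algebra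
    qed
    ultimately show ?thesis by simp
  qed
  have cG': "continuous_on UNIV (G' k)" for k unfolding G'_def using nz by (intro continuous_intros) auto
  have bG': "\<bar>G' k t\<bar> \<le> 1" for k t
  proof -
    have "\<bar>1 - (k * t)\<^sup>2\<bar> \<le> 1 + (k * t)\<^sup>2" by (simp add: abs_le_iff)
    also have "\<dots> \<le> (1 + (k * t)\<^sup>2)\<^sup>2" by (rule self_le_power) auto
    finally have "\<bar>1 - (k * t)\<^sup>2\<bar> * (inverse (1 + (k * t)\<^sup>2))\<^sup>2 \<le> (1 + (k * t)\<^sup>2)\<^sup>2 * (inverse (1 + (k * t)\<^sup>2))\<^sup>2"
      by (intro mult_right_mono) auto
    also have "\<dots> = 1" using nz[of k t] by (simp add: power_mult_distrib[symmetric])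
    finally show ?thesis by (simp add: G'_def abs_mult)
  qed
  have GT: "(\<lambda>x. G k (\<phi> x)) \<in> T" if p: "\<phi> \<in> T" for k \<phi>
  proof (rule T_compose[OF p])
    show "smooth_on UNIV (\<lambda>x. G k (\<phi> x))" unfolding G_def power2_eq_square
      by (intro smooth_on_mult smooth_on_inverse smooth_on_add smooth_on_const T_smooth[OF p] open_UNIV)
        (use nz in \<open>auto simp: power2_eq_square\<close>)
  qed (simp add: G_def)
  define f where "f m i x = (if i = 0 then G (real m) (h 0 x) else G' (real m) (h 0 x) * h i x)" for m i x
  have fW: "W0 (f m)" for m unfolding f_def[abs_def] by (rule W0_chain[OF dG cG' bG' _ GT h]) (simp add: G_def)
  have G'lim: "(\<lambda>m. G' (real m) t) \<longlonglongrightarrow> of_bool (t = 0)" for t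
  proof (cases "t = 0")
    case False
    have e: "filterlim (\<lambda>m. (real m * t)\<^sup>2) at_top sequentially"
    proof -
      have "filterlim (\<lambda>m. t\<^sup>2 * (real m)\<^sup>2) at_top sequentially"
        by (rule filterlim_tendsto_pos_mult_at_top[OF tendsto_const]) 
          (use False in \<open>auto intro!: filterlim_pow_at_top filterlim_real_sequentially\<close>)
      thus ?thesis by (simp add: power_mult_distrib mult.commute)
    qed
    have inv: "(\<lambda>m. inverse (1 + (real m * t)\<^sup>2)) \<longlonglongrightarrow> 0"
      by (rule tendsto_inverse_0_at_top) (rule filterlim_tendsto_add_at_top[OF tendsto_const e])
    \<comment> \<open>With i = 1/(1 + k^2 t^2), the derivative of t i equals 2 i^2 - i, and i tends
      to 0 for nonzero t.\<close>
    have "(\<lambda>m. 2 * (inverse (1 + (real m * t)\<^sup>2))\<^sup>2 - inverse (1 + (real m * t)\<^sup>2)) \<longlonglongrightarrow> 2 * 0\<^sup>2 - 0"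
      by (intro tendsto_intros inv)
    moreover have "2 * (inverse (1 + (real m * t)\<^sup>2))\<^sup>2 - inverse (1 + (real m * t)\<^sup>2) = G' (real m) t" for m
    proof -
      have "(1 + (real m * t)\<^sup>2) * inverse (1 + (real m * t)\<^sup>2) = 1" using nz[of "real m" t] by simp
      thus ?thesis unfolding G'_def by algebra
    qed
    ultimately show ?thesis using False by simp
  qed (simp add: G'_def)
  have Glim: "(\<lambda>m. G (real m) t) \<longlonglongrightarrow> 0" for t
  proof (cases "t = 0")
    case False
    have e: "filterlim (\<lambda>m. (real m * t)\<^sup>2) at_top sequentially"
    proof -
      have "filterlim (\<lambda>m. t\<^sup>2 * (real m)\<^sup>2) at_top sequentially"
        by (rule filterlim_tendsto_pos_mult_at_top[OF tendsto_const]) 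
          (use False in \<open>auto intro!: filterlim_pow_at_top filterlim_real_sequentially\<close>)
      thus ?thesis by (simp add: power_mult_distrib mult.commute)
    qed
    have "(\<lambda>m. t * inverse (1 + (real m * t)\<^sup>2)) \<longlonglongrightarrow> t * 0"
      by (intro tendsto_mult_left tendsto_inverse_0_at_top filterlim_tendsto_add_at_top[OF tendsto_const e])
    thus ?thesis by (simp add: G_def)
  qed (simp add: G_def)
  \<comment> \<open>The pointwise limit of the family: zero function, with derivatives equal to
    those of \<open>h\<close> on its zero set and 0 elsewhere.\<close>
  define g where "g i x = (if i = 0 then 0 else of_bool (h 0 x = 0) * h i x)" for i x
  have indm: "(\<lambda>x. of_bool (h 0 x = 0) :: real) \<in> borel_measurable M" by measurable
  have gs: "g i \<in> sqi M" if i: "i \<le> n" for i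
  proof (cases "i = 0")
    case True thus ?thesis by (simp add: g_def[abs_def] sqi_0)
  next
    case False
    have "(\<lambda>x. of_bool (h 0 x = 0) * h i x) \<in> sqi M" by (rule sqi_bounded_mult[OF hs[OF i] indm, of 1]) auto
    thus ?thesis using False by (simp add: g_def[abs_def])
  qed
  have fm: "f m i \<in> borel_measurable M" if "i \<le> n" for m i using W0_sq[OF fW] that by (auto simp: sq_def sqi_def)
  have "W0 g"
  proof (rule W0_closed[OF fW])
    show "sq g" using gs by (simp add: sq_def)
    show "(\<lambda>m. hn (hsub (f m) g)) \<longlonglongrightarrow> 0" unfolding hn_tendsto_iff
    proof (intro allI impI)
      fix i assume i: "i \<le> n"
      show "(\<lambda>m. nrm2 M (\<lambda>x. f m i x - g i x)) \<longlonglongrightarrow> 0"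
      proof (rule sqi_dominated_convergence[OF sqi_cmult[OF hs[OF i], of 2] fm[OF i]])
        show "g i \<in> borel_measurable M" using gs[OF i] by (simp add: sqi_def)
        show "AE x in M. (\<lambda>m. f m i x) \<longlonglongrightarrow> g i x"
        proof (rule AE_I2)
          fix x
          show "(\<lambda>m. f m i x) \<longlonglongrightarrow> g i x"
          proof (cases "i = 0")
            case True thus ?thesis using Glim[of "h 0 x"] by (simp add: f_def g_def)
          next
            case False thus ?thesis using tendsto_mult_right[OF G'lim[of "h 0 x"], of "h i x"] by (simp add: f_def g_def)
          qed
        qed
        have "\<bar>f m i x - g i x\<bar> \<le> \<bar>2 * h i x\<bar>" for m x
        proof (cases "i = 0")
          case True
          have "inverse (1 + (real m * h 0 x)\<^sup>2) \<le> 1" using pos[of "real m" "h 0 x"] by (simp add: inverse_le_1_iff)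
          hence "\<bar>h 0 x\<bar> * inverse (1 + (real m * h 0 x)\<^sup>2) \<le> \<bar>h 0 x\<bar> * 1" by (intro mult_left_mono) auto
          thus ?thesis using True pos[of "real m" "h 0 x"] by (simp add: f_def g_def G_def abs_mult)
        next
          case False
          have "\<bar>G' (real m) (h 0 x) - of_bool (h 0 x = 0)\<bar> \<le> 2" using bG'[of "real m" "h 0 x"] by (auto simp: abs_le_iff)
          from mult_right_mono[OF this abs_ge_zero[of "h i x"]] show ?thesis
            using False by (simp add: f_def g_def abs_mult left_diff_distrib[symmetric])
        qed
        thus "AE x in M. \<bar>f m i x - g i x\<bar> \<le> \<bar>2 * h i x\<bar>" for m by simp
      qed
    qed
  qed
  \<comment> \<open>Both \<open>g j\<close> and 0 are derivatives of the zero function along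
    \<open>Y j\<close>, so uniqueness makes \<open>g j\<close> vanish.\<close>
  from W0_has_dist_derivative[OF this j] have 1: "has_dist_derivative D (Y j) (\<lambda>x. 0) (g j)" by (simp add: g_def[abs_def])
  have 2: "has_dist_derivative D (Y j) (\<lambda>x. 0) (\<lambda>x. 0)" by (simp add: has_dist_derivative_iff)
  have "AE x in M. g j x = 0" by (rule has_dist_derivative_unique[OF 1 2 gs sqi_0]) (use j in auto)
  thus ?thesis using j by (auto simp: g_def)
qed

section \<open>A smooth substitute for truncation\<close>

text \<open>Nonnegative, 1-Lipschitz, zero only at 0 and at least 1/2 for |t| \<ge> 1. It preserves
  test functions without increasing their norm, and thus replaces |t| and min(|t|,1), both in
  estimating capacity and in writing {u \<noteq> 0} as a superlevel set.\<close>

definition frac :: "real \<Rightarrow> real" where "frac t = t\<^sup>2 * inverse (1 + t\<^sup>2)"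

lemma frac_pos: "1 + t\<^sup>2 > 0" for t :: real by (simp add: add_pos_nonneg)

lemma frac_nonneg: "0 \<le> frac t" using frac_pos[of t] by (simp add: frac_def)

lemma frac_eq_0_iff: "frac t = 0 \<longleftrightarrow> t = 0" using frac_pos[of t] by (simp add: frac_def)

lemma frac_ge_half: "1 \<le> \<bar>t\<bar> \<Longrightarrow> 1/2 \<le> frac t"
proof -
  assume "1 \<le> \<bar>t\<bar>"
  hence "1 \<le> t\<^sup>2" using abs_le_square_iff[of 1 t] by simp
  thus ?thesis using frac_pos[of t] by (simp add: frac_def field_simps)
qed

lemma frac_deriv: "(frac has_real_derivative 2 * t * (inverse (1 + t\<^sup>2))\<^sup>2) (at t)"
proof -
  have nz: "1 + t\<^sup>2 \<noteq> 0" using frac_pos[of t] by simp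
  have "(frac has_real_derivative ((2 * t) * inverse (1 + t\<^sup>2) + (- (inverse (1 + t\<^sup>2) * (2 * t) * inverse (1 + t\<^sup>2))) * t\<^sup>2)) (at t)"
    unfolding frac_def using nz by (auto intro!: derivative_eq_intros)
  moreover have "(2 * t) * inverse (1 + t\<^sup>2) + (- (inverse (1 + t\<^sup>2) * (2 * t) * inverse (1 + t\<^sup>2))) * t\<^sup>2 = 2 * t * (inverse (1 + t\<^sup>2))\<^sup>2"
  proof -
    have "(1 + t\<^sup>2) * inverse (1 + t\<^sup>2) = 1" using nz by simp
    thus ?thesis by algebra
  qed
  ultimately show ?thesis by simp
qed

lemma frac_deriv_le: "\<bar>2 * t * (inverse (1 + t\<^sup>2))\<^sup>2\<bar> \<le> 1" for t :: real
proof -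
  have "2 * \<bar>t\<bar> \<le> 1 + t\<^sup>2" using sum_squares_bound[of 1 "\<bar>t\<bar>"] by simp
  also have "\<dots> \<le> (1 + t\<^sup>2)\<^sup>2" by (rule self_le_power) auto
  finally have "2 * \<bar>t\<bar> * (inverse (1 + t\<^sup>2))\<^sup>2 \<le> (1 + t\<^sup>2)\<^sup>2 * (inverse (1 + t\<^sup>2))\<^sup>2" by (intro mult_right_mono) auto
  also have "\<dots> = 1" using frac_pos[of t] by (simp add: power_mult_distrib[symmetric])
  finally show ?thesis by (simp add: abs_mult)
qed

lemma frac_lipschitz: "\<bar>frac a - frac b\<bar> \<le> \<bar>a - b\<bar>"
  using differentiable_bound[of UNIV frac "\<lambda>t s. 2 * t * (inverse (1 + t\<^sup>2))\<^sup>2 * s" 1 a b] frac_deriv frac_deriv_le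
  by (simp add: has_field_derivative_def onorm_bound abs_mult mult_left_le_one_le)

lemma T_frac: assumes p: "\<phi> \<in> T" shows "(\<lambda>x. frac (\<phi> x)) \<in> T"
proof (rule T_compose[OF p])
  have nz: "1 + t * t \<noteq> 0" for t :: real using frac_pos[of t] by (simp add: power2_eq_square)
  show "smooth_on UNIV (\<lambda>x. frac (\<phi> x))" unfolding frac_def power2_eq_square
    by (intro smooth_on_mult smooth_on_inverse smooth_on_add smooth_on_const T_smooth[OF p] open_UNIV nz)
qed (simp add: frac_def)

lemma W0_frac:
  assumes "W0 h" shows "W0 (\<lambda>j x. if j = 0 then frac (h 0 x) else 2 * h 0 x * (inverse (1 + (h 0 x)\<^sup>2))\<^sup>2 * h j x)"
proof -
  have "continuous_on UNIV (\<lambda>t::real. 2 * t * (inverse (1 + t\<^sup>2))\<^sup>2)"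
    using frac_pos by (intro continuous_intros) (metis less_irrefl)
  from W0_chain[OF frac_deriv this frac_deriv_le _ T_frac assms] show ?thesis by (simp add: frac_def)
qed

lemma jet_frac: "\<phi> \<in> T \<Longrightarrow> j \<le> n \<Longrightarrow> \<bar>jet (\<lambda>x. frac (\<phi> x)) j x\<bar> \<le> \<bar>jet \<phi> j x\<bar>"
proof (cases "j = 0")
  case True
  thus ?thesis using frac_lipschitz[of "\<phi> x" 0] by (simp add: jet_def frac_def)
next
  case False
  assume p: "\<phi> \<in> T"
  have "(\<phi> has_derivative frechet_derivative \<phi> (at x)) (at x)" by (rule has_derivative_frechet[OF T_differentiable[OF p]])
  from frechet_derivative_eqI[OF has_derivative_compose[OF this frac_deriv[of "\<phi> x", unfolded has_field_derivative_def]]]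
  have "jet (\<lambda>x. frac (\<phi> x)) j x = (2 * \<phi> x * (inverse (1 + (\<phi> x)\<^sup>2))\<^sup>2) * jet \<phi> j x"
    using False by (simp add: jet_def deriv_along_def)
  thus ?thesis using mult_right_mono[OF frac_deriv_le[of "\<phi> x"] abs_ge_zero[of "jet \<phi> j x"]] by (simp add: abs_mult)
qed

lemma hn_frac_le: assumes p: "\<phi> \<in> T" shows "hn (jet (\<lambda>x. frac (\<phi> x))) \<le> hn (jet \<phi>)"
  unfolding hn_def
proof (rule L2_set_mono)
  fix j assume "j \<in> {..n}"
  hence j: "j \<le> n" by simp
  show "nrm2 M (jet (\<lambda>x. frac (\<phi> x)) j) \<le> nrm2 M (jet \<phi> j)"
    by (rule nrm2_mono) (use sq_jet[OF p] sq_jet[OF T_frac[OF p]] j jet_frac[OF p j] in \<open>auto simp: sq_def sqi_def\<close>)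
qed (simp add: nrm2_ge0)

end

section \<open>Compact embedding of the energy space\<close>

locale hormander_space = energy_space D U n Y
  for D U :: "(real ^ 'd) set" and n :: nat and Y :: "nat \<Rightarrow> real ^ 'd \<Rightarrow> real ^ 'd" +
  assumes H: "hormander U n Y"
begin

text \<open>Each member is replaced by a test function at distance below 1/(m+1); compactness for
  test functions supplies the subsequence, and the replacement error disappears in the
  limit.\<close>

theorem W0_compact:
  assumes h: "\<And>m. W0 (h m)" and B: "\<And>m. hn (h m) \<le> B"
  obtains r u where "strict_mono (r :: nat \<Rightarrow> nat)" "u \<in> sqi M" "(\<lambda>m. nrm2 M (\<lambda>x. h (r m) 0 x - u x)) \<longlonglongrightarrow> 0"
proof -
  have "\<exists>\<phi>. \<phi> \<in> T \<and> hn (hsub (jet \<phi>) (h m)) < inverse (real (Suc m))" for m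
    using h[of m] unfolding W0_def by (meson inverse_positive_iff_positive of_nat_0_less_iff zero_less_Suc)
  then obtain \<phi> where p: "\<And>m. \<phi> m \<in> T" "\<And>m. hn (hsub (jet (\<phi> m)) (h m)) < inverse (real (Suc m))" by metis
  have one: "inverse (real (Suc m)) \<le> 1" for m by (simp add: field_simps)
  have jb: "hn (jet (\<phi> m)) \<le> B + 1" for m
    using hn_le_hsub[OF sq_jet[OF p(1)] W0_sq[OF h], of m m] p(2)[of m] B[of m] one[of m] by linarith
  have b0: "bdd (closure D) \<phi>"
  proof -
    have "nrm2 lborel (\<phi> m) \<le> B + 1" for m
      using hn_component[of 0 "jet (\<phi> m)"] jb[of m] T_nrm2[OF p(1)[of m]] by (simp add: jet_def)
    thus ?thesis unfolding bdd_def using T_Cc[OF p(1)] by blast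
  qed
  have bY: "bdd (closure D) (\<lambda>m. deriv_along (Y j) (\<phi> m))" if j: "j \<in> {1..n}" for j
  proof -
    have "nrm2 lborel (deriv_along (Y j) (\<phi> m)) \<le> B + 1" for m
      using hn_component[of j "jet (\<phi> m)"] jb[of m] T_nrm2[OF T_along[OF p(1)[of m] j]] j by (simp add: jet_def)
    thus ?thesis unfolding bdd_def using T_Cc[OF T_along[OF p(1) j]] by blast
  qed
  obtain r :: "nat \<Rightarrow> nat" where r: "strict_mono r"
    "\<And>e. e > 0 \<Longrightarrow> \<exists>N. \<forall>k\<ge>N. \<forall>l\<ge>N. nrm2 lborel (\<lambda>x. \<phi> (r k) x - \<phi> (r l) x) \<le> e"
    using compact_embedding_smooth[OF D(2) U H Y b0 bY] by blast
  have "\<exists>N. \<forall>k\<ge>N. \<forall>l\<ge>N. nrm2 M (\<lambda>x. \<phi> (r k) x - \<phi> (r l) x) \<le> e" if "e > 0" for e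
    using r(2)[OF that] by (simp add: T_nrm2 T_diff p(1))
  from sqi_complete[OF finite_M, of "\<lambda>m. \<phi> (r m)", OF T_sqi[OF p(1)] this]
  obtain u where u: "u \<in> sqi M" "(\<lambda>m. nrm2 M (\<lambda>x. \<phi> (r m) x - u x)) \<longlonglongrightarrow> 0" by blast
  have hs: "h m 0 \<in> sqi M" for m using W0_sq[OF h] by (simp add: sq_def)
  have "(\<lambda>m. inverse (real (Suc (r m)))) \<longlonglongrightarrow> 0"
    using LIMSEQ_subseq_LIMSEQ[OF LIMSEQ_inverse_real_of_nat r(1)] by (simp add: o_def)
  from tendsto_add[OF this u(2)]
  have l: "(\<lambda>m. inverse (real (Suc (r m))) + nrm2 M (\<lambda>x. \<phi> (r m) x - u x)) \<longlonglongrightarrow> 0" by simp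
  have "nrm2 M (\<lambda>x. h (r m) 0 x - u x) \<le> inverse (real (Suc (r m))) + nrm2 M (\<lambda>x. \<phi> (r m) x - u x)" for m
  proof -
    have "nrm2 M (\<lambda>x. \<phi> (r m) x - h (r m) 0 x) \<le> inverse (real (Suc (r m)))"
      using hn_component[of 0 "hsub (jet (\<phi> (r m))) (h (r m))"] p(2)[of "r m"] by (simp add: hsub_def jet_def)
    thus ?thesis
      using nrm2_triangle3[OF hs T_sqi[OF p(1)] u(1), of "r m" "r m"] nrm2_minus_commute[of M "h (r m) 0" "\<phi> (r m)"] by linarith
  qed
  hence "(\<lambda>m. nrm2 M (\<lambda>x. h (r m) 0 x - u x)) \<longlonglongrightarrow> 0"
    by (intro tendsto_sandwich[OF _ _ tendsto_const l]) (auto simp: nrm2_ge0)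
  thus ?thesis using that r(1) u(1) by blast
qed

end

section \<open>Capacity\<close>

context energy_space
begin

abbreviation cp where "cp \<equiv> cap D n Y"

lemma W0_self: assumes "W0 h" shows "h 0 \<in> W12_0 D n Y" "norm_H D n Y (h 0) = hn h"
proof -
  have "h 0 \<in> borel_measurable M" using W0_sq[OF assms] by (simp add: sq_def sqi_def)
  from W0_imp_W12_0[OF assms this] show "h 0 \<in> W12_0 D n Y" "norm_H D n Y (h 0) = hn h" by (auto simp: norm_H_eq)
qed

lemma cap_le:
  assumes "W0 h" "AE x in M. 0 \<le> h 0 x" "open V" "E \<subseteq> V" "V \<subseteq> D" "AE x in lebesgue_on V. 1 \<le> h 0 x"
  shows "cp E \<le> ereal ((hn h)\<^sup>2)"
  unfolding cap_def W0_self(2)[OF assms(1), symmetric]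
  by (rule INF_lower) (use W0_self(1)[OF assms(1)] assms in blast)

lemma cap_lessE:
  assumes "cp E < ereal e"
  obtains h V where "W0 h" "AE x in M. 0 \<le> h 0 x" "open V" "E \<subseteq> V" "V \<subseteq> D" "AE x in lebesgue_on V. 1 \<le> h 0 x" "(hn h)\<^sup>2 < e"
proof -
  obtain u V where u: "u \<in> W12_0 D n Y" "AE x in M. 0 \<le> u x" "open V" "E \<subseteq> V" "V \<subseteq> D" "AE x in lebesgue_on V. 1 \<le> u x"
      "(norm_H D n Y u)\<^sup>2 < e"
    using assms unfolding cap_def INF_less_iff by auto
  have w0: "wjet u 0 = u" by (simp add: wjet_def)
  show ?thesis by (rule that[of "wjet u" V]) (use u in \<open>auto simp: w0 W12_0_iff norm_H_eq\<close>)
qed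

lemma cap_nonneg: "0 \<le> cp E" unfolding cap_def by (rule INF_greatest) simp

lemma cap_mono: assumes "E \<subseteq> F" shows "cp E \<le> cp F"
  unfolding cap_def by (rule INF_superset_mono) (use assms in auto)

lemma cap_empty: "cp {} = 0"
proof -
  have "cp {} \<le> ereal ((hn (\<lambda>j x. 0))\<^sup>2)" by (rule cap_le[OF W0_0, of "{}"]) auto
  thus ?thesis using cap_nonneg[of "{}"] by (intro antisym) (auto simp: hn_def L2_set_def zero_ereal_def)
qed

lemma cap_eq_0I: assumes "\<And>e. e > 0 \<Longrightarrow> cp E < ereal e" shows "cp E = 0"
proof (rule antisym[OF _ cap_nonneg])
  show "cp E \<le> 0" by (rule ereal_le_epsilon2) (use assms in \<open>auto intro: less_imp_le\<close>)
qed

lemma cap_Un_less: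
  assumes "cp E < ereal (e/4)" "cp F < ereal (e/4)" shows "cp (E \<union> F) < ereal e"
proof -
  obtain g V where g: "W0 g" "AE x in M. 0 \<le> g 0 x" "open V" "E \<subseteq> V" "V \<subseteq> D" "AE x in lebesgue_on V. 1 \<le> g 0 x" "(hn g)\<^sup>2 < e/4"
    using cap_lessE[OF assms(1)] by metis
  obtain h W where h: "W0 h" "AE x in M. 0 \<le> h 0 x" "open W" "F \<subseteq> W" "W \<subseteq> D" "AE x in lebesgue_on W. 1 \<le> h 0 x" "(hn h)\<^sup>2 < e/4"
    using cap_lessE[OF assms(2)] by metis
  have VW: "V \<in> sets lebesgue" "W \<in> sets lebesgue" "V \<union> W \<in> sets lebesgue" using g(3) h(3) by auto
  have L: "AE x in lebesgue. x \<in> D \<longrightarrow> 0 \<le> g 0 x" "AE x in lebesgue. x \<in> D \<longrightarrow> 0 \<le> h 0 x"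
    "AE x in lebesgue. x \<in> V \<longrightarrow> 1 \<le> g 0 x" "AE x in lebesgue. x \<in> W \<longrightarrow> 1 \<le> h 0 x"
    using g(2,6) h(2,6) Dl VW by (simp_all add: AE_restrict_space_iff)
  have "AE x in lebesgue. x \<in> V \<union> W \<longrightarrow> 1 \<le> g 0 x + h 0 x"
    using L by eventually_elim (use g(5) h(5) in force)
  hence ae: "AE x in lebesgue_on (V \<union> W). 1 \<le> g 0 x + h 0 x" using VW by (simp add: AE_restrict_space_iff)
  have "cp (E \<union> F) \<le> ereal ((hn (\<lambda>j x. g j x + h j x))\<^sup>2)"
    by (rule cap_le[OF W0_add[OF g(1) h(1)], of "V \<union> W"]) (use g h ae in auto)
  also have "(hn (\<lambda>j x. g j x + h j x))\<^sup>2 \<le> (hn g + hn h)\<^sup>2"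
    by (intro power_mono hn_triangle W0_sq g h hn_ge0)
  also have "(hn g + hn h)\<^sup>2 \<le> 2 * (hn g)\<^sup>2 + 2 * (hn h)\<^sup>2"
    using sum_squares_bound[of "hn g" "hn h"] by (simp add: power2_sum)
  also have "\<dots> < e" using g(7) h(7) by linarith
  finally show ?thesis by simp
qed

lemma cap_Un_eq_0: assumes "cp E = 0" "cp F = 0" shows "cp (E \<union> F) = 0"
proof (rule cap_eq_0I)
  fix e :: real assume "0 < e"
  thus "cp (E \<union> F) < ereal e" using cap_Un_less[of E e F] assms by simp
qed

lemma cap_eq_0_subset: "E \<subseteq> F \<Longrightarrow> cp F = 0 \<Longrightarrow> cp E = 0"
  using cap_mono[of E F] cap_nonneg[of E] by simp

lemma cap_UN_eq_0: "finite I \<Longrightarrow> (\<And>i. i \<in> I \<Longrightarrow> cp (E i) = 0) \<Longrightarrow> cp (\<Union>i\<in>I. E i) = 0"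
  by (induction I rule: finite_induct) (auto intro: cap_Un_eq_0 simp: cap_empty)

text \<open>Chebyshev's inequality: a competitor is at least 1 on an open set containing
  \<open>E\<close>, whose measure is therefore at most the squared norm.\<close>

lemma cap_eq_0_null: assumes "cp E = 0" shows "E \<in> null_sets lebesgue"
proof -
  have "negligible E"
    unfolding negligible_outer
  proof (intro allI impI)
    fix e :: real assume e: "e > 0"
    obtain h V where h: "W0 h" "AE x in M. 0 \<le> h 0 x" "open V" "E \<subseteq> V" "V \<subseteq> D" "AE x in lebesgue_on V. 1 \<le> h 0 x" "(hn h)\<^sup>2 < e"
      using cap_lessE[of E e] assms e by auto
    have Vl: "V \<in> sets lebesgue" using h(3) by simp
    have Vm: "V \<in> lmeasurable" using bounded_set_imp_lmeasurable[OF bounded_subset[OF D(2) h(5)] Vl] .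
    have s: "h 0 \<in> sqi M" using W0_sq[OF h(1)] by (simp add: sq_def)
    have VM: "V \<in> sets M" using Vl h(5) Dl by (auto simp: sets_restrict_space_iff)
    have L: "AE x in lebesgue. x \<in> V \<longrightarrow> 1 \<le> h 0 x" using h(6) Vl by (simp add: AE_restrict_space_iff)
    have "AE x in M. indicator V x \<le> (h 0 x)\<^sup>2"
    proof (subst AE_restrict_space_iff)
      show "D \<inter> space lebesgue \<in> sets lebesgue" using Dl by simp
      show "AE x in lebesgue. x \<in> D \<longrightarrow> indicator V x \<le> (h 0 x)\<^sup>2"
        using L by eventually_elim (auto simp: indicator_def one_le_power)
    qed
    hence "(\<integral>x. indicator V x \<partial>M) \<le> (\<integral>x. (h 0 x)\<^sup>2 \<partial>M)"
      using VM by (intro integral_mono_AE sqi_square[OF s]) (auto simp: less_top[symmetric])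
    also have "\<dots> \<le> (hn h)\<^sup>2" unfolding nrm2_sq[symmetric] by (intro power_mono hn_component nrm2_ge0) simp
    finally have "measure M V < e" using h(7) VM h(5) by (simp add: Int_absorb2)
    hence "measure lebesgue V < e" using h(5) Dl by (simp add: measure_restrict_space)
    thus "\<exists>T. E \<subseteq> T \<and> T \<in> lmeasurable \<and> measure lebesgue T < e" using h(4) Vm by blast
  qed
  thus ?thesis by (simp add: negligible_iff_null_sets)
qed

section \<open>Quasi-continuity\<close>

abbreviation qc where "qc \<equiv> quasi_continuous D n Y"

lemma qc_compose: assumes "qc u" "continuous_on UNIV F" shows "qc (\<lambda>x. F (u x))"
  unfolding quasi_continuous_def
proof (intro allI impI)
  fix e :: real assume "e > 0"
  then obtain G where G: "open G" "G \<subseteq> D" "cp G < ereal e" "continuous_on (D - G) u" using assms(1) unfolding quasi_continuous_def by blast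
  have "continuous_on (D - G) (\<lambda>x. F (u x))" by (rule continuous_on_compose2[OF assms(2) G(4)]) auto
  thus "\<exists>G. open G \<and> G \<subseteq> D \<and> cp G < ereal e \<and> continuous_on (D - G) (\<lambda>x. F (u x))" using G by blast
qed

lemma qc_add: assumes "qc u" "qc v" shows "qc (\<lambda>x. u x + v x)"
  unfolding quasi_continuous_def
proof (intro allI impI)
  fix e :: real assume "e > 0"
  hence e: "e/4 > 0" by simp
  obtain G where G: "open G" "G \<subseteq> D" "cp G < ereal (e/4)" "continuous_on (D - G) u" using assms(1) e unfolding quasi_continuous_def by blast
  obtain F where F: "open F" "F \<subseteq> D" "cp F < ereal (e/4)" "continuous_on (D - F) v" using assms(2) e unfolding quasi_continuous_def by blast
  have "continuous_on (D - (G \<union> F)) (\<lambda>x. u x + v x)"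
    by (intro continuous_on_add continuous_on_subset[OF G(4)] continuous_on_subset[OF F(4)]) auto
  thus "\<exists>G. open G \<and> G \<subseteq> D \<and> cp G < ereal e \<and> continuous_on (D - G) (\<lambda>x. u x + v x)"
    using G F cap_Un_less[OF G(3) F(3)] by (intro exI[of _ "G \<union> F"]) auto
qed

lemma qc_const: "qc (\<lambda>x. c)"
  unfolding quasi_continuous_def using cap_empty by (auto intro!: exI[of _ "{}"])

lemma qc_sum: "(\<And>i. i \<in> I \<Longrightarrow> qc (u i)) \<Longrightarrow> qc (\<lambda>x. \<Sum>i\<in>I. u i x)"
  by (induction I rule: infinite_finite_induct) (auto intro: qc_const qc_add)

lemma qc_cmult: "qc u \<Longrightarrow> qc (\<lambda>x. c * u x)"
  by (rule qc_compose[where F="\<lambda>t. c * t"]) (auto intro: continuous_intros)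

lemma H_qc_iff: "u \<in> H_qc D n Y \<longleftrightarrow> W0 (wjet u) \<and> qc u"
  by (simp add: H_qc_def W12_0_iff)

lemma H_qc_I:
  assumes "W0 h" "h 0 = u" "qc u" shows "u \<in> H_qc D n Y"
  using W0_self(1)[OF assms(1)] assms by (simp add: H_qc_def)

lemma H_qc_sum:
  assumes "\<And>i. i \<in> I \<Longrightarrow> u i \<in> H_qc D n Y" shows "(\<lambda>x. \<Sum>i\<in>I. a i * u i x) \<in> H_qc D n Y"
proof (rule H_qc_I)
  show "W0 (\<lambda>j x. \<Sum>i\<in>I. a i * wjet (u i) j x)" by (intro W0_sum W0_cmult) (use assms in \<open>auto simp: H_qc_iff\<close>)
  show "qc (\<lambda>x. \<Sum>i\<in>I. a i * u i x)" by (intro qc_sum qc_cmult) (use assms in \<open>auto simp: H_qc_iff\<close>)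
qed (simp add: wjet_def)

lemma H_qc_0: "(\<lambda>x. 0) \<in> H_qc D n Y" using H_qc_I[OF W0_0 refl qc_const] .

lemma H_qc_sqi: "u \<in> H_qc D n Y \<Longrightarrow> u \<in> sqi M"
  unfolding H_qc_iff using W0_sq[of "wjet u"] by (auto simp: sq_def wjet_def dest: spec[of _ 0])

text \<open>
  If \<open>\<phi> m\<close> converges fast in energy norm, the function \<open>2 * frac (2^m * (\<phi> (m+1) - \<phi> m))\<close> is at least \<open>1\<close>
  where the increment exceeds \<open>1/2^m\<close>, and the tails of the series of these functions test the capacity of
  the union of these sets.
\<close>

lemma quasi_continuous_representative:
  assumes h: "W0 h"
  obtains u where "u \<in> H_qc D n Y" "AE x in M. u x = h 0 x"
proof -
  have hs: "h 0 \<in> sqi M" using W0_sq[OF h] by (simp add: sq_def)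
  \<comment> \<open>The rate 1/8 leaves the summable bound 2 (1/4)^m after the increments have been
    multiplied by 2^m.\<close>
  have "\<exists>\<phi>. \<phi> \<in> T \<and> hn (hsub (jet \<phi>) h) < (1/8)^m" for m
    using h unfolding W0_def by (metis zero_less_power zero_less_divide_1_iff zero_less_numeral)
  then obtain \<phi> where p: "\<And>m. \<phi> m \<in> T" "\<And>m. hn (hsub (jet (\<phi> m)) h) < (1/8)^m" by metis
  define \<psi> where "\<psi> m x = \<phi> (Suc m) x - \<phi> m x" for m x
  have \<psi>T: "\<psi> m \<in> T" for m unfolding \<psi>_def[abs_def] by (intro T_diff p)
  have \<psi>n: "hn (jet (\<psi> m)) \<le> 2 * (1/8)^m" for m
  proof -
    have "hn (jet (\<psi> m)) \<le> hn (hsub (jet (\<phi> (Suc m))) h) + hn (hsub h (jet (\<phi> m)))"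
      unfolding \<psi>_def[abs_def] jet_diff[OF p(1) p(1)]
      by (rule hn_hsub_triangle[OF sq_jet[OF p(1)] W0_sq[OF h] sq_jet[OF p(1)]])
    also have "\<dots> \<le> (1/8)^(Suc m) + (1/8)^m" using p(2)[of "Suc m"] p(2)[of m] hn_hsub_commute[of h "jet (\<phi> m)"] by simp
    also have "\<dots> \<le> 2 * (1/8)^m" by simp
    finally show ?thesis .
  qed
  define g where "g m x = frac (2^m * \<psi> m x)" for m x
  have gT: "g m \<in> T" for m unfolding g_def[abs_def] by (intro T_frac T_cmult \<psi>T)
  have gn: "hn (jet (g m)) \<le> 2 * (1/4)^m" for m
  proof -
    have "hn (jet (g m)) \<le> hn (jet (\<lambda>x. 2^m * \<psi> m x))" unfolding g_def[abs_def] by (rule hn_frac_le[OF T_cmult[OF \<psi>T]])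
    also have "\<dots> = 2^m * hn (jet (\<psi> m))" by (simp add: jet_cmult[OF \<psi>T] hn_cmult)
    also have "\<dots> \<le> 2^m * (2 * (1/8)^m)" by (intro mult_left_mono \<psi>n) simp
    also have "\<dots> = 2 * (1/4)^m" by (simp add: power_mult_distrib[symmetric])
    finally show ?thesis .
  qed
  have g0: "0 \<le> g m x" for m x by (simp add: g_def frac_nonneg)
  define A where "A m = {x. (1/2)^m < \<bar>\<psi> m x\<bar>}" for m
  have gA: "1 \<le> 2 * g m x" if "x \<in> A m" for m x
  proof -
    have "2^m * (1/2)^m < 2^m * \<bar>\<psi> m x\<bar>" using that by (intro mult_strict_left_mono) (auto simp: A_def)
    hence "1 \<le> \<bar>2^m * \<psi> m x\<bar>" by (simp add: abs_mult power_divide)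
    from frac_ge_half[OF this] show ?thesis by (simp add: g_def)
  qed
  have Ao: "open (A m)" for m
    unfolding A_def by (intro open_Collect_less continuous_intros Cc_continuous[OF T_Cc[OF \<psi>T]])
  have AD: "A m \<subseteq> D" for m
    using T_outside[OF \<psi>T, of _ m] by (force simp: A_def)
  \<comment> \<open>The partial sums increase and converge in the energy norm to some s; the tail s
    - S N is a nonnegative competitor for the capacity of \<open>O' N\<close>, with norm tending to
    0.\<close>
  define S where "S k x = (\<Sum>m<k. 2 * g m x)" for k x
  have ST: "S k \<in> T" for k
  proof (induction k)
    case (Suc k)
    have "S (Suc k) = (\<lambda>x. S k x + 2 * g k x)" by (auto simp: S_def)
    thus ?case using T_add[OF Suc T_cmult[OF gT]] by simp
  qed (simp add: S_def[abs_def] T_0)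
  have Sinc: "S k x \<le> S l x" if "k \<le> l" for k l x
    unfolding S_def by (rule sum_mono2) (use that g0 in auto)
  have Sdiff: "hn (hsub (jet (S l)) (jet (S k))) \<le> (\<Sum>m=k..<l. 4 * (1/4)^m)" if "k \<le> l" for k l
    using that
  proof (induction l rule: dec_induct)
    case base
    show ?case by (simp add: hn_def hsub_def L2_set_def)
  next
    case (step l)
    have e: "hsub (jet (S (Suc l))) (jet (S k)) = (\<lambda>j x. hsub (jet (S l)) (jet (S k)) j x + 2 * jet (g l) j x)"
    proof -
      have "S (Suc l) = (\<lambda>x. S l x + 2 * g l x)" by (auto simp: S_def)
      thus ?thesis using jet_add[OF ST T_cmult[OF gT], of l 2 l] jet_cmult[OF gT, of 2 l] by (auto simp: hsub_def intro!: ext)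
    qed
    have "hn (hsub (jet (S (Suc l))) (jet (S k))) \<le> hn (hsub (jet (S l)) (jet (S k))) + hn (\<lambda>j x. 2 * jet (g l) j x)"
      unfolding e by (rule hn_triangle) (auto intro!: sq_hsub sq_jet ST W0_sq[OF W0_cmult[OF W0_jet[OF gT]]])
    also have "hn (\<lambda>j x. 2 * jet (g l) j x) \<le> 4 * (1/4)^l" using gn[of l] by (simp add: hn_cmult)
    finally show ?case using step by simp
  qed
  have summ: "summable (\<lambda>m. 4 * (1/4::real)^m)" by (intro summable_mult summable_geometric) simp
  have "\<exists>N. \<forall>k\<ge>N. \<forall>l\<ge>N. hn (hsub (jet (S k)) (jet (S l))) \<le> e" if e: "e > 0" for e
  proof -
    obtain N where N: "\<And>m k. m \<ge> N \<Longrightarrow> norm (\<Sum>i=m..<k. 4 * (1/4::real)^i) < e"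
      using summ e unfolding summable_Cauchy by blast
    have *: "hn (hsub (jet (S l)) (jet (S k))) \<le> e" if "N \<le> k" "k \<le> l" for k l
      using Sdiff[OF that(2)] N[OF that(1), of l] by simp
    have "hn (hsub (jet (S k)) (jet (S l))) \<le> e" if "N \<le> k" "N \<le> l" for k l
      using *[of k l] *[of l k] that hn_hsub_commute[of "jet (S k)" "jet (S l)"] by (cases "k \<le> l") auto
    thus ?thesis by blast
  qed
  from W0_complete[of "\<lambda>k. jet (S k)", OF W0_jet[OF ST] this]
  obtain s where s: "W0 s" "(\<lambda>m. hn (hsub (jet (S m)) s)) \<longlonglongrightarrow> 0" by blast
  have ss: "s 0 \<in> sqi M" using W0_sq[OF s(1)] by (simp add: sq_def)
  have "(\<lambda>m. nrm2 M (\<lambda>x. S m x - s 0 x)) \<longlonglongrightarrow> 0"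
    using s(2) by (auto simp: hn_tendsto_iff jet_def dest: spec[of _ 0])
  from nrm2_tendsto_AE_subseq[OF ss T_sqi[OF ST] this]
  obtain r where r: "strict_mono r" "AE x in M. (\<lambda>m. S (r m) x) \<longlonglongrightarrow> s 0 x" by blast
  have Sle: "AE x in M. \<forall>k. S k x \<le> s 0 x"
    using r(2)
  proof eventually_elim
    case (elim x)
    show ?case
    proof
      fix k
      show "S k x \<le> s 0 x"
        by (rule LIMSEQ_le_const[OF elim]) (use Sinc seq_suble[OF r(1)] order_trans in blast)
    qed
  qed
  define O' where "O' N = (\<Union>m\<in>{N..}. A m)" for N
  have Oo: "open (O' N)" "O' N \<subseteq> D" for N unfolding O'_def using Ao AD by auto
  have Ocap: "cp (O' N) \<le> ereal ((hn (hsub (jet (S N)) s))\<^sup>2)" for N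
  proof -
    have "cp (O' N) \<le> ereal ((hn (hsub s (jet (S N))))\<^sup>2)"
    proof (rule cap_le[OF W0_hsub[OF s(1) W0_jet[OF ST]] _ Oo(1) order_refl Oo(2)])
      show "AE x in M. 0 \<le> hsub s (jet (S N)) 0 x" using Sle by (auto simp: hsub_def jet_def)
      have "AE x in lebesgue. x \<in> D \<longrightarrow> (\<forall>k. S k x \<le> s 0 x)" using Sle Dl by (simp add: AE_restrict_space_iff)
      hence "AE x in lebesgue. x \<in> O' N \<longrightarrow> 1 \<le> s 0 x - S N x"
      proof eventually_elim
        case (elim x)
        show ?case
        proof
          assume x: "x \<in> O' N"
          then obtain m where m: "N \<le> m" "x \<in> A m" by (auto simp: O'_def)
          have "1 \<le> 2 * g m x" by (rule gA[OF m(2)])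
          also have "2 * g m x = S (Suc m) x - S m x" by (simp add: S_def)
          also have "\<dots> \<le> s 0 x - S N x" using elim Oo(2) x Sinc[OF m(1), of x] by (smt (verit) subsetD)
          finally show "1 \<le> s 0 x - S N x" .
        qed
      qed
      thus "AE x in lebesgue_on (O' N). 1 \<le> hsub s (jet (S N)) 0 x"
        using Oo(1) by (subst AE_restrict_space_iff) (auto simp: hsub_def jet_def)
    qed
    thus ?thesis by (simp add: hn_hsub_commute)
  qed
  have Osmall: "\<exists>N. cp (O' N) < ereal e" if e: "e > 0" for e
  proof -
    have "(\<lambda>m. (hn (hsub (jet (S m)) s))\<^sup>2) \<longlonglongrightarrow> 0\<^sup>2" by (intro tendsto_power s(2))
    hence "\<forall>\<^sub>F m in sequentially. (hn (hsub (jet (S m)) s))\<^sup>2 < e" by (rule order_tendstoD(2)) (use e in simp)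
    then obtain N where "(hn (hsub (jet (S N)) s))\<^sup>2 < e" by (auto simp: eventually_sequentially)
    thus ?thesis using Ocap[of N] by (metis ereal_less_le ereal_less(2) le_less_trans less_ereal.simps(1))
  qed
  define u where "u x = \<phi> 0 x + (\<Sum>i. \<psi> i x)" for x
  have tel: "\<phi> k x = \<phi> 0 x + (\<Sum>i<k. \<psi> i x)" for k x
    unfolding \<psi>_def by (induction k) auto
  \<comment> \<open>Off \<open>O' N\<close> all increments from index N on are at most (1/2)^m, so
    the series converges uniformly and its sum is continuous there.\<close>
  have unif: "uniform_limit (D - O' N) (\<lambda>k x. \<Sum>i<k. \<psi> i x) (\<lambda>x. \<Sum>i. \<psi> i x) sequentially" for N
  proof (rule Weierstrass_m_test_ev[where M="\<lambda>m. (1/2)^m"])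
    show "\<forall>\<^sub>F m in sequentially. \<forall>x\<in>D - O' N. norm (\<psi> m x) \<le> (1/2)^m"
      unfolding eventually_sequentially by (intro exI[of _ N]) (auto simp: O'_def A_def not_less)
  qed (simp add: summable_geometric)
  have uc: "continuous_on (D - O' N) u" for N
  proof -
    have "continuous_on (D - O' N) (\<lambda>x. \<Sum>i. \<psi> i x)"
      by (rule uniform_limit_theorem[OF _ unif])
        (auto intro!: always_eventually continuous_on_sum Cc_continuous[OF T_Cc[OF \<psi>T]])
    thus ?thesis unfolding u_def[abs_def] by (intro continuous_on_add Cc_continuous[OF T_Cc[OF p(1)]])
  qed
  have uqc: "qc u" unfolding quasi_continuous_def
  proof (intro allI impI)
    fix e :: real assume "e > 0"
    then obtain N where "cp (O' N) < ereal e" using Osmall by blast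
    thus "\<exists>G. open G \<and> G \<subseteq> D \<and> cp G < ereal e \<and> continuous_on (D - G) u" using Oo uc by blast
  qed
  have um: "u \<in> borel_measurable M"
    unfolding u_def[abs_def]
    by (intro borel_measurable_add borel_measurable_suminf borel_imp_M T_measurable p \<psi>T)
  \<comment> \<open>A point outside this null set lies off some \<open>O' N\<close>, so the series
    converges almost everywhere.\<close>
  have null: "(\<Inter>N. O' N) \<in> null_sets lebesgue"
  proof (rule cap_eq_0_null, rule cap_eq_0I)
    fix e :: real assume "0 < e"
    then obtain N where "cp (O' N) < ereal e" using Osmall by blast
    thus "cp (\<Inter>N. O' N) < ereal e" using cap_mono[of "\<Inter>N. O' N" "O' N"] by (auto intro: le_less_trans)
  qed
  have conv: "AE x in M. (\<lambda>k. \<phi> k x) \<longlonglongrightarrow> u x"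
  proof (subst AE_restrict_space_iff)
    show "D \<inter> space lebesgue \<in> sets lebesgue" using Dl by simp
    show "AE x in lebesgue. x \<in> D \<longrightarrow> (\<lambda>k. \<phi> k x) \<longlonglongrightarrow> u x"
      using AE_not_in[OF null]
    proof eventually_elim
      case (elim x)
      show ?case
      proof
        assume "x \<in> D"
        then obtain N where "x \<in> D - O' N" using elim by auto
        from tendsto_uniform_limitI[OF unif this]
        have "(\<lambda>k. \<phi> 0 x + (\<Sum>i<k. \<psi> i x)) \<longlonglongrightarrow> \<phi> 0 x + (\<Sum>i. \<psi> i x)" by (intro tendsto_intros)
        thus "(\<lambda>k. \<phi> k x) \<longlonglongrightarrow> u x" by (simp add: tel[symmetric] u_def)
      qed
    qed
  qed
  have "(\<lambda>m. nrm2 M (\<lambda>x. \<phi> m x - h 0 x)) \<longlonglongrightarrow> 0"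
  proof (rule tendsto_sandwich[OF _ _ tendsto_const])
    show "(\<lambda>m. (1/8::real)^m) \<longlonglongrightarrow> 0" by (rule LIMSEQ_realpow_zero) auto
    have "nrm2 M (\<lambda>x. \<phi> m x - h 0 x) \<le> (1/8)^m" for m
      using hn_component[of 0 "hsub (jet (\<phi> m)) h"] p(2)[of m] by (simp add: hsub_def jet_def)
    thus "\<forall>\<^sub>F m in sequentially. nrm2 M (\<lambda>x. \<phi> m x - h 0 x) \<le> (1/8)^m" by simp
  qed (simp add: nrm2_ge0)
  from nrm2_tendsto_AE_subseq[OF hs T_sqi[OF p(1)] this]
  obtain q where q: "strict_mono q" "AE x in M. (\<lambda>m. \<phi> (q m) x) \<longlonglongrightarrow> h 0 x" by blast
  have ae: "AE x in M. u x = h 0 x"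
    using conv q(2)
  proof eventually_elim
    case (elim x)
    from LIMSEQ_subseq_LIMSEQ[OF elim(1) q(1)] elim(2) show ?case by (auto simp: o_def intro: LIMSEQ_unique)
  qed
  have "u \<in> H_qc D n Y" using W0_imp_W12_0(1)[OF h um ae] uqc by (simp add: H_qc_def)
  thus ?thesis using that ae by blast
qed

end

section \<open>Existence of optimal sets\<close>

text \<open>The result is a matrix of coefficients and not a list of functions, so the new functions
  are visibly combinations of the old ones and inherit membership in any space closed under such
  sums. Linear independence is counted almost everywhere, which is what makes the norm of the
  residual positive.\<close>

lemma gram_schmidt:
  fixes e :: "nat \<Rightarrow> 'a \<Rightarrow> real"
  assumes e: "\<And>i. i < k \<Longrightarrow> e i \<in> sqi M"
    and ind: "\<And>a. (AE x in M. (\<Sum>i<k. a i * e i x) = 0) \<Longrightarrow> \<forall>i<k. a i = 0"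
  shows "\<exists>c. \<forall>i<k. \<forall>j<k. (\<integral>x. (\<Sum>l<k. c i l * e l x) * (\<Sum>l<k. c j l * e l x) \<partial>M) = of_bool (i = j)"
  using e ind
proof (induction k)
  case 0 show ?case by simp
next
  case (Suc k)
  have "\<forall>i<k. a i = 0" if a: "AE x in M. (\<Sum>i<k. a i * e i x) = 0" for a
  proof -
    \<comment> \<open>A relation among the first k functions becomes one among k + 1 by a zero
      coefficient.\<close>
    have "AE x in M. (\<Sum>i<Suc k. (a(k := 0)) i * e i x) = 0"
      using a by (simp add: sum.lessThan_Suc cong: sum.cong_simp)
    note z = Suc.prems(2)[OF this]
    show ?thesis
    proof (intro allI impI)
      fix i assume "i < k"
      thus "a i = 0" using z[rule_format, of i] by simp
    qed
  qed
  from Suc.IH[OF Suc.prems(1) this] obtain c where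
    c: "\<And>i j. i < k \<Longrightarrow> j < k \<Longrightarrow> (\<integral>x. (\<Sum>l<k. c i l * e l x) * (\<Sum>l<k. c j l * e l x) \<partial>M) = of_bool (i = j)"
    by auto
  define f where "f i x = (\<Sum>l<k. c i l * e l x)" for i x
  have fs: "f i \<in> sqi M" for i unfolding f_def[abs_def] by (intro sqi_sum sqi_cmult) (use Suc.prems(1) in auto)
  have fo: "(\<integral>x. f i x * f j x \<partial>M) = of_bool (i = j)" if "i < k" "j < k" for i j using c[OF that] by (simp add: f_def)
  have es: "e k \<in> sqi M" using Suc.prems(1) by simp
  define p where "p i = (\<integral>x. e k x * f i x \<partial>M)" for i
  define v where "v x = e k x - (\<Sum>i<k. p i * f i x)" for x
  have vs: "v \<in> sqi M" unfolding v_def[abs_def] by (intro sqi_diff es sqi_sum sqi_cmult fs)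
  have vf: "(\<integral>x. v x * f j x \<partial>M) = 0" if j: "j < k" for j
  proof -
    have "(\<integral>x. v x * f j x \<partial>M) = (\<integral>x. e k x * f j x - (\<Sum>i<k. p i * (f i x * f j x)) \<partial>M)"
      by (simp add: v_def left_diff_distrib sum_distrib_right mult.assoc)
    also have "\<dots> = p j - (\<Sum>i<k. p i * (\<integral>x. f i x * f j x \<partial>M))"
      using sqi_integrable_mult[OF es fs[of j]] sqi_integrable_mult[OF fs fs[of j]] by (simp add: p_def)
    also have "(\<Sum>i<k. p i * (\<integral>x. f i x * f j x \<partial>M)) = (\<Sum>i<k. if i = j then p i else 0)"
      by (intro sum.cong) (auto simp: fo j)
    also have "\<dots> = p j" using j by simp
    finally show ?thesis by simp
  qed
  \<comment> \<open>Coefficients of the residual in terms of the original functions; the coefficient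
    1 at index k contradicts independence if the residual vanishes.\<close>
  define b where "b l = (if l = k then 1 else - (\<Sum>i<k. p i * c i l))" for l
  have vb: "v x = (\<Sum>l<Suc k. b l * e l x)" for x
  proof -
    have "(\<Sum>i<k. p i * f i x) = (\<Sum>l<k. (\<Sum>i<k. p i * c i l) * e l x)"
      unfolding f_def sum_distrib_left sum_distrib_right by (subst sum.swap) (simp add: mult.assoc)
    thus ?thesis by (simp add: v_def b_def sum_negf)
  qed
  define N where "N = nrm2 M v"
  have N: "N > 0"
  proof (rule ccontr)
    assume "\<not> N > 0"
    hence "N = 0" using nrm2_ge0[of M v] by (simp add: N_def)
    hence "AE x in M. v x = 0" using nrm2_eq_0D[OF vs] by (simp add: N_def)
    hence "AE x in M. (\<Sum>l<Suc k. b l * e l x) = 0" by (simp add: vb)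
    from Suc.prems(2)[OF this] have "b k = 0" by simp
    thus False by (simp add: b_def)
  qed
  have vv: "(\<integral>x. v x * v x \<partial>M) = N * N" using nrm2_sq[of M v] by (simp add: N_def power2_eq_square)
  define c' where "c' i l = (if i < k then (if l < k then c i l else 0) else b l / N)" for i l
  have c'1: "(\<Sum>l<Suc k. c' i l * e l x) = f i x" if "i < k" for i x using that by (simp add: c'_def f_def)
  have c'2: "(\<Sum>l<Suc k. c' k l * e l x) = v x / N" for x
    unfolding vb sum_divide_distrib by (simp add: c'_def)
  have "(\<integral>x. (\<Sum>l<Suc k. c' i l * e l x) * (\<Sum>l<Suc k. c' j l * e l x) \<partial>M) = of_bool (i = j)" if ij: "i < Suc k" "j < Suc k" for i j
  proof -
    consider "i < k" "j < k" | "i < k" "j = k" | "i = k" "j < k" | "i = k" "j = k" using ij by linarith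
    thus ?thesis
    proof cases
      case 1 thus ?thesis by (simp only: c'1 fo)
    next
      case 2
      have "(\<integral>x. f i x * (v x / N) \<partial>M) = (\<integral>x. v x * f i x / N \<partial>M)" by (simp add: mult.commute)
      thus ?thesis using 2 vf[OF 2(1)] by (simp only: c'1 c'2) simp
    next
      case 3
      have "(\<integral>x. (v x / N) * f j x \<partial>M) = (\<integral>x. v x * f j x / N \<partial>M)" by simp
      thus ?thesis using 3 vf[OF 3(2)] by (simp only: c'1 c'2) simp
    next
      case 4
      have "(\<integral>x. (v x / N) * (v x / N) \<partial>M) = (\<integral>x. v x * v x / (N * N) \<partial>M)" by simp
      thus ?thesis using 4 vv N by (simp only: c'2) simp
    qed
  qed
  thus ?case by blast
qed

lemma sum_square_orthonormal:
  fixes f :: "nat \<Rightarrow> 'a \<Rightarrow> real"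
  assumes f: "\<And>i. i < k \<Longrightarrow> f i \<in> sqi M"
    and o: "\<And>i j. i < k \<Longrightarrow> j < k \<Longrightarrow> (\<integral>x. f i x * f j x \<partial>M) = of_bool (i = j)"
  shows "(\<integral>x. (\<Sum>i<k. a i * f i x)\<^sup>2 \<partial>M) = (\<Sum>i<k. (a i)\<^sup>2)"
proof -
  have "(\<integral>x. (\<Sum>i<k. a i * f i x)\<^sup>2 \<partial>M) = (\<integral>x. (\<Sum>i<k. \<Sum>j<k. a i * a j * (f i x * f j x)) \<partial>M)"
    by (simp add: power2_eq_square sum_product ac_simps)
  also have "\<dots> = (\<Sum>i<k. \<Sum>j<k. a i * a j * (\<integral>x. f i x * f j x \<partial>M))"
  proof -
    have i: "integrable M (\<lambda>x. a i * a j * (f i x * f j x))" if "i \<in> {..<k}" "j \<in> {..<k}" for i j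
      using sqi_integrable_mult[OF f f, of i j] that by simp
    have "(\<integral>x. (\<Sum>i<k. \<Sum>j<k. a i * a j * (f i x * f j x)) \<partial>M) = (\<Sum>i<k. \<integral>x. (\<Sum>j<k. a i * a j * (f i x * f j x)) \<partial>M)"
      by (intro Bochner_Integration.integral_sum Bochner_Integration.integrable_sum i)
    also have "\<dots> = (\<Sum>i<k. \<Sum>j<k. \<integral>x. a i * a j * (f i x * f j x) \<partial>M)"
      by (intro sum.cong refl Bochner_Integration.integral_sum i)
    finally show ?thesis by simp
  qed
  also have "\<dots> = (\<Sum>i<k. \<Sum>j<k. if i = j then a i * a j else 0)"
    by (intro sum.cong refl) (auto simp: o)
  also have "\<dots> = (\<Sum>i<k. (a i)\<^sup>2)" by (simp add: power2_eq_square)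
  finally show ?thesis .
qed

section \<open>Functions on quasi-open sets\<close>

context energy_space
begin

abbreviation QO where "QO \<equiv> quasi_open D n Y"
abbreviation HO where "HO \<equiv> H0 D n Y"

lemma QO_subset: "QO \<Omega> \<Longrightarrow> \<Omega> \<subseteq> D" by (simp add: quasi_open_def)

text \<open>A quasi-open set differs from a measurable superlevel set by a set of zero capacity,
  which is null.\<close>

lemma QO_measurable: assumes "QO \<Omega>" shows "\<Omega> \<in> sets lebesgue"
proof -
  obtain u where u: "u \<in> H_qc D n Y" "cp (sym_diff \<Omega> {x \<in> D. 0 < u x}) = 0" using assms by (auto simp: quasi_open_def)
  define S where "S = {x \<in> D. 0 < u x}"
  have "{x \<in> space M. 0 < u x} \<in> sets M" using H_qc_sqi[OF u(1)] by measurable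
  hence S: "S \<in> sets lebesgue" using Dl by (auto simp: S_def sets_restrict_space_iff)
  have null: "sym_diff \<Omega> S \<in> null_sets lebesgue" unfolding S_def by (rule cap_eq_0_null[OF u(2)])
  have "\<Omega> - S \<in> null_sets lebesgue" "S - \<Omega> \<in> null_sets lebesgue"
    using null by (auto intro: null_sets_completion_subset)
  hence "(S - (S - \<Omega>)) \<union> (\<Omega> - S) \<in> sets lebesgue" using S by auto
  moreover have "(S - (S - \<Omega>)) \<union> (\<Omega> - S) = \<Omega>" by auto
  ultimately show ?thesis by simp
qed

lemma HO_qc: "u \<in> HO \<Omega> \<Longrightarrow> u \<in> H_qc D n Y" by (simp add: H0_def)
lemma HO_sqi: "u \<in> HO \<Omega> \<Longrightarrow> u \<in> sqi M" using HO_qc H_qc_sqi by blast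
lemma HO_W0: "u \<in> HO \<Omega> \<Longrightarrow> W0 (wjet u)" using HO_qc H_qc_iff by blast

lemma HO_zero_outside: assumes "u \<in> HO \<Omega>" shows "AE x in M. x \<notin> \<Omega> \<longrightarrow> u x = 0"
proof (subst AE_restrict_space_iff)
  have "{x \<in> D. u x \<noteq> 0} - \<Omega> \<in> null_sets lebesgue" using assms by (intro cap_eq_0_null) (simp add: H0_def)
  from AE_not_in[OF this] show "AE x in lebesgue. x \<in> D \<longrightarrow> x \<notin> \<Omega> \<longrightarrow> u x = 0" by eventually_elim auto
qed (use Dl in simp)

lemma integral_on_subset:
  fixes g :: "real ^ 'd \<Rightarrow> real"
  assumes \<Omega>: "\<Omega> \<in> sets lebesgue" "\<Omega> \<subseteq> D" and g: "g \<in> borel_measurable M" and z: "AE x in M. x \<notin> \<Omega> \<longrightarrow> g x = 0"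
  shows "(\<integral>x. g x \<partial>lebesgue_on \<Omega>) = (\<integral>x. g x \<partial>M)"
proof -
  have "(\<integral>x. g x \<partial>lebesgue_on \<Omega>) = (\<integral>x. indicator \<Omega> x *\<^sub>R g x \<partial>lebesgue)"
    by (rule integral_restrict_space) (use \<Omega> in simp)
  also have "\<dots> = (\<integral>x. indicator D x *\<^sub>R (indicator \<Omega> x *\<^sub>R g x) \<partial>lebesgue)"
    by (rule Bochner_Integration.integral_cong) (use \<Omega> in \<open>auto simp: indicator_def\<close>)
  also have "\<dots> = (\<integral>x. indicator \<Omega> x *\<^sub>R g x \<partial>M)"
    by (rule integral_restrict_space[symmetric]) (use Dl in simp)
  also have "\<dots> = (\<integral>x. g x \<partial>M)"
  proof (rule integral_cong_AE)
    have "\<Omega> \<in> sets M" using \<Omega> Dl by (auto simp: sets_restrict_space_iff)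
    thus "(\<lambda>x. indicator \<Omega> x *\<^sub>R g x) \<in> borel_measurable M" using g by (intro borel_measurable_scaleR borel_measurable_indicator)
    show "AE x in M. indicator \<Omega> x *\<^sub>R g x = g x" using z by eventually_elim (auto simp: indicator_def)
  qed (rule g)
  finally show ?thesis .
qed

lemma integral_sq_HO:
  assumes "QO \<Omega>" "u \<in> HO \<Omega>" shows "(\<integral>x. (u x)\<^sup>2 \<partial>lebesgue_on \<Omega>) = (nrm2 M u)\<^sup>2"
  unfolding nrm2_sq
  by (rule integral_on_subset[OF QO_measurable[OF assms(1)] QO_subset[OF assms(1)]])
    (use HO_sqi[OF assms(2)] HO_zero_outside[OF assms(2)] in \<open>auto simp: sqi_def\<close>)

lemma integral_mult_HO:
  assumes "QO \<Omega>" "u \<in> HO \<Omega>" "f \<in> sqi M" shows "(\<integral>x. u x * f x \<partial>lebesgue_on \<Omega>) = (\<integral>x. u x * f x \<partial>M)"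
  by (rule integral_on_subset[OF QO_measurable[OF assms(1)] QO_subset[OF assms(1)]])
    (use HO_sqi[OF assms(2)] HO_zero_outside[OF assms(2)] assms(3) in \<open>auto simp: sqi_def\<close>)

text \<open>Almost everywhere outside \<Omega> the function vanishes and hence so do its
  derivatives, so the energy on \<Omega> is the energy on \<open>D\<close>. The squared norm
  contains the squared L2 norm of u as its zeroth term, which is subtracted.\<close>

lemma integral_norm_Y_HO:
  assumes "QO \<Omega>" "u \<in> HO \<Omega>"
  shows "(\<integral>x. (norm_Y D n Y u x)\<^sup>2 \<partial>lebesgue_on \<Omega>) = (hn (wjet u))\<^sup>2 - (nrm2 M u)\<^sup>2"
proof -
  note W = HO_W0[OF assms(2)]
  have s: "dd j u \<in> sqi M" if "j \<in> {1..n}" for j using W0_sq[OF W] that by (auto simp: sq_def wjet_def dest!: spec[of _ j])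
  have eq: "(norm_Y D n Y u x)\<^sup>2 = (\<Sum>j=1..n. (dd j u x)\<^sup>2)" for x
    by (simp add: norm_Y_def sum_nonneg)
  have z: "AE x in M. \<forall>j\<in>{1..n}. x \<notin> \<Omega> \<longrightarrow> dd j u x = 0"
  proof (rule AE_finite_allI)
    fix j assume j: "j \<in> {1..n}"
    show "AE x in M. x \<notin> \<Omega> \<longrightarrow> dd j u x = 0"
      using W0_derivative_zero_set[OF W j] HO_zero_outside[OF assms(2)] by eventually_elim (use j in \<open>auto simp: wjet_def\<close>)
  qed simp
  have "(\<integral>x. (norm_Y D n Y u x)\<^sup>2 \<partial>lebesgue_on \<Omega>) = (\<integral>x. (\<Sum>j=1..n. (dd j u x)\<^sup>2) \<partial>M)"
    unfolding eq
  proof (rule integral_on_subset[OF QO_measurable[OF assms(1)] QO_subset[OF assms(1)]])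
    show "(\<lambda>x. \<Sum>j=1..n. (dd j u x)\<^sup>2) \<in> borel_measurable M"
      by (intro borel_measurable_sum borel_measurable_power sqi_measurable s)
    show "AE x in M. x \<notin> \<Omega> \<longrightarrow> (\<Sum>j=1..n. (dd j u x)\<^sup>2) = 0" using z by eventually_elim auto
  qed
  also have "\<dots> = (\<Sum>j=1..n. (nrm2 M (dd j u))\<^sup>2)"
    unfolding nrm2_sq by (intro Bochner_Integration.integral_sum sqi_square s)
  also have "\<dots> = (hn (wjet u))\<^sup>2 - (nrm2 M u)\<^sup>2"
  proof -
    have "{..n} = insert 0 {1..n}" by auto
    thus ?thesis unfolding hn_square by (simp add: wjet_def)
  qed
  finally show ?thesis .
qed

lemma HO_sum:
  assumes "finite I" "\<And>i. i \<in> I \<Longrightarrow> u i \<in> HO \<Omega>" shows "(\<lambda>x. \<Sum>i\<in>I. a i * u i x) \<in> HO \<Omega>"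
proof -
  have "{x \<in> D. (\<Sum>i\<in>I. a i * u i x) \<noteq> 0} - \<Omega> \<subseteq> (\<Union>i\<in>I. {x \<in> D. u i x \<noteq> 0} - \<Omega>)"
    by (auto intro: ccontr)
  moreover have "cp (\<Union>i\<in>I. {x \<in> D. u i x \<noteq> 0} - \<Omega>) = 0"
    by (rule cap_UN_eq_0[OF assms(1)]) (use assms(2) in \<open>simp add: H0_def\<close>)
  ultimately have "cp ({x \<in> D. (\<Sum>i\<in>I. a i * u i x) \<noteq> 0} - \<Omega>) = 0" by (rule cap_eq_0_subset)
  moreover have "(\<lambda>x. \<Sum>i\<in>I. a i * u i x) \<in> H_qc D n Y" by (rule H_qc_sum) (use assms(2) HO_qc in blast)
  ultimately show ?thesis by (simp add: H0_def)
qed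

lemma QO_superlevel: assumes "u \<in> H_qc D n Y" shows "QO {x \<in> D. 0 < u x}"
  unfolding quasi_open_def using assms cap_empty by (intro conjI bexI[of _ u]) auto

lemma QO_empty: "QO {}" using QO_superlevel[OF H_qc_0] by simp

lemma HO_0: "(\<lambda>x. 0) \<in> HO \<Omega>" using H_qc_0 cap_empty by (simp add: H0_def)

text \<open>The sum of \<open>frac\<close> of the functions belongs to the space, is
  quasi-continuous, and is positive exactly where one of them is nonzero.\<close>

lemma QO_support:
  fixes k :: nat
  assumes "\<And>i. i < k \<Longrightarrow> u i \<in> H_qc D n Y" defines "\<Omega> \<equiv> {x \<in> D. \<exists>i<k. u i x \<noteq> 0}"
  shows "QO \<Omega>" "\<And>i. i < k \<Longrightarrow> u i \<in> HO \<Omega>"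
proof -
  define w where "w x = (\<Sum>i<k. 1 * frac (u i x))" for x
  have "(\<lambda>x. frac (u i x)) \<in> H_qc D n Y" if "i < k" for i
  proof (rule H_qc_I)
    have u: "W0 (wjet (u i))" "qc (u i)" using assms(1)[OF that] by (auto simp: H_qc_iff)
    show "W0 (\<lambda>j x. if j = 0 then frac (wjet (u i) 0 x) else 2 * wjet (u i) 0 x * (inverse (1 + (wjet (u i) 0 x)\<^sup>2))\<^sup>2 * wjet (u i) j x)"
      by (rule W0_frac[OF u(1)])
    have "continuous_on UNIV frac" using DERIV_isCont[OF frac_deriv] by (auto intro!: continuous_at_imp_continuous_on)
    thus "qc (\<lambda>x. frac (u i x))" by (rule qc_compose[OF u(2)])
  qed (simp add: wjet_def)
  hence "w \<in> H_qc D n Y" unfolding w_def[abs_def] by (intro H_qc_sum) auto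
  moreover have "\<Omega> = {x \<in> D. 0 < w x}"
  proof -
    have "0 < w x \<longleftrightarrow> (\<exists>i<k. u i x \<noteq> 0)" for x
    proof -
      have "w x = 0 \<longleftrightarrow> (\<forall>i<k. u i x = 0)"
        unfolding w_def by (subst sum_nonneg_eq_0_iff) (auto simp: frac_nonneg frac_eq_0_iff)
      moreover have "0 \<le> w x" unfolding w_def by (intro sum_nonneg) (simp add: frac_nonneg)
      ultimately show ?thesis by (auto simp: less_le)
    qed
    thus ?thesis by (simp add: \<Omega>_def)
  qed
  ultimately show "QO \<Omega>" using QO_superlevel by simp
  show "u i \<in> HO \<Omega>" if "i < k" for i
  proof -
    have e: "{x \<in> D. u i x \<noteq> 0} - \<Omega> = {}" using that by (auto simp: \<Omega>_def)
    have "cp ({x \<in> D. u i x \<noteq> 0} - \<Omega>) = 0" unfolding e by (rule cap_empty)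
    thus ?thesis using assms(1)[OF that] by (simp add: H0_def)
  qed
qed

end

section \<open>Limits of finite families on varying sets\<close>

context hormander_space
begin

text \<open>The subsequence is refined once for each member, which preserves the limits already
  found. Pointwise convergence is recorded too, since the measure bound for the limit set depends on
  it.\<close>

lemma compact_family:
  fixes k :: nat
  assumes "\<And>i m. i < k \<Longrightarrow> W0 (h i m)" "\<And>i m. i < k \<Longrightarrow> hn (h i m) \<le> B"
  shows "\<exists>r u. strict_mono (r :: nat \<Rightarrow> nat) \<and> (\<forall>i<k. u i \<in> sqi M \<and> (\<lambda>m. nrm2 M (\<lambda>x. h i (r m) 0 x - u i x)) \<longlonglongrightarrow> 0
    \<and> (AE x in M. (\<lambda>m. h i (r m) 0 x) \<longlonglongrightarrow> u i x))"
  using assms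
proof (induction k)
  case 0 show ?case by (intro exI[of _ id]) (simp add: strict_mono_def)
next
  case (Suc k)
  obtain r u where r: "strict_mono (r :: nat \<Rightarrow> nat)" and u: "\<And>i. i < k \<Longrightarrow> u i \<in> sqi M"
    "\<And>i. i < k \<Longrightarrow> (\<lambda>m. nrm2 M (\<lambda>x. h i (r m) 0 x - u i x)) \<longlonglongrightarrow> 0"
    "\<And>i. i < k \<Longrightarrow> AE x in M. (\<lambda>m. h i (r m) 0 x) \<longlonglongrightarrow> u i x"
    using Suc.IH[OF Suc.prems(1)[OF less_SucI] Suc.prems(2)[OF less_SucI]] by blast
  obtain s v where s: "strict_mono (s :: nat \<Rightarrow> nat)" "v \<in> sqi M" "(\<lambda>m. nrm2 M (\<lambda>x. h k (r (s m)) 0 x - v x)) \<longlonglongrightarrow> 0"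
    using W0_compact[of "\<lambda>m. h k (r m)" B] Suc.prems by blast
  have hs: "h k m 0 \<in> sqi M" for m using W0_sq[OF Suc.prems(1)[of k m]] by (simp add: sq_def)
  obtain t where t: "strict_mono (t :: nat \<Rightarrow> nat)" "AE x in M. (\<lambda>m. h k (r (s (t m))) 0 x) \<longlonglongrightarrow> v x"
    using nrm2_tendsto_AE_subseq[OF s(2) hs s(3)] by blast
  define q where "q m = s (t m)" for m
  have q: "strict_mono q" unfolding q_def using s(1) t(1) by (simp add: strict_mono_def)
  have rq: "strict_mono (\<lambda>m. r (q m))" using r q by (simp add: strict_mono_def)
  have "(u(k := v)) i \<in> sqi M \<and> (\<lambda>m. nrm2 M (\<lambda>x. h i (r (q m)) 0 x - (u(k := v)) i x)) \<longlonglongrightarrow> 0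
    \<and> (AE x in M. (\<lambda>m. h i (r (q m)) 0 x) \<longlonglongrightarrow> (u(k := v)) i x)" if i: "i < Suc k" for i
  proof (cases "i = k")
    case True
    have "(\<lambda>m. nrm2 M (\<lambda>x. h k (r (q m)) 0 x - v x)) \<longlonglongrightarrow> 0"
      using LIMSEQ_subseq_LIMSEQ[OF s(3) t(1)] by (simp add: o_def q_def)
    thus ?thesis using True s(2) t(2) by (simp add: q_def)
  next
    case False
    hence ik: "i < k" using i by simp
    have 1: "(\<lambda>m. nrm2 M (\<lambda>x. h i (r (q m)) 0 x - u i x)) \<longlonglongrightarrow> 0"
      using LIMSEQ_subseq_LIMSEQ[OF u(2)[OF ik] q] by (simp add: o_def)
    have 2: "AE x in M. (\<lambda>m. h i (r (q m)) 0 x) \<longlonglongrightarrow> u i x"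
      using u(3)[OF ik]
    proof eventually_elim
      case (elim x) from LIMSEQ_subseq_LIMSEQ[OF elim q] show ?case by (simp add: o_def)
    qed
    show ?thesis using False 1 2 u(1)[OF ik] by simp
  qed
  thus ?case using rq by (intro exI[of _ "\<lambda>m. r (q m)"] exI[of _ "u(k := v)"]) auto
qed

text \<open>The pointwise limits can only be nonzero where the approximants eventually are, so Fatou's lemma bounds the measure.\<close>

lemma limit_family:
  fixes k :: nat
  assumes \<Omega>: "\<And>m. QO (\<Omega> m)" "\<And>m. measure lebesgue (\<Omega> m) \<le> c"
    and e: "\<And>i m. i < k \<Longrightarrow> e i m \<in> HO (\<Omega> m)" and B: "\<And>i m. i < k \<Longrightarrow> hn (wjet (e i m)) \<le> B"
  obtains r u where "strict_mono (r :: nat \<Rightarrow> nat)" "\<And>i. i < k \<Longrightarrow> u i \<in> H_qc D n Y"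
    "\<And>i. i < k \<Longrightarrow> (\<lambda>m. nrm2 M (\<lambda>x. e i (r m) x - u i x)) \<longlonglongrightarrow> 0"
    "measure lebesgue {x \<in> D. \<exists>i<k. u i x \<noteq> 0} \<le> c"
proof -
  have w0: "wjet v 0 = v" for v by (simp add: wjet_def)
  have hb: "hn (wjet (e i m)) \<le> B" if "i < k" for i m by (rule B[OF that])
  obtain r v where r: "strict_mono (r :: nat \<Rightarrow> nat)"
    and v: "\<And>i. i < k \<Longrightarrow> v i \<in> sqi M" "\<And>i. i < k \<Longrightarrow> (\<lambda>m. nrm2 M (\<lambda>x. e i (r m) x - v i x)) \<longlonglongrightarrow> 0"
      "\<And>i. i < k \<Longrightarrow> AE x in M. (\<lambda>m. e i (r m) x) \<longlonglongrightarrow> v i x"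
    using compact_family[of k "\<lambda>i m. wjet (e i m)" B, OF HO_W0[OF e] hb] unfolding w0 by blast
  have "\<exists>u. u \<in> H_qc D n Y \<and> (AE x in M. u x = v i x)" if i: "i < k" for i
  proof -
    have h1: "W0 (wjet (e i (r m)))" for m by (rule HO_W0[OF e[OF i]])
    have h2: "(\<lambda>m. nrm2 M (\<lambda>x. wjet (e i (r m)) 0 x - v i x)) \<longlonglongrightarrow> 0" using v(2)[OF i] by (simp add: w0)
    \<comment> \<open>Lower semicontinuity with the constant bound serves only to place the limit in
      the energy space; the sharp energy inequalities are derived separately for each of the two
      problems.\<close>
    obtain h where h: "W0 h" "h 0 = v i"
      using W0_lower_semicontinuous[OF h1 hb[OF i] tendsto_const v(1)[OF i] h2] by blast
    show ?thesis using quasi_continuous_representative[OF h(1)] unfolding h(2) by blast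
  qed
  then obtain u where u: "\<And>i. i < k \<Longrightarrow> u i \<in> H_qc D n Y" "\<And>i. i < k \<Longrightarrow> AE x in M. u i x = v i x" by metis
  have conv: "(\<lambda>m. nrm2 M (\<lambda>x. e i (r m) x - u i x)) \<longlonglongrightarrow> 0" if i: "i < k" for i
  proof -
    have "nrm2 M (\<lambda>x. e i (r m) x - u i x) = nrm2 M (\<lambda>x. e i (r m) x - v i x)" for m
    proof (rule nrm2_cong_AE)
      show "AE x in M. e i (r m) x - u i x = e i (r m) x - v i x" using u(2)[OF i] by eventually_elim simp
    qed (use sqi_diff[OF HO_sqi[OF e[OF i]] H_qc_sqi[OF u(1)[OF i]]] sqi_diff[OF HO_sqi[OF e[OF i]] v(1)[OF i]] in \<open>auto simp: sqi_def\<close>)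
    thus ?thesis using v(2)[OF i] by simp
  qed
  define S where "S = {x \<in> D. \<exists>i<k. u i x \<noteq> 0}"
  have S: "QO S" unfolding S_def by (rule QO_support(1)[OF u(1)])
  have Sm: "S \<in> sets M" using QO_measurable[OF S] QO_subset[OF S] Dl by (auto simp: sets_restrict_space_iff)
  have Om: "\<Omega> m \<in> sets M" for m using QO_measurable[OF \<Omega>(1)] QO_subset[OF \<Omega>(1)] Dl by (auto simp: sets_restrict_space_iff)
  have mM: "emeasure M A = ennreal (measure lebesgue A)" if "A \<in> sets M" "A \<subseteq> D" for A
  proof -
    have "measure M A = measure lebesgue A" using that Dl by (simp add: measure_restrict_space)
    thus ?thesis using emeasure_eq_measure[of A] by simp
  qed
  have c0: "0 \<le> c" using \<Omega>(2)[of 0] measure_nonneg order_trans by blast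
  have ae1: "AE x in M. \<forall>i\<in>{..<k}. (\<lambda>m. e i (r m) x) \<longlonglongrightarrow> u i x"
  proof (rule AE_finite_allI)
    fix i assume "i \<in> {..<k}"
    hence i: "i < k" by simp
    show "AE x in M. (\<lambda>m. e i (r m) x) \<longlonglongrightarrow> u i x" using v(3)[OF i] u(2)[OF i] by eventually_elim simp
  qed simp
  have ae2: "AE x in M. \<forall>i\<in>{..<k}. \<forall>m. x \<notin> \<Omega> (r m) \<longrightarrow> e i (r m) x = 0"
    by (rule AE_finite_allI) (auto simp: AE_all_countable intro: HO_zero_outside[OF e])
  have "AE x in M. indicator S x \<le> liminf (\<lambda>m. indicator (\<Omega> (r m)) x :: ennreal)"
    using ae1 ae2
  proof eventually_elim
    case (elim x)
    show ?case
    proof (cases "x \<in> S")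
      case True
      then obtain i where i: "i < k" "u i x \<noteq> 0" by (auto simp: S_def)
      have l: "(\<lambda>m. e i (r m) x) \<longlonglongrightarrow> u i x" using elim(1) i by simp
      have "\<forall>\<^sub>F m in sequentially. e i (r m) x \<noteq> 0" by (rule tendsto_imp_eventually_ne[OF l i(2)])
      moreover have "x \<in> \<Omega> (r m)" if "e i (r m) x \<noteq> 0" for m using elim(2) i(1) that by auto
      ultimately have "\<forall>\<^sub>F m in sequentially. (1::ennreal) \<le> indicator (\<Omega> (r m)) x"
        by (auto elim!: eventually_mono)
      hence "1 \<le> liminf (\<lambda>m. indicator (\<Omega> (r m)) x :: ennreal)" by (rule Liminf_bounded)
      thus ?thesis using True by simp
    qed simp
  qed
  hence "(\<integral>\<^sup>+x. indicator S x \<partial>M) \<le> (\<integral>\<^sup>+x. liminf (\<lambda>m. indicator (\<Omega> (r m)) x) \<partial>M)" by (rule nn_integral_mono_AE)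
  also have "\<dots> \<le> liminf (\<lambda>m. \<integral>\<^sup>+x. indicator (\<Omega> (r m)) x \<partial>M)"
    by (rule nn_integral_liminf) (use Om in simp)
  also have "\<dots> \<le> liminf (\<lambda>m. ennreal c)"
  proof (rule Liminf_mono, rule always_eventually, rule allI)
    fix m
    show "(\<integral>\<^sup>+x. indicator (\<Omega> (r m)) x \<partial>M) \<le> ennreal c"
      using Om[of "r m"] mM[OF Om QO_subset[OF \<Omega>(1)]] \<Omega>(2)[of "r m"] by (simp add: ennreal_leI)
  qed
  also have "\<dots> = ennreal c" by (simp add: Liminf_const)
  finally have "emeasure M S \<le> ennreal c" using Sm by simp
  hence "measure lebesgue S \<le> c" using mM[OF Sm QO_subset[OF S]] c0 by simp
  thus ?thesis using that[OF r u(1) conv] unfolding S_def by blast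
qed

section \<open>The eigenvalue problem\<close>

text \<open>An almost optimal subspace is represented by an L2-orthonormal basis. Orthonormality
  survives the L2 limit, so the limit functions again span k dimensions, and the energy bound on the
  unit sphere survives by lower semicontinuity for each fixed coefficient vector.\<close>

lemma eigenvalue_minimizer:
  assumes k: "k \<ge> 1" and c: "0 < c"
  shows "\<exists>\<Omega>. QO \<Omega> \<and> measure lebesgue \<Omega> \<le> c \<and> (\<forall>\<Omega>'. QO \<Omega>' \<and> measure lebesgue \<Omega>' \<le> c \<longrightarrow>
    eigenvalue D n Y k \<Omega> \<le> eigenvalue D n Y k \<Omega>')"
proof -
  define adm where "adm = {\<Omega>. QO \<Omega> \<and> measure lebesgue \<Omega> \<le> c}"
  define I where "I = (INF \<Omega>\<in>adm. eigenvalue D n Y k \<Omega>)"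
  have Ile: "I \<le> eigenvalue D n Y k \<Omega>" if "\<Omega> \<in> adm" for \<Omega> unfolding I_def by (rule INF_lower[OF that])
  define sup where "sup \<Omega> K = (SUP u \<in> {u \<in> K. (\<integral>x. (u x)\<^sup>2 \<partial>lebesgue_on \<Omega>) = 1}. ereal (\<integral>x. (norm_Y D n Y u x)\<^sup>2 \<partial>lebesgue_on \<Omega>))" for \<Omega> K
  \<comment> \<open>For a normalized function the squared norm is 1 plus the energy, which explains
    the -1.\<close>
  have basis: "\<exists>f. (\<forall>i<k. f i \<in> HO \<Omega>) \<and> (\<forall>i<k. \<forall>j<k. (\<integral>x. f i x * f j x \<partial>M) = of_bool (i = j)) \<and>
      (\<forall>a. (\<Sum>i<k. (a i)\<^sup>2) = 1 \<longrightarrow> ereal ((hn (wjet (\<lambda>x. \<Sum>i<k. a i * f i x)))\<^sup>2 - 1) \<le> sup \<Omega> K)"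
    if \<Omega>: "QO \<Omega>" and K: "subspace_of_dim D k (HO \<Omega>) K" for \<Omega> K
  proof -
    obtain e where e: "\<And>i. i < k \<Longrightarrow> e i \<in> HO \<Omega>"
      and ind: "\<And>a. (AE x in M. (\<Sum>i<k. a i * e i x) = 0) \<Longrightarrow> \<forall>i<k. a i = 0"
      and Keq: "K = {u \<in> HO \<Omega>. \<exists>a. AE x in M. u x = (\<Sum>i<k. a i * e i x)}"
      using K unfolding subspace_of_dim_def by blast
    obtain b where b: "\<And>i j. i < k \<Longrightarrow> j < k \<Longrightarrow> (\<integral>x. (\<Sum>l<k. b i l * e l x) * (\<Sum>l<k. b j l * e l x) \<partial>M) = of_bool (i = j)"
      using gram_schmidt[of k e M, OF HO_sqi[OF e] ind] by blast
    define f where "f i x = (\<Sum>l<k. b i l * e l x)" for i x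
    have f: "f i \<in> HO \<Omega>" for i unfolding f_def[abs_def] by (rule HO_sum) (use e in auto)
    have fo: "(\<integral>x. f i x * f j x \<partial>M) = of_bool (i = j)" if "i < k" "j < k" for i j using b[OF that] by (simp add: f_def)
    have "ereal ((hn (wjet (\<lambda>x. \<Sum>i<k. a i * f i x)))\<^sup>2 - 1) \<le> sup \<Omega> K" if a: "(\<Sum>i<k. (a i)\<^sup>2) = 1" for a
    proof -
      define u where "u x = (\<Sum>i<k. a i * f i x)" for x
      have u: "u \<in> HO \<Omega>" unfolding u_def[abs_def] by (rule HO_sum) (use f in auto)
      have "u x = (\<Sum>l<k. (\<Sum>i<k. a i * b i l) * e l x)" for x
        unfolding u_def f_def sum_distrib_left sum_distrib_right by (subst sum.swap) (simp add: mult.assoc)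
      hence uK: "u \<in> K" unfolding Keq using u by (intro CollectI conjI exI[of _ "\<lambda>l. \<Sum>i<k. a i * b i l"]) auto
      have n1: "(nrm2 M u)\<^sup>2 = 1" unfolding nrm2_sq u_def using sum_square_orthonormal[of k f M a, OF HO_sqi[OF f] fo] a by simp
      have "ereal (\<integral>x. (norm_Y D n Y u x)\<^sup>2 \<partial>lebesgue_on \<Omega>) \<le> sup \<Omega> K"
        unfolding sup_def by (rule SUP_upper) (use uK integral_sq_HO[OF \<Omega> u] n1 in simp)
      thus ?thesis unfolding integral_norm_Y_HO[OF \<Omega> u] n1 by (simp add: u_def[abs_def])
    qed
    thus ?thesis using f fo by blast
  qed
  show ?thesis
  \<comment> \<open>If no admissible set has a finite eigenvalue, every admissible set is optimal;
    the empty set is one.\<close>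
  proof (cases "I = \<infinity>")
    case True
    hence "eigenvalue D n Y k \<Omega>' = \<infinity>" if "QO \<Omega>'" "measure lebesgue \<Omega>' \<le> c" for \<Omega>'
      using Ile[of \<Omega>'] that by (simp add: adm_def)
    thus ?thesis using QO_empty c by (intro exI[of _ "{}"]) auto
  next
    case False
    have unit: "(\<Sum>i<k. (of_bool (i = i0) :: real)\<^sup>2) = 1" if "i0 < k" for i0
    proof -
      have "(\<Sum>i<k. (of_bool (i = i0) :: real)\<^sup>2) = (\<Sum>i<k. if i = i0 then 1 else 0)" by (intro sum.cong) auto
      thus ?thesis using that by simp
    qed
    have pick: "(\<lambda>x. \<Sum>i<k. of_bool (i = i0) * f i x) = f i0" if "i0 < k" for i0 and f :: "nat \<Rightarrow> real^'d \<Rightarrow> real"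
    proof
      fix x
      have "(\<Sum>i<k. of_bool (i = i0) * f i x) = (\<Sum>i<k. if i = i0 then f i x else 0)" by (intro sum.cong) auto
      thus "(\<Sum>i<k. of_bool (i = i0) * f i x) = f i0 x" using that by simp
    qed
    have hn1: "(hn (wjet (f i)))\<^sup>2 \<ge> 1" if "f i \<in> HO \<Omega>" "(\<integral>x. f i x * f i x \<partial>M) = 1" for f :: "nat \<Rightarrow> real^'d \<Rightarrow> real" and i \<Omega>
    proof -
      have "nrm2 M (f i) \<le> hn (wjet (f i))" using hn_component[of 0 "wjet (f i)"] by (simp add: wjet_def)
      moreover have "nrm2 M (f i) = 1" unfolding nrm2_def using that(2) by (simp add: power2_eq_square)
      ultimately show ?thesis by simp
    qed
    \<comment> \<open>Here k \<ge> 1 enters: the supremum is taken over a nonempty set of normalized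
      functions, so it is not the supremum of the empty set.\<close>
    have sup0: "0 \<le> sup \<Omega> K" if \<Omega>: "QO \<Omega>" and K: "subspace_of_dim D k (HO \<Omega>) K" for \<Omega> K
    proof -
      obtain f where f: "\<forall>i<k. f i \<in> HO \<Omega>" "\<forall>i<k. \<forall>j<k. (\<integral>x. f i x * f j x \<partial>M) = of_bool (i = j)"
        "\<forall>a. (\<Sum>i<k. (a i)\<^sup>2) = 1 \<longrightarrow> ereal ((hn (wjet (\<lambda>x. \<Sum>i<k. a i * f i x)))\<^sup>2 - 1) \<le> sup \<Omega> K"
        using basis[OF \<Omega> K] by blast
      have k0: "0 < k" using k by simp
      have "ereal ((hn (wjet (f 0)))\<^sup>2 - 1) \<le> sup \<Omega> K"
        using f(3)[rule_format, OF unit[OF k0]] pick[OF k0, of f] by simp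
      moreover have "0 \<le> ereal ((hn (wjet (f 0)))\<^sup>2 - 1)" using hn1[of f 0 \<Omega>] f(1,2) k0 by simp
      ultimately show ?thesis by (rule order_trans[rotated])
    qed
    have "0 \<le> I" unfolding I_def
    proof (rule INF_greatest)
      fix \<Omega> assume "\<Omega> \<in> adm"
      thus "0 \<le> eigenvalue D n Y k \<Omega>"
        unfolding eigenvalue_def by (intro INF_greatest) (use sup0 in \<open>auto simp: adm_def sup_def\<close>)
    qed
    then obtain \<mu> where \<mu>: "I = ereal \<mu>" "0 \<le> \<mu>" using False by (cases I) auto
    define \<epsilon> where "\<epsilon> m = inverse (real (Suc m))" for m
    have \<epsilon>: "0 < \<epsilon> m" "\<epsilon> m \<le> 1" for m by (auto simp: \<epsilon>_def field_simps)
    have \<epsilon>0: "\<epsilon> \<longlonglongrightarrow> 0" unfolding \<epsilon>_def by (rule LIMSEQ_inverse_real_of_nat)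
    define P where "P m \<Omega> f \<longleftrightarrow> \<Omega> \<in> adm \<and> (\<forall>i<k. f i \<in> HO \<Omega>) \<and>
      (\<forall>i<k. \<forall>j<k. (\<integral>x. f i x * f j x \<partial>M) = of_bool (i = j)) \<and>
      (\<forall>a. (\<Sum>i<k. (a i)\<^sup>2) = 1 \<longrightarrow> (hn (wjet (\<lambda>x. \<Sum>i<k. a i * f i x)))\<^sup>2 \<le> 1 + \<mu> + \<epsilon> m)" for m \<Omega> f
    have "\<exists>\<Omega> f. P m \<Omega> f" for m
    proof -
      have "I < ereal (\<mu> + \<epsilon> m)" using \<mu> \<epsilon>(1)[of m] by simp
      then obtain \<Omega> where \<Omega>: "\<Omega> \<in> adm" "eigenvalue D n Y k \<Omega> < ereal (\<mu> + \<epsilon> m)" unfolding I_def INF_less_iff by blast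
      then obtain K where K: "subspace_of_dim D k (HO \<Omega>) K" "sup \<Omega> K < ereal (\<mu> + \<epsilon> m)"
        unfolding eigenvalue_def sup_def INF_less_iff by blast
      have Q: "QO \<Omega>" using \<Omega>(1) by (simp add: adm_def)
      obtain f where f: "\<forall>i<k. f i \<in> HO \<Omega>" "\<forall>i<k. \<forall>j<k. (\<integral>x. f i x * f j x \<partial>M) = of_bool (i = j)"
        "\<forall>a. (\<Sum>i<k. (a i)\<^sup>2) = 1 \<longrightarrow> ereal ((hn (wjet (\<lambda>x. \<Sum>i<k. a i * f i x)))\<^sup>2 - 1) \<le> sup \<Omega> K"
        using basis[OF Q K(1)] by blast
      have "(hn (wjet (\<lambda>x. \<Sum>i<k. a i * f i x)))\<^sup>2 \<le> 1 + \<mu> + \<epsilon> m" if a: "(\<Sum>i<k. (a i)\<^sup>2) = 1" for a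
      proof -
        have "ereal ((hn (wjet (\<lambda>x. \<Sum>i<k. a i * f i x)))\<^sup>2 - 1) < ereal (\<mu> + \<epsilon> m)"
          using f(3) a K(2) le_less_trans by blast
        thus ?thesis by simp
      qed
      thus ?thesis unfolding P_def using \<Omega>(1) f(1,2) by blast
    qed
    then obtain \<Omega> f where "\<And>m. P m (\<Omega> m) (f m)" by metis
    hence \<Omega>: "\<And>m. \<Omega> m \<in> adm" and f: "\<And>m i. i < k \<Longrightarrow> f m i \<in> HO (\<Omega> m)"
      and fo: "\<And>m i j. i < k \<Longrightarrow> j < k \<Longrightarrow> (\<integral>x. f m i x * f m j x \<partial>M) = of_bool (i = j)"
      and fn: "\<And>m a. (\<Sum>i<k. (a i)\<^sup>2) = 1 \<Longrightarrow> (hn (wjet (\<lambda>x. \<Sum>i<k. a i * f m i x)))\<^sup>2 \<le> 1 + \<mu> + \<epsilon> m"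
      unfolding P_def by auto
    have B: "hn (wjet (f m i)) \<le> 1 + \<mu> + 1" if "i < k" for m i
    proof -
      have "(hn (wjet (f m i)))\<^sup>2 \<le> 1 + \<mu> + \<epsilon> m" using fn[OF unit[OF that], of m] pick[OF that, of "f m"] by simp
      also have "\<dots> \<le> 1 + \<mu> + 1" using \<epsilon>(2)[of m] by simp
      also have "\<dots> \<le> (1 + \<mu> + 1)\<^sup>2" by (rule self_le_power) (use \<mu>(2) in auto)
      finally show ?thesis by (rule power2_le_imp_le) (use \<mu>(2) in simp)
    qed
    have Oq: "QO (\<Omega> m)" "measure lebesgue (\<Omega> m) \<le> c" for m using \<Omega>[of m] by (auto simp: adm_def)
    obtain r u where r: "strict_mono (r :: nat \<Rightarrow> nat)" and u: "\<And>i. i < k \<Longrightarrow> u i \<in> H_qc D n Y"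
      and conv: "\<And>i. i < k \<Longrightarrow> (\<lambda>m. nrm2 M (\<lambda>x. f (r m) i x - u i x)) \<longlonglongrightarrow> 0"
      and meas: "measure lebesgue {x \<in> D. \<exists>i<k. u i x \<noteq> 0} \<le> c"
      using limit_family[of \<Omega> c k "\<lambda>i m. f m i", OF Oq f B] by blast
    define O' where "O' = {x \<in> D. \<exists>i<k. u i x \<noteq> 0}"
    have Q: "QO O'" and uH: "\<And>i. i < k \<Longrightarrow> u i \<in> HO O'" unfolding O'_def using QO_support[of k u, OF u] by auto
    have us: "u i \<in> sqi M" if "i < k" for i using H_qc_sqi[OF u[OF that]] .
    have fs: "f m i \<in> sqi M" if "i < k" for m i using HO_sqi[OF f[OF that]] .
    have uo: "(\<integral>x. u i x * u j x \<partial>M) = of_bool (i = j)" if ij: "i < k" "j < k" for i j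
    proof -
      \<comment> \<open>One factor is frozen at its limit, and the remaining difference is bounded
        because the other factor has norm 1.\<close>
      have "(\<lambda>m. \<integral>x. f (r m) i x * f (r m) j x \<partial>M) \<longlonglongrightarrow> (\<integral>x. u i x * u j x \<partial>M)"
      proof -
        have 1: "(\<lambda>m. \<integral>x. f (r m) i x * u j x \<partial>M) \<longlonglongrightarrow> (\<integral>x. u i x * u j x \<partial>M)"
          by (rule nrm2_tendsto_imp_tendsto_integral[OF us[OF ij(1)] fs[OF ij(1)] us[OF ij(2)] conv[OF ij(1)]])
        have 2: "(\<lambda>m. \<integral>x. f (r m) i x * (f (r m) j x - u j x) \<partial>M) \<longlonglongrightarrow> 0"
        proof (rule Lim_null_comparison[OF always_eventually conv[OF ij(2)]], rule allI)
          fix m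
          have "nrm2 M (f (r m) i) = 1" unfolding nrm2_def using fo[OF ij(1) ij(1), of "r m"] by (simp add: power2_eq_square)
          thus "norm (\<integral>x. f (r m) i x * (f (r m) j x - u j x) \<partial>M) \<le> nrm2 M (\<lambda>x. f (r m) j x - u j x)"
            using Cauchy_Schwarz_nrm2[OF fs[OF ij(1)] sqi_diff[OF fs[OF ij(2)] us[OF ij(2)]], of "r m" "r m"] by simp
        qed
        have "(\<integral>x. f (r m) i x * f (r m) j x \<partial>M) = (\<integral>x. f (r m) i x * u j x \<partial>M) + (\<integral>x. f (r m) i x * (f (r m) j x - u j x) \<partial>M)" for m
          using sqi_integrable_mult[OF fs[OF ij(1)] us[OF ij(2)], of "r m"] sqi_integrable_mult[OF fs[OF ij(1)] fs[OF ij(2)], of "r m" "r m"]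
          by (simp add: right_diff_distrib)
        thus ?thesis using tendsto_add[OF 1 2] by simp
      qed
      hence "(\<lambda>m::nat. of_bool (i = j)) \<longlonglongrightarrow> (\<integral>x. u i x * u j x \<partial>M)" by (simp only: fo[OF ij])
      from LIMSEQ_unique[OF this tendsto_const] show ?thesis .
    qed
    have coef: "a j = (\<integral>x. (\<Sum>i<k. a i * u i x) * u j x \<partial>M)" if j: "j < k" for a j
    proof -
      have "(\<integral>x. (\<Sum>i<k. a i * u i x) * u j x \<partial>M) = (\<integral>x. (\<Sum>i<k. a i * (u i x * u j x)) \<partial>M)"
        by (simp add: sum_distrib_right mult.assoc)
      also have "\<dots> = (\<Sum>i<k. a i * (\<integral>x. u i x * u j x \<partial>M))"
        using sqi_integrable_mult[OF us us[OF j]] by (simp add: Bochner_Integration.integral_sum)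
      also have "\<dots> = (\<Sum>i<k. if i = j then a i else 0)" by (intro sum.cong) (auto simp: uo j)
      finally show ?thesis using j by simp
    qed
    define K where "K = {v \<in> HO O'. \<exists>a. AE x in M. v x = (\<Sum>i<k. a i * u i x)}"
    have KS: "subspace_of_dim D k (HO O') K"
      unfolding subspace_of_dim_def
    proof (intro exI[of _ u] conjI allI impI uH)
      fix a :: "nat \<Rightarrow> real" and j assume ae: "AE x in M. (\<Sum>i<k. a i * u i x) = 0" and j: "j < k"
      have "(\<integral>x. (\<Sum>i<k. a i * u i x) * u j x \<partial>M) = (\<integral>x. 0 \<partial>M)"
      proof (rule integral_cong_AE)
        show "(\<lambda>x. (\<Sum>i<k. a i * u i x) * u j x) \<in> borel_measurable M"
          by (intro borel_measurable_times borel_measurable_sum borel_measurable_const sqi_measurable us) (use j in auto)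
        show "AE x in M. (\<Sum>i<k. a i * u i x) * u j x = 0" using ae by eventually_elim simp
      qed simp
      thus "a j = 0" using coef[OF j, of a] by simp
    qed (auto simp: K_def)
    have "sup O' K \<le> ereal \<mu>" unfolding sup_def
    proof (rule SUP_least)
      fix v assume "v \<in> {v \<in> K. (\<integral>x. (v x)\<^sup>2 \<partial>lebesgue_on O') = 1}"
      then obtain a where v: "v \<in> HO O'" "AE x in M. v x = (\<Sum>i<k. a i * u i x)" "(\<integral>x. (v x)\<^sup>2 \<partial>lebesgue_on O') = 1"
        by (auto simp: K_def)
      have nv: "(nrm2 M v)\<^sup>2 = 1" using v(3) integral_sq_HO[OF Q v(1)] by simp
      define w where "w x = (\<Sum>i<k. a i * u i x)" for x
      have ws: "w \<in> sqi M" unfolding w_def[abs_def] by (intro sqi_sum sqi_cmult us) auto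
      have "nrm2 M v = nrm2 M w"
        by (rule nrm2_cong_AE) (use HO_sqi[OF v(1)] ws v(2) in \<open>auto simp: sqi_def w_def\<close>)
      hence "(\<Sum>i<k. (a i)\<^sup>2) = 1"
        using nv sum_square_orthonormal[of k u M a, OF us uo] unfolding nrm2_sq[of M w] by (simp add: w_def nrm2_sq)
      note fa = fn[OF this]
      \<comment> \<open>The same coefficients applied to the approximating bases: these functions
        are normalized, satisfy the energy bound on the sphere, and converge to w.\<close>
      define g where "g m x = (\<Sum>i<k. a i * f (r m) i x)" for m x
      have gH: "g m \<in> HO (\<Omega> (r m))" for m unfolding g_def[abs_def] by (rule HO_sum) (use f in auto)
      have gW: "W0 (wjet (g m))" for m by (rule HO_W0[OF gH])
      have gb: "hn (wjet (g m)) \<le> sqrt (1 + \<mu> + \<epsilon> (r m))" for m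
        using real_sqrt_le_mono[OF fa[of "r m"]] by (simp add: g_def[abs_def] hn_ge0)
      have "(\<lambda>m. \<epsilon> (r m)) \<longlonglongrightarrow> 0" using LIMSEQ_subseq_LIMSEQ[OF \<epsilon>0 r] by (simp add: o_def)
      hence "(\<lambda>m. sqrt (1 + \<mu> + \<epsilon> (r m))) \<longlonglongrightarrow> sqrt (1 + \<mu> + 0)" by (intro tendsto_intros)
      hence bl: "(\<lambda>m. sqrt (1 + \<mu> + \<epsilon> (r m))) \<longlonglongrightarrow> sqrt (1 + \<mu>)" by simp
      have gc: "(\<lambda>m. nrm2 M (\<lambda>x. wjet (g m) 0 x - w x)) \<longlonglongrightarrow> 0"
      proof (rule tendsto_sandwich[OF _ _ tendsto_const])
        have "nrm2 M (\<lambda>x. wjet (g m) 0 x - w x) \<le> (\<Sum>i<k. \<bar>a i\<bar> * nrm2 M (\<lambda>x. f (r m) i x - u i x))" for m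
        proof -
          have "(\<lambda>x. wjet (g m) 0 x - w x) = (\<lambda>x. \<Sum>i<k. a i * (f (r m) i x - u i x))"
            by (simp add: wjet_def g_def w_def right_diff_distrib sum_subtractf)
          thus ?thesis using nrm2_sum[of "{..<k}" "\<lambda>i x. a i * (f (r m) i x - u i x)" M] sqi_cmult[OF sqi_diff[OF fs us]]
            by (simp add: nrm2_cmult)
        qed
        thus "\<forall>\<^sub>F m in sequentially. nrm2 M (\<lambda>x. wjet (g m) 0 x - w x) \<le> (\<Sum>i<k. \<bar>a i\<bar> * nrm2 M (\<lambda>x. f (r m) i x - u i x))" by simp
        have "(\<lambda>m. \<Sum>i<k. \<bar>a i\<bar> * nrm2 M (\<lambda>x. f (r m) i x - u i x)) \<longlonglongrightarrow> (\<Sum>i<k. \<bar>a i\<bar> * 0)"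
          by (intro tendsto_intros conv) auto
        thus "(\<lambda>m. \<Sum>i<k. \<bar>a i\<bar> * nrm2 M (\<lambda>x. f (r m) i x - u i x)) \<longlonglongrightarrow> 0" by simp
      qed (simp add: nrm2_ge0)
      obtain h where h: "W0 h" "h 0 = w" "hn h \<le> sqrt (1 + \<mu>)"
        using W0_lower_semicontinuous[OF gW gb bl ws gc] by blast
      \<comment> \<open>The element v of \<open>K\<close> is only almost everywhere equal to the
        combination w; its norm does not depend on the representative.\<close>
      have "hn (wjet v) = hn h"
        by (rule W0_imp_W12_0(3)[OF h(1)]) (use HO_sqi[OF v(1)] v(2) h(2) in \<open>auto simp: sqi_def w_def\<close>)
      hence "(hn (wjet v))\<^sup>2 \<le> (sqrt (1 + \<mu>))\<^sup>2" using h(3) hn_ge0[of h] by (intro power_mono) auto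
      thus "ereal (\<integral>x. (norm_Y D n Y v x)\<^sup>2 \<partial>lebesgue_on O') \<le> ereal \<mu>"
        using integral_norm_Y_HO[OF Q v(1)] nv \<mu>(2) by simp
    qed
    moreover have "eigenvalue D n Y k O' \<le> sup O' K"
      unfolding eigenvalue_def sup_def by (rule INF_lower) (use KS in simp)
    ultimately have "eigenvalue D n Y k O' \<le> I" using \<mu>(1) by simp
    thus ?thesis using Q meas Ile order_trans unfolding O'_def[symmetric] by (intro exI[of _ O']) (auto simp: adm_def)
  qed
qed

section \<open>The Dirichlet energy problem\<close>

text \<open>Minimizing over sets the infimum over functions is a single minimization of J over pairs
  of a set and a function on it. A minimizing sequence of pairs is bounded by coercivity; the limit
  function is optimal on the set where it is nonzero.\<close>

lemma energy_minimizer: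
  assumes c: "0 < c" and f: "f \<in> sqi M"
  shows "\<exists>\<Omega>. QO \<Omega> \<and> measure lebesgue \<Omega> \<le> c \<and> (\<forall>\<Omega>'. QO \<Omega>' \<and> measure lebesgue \<Omega>' \<le> c \<longrightarrow>
    dirichlet_energy D n Y f \<Omega> \<le> dirichlet_energy D n Y f \<Omega>')"
proof -
  define J where "J u = 1/2 * (hn (wjet u))\<^sup>2 - (\<integral>x. u x * f x \<partial>M)" for u
  have J: "1/2 * (\<integral>x. (norm_Y D n Y u x)\<^sup>2 \<partial>lebesgue_on \<Omega>) + 1/2 * (\<integral>x. (u x)\<^sup>2 \<partial>lebesgue_on \<Omega>) - (\<integral>x. u x * f x \<partial>lebesgue_on \<Omega>) = J u"
    if "QO \<Omega>" "u \<in> HO \<Omega>" for \<Omega> u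
    unfolding J_def integral_norm_Y_HO[OF that] integral_sq_HO[OF that] integral_mult_HO[OF that f] right_diff_distrib by simp
  define F where "F = nrm2 M f"
  define S where "S = {J u |u \<Omega>. QO \<Omega> \<and> measure lebesgue \<Omega> \<le> c \<and> u \<in> HO \<Omega>}"
  \<comment> \<open>Young's inequality absorbs half of the quadratic term: J \<ge> h^2/4 - F^2, with
    h the norm of u in the energy space.\<close>
  have lower: "(hn (wjet u))\<^sup>2 \<le> 4 * (J u + F\<^sup>2)" if "u \<in> HO \<Omega>" for u \<Omega>
  proof -
    have "(\<integral>x. u x * f x \<partial>M) \<le> nrm2 M u * F" using Cauchy_Schwarz_nrm2[OF HO_sqi[OF that] f] by (simp add: F_def)
    also have "\<dots> \<le> hn (wjet u) * F"
      using hn_component[of 0 "wjet u"] nrm2_ge0[of M f] by (intro mult_right_mono) (auto simp: wjet_def F_def)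
    also have "\<dots> \<le> (hn (wjet u))\<^sup>2 / 4 + F\<^sup>2"
      using sum_squares_bound[of "hn (wjet u) / 2" F] by (simp add: power_divide)
    finally show ?thesis by (simp add: J_def)
  qed
  have bb: "bdd_below S"
  proof (rule bdd_belowI[of _ "- F\<^sup>2"])
    fix s assume "s \<in> S"
    then obtain u \<Omega> where u: "s = J u" "u \<in> HO \<Omega>" by (auto simp: S_def)
    have "0 \<le> 4 * (J u + F\<^sup>2)" by (rule order_trans[OF zero_le_power2 lower[OF u(2)]])
    hence "0 \<le> J u + F\<^sup>2" by simp
    thus "- F\<^sup>2 \<le> s" using u(1) by simp
  qed
  have ne: "S \<noteq> {}" unfolding S_def using QO_empty HO_0[of "{}"] c by fastforce
  define \<beta> where "\<beta> = Inf S"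
  have \<beta>le: "\<beta> \<le> J u" if "QO \<Omega>" "measure lebesgue \<Omega> \<le> c" "u \<in> HO \<Omega>" for u \<Omega>
    unfolding \<beta>_def by (rule cInf_lower[OF _ bb]) (use that in \<open>auto simp: S_def\<close>)
  define \<epsilon> where "\<epsilon> m = inverse (real (Suc m))" for m
  have \<epsilon>: "0 < \<epsilon> m" "\<epsilon> m \<le> 1" for m by (auto simp: \<epsilon>_def field_simps)
  have \<epsilon>0: "\<epsilon> \<longlonglongrightarrow> 0" unfolding \<epsilon>_def by (rule LIMSEQ_inverse_real_of_nat)
  have "\<exists>u \<Omega>. QO \<Omega> \<and> measure lebesgue \<Omega> \<le> c \<and> u \<in> HO \<Omega> \<and> J u < \<beta> + \<epsilon> m" for m
    using cInf_lessD[OF ne, of "\<beta> + \<epsilon> m"] \<epsilon>(1)[of m] unfolding \<beta>_def S_def by auto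
  then obtain v \<Omega> where \<Omega>: "\<And>m. QO (\<Omega> m)" "\<And>m. measure lebesgue (\<Omega> m) \<le> c" and v: "\<And>m. v m \<in> HO (\<Omega> m)"
    and Jv: "\<And>m. J (v m) < \<beta> + \<epsilon> m" by metis
  define B where "B = 4 * (\<beta> + 1 + F\<^sup>2)"
  have B: "hn (wjet (v m)) \<le> sqrt B" for m
  proof -
    have "(hn (wjet (v m)))\<^sup>2 \<le> B" using lower[OF v[of m]] Jv[of m] \<epsilon>(2)[of m] by (simp add: B_def)
    from real_sqrt_le_mono[OF this] show ?thesis by (simp add: hn_ge0)
  qed
  obtain r u where r: "strict_mono (r :: nat \<Rightarrow> nat)" and u: "\<And>i. i < (1::nat) \<Longrightarrow> u i \<in> H_qc D n Y"
    and conv: "\<And>i. i < 1 \<Longrightarrow> (\<lambda>m. nrm2 M (\<lambda>x. v (r m) x - u i x)) \<longlonglongrightarrow> 0"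
    and meas: "measure lebesgue {x \<in> D. \<exists>i<1. u i x \<noteq> 0} \<le> c"
    using limit_family[of \<Omega> c 1 "\<lambda>i. v", OF \<Omega> v B] by blast
  define w where "w = u 0"
  define O' where "O' = {x \<in> D. \<exists>i<(1::nat). u i x \<noteq> 0}"
  have Q: "QO O'" and wH: "w \<in> HO O'" unfolding O'_def w_def using QO_support[of 1 u, OF u] by auto
  note ws = HO_sqi[OF wH]
  have vc: "(\<lambda>m. nrm2 M (\<lambda>x. v (r m) x - w x)) \<longlonglongrightarrow> 0" using conv[of 0] by (simp add: w_def)
  \<comment> \<open>The upper bound for the squared norm that near-minimality yields when J is
    solved for it; the linear term converges, so these bounds converge.\<close>
  define b where "b m = 2 * (\<beta> + \<epsilon> (r m) + (\<integral>x. v (r m) x * f x \<partial>M))" for m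
  have bv: "(hn (wjet (v (r m))))\<^sup>2 \<le> b m" for m using Jv[of "r m"] by (simp add: J_def b_def)
  have "(\<lambda>m. \<epsilon> (r m)) \<longlonglongrightarrow> 0" using LIMSEQ_subseq_LIMSEQ[OF \<epsilon>0 r] by (simp add: o_def)
  moreover have "(\<lambda>m. \<integral>x. v (r m) x * f x \<partial>M) \<longlonglongrightarrow> (\<integral>x. w x * f x \<partial>M)"
    by (rule nrm2_tendsto_imp_tendsto_integral[OF ws HO_sqi[OF v] f vc])
  ultimately have "b \<longlonglongrightarrow> 2 * (\<beta> + 0 + (\<integral>x. w x * f x \<partial>M))" unfolding b_def by (intro tendsto_intros)
  hence bl: "b \<longlonglongrightarrow> 2 * (\<beta> + (\<integral>x. w x * f x \<partial>M))" by simp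
  \<comment> \<open>Needed to recover the limit bound from the square of its square root.\<close>
  have b0: "0 \<le> 2 * (\<beta> + (\<integral>x. w x * f x \<partial>M))"
    by (rule LIMSEQ_le_const[OF bl]) (use bv order_trans[OF zero_le_power2] in blast)
  have hb: "hn (wjet (v (r m))) \<le> sqrt (b m)" for m using real_sqrt_le_mono[OF bv[of m]] by (simp add: hn_ge0)
  have vc': "(\<lambda>m. nrm2 M (\<lambda>x. wjet (v (r m)) 0 x - w x)) \<longlonglongrightarrow> 0" using vc by (simp add: wjet_def)
  obtain h where h: "W0 h" "h 0 = w" "hn h \<le> sqrt (2 * (\<beta> + (\<integral>x. w x * f x \<partial>M)))"
    using W0_lower_semicontinuous[OF HO_W0[OF v] hb tendsto_real_sqrt[OF bl] ws vc'] by blast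
  have "hn (wjet w) = hn h"
    by (rule W0_imp_W12_0(3)[OF h(1)]) (use ws h(2) in \<open>auto simp: sqi_def\<close>)
  hence "(hn (wjet w))\<^sup>2 \<le> (sqrt (2 * (\<beta> + (\<integral>x. w x * f x \<partial>M))))\<^sup>2" using h(3) hn_ge0[of h] by (intro power_mono) auto
  also have "\<dots> = 2 * (\<beta> + (\<integral>x. w x * f x \<partial>M))" using b0 by (rule real_sqrt_pow2)
  finally have "J w \<le> \<beta>" by (simp add: J_def)
  have "dirichlet_energy D n Y f O' \<le> dirichlet_energy D n Y f \<Omega>'" if "QO \<Omega>'" "measure lebesgue \<Omega>' \<le> c" for \<Omega>'
  proof -
    have "dirichlet_energy D n Y f O' \<le> ereal (J w)"
      unfolding dirichlet_energy_def by (rule INF_lower2[OF wH]) (use J[OF Q wH] in simp)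
    also have "\<dots> \<le> ereal \<beta>" using \<open>J w \<le> \<beta>\<close> by simp
    also have "\<dots> \<le> dirichlet_energy D n Y f \<Omega>'"
      unfolding dirichlet_energy_def by (rule INF_greatest) (use J[OF that(1)] \<beta>le[OF that] in simp)
    finally show ?thesis .
  qed
  thus ?thesis using Q meas unfolding O'_def[symmetric] by blast
qed

end

theorem theorem2p12:
  fixes D U :: "(real ^ 'd) set"
    and n k :: nat
    and Y :: "nat \<Rightarrow> real ^ 'd \<Rightarrow> real ^ 'd"
    and c :: real
    and f :: "real ^ 'd \<Rightarrow> real"
  assumes "open D" and "bounded D"
    and "open U" and "closure D \<subseteq> U"
    and "\<forall>j\<in>{1..n}. smooth_on U (Y j)"
    and "hormander U n Y"
    and "k \<ge> 1"
    and "0 < c" and "c \<le> measure lebesgue D"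
    and "f \<in> L2 D"
  shows "(\<exists>\<Omega>. quasi_open D n Y \<Omega> \<and> measure lebesgue \<Omega> \<le> c \<and>
            (\<forall>\<Omega>'. quasi_open D n Y \<Omega>' \<and> measure lebesgue \<Omega>' \<le> c \<longrightarrow>
                 eigenvalue D n Y k \<Omega> \<le> eigenvalue D n Y k \<Omega>')) \<and>
         (\<exists>\<Omega>. quasi_open D n Y \<Omega> \<and> measure lebesgue \<Omega> \<le> c \<and>
            (\<forall>\<Omega>'. quasi_open D n Y \<Omega>' \<and> measure lebesgue \<Omega>' \<le> c \<longrightarrow>
                 dirichlet_energy D n Y f \<Omega> \<le> dirichlet_energy D n Y f \<Omega>'))"
proof -
  interpret hormander_space D U n Y
    by unfold_locales (use assms in auto)
  have "f \<in> sqi (lebesgue_on D)" using assms(10) by (simp add: L2_eq)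
  thus ?thesis using eigenvalue_minimizer[OF assms(7,8)] energy_minimizer[OF assms(8)] by blast
qed

end
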